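(* Consider a geometric flow of almost Hermitian structures $\frac{\partial}{\partial t}g=h$, $\frac{\partial}{\partial t}J=K$, where the pair $(h,K)=(h(g,J,\omega),K(g,J,\omega))$ satisfies Assumption (A) of the context. Then the flow is of the form $$\frac{\partial}{\partial t}g=-2Ric+aL_{\theta^{\sharp}}g+Q_{1},\qquad \frac{\partial}{\partial t}J=\triangle J+\mathcal{N}+\mathcal{R}+aL_{\theta^{\sharp}}J+Q_{2},$$ where $a\in\mathbb{R}$, $L$ denotes the Lie derivative, and $Q_{1},Q_{2}$ are of the form $DJ*DJ$ and satisfy the algebraic, necessary conditions: $Q_{1}$ is symmetric; $Q_{2}$ is $(0,2)+(2,0)$; and $Q_{1}^{(0,2)+(2,0)}=Q_{2}^{sym}J$.
   Context: An almost Hermitian structure $(g,J,\omega)$ on a manifold $M$ consists of a Riemannian metric $g$, an almost complex structure $J$ ($J^2=-1$) with $g(JX,JY)=g(X,Y)$, and $\omega(X,Y)=g(JX,Y)$. $D$ is the Levi-Civita connection. Tensors are identified via $g$: an endomorphism $A$ of $TM$ is identified with the 2-tensor $A(X,Y)=g(AX,Y)$, and $DJ(X,Y)=(D_XJ)Y$, $DJ(X,Y,Z)=g((D_XJ)Y,Z)$. For a 2-tensor $T$: $(TJ)(X,Y)=T(JX,Y)$; $T^{(1,1)}(X,Y)=\frac12(T(X,Y)+T(JX,JY))$; $T^{(0,2)+(2,0)}(X,Y)=\frac12(T(X,Y)-T(JX,JY))$; $T^{sym}(X,Y)=\frac12(T(X,Y)+T(Y,X))$. $T$ is called $(0,2)+(2,0)$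 if $T^{(1,1)}=0$. $Ric$ is the Ricci curvature of $D$ and $\triangle=g^{ij}D^2_{i,j}$ is the rough Laplacian of $D$. In a local frame $\{e_i\}$, $g(\mathcal{N}(X),Y)=g^{ab}g((D_aJ)(JX),(D_bJ)(Y))$, $g(\mathcal{R}(X),Y)=Ric(JX,Y)+Ric(X,JY)$, $\theta(X)=g^{ij}DJ(e_i,Je_j,X)$, and $\theta^\sharp$ is the $g$-dual vector field. "Of the form $DJ*DJ$" means: a linear combination with universal real constant coefficients of tensors obtained from $DJ\otimes DJ$ by raising and lowering indices and contracting, where contractions may be taken with $g$ or with $\omega$, arguments may be composed with $J$, and a fully contracted scalar may be multiplied by $g$ or $\omega$. A tensor $T=T(g,J,\omega)$ is of even type if $T(g,-J,-\omega)=T(g,J,\omega)$ and of odd type if $T(g,-J,-\omega)=-T(g,J,\omega)$. $T$ scales as $r^k$ if $T(r^2g,J,r^2\omega)=r^kT(g,J,\omega)$. Assumption (A): (1) $(h,K)$ is tensorial in $(g,J,\omega)$ and is a differential operator with respect to $(g,J,\omega)$. (Only natural tensors are considered, i.e. those built from $g,J,\omega$ and their derivatives, namely linear combinations with universal constant coefficients of contractions, by $g$ and $\omega$, of the Riemann curvature, $D^2J$, $DJ\otimes DJ$ and copies of $J$ and $g$.) (2) $(h,K)$ is a second order system with respect to $(g,J)$. (3) $h$ is of even type and $K$ is of odd type. (4) $h$ (a 2-tensor) scales as $r^0$ and $K$ (an endomorphism) scales as $r^{-2}$. (5) Modulo gauge transformation, the symbol of the system $(h,K)$ is the identity: there is a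 vector field $\overline X$, defined from $(g,J,\omega,\overline D)$ with $\overline D$ a fixed background linear connection, of first order and even type (a linear combination of contractions by $g$ and $J$ of $\overline Dg$ and $DJ$), such that in local coordinates $h+L_{\overline X}g=g^{ij}\partial_i\partial_jg+\mathcal{O}(\partial g,\partial J)$ and $K+L_{\overline X}J=g^{ij}\partial_i\partial_jJ+\mathcal{O}(\partial g,\partial J)$; equivalently, after adding the gauge terms the linearization has principal symbol $|\xi|^2\,\mathrm{Id}$. Here $\mathcal{O}(\partial g,\partial J)$ denotes terms involving at most first derivatives of $g,J$. Saying that $(h,K)$ defines a flow of almost Hermitian structures means that it is tangent to the space of such structures. *)

theory Defs
  imports "HOL-Analysis.Analysis"
begin

(* All local geometry is done in coordinates on open subsets of real^'n.  A 2-tensor B is the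
   matrix with entries B $ i $ j = B(e_i, e_j); an endomorphism A is the matrix with
   A *v e_j = A(e_j).  All fields are total functions, but only their germs at points of an open
   coordinate domain are used. *)

type_synonym 'n vfield = "(real,'n) vec \<Rightarrow> (real,'n) vec"
type_synonym 'n mfield = "(real,'n) vec \<Rightarrow> ((real,'n) vec,'n) vec"

(* An expression in the pair (g, J) with values in 2-tensors or endomorphisms.  The form omega is
   not a separate argument because it is determined by g and J. *)
type_synonym 'n mop = "'n mfield \<Rightarrow> 'n mfield \<Rightarrow> 'n mfield"

(* An expression in (g, J) with values in covariant tensors of some rank k: the last argument is
   the list of the k coordinate indices (values at lists of other lengths are irrelevant). *)
type_synonym 'n top = "'n mfield \<Rightarrow> 'n mfield \<Rightarrow> (real,'n) vec \<Rightarrow> 'n list \<Rightarrow> real"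

abbreviation frame :: "'n::finite \<Rightarrow> real^'n" where
  "frame i \<equiv> axis i 1"

definition bil :: "real^'n^'n \<Rightarrow> real^'n \<Rightarrow> real^'n \<Rightarrow> real" where
  "bil B u v = u \<bullet> (B *v v)"

definition pd :: "'n::finite \<Rightarrow> (real^'n \<Rightarrow> 'b::real_normed_vector) \<Rightarrow> real^'n \<Rightarrow> 'b" where
  "pd i f x = frechet_derivative f (at x) (frame i)"

(* C-infinity on an open set: all iterated partial derivatives exist and are differentiable. *)
definition smooth_on :: "(real^'n) set \<Rightarrow> (real^'n \<Rightarrow> 'b::real_normed_vector) \<Rightarrow> bool" where
  "smooth_on U f \<longleftrightarrow> (\<forall>is. foldr pd is f differentiable_on U)"


section \<open>Almost Hermitian structures\<close>

definition linear_ah :: "real^'n^'n \<Rightarrow> real^'n^'n \<Rightarrow> bool" where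
  "linear_ah G I \<longleftrightarrow>
     (\<forall>u v. bil G u v = bil G v u) \<and> (\<forall>u. u \<noteq> 0 \<longrightarrow> bil G u u > 0) \<and>
     I ** I = - mat 1 \<and> (\<forall>u v. bil G (I *v u) (I *v v) = bil G u v)"

definition ah_on :: "(real^'n) set \<Rightarrow> 'n mfield \<Rightarrow> 'n mfield \<Rightarrow> bool" where
  "ah_on U g J \<longleftrightarrow> open U \<and> smooth_on U g \<and> smooth_on U J \<and> (\<forall>x\<in>U. linear_ah (g x) (J x))"

(* A chart is a domain together with its coordinate map; the manifold is the whole type 'a. *)
type_synonym ('a,'n) chart = "'a set \<times> ('a \<Rightarrow> (real,'n) vec)"

definition smooth_atlas ::
  "('a::{t2_space,second_countable_topology} set \<times> ('a \<Rightarrow> real^'n)) set \<Rightarrow> bool" where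
  "smooth_atlas A \<longleftrightarrow>
     (\<Union>c\<in>A. fst c) = UNIV \<and>
     (\<forall>c\<in>A. open (fst c) \<and> open (snd c ` fst c) \<and>
        (\<exists>\<psi>. homeomorphism (fst c) (snd c ` fst c) (snd c) \<psi>)) \<and>
     (\<forall>c\<in>A. \<forall>d\<in>A. smooth_on (snd c ` (fst c \<inter> fst d)) (snd d \<circ> the_inv_into (fst c) (snd c)))"

(* An almost Hermitian structure on the manifold, given by its components in each chart, which
   transform as a 2-tensor and as an endomorphism under the changes of coordinates. *)
definition ah_structure ::
  "('a::{t2_space,second_countable_topology} set \<times> ('a \<Rightarrow> real^'n)) set \<Rightarrow>
    (('a,'n) chart \<Rightarrow> 'n mfield) \<Rightarrow> (('a,'n) chart \<Rightarrow> 'n mfield) \<Rightarrow> bool" where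
  "ah_structure A g J \<longleftrightarrow>
     smooth_atlas A \<and>
     (\<forall>c\<in>A. ah_on (snd c ` fst c) (g c) (J c)) \<and>
     (\<forall>c\<in>A. \<forall>d\<in>A. \<forall>p \<in> fst c \<inter> fst d.
        let P = jacobian (snd d \<circ> the_inv_into (fst c) (snd c)) (at (snd c p)) in
          g c (snd c p) = transpose P ** g d (snd d p) ** P \<and>
          P ** J c (snd c p) = J d (snd d p) ** P)"

definition flow_of ::
  "'n mop \<Rightarrow> 'n mop \<Rightarrow> ('a::{t2_space,second_countable_topology} set \<times> ('a \<Rightarrow> real^'n)) set \<Rightarrow>
    real \<Rightarrow> (real \<Rightarrow> ('a,'n) chart \<Rightarrow> 'n mfield) \<Rightarrow> (real \<Rightarrow> ('a,'n) chart \<Rightarrow> 'n mfield) \<Rightarrow> bool" where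
  "flow_of h K A T g J \<longleftrightarrow>
     (\<forall>t\<in>{0..<T}. ah_structure A (g t) (J t) \<and>
       (\<forall>c\<in>A. \<forall>x \<in> snd c ` fst c.
          ((\<lambda>s. g s c x) has_vector_derivative h (g t c) (J t c) x) (at t within {0..<T}) \<and>
          ((\<lambda>s. J s c x) has_vector_derivative K (g t c) (J t c) x) (at t within {0..<T})))"


section \<open>Identifications via the metric\<close>

(* lower_endo G A is the 2-tensor (X,Y) \<mapsto> G(A X, Y), raise_form G B the endomorphism A with
   G(A X, Y) = B(X, Y). *)
definition lower_endo :: "real^'n^'n \<Rightarrow> real^'n^'n \<Rightarrow> real^'n^'n" where
  "lower_endo G A = (\<chi> i j. bil G (A *v frame i) (frame j))"

definition raise_form :: "real^'n^'n \<Rightarrow> real^'n^'n \<Rightarrow> real^'n^'n" where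
  "raise_form G B = matrix_inv G ** transpose B"

definition sharp :: "real^'n^'n \<Rightarrow> real^'n \<Rightarrow> real^'n" where
  "sharp G \<alpha> = matrix_inv G *v \<alpha>"

definition omega :: "'n mfield \<Rightarrow> 'n mfield \<Rightarrow> real^'n \<Rightarrow> real^'n^'n" where
  "omega g J x = lower_endo (g x) (J x)"

definition form_J :: "real^'n^'n \<Rightarrow> real^'n^'n \<Rightarrow> real^'n^'n" where
  "form_J I B = (\<chi> i j. bil B (I *v frame i) (frame j))"

definition part_11 :: "real^'n^'n \<Rightarrow> real^'n^'n \<Rightarrow> real^'n^'n" where
  "part_11 I B = (\<chi> i j. (1/2) * (bil B (frame i) (frame j) + bil B (I *v frame i) (I *v frame j)))"

definition part_02_20 :: "real^'n^'n \<Rightarrow> real^'n^'n \<Rightarrow> real^'n^'n" where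
  "part_02_20 I B = (\<chi> i j. (1/2) * (bil B (frame i) (frame j) - bil B (I *v frame i) (I *v frame j)))"

definition part_sym :: "real^'n^'n \<Rightarrow> real^'n^'n" where
  "part_sym B = (\<chi> i j. (1/2) * (bil B (frame i) (frame j) + bil B (frame j) (frame i)))"


section \<open>Connections, curvature, Lie derivatives\<close>

(* A linear connection in coordinates: the matrix \<Gamma> x i is the endomorphism sending e_j to the
   covariant derivative of e_j in direction e_i, that is \<Gamma> x i $ k $ j is the Christoffel symbol
   with upper index k and lower indices i, j. *)
type_synonym 'n connection = "(real,'n) vec \<Rightarrow> 'n \<Rightarrow> ((real,'n) vec,'n) vec"

definition levi_civita :: "'n mfield \<Rightarrow> real^'n \<Rightarrow> 'n::finite \<Rightarrow> real^'n^'n" where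
  "levi_civita g x i = (\<chi> k j. (1/2) * (\<Sum>l\<in>UNIV. matrix_inv (g x) $ k $ l *
      (pd i g x $ j $ l + pd j g x $ i $ l - pd l g x $ i $ j)))"

definition cov_endo :: "'n connection \<Rightarrow> 'n mfield \<Rightarrow> 'n::finite \<Rightarrow> real^'n \<Rightarrow> real^'n^'n" where
  "cov_endo \<Gamma> A i x = pd i A x + \<Gamma> x i ** A x - A x ** \<Gamma> x i"

definition cov_form :: "'n connection \<Rightarrow> 'n mfield \<Rightarrow> 'n::finite \<Rightarrow> real^'n \<Rightarrow> real^'n^'n" where
  "cov_form \<Gamma> B i x = (\<chi> j k. pd i B x $ j $ k
      - bil (B x) (\<Gamma> x i *v frame j) (frame k) - bil (B x) (frame j) (\<Gamma> x i *v frame k))"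

definition DJ :: "'n mfield \<Rightarrow> 'n mfield \<Rightarrow> 'n::finite \<Rightarrow> real^'n \<Rightarrow> real^'n^'n" where
  "DJ g J i = cov_endo (levi_civita g) J i"

definition D2J :: "'n mfield \<Rightarrow> 'n mfield \<Rightarrow> 'n::finite \<Rightarrow> 'n \<Rightarrow> real^'n \<Rightarrow> real^'n^'n" where
  "D2J g J i j x = cov_endo (levi_civita g) (DJ g J j) i x
      - (\<Sum>l\<in>UNIV. levi_civita g x i $ l $ j *\<^sub>R DJ g J l x)"

definition rough_laplacian :: "'n mfield \<Rightarrow> 'n mfield \<Rightarrow> real^'n \<Rightarrow> real^'n^'n" where
  "rough_laplacian g J x = (\<Sum>i\<in>UNIV. \<Sum>j\<in>UNIV. matrix_inv (g x) $ i $ j *\<^sub>R D2J g J i j x)"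

(* The endomorphism R(e_i, e_j) = [D_i, D_j]. *)
definition riemann :: "'n mfield \<Rightarrow> 'n::finite \<Rightarrow> 'n \<Rightarrow> real^'n \<Rightarrow> real^'n^'n" where
  "riemann g i j x = pd i (\<lambda>y. levi_civita g y j) x - pd j (\<lambda>y. levi_civita g y i) x
      + levi_civita g x i ** levi_civita g x j - levi_civita g x j ** levi_civita g x i"

(* Ric(Y, Z) is the trace of X \<mapsto> R(X, Y) Z. *)
definition ricci :: "'n mfield \<Rightarrow> real^'n \<Rightarrow> real^'n^'n" where
  "ricci g x = (\<chi> j k. \<Sum>i\<in>UNIV. riemann g i j x $ i $ k)"

definition lie_form :: "'n vfield \<Rightarrow> 'n mfield \<Rightarrow> real^'n \<Rightarrow> real^'n^'n" where
  "lie_form X B x = frechet_derivative B (at x) (X x)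
      + transpose (jacobian X (at x)) ** B x + B x ** jacobian X (at x)"

definition lie_endo :: "'n vfield \<Rightarrow> 'n mfield \<Rightarrow> real^'n \<Rightarrow> real^'n^'n" where
  "lie_endo X A x = frechet_derivative A (at x) (X x)
      - jacobian X (at x) ** A x + A x ** jacobian X (at x)"

definition theta :: "'n mfield \<Rightarrow> 'n mfield \<Rightarrow> real^'n \<Rightarrow> real^'n" where
  "theta g J x = (\<chi> k. \<Sum>i\<in>UNIV. \<Sum>j\<in>UNIV.
      matrix_inv (g x) $ i $ j * bil (g x) (DJ g J i x *v (J x *v frame j)) (frame k))"

definition theta_sharp :: "'n mfield \<Rightarrow> 'n mfield \<Rightarrow> real^'n \<Rightarrow> real^'n" where
  "theta_sharp g J x = sharp (g x) (theta g J x)"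

definition N_endo :: "'n mfield \<Rightarrow> 'n mfield \<Rightarrow> real^'n \<Rightarrow> real^'n^'n" where
  "N_endo g J x = raise_form (g x) (\<chi> i j. \<Sum>a\<in>UNIV. \<Sum>b\<in>UNIV. matrix_inv (g x) $ a $ b *
      bil (g x) (DJ g J a x *v (J x *v frame i)) (DJ g J b x *v frame j))"

definition R_endo :: "'n mfield \<Rightarrow> 'n mfield \<Rightarrow> real^'n \<Rightarrow> real^'n^'n" where
  "R_endo g J x = raise_form (g x) (\<chi> i j.
      bil (ricci g x) (J x *v frame i) (frame j) + bil (ricci g x) (frame i) (J x *v frame j))"


section \<open>Universal contraction expressions\<close>

definition Rm_t :: "'n::finite top" where
  "Rm_t g J x is = bil (g x) (riemann g (is!0) (is!1) x *v frame (is!2)) (frame (is!3))"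

definition D2J_t :: "'n::finite top" where
  "D2J_t g J x is = bil (g x) (D2J g J (is!0) (is!1) x *v frame (is!2)) (frame (is!3))"

definition DJ_t :: "'n::finite top" where
  "DJ_t g J x is = bil (g x) (DJ g J (is!0) x *v frame (is!1)) (frame (is!2))"

definition DJDJ_t :: "'n::finite top" where
  "DJDJ_t g J x is = DJ_t g J x (take 3 is) * DJ_t g J x (drop 3 is)"

definition Dg_t :: "'n::finite connection \<Rightarrow> 'n top" where
  "Dg_t \<Gamma> g J x is = cov_form \<Gamma> g (is!0) x $ (is!1) $ (is!2)"

(* contraction C k T: the rank k tensor expression T is a linear combination, with constant real
   coefficients, of contractions (with g and with omega) of tensor products of one of the pairs
   (rank, tensor) listed in C with copies of g and of J, the latter as the 2-tensor g(J X, Y).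
   Composing an argument with J and raising or lowering indices are special cases. *)
inductive contraction :: "(nat \<times> 'n::finite top) set \<Rightarrow> nat \<Rightarrow> 'n top \<Rightarrow> bool"
  for C :: "(nat \<times> 'n::finite top) set" where
  core: "(k, T) \<in> C \<Longrightarrow> contraction C k T"
| times_g: "contraction C k T \<Longrightarrow>
    contraction C (k + 2) (\<lambda>g J x is. T g J x (take k is) * g x $ (is!k) $ (is!(k+1)))"
| times_J: "contraction C k T \<Longrightarrow>
    contraction C (k + 2) (\<lambda>g J x is. T g J x (take k is) * omega g J x $ (is!k) $ (is!(k+1)))"
| permute: "contraction C k T \<Longrightarrow> \<pi> permutes {..<k} \<Longrightarrow>
    contraction C k (\<lambda>g J x is. T g J x (permute_list \<pi> is))"
| contract_g: "contraction C (k + 2) T \<Longrightarrow>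
    contraction C k (\<lambda>g J x is. \<Sum>a\<in>UNIV. \<Sum>b\<in>UNIV.
      matrix_inv (g x) $ a $ b * T g J x (a # b # is))"
| contract_omega: "contraction C (k + 2) T \<Longrightarrow>
    contraction C k (\<lambda>g J x is. \<Sum>a\<in>UNIV. \<Sum>b\<in>UNIV.
      (\<Sum>c\<in>UNIV. \<Sum>d\<in>UNIV. matrix_inv (g x) $ a $ c * matrix_inv (g x) $ b $ d * omega g J x $ c $ d)
        * T g J x (a # b # is))"
| add: "contraction C k T \<Longrightarrow> contraction C k S \<Longrightarrow>
    contraction C k (\<lambda>g J x is. T g J x is + S g J x is)"
| scale: "contraction C k T \<Longrightarrow> contraction C k (\<lambda>g J x is. r * T g J x is)"

definition form_contraction :: "(nat \<times> 'n::finite top) set \<Rightarrow> 'n mop \<Rightarrow> bool" where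
  "form_contraction C B \<longleftrightarrow> (\<exists>T. contraction C 2 T \<and>
     (\<forall>U g J. ah_on U g J \<longrightarrow> (\<forall>x\<in>U. \<forall>i j. B g J x $ i $ j = T g J x [i, j])))"

definition endo_contraction :: "(nat \<times> 'n::finite top) set \<Rightarrow> 'n mop \<Rightarrow> bool" where
  "endo_contraction C A \<longleftrightarrow> form_contraction C (\<lambda>g J x. lower_endo (g x) (A g J x))"

(* The entry of rank 0 admits contractions of copies of g and J alone. *)
definition natural_cores :: "(nat \<times> 'n::finite top) set" where
  "natural_cores = {(4, Rm_t), (4, D2J_t), (6, DJDJ_t), (0, \<lambda>g J x is. 1)}"

definition DJ_DJ_cores :: "(nat \<times> 'n::finite top) set" where
  "DJ_DJ_cores = {(6, DJDJ_t)}"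


section \<open>The assumptions on the system\<close>

definition natural_system :: "'n::finite mop \<Rightarrow> 'n mop \<Rightarrow> bool" where
  "natural_system h K \<longleftrightarrow> form_contraction natural_cores h \<and> endo_contraction natural_cores K"

abbreviation jet1 where
  "jet1 g J x \<equiv> (x, g x, J x, \<lambda>i. pd i g x, \<lambda>i. pd i J x)"

abbreviation jet2 where
  "jet2 g J x \<equiv> (jet1 g J x, \<lambda>i j. pd i (pd j g) x, \<lambda>i j. pd i (pd j J) x)"

definition second_order_system :: "'n::finite mop \<Rightarrow> 'n mop \<Rightarrow> bool" where
  "second_order_system h K \<longleftrightarrow> (\<exists>F G. \<forall>U g J. ah_on U g J \<longrightarrow>
     (\<forall>x\<in>U. h g J x = F (jet2 g J x) \<and> K g J x = G (jet2 g J x)))"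

definition parity_system :: "'n::finite mop \<Rightarrow> 'n mop \<Rightarrow> bool" where
  "parity_system h K \<longleftrightarrow> (\<forall>U g J. ah_on U g J \<longrightarrow>
     (\<forall>x\<in>U. h g (\<lambda>y. - J y) x = h g J x \<and> K g (\<lambda>y. - J y) x = - K g J x))"

definition scaling_system :: "'n::finite mop \<Rightarrow> 'n mop \<Rightarrow> bool" where
  "scaling_system h K \<longleftrightarrow> (\<forall>r>0. \<forall>U g J. ah_on U g J \<longrightarrow>
     (\<forall>x\<in>U. h (\<lambda>y. r\<^sup>2 *\<^sub>R g y) J x = h g J x \<and>
            K (\<lambda>y. r\<^sup>2 *\<^sub>R g y) J x = (1 / r\<^sup>2) *\<^sub>R K g J x))"

(* The gauge vector field X is the metric dual of a 1-form T built by contraction from the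
   background derivative of g and from DJ.  The terms involving at most first derivatives of g
   and J are those that depend only on the 1-jet of (g, J) at the point; this dependence may
   involve the point, through the background connection. *)
definition identity_symbol_mod_gauge :: "'n::finite mop \<Rightarrow> 'n mop \<Rightarrow> bool" where
  "identity_symbol_mod_gauge h K \<longleftrightarrow>
    (\<exists>\<Gamma> T X. (\<forall>i. smooth_on UNIV (\<lambda>x. \<Gamma> x i)) \<and>
      contraction {(3, Dg_t \<Gamma>), (3, DJ_t)} 1 T \<and>
      (\<forall>g J x. X g J x = sharp (g x) (\<chi> i. T g J x [i])) \<and>
      (\<forall>U g J. ah_on U g J \<longrightarrow> (\<forall>x\<in>U. X g (\<lambda>y. - J y) x = X g J x)) \<and>
      (\<exists>F G. \<forall>U g J. ah_on U g J \<longrightarrow> (\<forall>x\<in>U.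
         h g J x + lie_form (X g J) g x =
           (\<Sum>i\<in>UNIV. \<Sum>j\<in>UNIV. matrix_inv (g x) $ i $ j *\<^sub>R pd i (pd j g) x) + F (jet1 g J x) \<and>
         K g J x + lie_endo (X g J) J x =
           (\<Sum>i\<in>UNIV. \<Sum>j\<in>UNIV. matrix_inv (g x) $ i $ j *\<^sub>R pd i (pd j J) x) + G (jet1 g J x))))"

(* Tangency to the space of almost Hermitian structures, the sections of the bundle with fibre
   the set of pairs satisfying linear_ah: at each point (h, K) is the velocity of a curve in the
   fibre. *)
definition tangent_to_ah :: "'n::finite mop \<Rightarrow> 'n mop \<Rightarrow> bool" where
  "tangent_to_ah h K \<longleftrightarrow> (\<forall>U g J. ah_on U g J \<longrightarrow> (\<forall>x\<in>U.
     \<exists>\<gamma> \<eta>. (\<forall>s. linear_ah (\<gamma> s) (\<eta> s)) \<and> \<gamma> 0 = g x \<and> \<eta> 0 = J x \<and>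
       (\<gamma> has_vector_derivative h g J x) (at 0) \<and> (\<eta> has_vector_derivative K g J x) (at 0)))"


section \<open>The right-hand sides\<close>

definition metric_rhs :: "real \<Rightarrow> 'n mop \<Rightarrow> 'n::finite mop" where
  "metric_rhs a Q1 g J x =
     - 2 *\<^sub>R ricci g x + a *\<^sub>R lie_form (theta_sharp g J) g x + Q1 g J x"

definition acs_rhs :: "real \<Rightarrow> 'n mop \<Rightarrow> 'n::finite mop" where
  "acs_rhs a Q2 g J x =
     rough_laplacian g J x + N_endo g J x + R_endo g J x
       + a *\<^sub>R lie_endo (theta_sharp g J) J x + Q2 g J x"

end

theory Submission
  imports Defs
begin

text \<open>A natural expression is a universal operator \<Phi>, linear in the family of cores Rm, D^2 J,
  DJ \<otimes> DJ, 1, and scaling kills its part in the core 1.  At a point where the first derivatives of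
  (g, J) vanish, \<Phi> is therefore a linear function of the second jet, and it is determined by its
  values on an explicit family of structures.  There the symbol condition expresses (h, K) through
  the second jet and the first jet of the gauge one-form T, where T = \<Phi>'(Dg, DJ).  Some of these
  structures are flat up to second order (pullbacks of constant ones); (h, K) vanishes on them,
  which forces the Dg part of T to be the one-form of DeTurck and turns the second order part into
  (-2 Ric, \<Delta>J + R).  As D_X J is skew and anticommutes with J, the only
  one-forms contracted from DJ are \<theta> and \<theta> composed with J; parity excludes the second.

  With the resulting constant a, the difference of the two sides vanishes on all second jets with
  vanishing first derivatives.  Every pair of algebraic curvature data (Rm, D^2 J - quadratic
  correction in DJ) is realized by such a jet, so \<Phi> of the difference only sees DJ \<otimes> DJ.  The
  algebraic conditions hold because both (h, K) and the explicit terms are tangent to the space of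
  almost Hermitian structures.\<close>

text \<open>Two obstacles shape the proof. The equations defining an almost Hermitian pair are
  nonlinear, so only jets of genuine structures can be fed into h and K, and at a point with DJ
  nonzero no coordinates make the first derivatives of both g and J vanish. Both are overcome
  because \<Phi> is linear in the cores: polarization in \<open>\<xi>\<close> and linearity in m
  extend an identity from the polynomial models to all second jets, and a general point is compared
  with such jets only through its algebraic curvature data. The quadratic correction is forced: with
  A_i = D_i J, differentiating J^2 = -1 twice gives D^2_ij J o J + J o D^2_ij J = -(A_i A_j + A_j
  A_i), and (1/2) J (A_i A_j + A_j A_i) is a particular solution of this equation, itself quadratic
  in DJ. The unknown lower order terms and the background connection enter the values on the models
  only through quantities depending on (G, I); subtracting the constant structure m = 0 removes
  them. On pulled-back constant structures the deviation D of the gauge form satisfies xi_i D_j +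
  xi_j D_i = 0, which has only the zero solution for xi nonzero. The constant a is minus the
  coefficient of \<theta> in T.\<close>

section \<open>Matrix algebra, and the linear algebra of an almost Hermitian pair\<close>

lemma matrix_sub_ldistrib: "(A::real^'n^'m) ** (B - C) = A ** B - A ** C"
  by (vector matrix_matrix_mult_def algebra_simps sum_subtractf)

lemma matrix_sub_rdistrib: "((A::real^'n^'m) - B) ** C = A ** C - B ** C"
  by (vector matrix_matrix_mult_def algebra_simps sum_subtractf)

lemma matrix_neg_left: "(- (A::real^'n^'m)) ** B = - (A ** B)"
  by (vector matrix_matrix_mult_def sum_negf)

lemma matrix_neg_right: "(A::real^'n^'m) ** (- B) = - (A ** B)"
  by (vector matrix_matrix_mult_def sum_negf)

lemma matrix_scaleR_left: "(c *\<^sub>R (A::real^'n^'m)) ** B = c *\<^sub>R (A ** B)"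
  by (simp add: scalar_matrix_assoc)

lemma matrix_scaleR_right: "(A::real^'n^'m) ** (c *\<^sub>R B) = c *\<^sub>R (A ** B)"
  by (simp add: matrix_scalar_ac matrix_scaleR_left)

lemma matrix_add_rdistrib: "((A::real^'n^'m) + B) ** C = A ** C + B ** C"
  by (vector matrix_matrix_mult_def algebra_simps sum.distrib)

lemma matrix_zero_left [simp]: "(0::real^'n^'m) ** B = 0"
  by (vector matrix_matrix_mult_def)

lemma matrix_zero_right [simp]: "(A::real^'n^'m) ** 0 = 0"
  by (vector matrix_matrix_mult_def)

lemma matrix_sum_left: "(\<Sum>i\<in>S. (A i :: real^'n^'m)) ** B = (\<Sum>i\<in>S. A i ** B)"
  by (induction S rule: infinite_finite_induct) (simp_all add: matrix_add_rdistrib)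

lemma matrix_sum_right: "(B::real^'n^'m) ** (\<Sum>i\<in>S. A i) = (\<Sum>i\<in>S. B ** A i)"
  by (induction S rule: infinite_finite_induct) (simp_all add: matrix_add_ldistrib)

lemmas matrix_ring = matrix_add_ldistrib matrix_add_rdistrib matrix_sub_ldistrib
  matrix_sub_rdistrib matrix_neg_left matrix_neg_right matrix_scaleR_left matrix_scaleR_right
  matrix_mul_assoc

lemma transpose_add: "transpose ((A::real^'n^'m) + B) = transpose A + transpose B"
  by (vector transpose_def)

lemma transpose_diff: "transpose ((A::real^'n^'m) - B) = transpose A - transpose B"
  by (vector transpose_def)

lemma transpose_minus: "transpose (- (A::real^'n^'m)) = - transpose A"
  by (vector transpose_def)

lemma transpose_zero [simp]: "transpose (0::real^'n^'m) = 0"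
  by (vector transpose_def)

lemma transpose_sum: "transpose (\<Sum>i\<in>S. (A i :: real^'n^'m)) = (\<Sum>i\<in>S. transpose (A i))"
  by (induction S rule: infinite_finite_induct) (simp_all add: transpose_add)

lemma transpose_nth: "transpose A $ i $ j = A $ j $ i"
  by (simp add: transpose_def)

lemmas transpose_ring = transpose_add transpose_diff transpose_minus transpose_scalar
  matrix_transpose_mul

lemma matrix_mult_nth: "((A::real^'n^'m) ** B) $ i $ j = (\<Sum>k\<in>UNIV. A $ i $ k * B $ k $ j)"
  by (simp add: matrix_matrix_mult_def)

lemma matrix_vector_frame: "(A::real^'n^'m) *v frame j = (\<chi> i. A $ i $ j)"
  by (simp add: matrix_vector_mult_basis column_def)

lemma bil_frame: "bil B (frame i) (frame j) = B $ i $ j"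
  by (simp add: bil_def matrix_vector_frame inner_axis')

lemma bil_mult: "bil B (A *v u) (C *v v) = bil (transpose A ** B ** C) u v"
  by (simp add: bil_def matrix_vector_mul_assoc[symmetric])
     (metis dot_lmul_matrix inner_commute transpose_matrix_vector matrix_vector_mul_assoc)

lemma bil_mult_left: "bil B (A *v u) v = bil (transpose A ** B) u v"
  using bil_mult[of B A u "mat 1" v] by simp

lemma bil_mult_right: "bil B u (C *v v) = bil (B ** C) u v"
  using bil_mult[of B "mat 1" u C v] by simp

lemma bil_eq_iff: "(\<forall>u v. bil A u v = bil B u v) \<longleftrightarrow> A = B"
  by (metis bil_frame vec_eq_iff)

lemma bil_commute: "bil B v u = bil (transpose B) u v"
  unfolding bil_def by (metis dot_lmul_matrix inner_commute transpose_matrix_vector)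

lemma lower_endo_eq: "lower_endo G A = transpose A ** G"
  by (simp add: lower_endo_def bil_mult_left bil_frame vec_eq_iff)

lemma lower_endo_nth: "lower_endo G A $ i $ j = (\<Sum>k\<in>UNIV. A $ k $ i * G $ k $ j)"
  by (simp add: lower_endo_eq matrix_mult_nth transpose_nth)

lemma form_J_eq: "form_J I B = transpose I ** B"
  by (simp add: form_J_def bil_mult_left bil_frame vec_eq_iff)

lemma part_11_eq: "part_11 I B = (1/2) *\<^sub>R (B + transpose I ** B ** I)"
  by (simp add: part_11_def bil_mult bil_frame vec_eq_iff)

lemma part_02_20_eq: "part_02_20 I B = (1/2) *\<^sub>R (B - transpose I ** B ** I)"
  by (simp add: part_02_20_def bil_mult bil_frame vec_eq_iff)

lemma part_sym_eq: "part_sym B = (1/2) *\<^sub>R (B + transpose B)"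
  by (simp add: part_sym_def bil_frame vec_eq_iff transpose_nth)

text \<open>\<open>matrix_inv\<close> is a choice; a one-sided inverse of a square matrix is
  two-sided, which pins the choice down.\<close>

lemma matrix_inv_unique:
  assumes "(A::real^'n^'n) ** B = mat 1"
  shows "matrix_inv A = B"
proof -
  have BA: "B ** A = mat 1" using assms by (simp add: matrix_left_right_inverse)
  have "\<exists>A'. A ** A' = mat 1 \<and> A' ** A = mat 1" using assms BA by blast
  then have "A ** matrix_inv A = mat 1 \<and> matrix_inv A ** A = mat 1"
    unfolding matrix_inv_def by (rule someI_ex)
  then show ?thesis
    by (metis BA matrix_mul_assoc matrix_mul_lid matrix_mul_rid)
qed

lemma matrix_inv_scaleR:
  assumes "invertible (A::real^'n^'n)" "c \<noteq> 0"
  shows "matrix_inv (c *\<^sub>R A) = (1 / c) *\<^sub>R matrix_inv A"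
proof (rule matrix_inv_unique)
  obtain B where B: "A ** B = mat 1" using assms(1) by (auto simp: invertible_def)
  show "(c *\<^sub>R A) ** ((1 / c) *\<^sub>R matrix_inv A) = mat 1"
    using assms(2) B matrix_inv_unique[OF B] by (simp add: matrix_scaleR_left matrix_scaleR_right)
qed

text \<open>Positivity makes the kernel of \<open>G\<close> trivial, hence \<open>G\<close>
  invertible; skewness of \<open>I\<close> is compatibility combined with I^2 = -1.\<close>

lemma linear_ahD:
  assumes "linear_ah G I"
  shows linear_ah_sym: "transpose G = G"
    and linear_ah_pos: "u \<noteq> 0 \<Longrightarrow> bil G u u > 0"
    and linear_ah_square: "I ** I = - mat 1"
    and linear_ah_compat: "transpose I ** G ** I = G"
    and linear_ah_skew: "transpose I ** G = - (G ** I)"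
    and linear_ah_invertible: "invertible G"
    and linear_ah_inv_left: "matrix_inv G ** G = mat 1"
    and linear_ah_inv_right: "G ** matrix_inv G = mat 1"
    and linear_ah_inv_sym: "transpose (matrix_inv G) = matrix_inv G"
proof -
  show sym: "transpose G = G"
    using assms unfolding linear_ah_def by (metis bil_commute bil_eq_iff)
  show sq: "I ** I = - mat 1" using assms by (simp add: linear_ah_def)
  show c: "transpose I ** G ** I = G"
    using assms unfolding linear_ah_def bil_mult by (metis bil_eq_iff)
  show pos: "\<And>u. u \<noteq> 0 \<Longrightarrow> bil G u u > 0" using assms by (simp add: linear_ah_def)
  have "transpose I ** G ** I ** I = G ** I" by (simp add: c)
  then have "- (transpose I ** G) = G ** I"
    by (simp add: matrix_mul_assoc[symmetric] sq matrix_neg_right)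
  then show "transpose I ** G = - (G ** I)" by (metis minus_minus)
  have "\<And>u. G *v u = 0 \<Longrightarrow> u = 0"
    using pos unfolding bil_def by fastforce
  then have "\<exists>B. B ** G = mat 1" by (simp add: matrix_left_invertible_ker)
  then obtain B where B: "B ** G = mat 1" "G ** B = mat 1"
    using matrix_left_right_inverse by blast
  then show "invertible G" by (auto simp: invertible_def)
  have Bi: "matrix_inv G = B" by (rule matrix_inv_unique[OF B(2)])
  show "matrix_inv G ** G = mat 1" "G ** matrix_inv G = mat 1" using B Bi by auto
  have "G ** transpose B = mat 1"
    by (metis B(1) matrix_transpose_mul sym transpose_mat)
  then show "transpose (matrix_inv G) = matrix_inv G" by (metis Bi matrix_inv_unique)
qed

lemma linear_ahI:
  assumes "transpose G = G" "\<And>u. u \<noteq> 0 \<Longrightarrow> bil G u u > 0" "I ** I = - mat 1"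
    "transpose I ** G ** I = G"
  shows "linear_ah G I"
  using assms unfolding linear_ah_def bil_mult by (metis bil_commute)

lemma linear_ah_uminus:
  assumes "linear_ah G I" shows "linear_ah G (- I)"
  by (rule linear_ahI)
     (simp_all add: linear_ah_sym[OF assms] linear_ah_pos[OF assms] linear_ah_square[OF assms]
       linear_ah_compat[OF assms] matrix_neg_left matrix_neg_right transpose_minus)

lemma bounded_bilinear_matrix_mult:
  "bounded_bilinear (\<lambda>(A::real^'n^'m) (B::real^'k^'n). A ** B)"
  unfolding bilinear_conv_bounded_bilinear[symmetric] bilinear_def
  by (auto intro!: linearI simp: matrix_ring)

lemma bounded_linear_transpose: "bounded_linear (transpose :: real^'n^'m \<Rightarrow> _)"
  by (rule linear_conv_bounded_linear[THEN iffD1])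
     (auto intro!: linearI simp: transpose_add transpose_scalar)

section \<open>Contraction operators\<close>

text \<open>Applying \<^const>\<open>contraction\<close> to cores amounts to applying a linear operator, depending on the
  values of g and J at the point alone, to the components of the cores there.\<close>

inductive contraction_op :: "(nat \<Rightarrow> nat) \<Rightarrow> nat \<Rightarrow>
    (real^'n^'n \<Rightarrow> real^'n^'n \<Rightarrow> (nat \<Rightarrow> 'n::finite list \<Rightarrow> real) \<Rightarrow> 'n list \<Rightarrow> real) \<Rightarrow> bool"
  for r :: "nat \<Rightarrow> nat" where
  core: "contraction_op r (r i) (\<lambda>G I c. c i)"
| times_g: "contraction_op r k \<Phi> \<Longrightarrow>
    contraction_op r (k + 2) (\<lambda>G I c is. \<Phi> G I c (take k is) * G $ (is!k) $ (is!(k+1)))"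
| times_J: "contraction_op r k \<Phi> \<Longrightarrow>
    contraction_op r (k + 2) (\<lambda>G I c is. \<Phi> G I c (take k is) * lower_endo G I $ (is!k) $ (is!(k+1)))"
| permute: "contraction_op r k \<Phi> \<Longrightarrow> \<pi> permutes {..<k} \<Longrightarrow>
    contraction_op r k (\<lambda>G I c is. \<Phi> G I c (permute_list \<pi> is))"
| contract_g: "contraction_op r (k + 2) \<Phi> \<Longrightarrow>
    contraction_op r k (\<lambda>G I c is. \<Sum>a\<in>UNIV. \<Sum>b\<in>UNIV. matrix_inv G $ a $ b * \<Phi> G I c (a # b # is))"
| contract_omega: "contraction_op r (k + 2) \<Phi> \<Longrightarrow>
    contraction_op r k (\<lambda>G I c is. \<Sum>a\<in>UNIV. \<Sum>b\<in>UNIV.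
      (\<Sum>p\<in>UNIV. \<Sum>q\<in>UNIV. matrix_inv G $ a $ p * matrix_inv G $ b $ q * lower_endo G I $ p $ q)
        * \<Phi> G I c (a # b # is))"
| add: "contraction_op r k \<Phi> \<Longrightarrow> contraction_op r k \<Psi> \<Longrightarrow>
    contraction_op r k (\<lambda>G I c is. \<Phi> G I c is + \<Psi> G I c is)"
| scale: "contraction_op r k \<Phi> \<Longrightarrow> contraction_op r k (\<lambda>G I c is. s * \<Phi> G I c is)"

text \<open>The two inductive predicates have matching rules, so the operator is the derivation of
  \<open>T\<close> with the cores kept as variables. Indexing the cores by numbers turns a family of
  tensors of different ranks into one function.\<close>

lemma contraction_imp_op:
  assumes "contraction (range (\<lambda>i. (r i, f i))) k T"
  shows "\<exists>\<Phi>. contraction_op r k \<Phi> \<and> T = (\<lambda>g J x. \<Phi> (g x) (J x) (\<lambda>i. f i g J x))"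
  using assms
proof induction
  case (core k T)
  then obtain i where i: "k = r i" "T = f i" by auto
  show ?case unfolding i
    by (rule exI, rule conjI, rule contraction_op.core[of r i], rule refl)
next
  case (times_g k T)
  then obtain \<Phi> where \<Phi>: "contraction_op r k \<Phi>" "T = (\<lambda>g J x. \<Phi> (g x) (J x) (\<lambda>i. f i g J x))"
    by blast
  show ?case unfolding \<Phi>(2) omega_def
    by (rule exI, rule conjI, rule contraction_op.times_g, (rule \<Phi>(1) refl)+)
next
  case (times_J k T)
  then obtain \<Phi> where \<Phi>: "contraction_op r k \<Phi>" "T = (\<lambda>g J x. \<Phi> (g x) (J x) (\<lambda>i. f i g J x))"
    by blast
  show ?case unfolding \<Phi>(2) omega_def
    by (rule exI, rule conjI, rule contraction_op.times_J, (rule \<Phi>(1) refl)+)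
next
  case (permute k T \<pi>)
  then obtain \<Phi> where \<Phi>: "contraction_op r k \<Phi>" "T = (\<lambda>g J x. \<Phi> (g x) (J x) (\<lambda>i. f i g J x))"
    by blast
  show ?case unfolding \<Phi>(2) omega_def
    by (rule exI, rule conjI, rule contraction_op.permute, (rule \<Phi>(1) refl permute.hyps(2))+)
next
  case (contract_g k T)
  then obtain \<Phi> where \<Phi>: "contraction_op r (k + 2) \<Phi>" "T = (\<lambda>g J x. \<Phi> (g x) (J x) (\<lambda>i. f i g J x))"
    by blast
  show ?case unfolding \<Phi>(2) omega_def
    by (rule exI, rule conjI, rule contraction_op.contract_g, (rule \<Phi>(1) refl)+)
next
  case (contract_omega k T)
  then obtain \<Phi> where \<Phi>: "contraction_op r (k + 2) \<Phi>" "T = (\<lambda>g J x. \<Phi> (g x) (J x) (\<lambda>i. f i g J x))"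
    by blast
  show ?case unfolding \<Phi>(2) omega_def
    by (rule exI, rule conjI, rule contraction_op.contract_omega, (rule \<Phi>(1) refl)+)
next
  case (add k T S)
  then obtain \<Phi> \<Psi> where \<Phi>: "contraction_op r k \<Phi>" "T = (\<lambda>g J x. \<Phi> (g x) (J x) (\<lambda>i. f i g J x))"
    and \<Psi>: "contraction_op r k \<Psi>" "S = (\<lambda>g J x. \<Psi> (g x) (J x) (\<lambda>i. f i g J x))" by blast
  show ?case unfolding \<Phi>(2) \<Psi>(2)
    by (rule exI, rule conjI, rule contraction_op.add[OF \<Phi>(1) \<Psi>(1)], rule refl)
next
  case (scale k T s)
  then obtain \<Phi> where \<Phi>: "contraction_op r k \<Phi>" "T = (\<lambda>g J x. \<Phi> (g x) (J x) (\<lambda>i. f i g J x))"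
    by blast
  show ?case unfolding \<Phi>(2) omega_def
    by (rule exI, rule conjI, rule contraction_op.scale, (rule \<Phi>(1) refl)+)
qed

text \<open>Substitution: contractions may be plugged into an operator in place of its cores. This
  is how the remainder, an operator applied to expressions quadratic in DJ, becomes a contraction of
  DJ tensor DJ alone.\<close>

lemma op_imp_contraction:
  assumes "contraction_op r k \<Phi>" "\<And>i. contraction C (r i) (f i)"
  shows "contraction C k (\<lambda>g J x. \<Phi> (g x) (J x) (\<lambda>i. f i g J x))"
  using assms(1)
proof induction
  case (core i) then show ?case using assms(2) by simp
next
  case (times_g k \<Phi>) from contraction.times_g[OF times_g.IH] show ?case .
next
  case (times_J k \<Phi>) from contraction.times_J[OF times_J.IH] show ?case unfolding omega_def .
next
  case (permute k \<Phi> \<pi>) from contraction.permute[OF permute.IH permute.hyps(2)] show ?case .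
next
  case (contract_g k \<Phi>) from contraction.contract_g[OF contract_g.IH] show ?case .
next
  case (contract_omega k \<Phi>)
  from contraction.contract_omega[OF contract_omega.IH] show ?case unfolding omega_def .
next
  case (add k \<Phi> \<Psi>) from contraction.add[OF add.IH] show ?case .
next
  case (scale k \<Phi> s) from contraction.scale[OF scale.IH] show ?case .
qed

text \<open>No rule multiplies two cores: the only products are with \<open>G\<close>,
  \<open>I\<close> and the inverse of \<open>G\<close>. This is why DJ tensor DJ has to be a single
  core.\<close>

lemma contraction_op_linear:
  assumes "contraction_op r k \<Phi>"
  shows "\<Phi> G I (\<lambda>i js. x * c i js + y * d i js) is = x * \<Phi> G I c is + y * \<Phi> G I d is"
  using assms
  by (induction arbitrary: "is")
     (simp_all add: algebra_simps sum.distrib sum_distrib_left)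

text \<open>Tensor values at index lists of the wrong length are junk, so identities between cores
  are available only at the correct length; the rules never look elsewhere.\<close>

lemma contraction_op_cong:
  assumes "contraction_op r k \<Phi>" "\<And>i js. length js = r i \<Longrightarrow> c i js = d i js" "length is = k"
  shows "\<Phi> G I c is = \<Phi> G I d is"
  using assms(1,3)
proof (induction arbitrary: "is")
  case (core i) then show ?case using assms(2) by simp
next
  case (times_g k \<Phi>) then show ?case using times_g.IH[of "take k is"] by simp
next
  case (times_J k \<Phi>) then show ?case using times_J.IH[of "take k is"] by simp
next
  case (permute k \<Phi> \<pi>) then show ?case by simp
next
  case (contract_g k \<Phi>)
  then have "\<And>a b. \<Phi> G I c (a # b # is) = \<Phi> G I d (a # b # is)" by simp
  then show ?case by simp
next
  case (contract_omega k \<Phi>)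
  then have "\<And>a b. \<Phi> G I c (a # b # is) = \<Phi> G I d (a # b # is)" by simp
  then show ?case by simp
qed simp_all

lemma contraction_op_0:
  assumes "contraction_op r k \<Phi>"
  shows "\<Phi> G I (\<lambda>i js. 0) is = 0"
  using contraction_op_linear[OF assms, of G I 0 "\<lambda>i js. 0" 0 "\<lambda>i js. 0"] by simp

lemma contraction_op_add:
  assumes "contraction_op r k \<Phi>"
  shows "\<Phi> G I (\<lambda>i js. c i js + d i js) is = \<Phi> G I c is + \<Phi> G I d is"
  using contraction_op_linear[OF assms, of G I 1 c 1 d] by simp

lemma contraction_op_diff:
  assumes "contraction_op r k \<Phi>"
  shows "\<Phi> G I (\<lambda>i js. c i js - d i js) is = \<Phi> G I c is - \<Phi> G I d is"
  using contraction_op_linear[OF assms, of G I 1 c "-1" d] by simp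

lemma contraction_op_mult:
  assumes "contraction_op r k \<Phi>"
  shows "\<Phi> G I (\<lambda>i js. x * c i js) is = x * \<Phi> G I c is"
  using contraction_op_linear[OF assms, of G I x c 0 c] by simp

lemma contraction_op_sum:
  assumes "contraction_op r k \<Phi>"
  shows "\<Phi> G I (\<lambda>i js. \<Sum>s\<in>S. c s i js) is = (\<Sum>s\<in>S. \<Phi> G I (c s) is)"
  by (induction S rule: infinite_finite_induct)
     (simp_all add: contraction_op_0[OF assms] contraction_op_add[OF assms])

text \<open>Where the derivatives of g, J and the inverse metric vanish, the operator differentiates
  like a linear map with constant coefficients. This gives the first derivative of the gauge
  one-form on the models.\<close>

lemma contraction_op_has_derivative:
  fixes g J :: "real^'n \<Rightarrow> real^'n^'n"
  assumes "contraction_op r k \<Phi>"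
    and g: "(g has_derivative (\<lambda>v. 0)) (at x)" and J: "(J has_derivative (\<lambda>v. 0)) (at x)"
    and gi: "((\<lambda>y. matrix_inv (g y)) has_derivative (\<lambda>v. 0)) (at x)"
    and c: "\<And>i js. length js = r i \<Longrightarrow> ((\<lambda>y. c y i js) has_derivative (\<lambda>v. c' v i js)) (at x)"
    and "length is = k"
  shows "((\<lambda>y. \<Phi> (g y) (J y) (c y) is) has_derivative (\<lambda>v. \<Phi> (g x) (J x) (c' v) is)) (at x)"
proof -
  have nth: "((\<lambda>y. f y $ a $ b) has_derivative (\<lambda>v. 0)) (at x)"
    if "(f has_derivative (\<lambda>v. 0)) (at x)" for f :: "real^'n \<Rightarrow> real^'n^'n" and a b
    using bounded_linear.has_derivative[OF bounded_linear_vec_nth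
        bounded_linear.has_derivative[OF bounded_linear_vec_nth that, of a], of b] by simp
  have "((\<lambda>y. transpose (J y) ** g y) has_derivative (\<lambda>v. 0)) (at x)"
    using bounded_bilinear.FDERIV[OF bounded_bilinear_matrix_mult
        bounded_linear.has_derivative[OF bounded_linear_transpose J] g] by simp
  then have w: "((\<lambda>y. lower_endo (g y) (J y)) has_derivative (\<lambda>v. 0)) (at x)"
    by (simp add: lower_endo_eq)
  have mult: "((\<lambda>y. u y * f y) has_derivative (\<lambda>v. u x * f' v)) (at x)"
    "((\<lambda>y. f y * u y) has_derivative (\<lambda>v. f' v * u x)) (at x)"
    if "(u has_derivative (\<lambda>v. 0)) (at x)" "(f has_derivative f') (at x)"
    for u f :: "real^'n \<Rightarrow> real" and f'
    using has_derivative_mult[OF that] has_derivative_mult[OF that(2,1)] by simp_all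
  have wi: "((\<lambda>y. \<Sum>p\<in>UNIV. \<Sum>q\<in>UNIV. matrix_inv (g y) $ a $ p * matrix_inv (g y) $ b $ q *
      lower_endo (g y) (J y) $ p $ q) has_derivative (\<lambda>v. 0)) (at x)" for a b
  proof -
    have "((\<lambda>y. \<Sum>p\<in>UNIV. \<Sum>q\<in>UNIV. matrix_inv (g y) $ a $ p * matrix_inv (g y) $ b $ q *
      lower_endo (g y) (J y) $ p $ q) has_derivative (\<lambda>v. \<Sum>p\<in>(UNIV::'n set). \<Sum>q\<in>(UNIV::'n set). 0)) (at x)"
      using nth[OF gi] nth[OF w]
      by (intro has_derivative_sum) (auto intro!: derivative_eq_intros)
    then show ?thesis by simp
  qed
  show ?thesis using assms(1,6)
  proof (induction arbitrary: "is")
    case (core i) then show ?case using c by simp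
  next
    case (times_g k \<Phi>) then show ?case by (intro mult(2) nth g times_g.IH) simp
  next
    case (times_J k \<Phi>) then show ?case by (intro mult(2) nth w times_J.IH) simp
  next
    case (permute k \<Phi> \<pi>) then show ?case by simp
  next
    case (contract_g k \<Phi>)
    then show ?case by (intro has_derivative_sum mult(1) nth gi contract_g.IH) simp
  next
    case (contract_omega k \<Phi>)
    then show ?case by (intro has_derivative_sum mult(1) wi contract_omega.IH) simp
  next
    case (add k \<Phi> \<Psi>) then show ?case by (intro has_derivative_add) auto
  next
    case (scale k \<Phi> s) then show ?case by (intro has_derivative_mult_right) auto
  qed
qed

text \<open>A weight count. Multiplying by \<open>G\<close> or by the form adds two indices and a
  factor s^2; either contraction removes two indices and contributes s^(-2), which for omega arises
  as s^(-4) s^2. Starting from scalars, each free index thus carries one factor s.\<close>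

lemma contraction_op_scaling:
  assumes "contraction_op r k \<Phi>" "invertible G" "s \<noteq> 0"
  shows "\<Phi> (s\<^sup>2 *\<^sub>R G) I (\<lambda>i js. if r i = 0 then c i else 0) is =
    s ^ k * \<Phi> G I (\<lambda>i js. if r i = 0 then c i else 0) is"
proof -
  have inv: "matrix_inv (s\<^sup>2 *\<^sub>R G) $ a $ b = (1 / s\<^sup>2) * matrix_inv G $ a $ b" for a b
    using matrix_inv_scaleR[OF assms(2), of "s\<^sup>2"] assms(3) by simp
  have low: "lower_endo (s\<^sup>2 *\<^sub>R G) I $ a $ b = s\<^sup>2 * lower_endo G I $ a $ b" for a b
    by (simp add: lower_endo_eq matrix_scaleR_right)
  from assms(1) show ?thesis
  proof (induction arbitrary: "is")
    case (contract_omega k \<Phi>)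
    have "(1 / s\<^sup>2 * p) * (1 / s\<^sup>2 * q) * (s\<^sup>2 * w) * (s ^ (k + 2) * u) = s ^ k * (p * q * w * u)"
      for p q w u
      using assms(3) by (simp add: power2_eq_square power_add field_simps)
    then show ?case using contract_omega
      by (simp only: inv low sum_distrib_left sum_distrib_right)
  next
    case (contract_g k \<Phi>)
    have "(1 / s\<^sup>2 * p) * (s ^ (k + 2) * u) = s ^ k * (p * u)" for p u
      using assms(3) by (simp add: power2_eq_square power_add field_simps)
    then show ?case using contract_g
      by (simp only: inv low sum_distrib_left sum_distrib_right)
  qed (simp_all add: low[unfolded power2_eq_square] algebra_simps power_add power2_eq_square)
qed

section \<open>Pairings\<close>

text \<open>A contraction of a core of rank 3 of the form G(u, _) G(v, _) G(w, _) is a combination of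
  products of pairings G(x, y) and G(I x, y) over the vectors u, v, w (labels 0, 1, 2) and the frame
  vectors in the free slots (labels 3, 4, ...); an edge (e, p, q) stands for a pairing of the labels
  p and q, with I inserted when e is true.\<close>

definition pairing :: "real^'n^'n \<Rightarrow> real^'n^'n \<Rightarrow> bool \<Rightarrow> real^'n \<Rightarrow> real^'n \<Rightarrow> real" where
  "pairing G I e x y = bil G (if e then I *v x else x) y"

definition pairings_value ::
  "real^'n^'n \<Rightarrow> real^'n^'n \<Rightarrow> (bool \<times> nat \<times> nat) list \<Rightarrow> (nat \<Rightarrow> real^'n) \<Rightarrow> real" where
  "pairings_value G I E \<alpha> = (\<Prod>(e, p, q)\<leftarrow>E. pairing G I e (\<alpha> p) (\<alpha> q))"

definition edge_labels :: "(bool \<times> nat \<times> nat) list \<Rightarrow> nat list" where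
  "edge_labels E = concat (map (\<lambda>(e, p, q). [p, q]) E)"

text \<open>A perfect matching of the labels: by multilinearity each vector enters the product
  exactly once.\<close>

definition perfect :: "nat \<Rightarrow> (bool \<times> nat \<times> nat) list \<Rightarrow> bool" where
  "perfect N E \<longleftrightarrow> distinct (edge_labels E) \<and> set (edge_labels E) = {..<N}"

definition relabel :: "(nat \<Rightarrow> nat) \<Rightarrow> (bool \<times> nat \<times> nat) list \<Rightarrow> (bool \<times> nat \<times> nat) list" where
  "relabel f E = map (\<lambda>(e, p, q). (e, f p, f q)) E"

lemma edge_labels_simps [simp]:
  "edge_labels [] = []" "edge_labels ((e, p, q) # E) = p # q # edge_labels E"
  "edge_labels (E @ F) = edge_labels E @ edge_labels F"
  by (simp_all add: edge_labels_def)

lemma pairings_value_simps [simp]: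
  "pairings_value G I [] \<alpha> = 1"
  "pairings_value G I ((e, p, q) # E) \<alpha> = pairing G I e (\<alpha> p) (\<alpha> q) * pairings_value G I E \<alpha>"
  "pairings_value G I (E @ F) \<alpha> = pairings_value G I E \<alpha> * pairings_value G I F \<alpha>"
  by (simp_all add: pairings_value_def)

lemma edge_labels_relabel: "edge_labels (relabel f E) = map f (edge_labels E)"
  by (induction E) (auto simp: relabel_def edge_labels_def)

lemma pairings_value_relabel: "pairings_value G I (relabel f E) \<alpha> = pairings_value G I E (\<alpha> \<circ> f)"
  by (induction E) (auto simp: relabel_def pairings_value_def)

lemma pairings_value_cong:
  "(\<And>p. p \<in> set (edge_labels E) \<Longrightarrow> \<alpha> p = \<beta> p) \<Longrightarrow> pairings_value G I E \<alpha> = pairings_value G I E \<beta>"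
  by (induction E) auto

lemma perfect_relabel:
  assumes "perfect N E" "bij_betw f {..<N} {..<M}"
  shows "perfect M (relabel f E)"
  using assms by (auto simp: perfect_def edge_labels_relabel distinct_map bij_betw_def)

lemma matrix_vector_neg_left: "(- A) *v x = - ((A::real^'n^'m) *v x)"
  by (simp add: vec_eq_iff matrix_vector_mult_def sum_negf)

lemma matrix_vector_neg_right: "(A::real^'n^'m) *v (- x) = - (A *v x)"
  by (simp add: vec_eq_iff matrix_vector_mult_def sum_negf)

lemma bil_neg: "bil B (- x) y = - bil B x y" "bil B x (- y) = - bil B x y" "bil (- B) x y = - bil B x y"
  by (simp_all add: bil_def matrix_vector_neg_left matrix_vector_neg_right)

text \<open>\<open>I\<close> is skew for \<open>G\<close>, so reversing a marked edge costs a
  sign.\<close>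

lemma pairing_commute:
  assumes "linear_ah G I"
  shows "pairing G I e y x = (if e then - 1 else 1) * pairing G I e x y"
proof -
  have "bil G y x = bil G x y" by (metis bil_commute linear_ah_sym[OF assms])
  moreover have "bil G (I *v y) x = - bil G (I *v x) y"
  proof -
    have "bil G (I *v y) x = bil G x (I *v y)" by (metis bil_commute linear_ah_sym[OF assms])
    also have "\<dots> = bil (G ** I) x y" by (simp add: bil_mult_right)
    also have "\<dots> = - bil (transpose I ** G) x y"
      by (simp add: linear_ah_skew[OF assms] bil_neg)
    finally show ?thesis by (simp add: bil_mult_left)
  qed
  ultimately show ?thesis by (simp add: pairing_def)
qed

text \<open>Edges may be reordered freely and reversed up to sign, so any label can be made the
  first end of the first edge. The factor \<open>s\<close> is a sign that does not depend on
  \<open>G\<close>, \<open>I\<close> or the vectors.\<close>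

lemma pull_label:
  assumes "p \<in> set (edge_labels E)" "distinct (edge_labels E)"
  obtains s e q R where "distinct (edge_labels ((e, p, q) # R))"
    "set (edge_labels ((e, p, q) # R)) = set (edge_labels E)" "length E = Suc (length R)"
    "\<And>(G::real^'n^'n) I \<alpha>. linear_ah G I \<Longrightarrow>
       pairings_value G I E \<alpha> = s * pairings_value G I ((e, p, q) # R) \<alpha>"
proof -
  from assms(1) obtain e x y where e: "(e, x, y) \<in> set E" "p = x \<or> p = y"
    by (auto simp: edge_labels_def)
  then obtain A B where E: "E = A @ (e, x, y) # B" by (meson split_list)
  show ?thesis
  proof (cases "p = x")
    case True
    show ?thesis
      by (rule that[of e y "A @ B" 1]) (use assms True in \<open>auto simp: E\<close>)
  next
    case False
    then have p: "p = y" using e by simp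
    show ?thesis
      by (rule that[of e x "A @ B" "if e then - 1 else 1"])
         (use assms p in \<open>auto simp: E pairing_commute[of _ _ _ _ "_ y"]\<close>)
  qed
qed

lemma sum_inv_bil:
  assumes "linear_ah G I"
  shows "(\<Sum>a\<in>UNIV. \<Sum>b\<in>UNIV. matrix_inv G $ a $ b * (bil G (frame a) X * bil G (frame b) Y)) = bil G X Y"
proof -
  have fr: "bil G (frame a) Z = (G *v Z) $ a" for a Z by (simp add: bil_def inner_axis')
  have "(\<Sum>a\<in>UNIV. \<Sum>b\<in>UNIV. matrix_inv G $ a $ b * (bil G (frame a) X * bil G (frame b) Y))
    = (G *v X) \<bullet> (matrix_inv G *v (G *v Y))"
    by (simp add: fr inner_vec_def matrix_vector_mult_def sum_distrib_left algebra_simps)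
  also have "\<dots> = bil G X Y"
    by (simp add: matrix_vector_mul_assoc linear_ah_inv_left[OF assms] bil_def)
       (metis bil_commute bil_def inner_commute linear_ah_sym[OF assms])
  finally show ?thesis .
qed

lemma pairing_move:
  assumes "linear_ah G I"
  shows "pairing G I e x y = (if e then - 1 else 1) * bil G x (if e then I *v y else y)"
proof -
  have "bil G x' y' = bil G y' x'" for x' y' by (metis bil_commute linear_ah_sym[OF assms])
  then have "pairing G I e y x = bil G x (if e then I *v y else y)" by (simp add: pairing_def)
  then show ?thesis using pairing_commute[OF assms, of e x y] by simp
qed

lemma pairing_square:
  assumes "linear_ah G I"
  shows "pairing G I e (I *v x) y = (if e then - 1 else 1) * pairing G I (\<not> e) x y"
    "pairing G I e x (I *v y) = (if e then 1 else - 1) * pairing G I (\<not> e) x y"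
proof -
  have II: "I *v (I *v x) = - x" for x
    by (simp add: matrix_vector_mul_assoc linear_ah_square[OF assms] matrix_vector_neg_left)
  show "pairing G I e (I *v x) y = (if e then - 1 else 1) * pairing G I (\<not> e) x y"
    by (simp add: pairing_def II bil_neg)
  show "pairing G I e x (I *v y) = (if e then 1 else - 1) * pairing G I (\<not> e) x y"
    by (cases e) (simp_all add: pairing_move[OF assms] II bil_neg)
qed

text \<open>Contracting ends of two different edges joins them into one; since I^2 = -1, the marks
  add modulo 2 up to sign.\<close>

lemma sum_inv_pairing2:
  assumes "linear_ah G I"
  shows "(\<Sum>a\<in>UNIV. \<Sum>b\<in>UNIV. matrix_inv G $ a $ b *
      (pairing G I e (frame a) X * pairing G I f (frame b) Y)) =
    (if e \<and> \<not> f then - 1 else 1) * pairing G I (e \<noteq> f) X Y"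
proof -
  let ?s = "\<lambda>e. if e then - 1 else (1::real)"
  have "(\<Sum>a\<in>UNIV. \<Sum>b\<in>UNIV. matrix_inv G $ a $ b *
      (pairing G I e (frame a) X * pairing G I f (frame b) Y)) =
    (\<Sum>a\<in>UNIV. \<Sum>b\<in>UNIV. ?s e * ?s f * (matrix_inv G $ a $ b *
      (bil G (frame a) (if e then I *v X else X) * bil G (frame b) (if f then I *v Y else Y))))"
    by (simp add: pairing_move[OF assms] algebra_simps)
  also have "\<dots> = ?s e * ?s f * bil G (if e then I *v X else X) (if f then I *v Y else Y)"
    by (simp only: sum_distrib_left[symmetric] sum_inv_bil[OF assms])
  also have "\<dots> = ?s e * ?s f * pairing G I e X (if f then I *v Y else Y)"
    by (simp add: pairing_def)
  also have "\<dots> = (if e \<and> \<not> f then - 1 else 1) * pairing G I (e \<noteq> f) X Y"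
    by (cases e; cases f) (simp_all add: pairing_square(2)[OF assms])
  finally show ?thesis .
qed

text \<open>Contracting both ends of one edge closes a loop: the trace of the identity, or the
  symmetric inverse metric against the skew form, which is 0.\<close>

lemma sum_inv_pairing1:
  assumes "linear_ah (G::real^'n^'n) I"
  shows "(\<Sum>a\<in>UNIV. \<Sum>b\<in>UNIV. matrix_inv G $ a $ b * pairing G I e (frame a) (frame b)) =
    (if e then 0 else real CARD('n))"
proof (cases e)
  case True
  let ?S = "\<Sum>a\<in>UNIV. \<Sum>b\<in>UNIV. matrix_inv G $ a $ b * pairing G I True (frame a) (frame b)"
  have "?S = (\<Sum>a\<in>UNIV. \<Sum>b\<in>UNIV. matrix_inv G $ b $ a * pairing G I True (frame b) (frame a))"
    by (rule sum.swap)
  also have "\<dots> = (\<Sum>a\<in>UNIV. \<Sum>b\<in>UNIV. - (matrix_inv G $ a $ b * pairing G I True (frame a) (frame b)))"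
  proof (intro sum.cong refl)
    fix a b
    have "matrix_inv G $ b $ a = matrix_inv G $ a $ b"
      by (metis transpose_nth linear_ah_inv_sym[OF assms])
    then show "matrix_inv G $ b $ a * pairing G I True (frame b) (frame a) =
        - (matrix_inv G $ a $ b * pairing G I True (frame a) (frame b))"
      using pairing_commute[OF assms, of True "frame b" "frame a"] by simp
  qed
  also have "\<dots> = - ?S" by (simp add: sum_negf)
  finally show ?thesis using True by simp
next
  case False
  have "(\<Sum>a\<in>UNIV. \<Sum>b\<in>UNIV. matrix_inv G $ a $ b * G $ a $ b) =
      (\<Sum>a\<in>UNIV. (matrix_inv G ** transpose G) $ a $ a)"
    by (simp add: matrix_mult_nth transpose_nth)
  also have "\<dots> = real CARD('n)"
    by (simp add: linear_ah_sym[OF assms] linear_ah_inv_left[OF assms] mat_def)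
  finally show ?thesis using False by (simp add: pairing_def bil_frame)
qed

lemma omega_inv_eq:
  assumes "linear_ah G I"
  shows "(\<Sum>p\<in>UNIV. \<Sum>q\<in>UNIV. matrix_inv G $ a $ p * matrix_inv G $ b $ q * lower_endo G I $ p $ q)
    = (matrix_inv G ** transpose I) $ a $ b"
proof -
  have "(\<Sum>p\<in>UNIV. \<Sum>q\<in>UNIV. matrix_inv G $ a $ p * matrix_inv G $ b $ q * lower_endo G I $ p $ q)
    = (matrix_inv G ** lower_endo G I ** transpose (matrix_inv G)) $ a $ b"
    unfolding matrix_mult_nth transpose_nth sum_distrib_right
    by (subst sum.swap) (simp add: algebra_simps)
  then show ?thesis
    by (simp add: lower_endo_eq linear_ah_inv_sym[OF assms] matrix_mul_assoc[symmetric]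
        linear_ah_inv_right[OF assms])
qed

text \<open>Raising both indices of omega gives the inverse metric times the transpose of
  \<open>I\<close>, so contracting with omega is contracting with g after inserting \<open>I\<close>
  in the second slot. This reduces every omega contraction to a g contraction.\<close>

lemma sum_omega_inv:
  assumes "linear_ah G I" "\<And>a. linear (\<phi> a :: real^'n \<Rightarrow> real)"
  shows "(\<Sum>a\<in>UNIV. \<Sum>b\<in>UNIV. (\<Sum>p\<in>UNIV. \<Sum>q\<in>UNIV. matrix_inv G $ a $ p * matrix_inv G $ b $ q *
      lower_endo G I $ p $ q) * \<phi> a (frame b)) =
    (\<Sum>a\<in>UNIV. \<Sum>b\<in>UNIV. matrix_inv G $ a $ b * \<phi> a (I *v frame b))"
proof -
  have ex: "\<phi> a (I *v frame p) = (\<Sum>b\<in>UNIV. I $ b $ p * \<phi> a (frame b))" for a p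
  proof -
    have "I *v frame p = (\<Sum>b\<in>UNIV. (I $ b $ p) *\<^sub>R frame b)"
      unfolding matrix_vector_frame vec_eq_iff
      by (simp add: axis_def if_distrib cong: if_cong)
    then show ?thesis by (simp add: linear_sum[OF assms(2)] linear_cmul[OF assms(2)])
  qed
  show ?thesis
    unfolding omega_inv_eq[OF assms(1)] matrix_mult_nth transpose_nth ex
      sum_distrib_left sum_distrib_right
    by (subst sum.swap) (simp add: algebra_simps)
qed

lemma linear_pairing: "linear (pairing G I e x)" "linear (\<lambda>x. pairing G I e x y)"
  by (cases e; auto intro!: linearI simp: pairing_def bil_def algebra_simps inner_add_left inner_add_right)+

text \<open>If \<open>p\<close> and \<open>q\<close> are the ends of one edge, it closes to a trace;
  otherwise their two edges merge. Contraction with omega inserts one more \<open>I\<close> and so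
  only flips the mark of the edge at \<open>q\<close>. The factors depend on the matching and the
  dimension, not on the pair (G, I).\<close>

lemma contract_labels:
  assumes "distinct (edge_labels E)" "p \<in> set (edge_labels E)" "q \<in> set (edge_labels E)" "p \<noteq> q"
  obtains t R t' R' where
    "distinct (edge_labels R)" "set (edge_labels R) = set (edge_labels E) - {p, q}"
    "distinct (edge_labels R')" "set (edge_labels R') = set (edge_labels E) - {p, q}"
    "\<And>(G::real^'n^'n) I \<alpha>. linear_ah G I \<Longrightarrow>
       (\<Sum>a\<in>UNIV. \<Sum>b\<in>UNIV. matrix_inv G $ a $ b *
         pairings_value G I E (\<alpha>(p := frame a, q := frame b))) = t * pairings_value G I R \<alpha>"
    "\<And>(G::real^'n^'n) I \<alpha>. linear_ah G I \<Longrightarrow>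
       (\<Sum>a\<in>UNIV. \<Sum>b\<in>UNIV. (\<Sum>i\<in>UNIV. \<Sum>j\<in>UNIV. matrix_inv G $ a $ i * matrix_inv G $ b $ j *
           lower_endo G I $ i $ j) *
         pairings_value G I E (\<alpha>(p := frame a, q := frame b))) = t' * pairings_value G I R' \<alpha>"
proof -
  obtain s e x R where R: "distinct (edge_labels ((e, p, x) # R))"
    "set (edge_labels ((e, p, x) # R)) = set (edge_labels E)"
    "\<And>(G::real^'n^'n) I \<alpha>. linear_ah G I \<Longrightarrow>
       pairings_value G I E \<alpha> = s * pairings_value G I ((e, p, x) # R) \<alpha>"
    by (rule pull_label[OF assms(2,1)]) blast
  show ?thesis
  proof (cases "x = q")
    case True
    have nR: "pairings_value G I R (\<alpha>(p := u, q := v)) = pairings_value G I R \<alpha>"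
      for G I :: "real^'n^'n" and \<alpha> u v
      by (rule pairings_value_cong) (use R(1) True in auto)
    have E: "pairings_value G I E (\<alpha>(p := u, q := v)) =
        pairing G I e u v * (s * pairings_value G I R \<alpha>)" if "linear_ah G I"
      for G I :: "real^'n^'n" and \<alpha> u v
      using R(3)[OF that] True assms(4) nR by simp
    show ?thesis
    \<comment> \<open>The extra \<open>I\<close> of omega exchanges the two traces: a marked loop
      now gives the dimension, an unmarked one gives 0.\<close>
    proof (rule that[of R R "(if e then 0 else real CARD('n)) * s" "(if e then real CARD('n) else 0) * s"])
      fix G I :: "real^'n^'n" and \<alpha> assume ah: "linear_ah G I"
      show "(\<Sum>a\<in>UNIV. \<Sum>b\<in>UNIV. matrix_inv G $ a $ b *
         pairings_value G I E (\<alpha>(p := frame a, q := frame b))) =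
         (if e then 0 else real CARD('n)) * s * pairings_value G I R \<alpha>"
        unfolding E[OF ah] mult.assoc[symmetric] sum_distrib_right[symmetric]
          sum_inv_pairing1[OF ah] by simp
      show "(\<Sum>a\<in>UNIV. \<Sum>b\<in>UNIV. (\<Sum>i\<in>UNIV. \<Sum>j\<in>UNIV. matrix_inv G $ a $ i * matrix_inv G $ b $ j *
           lower_endo G I $ i $ j) *
         pairings_value G I E (\<alpha>(p := frame a, q := frame b))) =
         (if e then real CARD('n) else 0) * s * pairings_value G I R \<alpha>"
      proof -
        have "(\<Sum>a\<in>UNIV. \<Sum>b\<in>UNIV. (\<Sum>i\<in>UNIV. \<Sum>j\<in>UNIV. matrix_inv G $ a $ i * matrix_inv G $ b $ j *
           lower_endo G I $ i $ j) * pairing G I e (frame a) (frame b)) =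
          (\<Sum>a\<in>UNIV. \<Sum>b\<in>UNIV. matrix_inv G $ a $ b * pairing G I e (frame a) (I *v frame b))"
          by (rule sum_omega_inv[OF ah linear_pairing(1)])
        also have "\<dots> = (if e then 1 else - 1) *
            (\<Sum>a\<in>UNIV. \<Sum>b\<in>UNIV. matrix_inv G $ a $ b * pairing G I (\<not> e) (frame a) (frame b))"
          by (simp add: pairing_square(2)[OF ah] sum_negf)
        also have "\<dots> = (if e then real CARD('n) else 0)"
          by (simp add: sum_inv_pairing1[OF ah])
        finally have *: "(\<Sum>a\<in>UNIV. \<Sum>b\<in>UNIV. (\<Sum>i\<in>UNIV. \<Sum>j\<in>UNIV. matrix_inv G $ a $ i * matrix_inv G $ b $ j *
           lower_endo G I $ i $ j) * pairing G I e (frame a) (frame b)) = (if e then real CARD('n) else 0)" .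
        show ?thesis
          unfolding E[OF ah] mult.assoc[of _ "pairing _ _ _ _ _", symmetric]
            sum_distrib_right[of _ _ "s * pairings_value G I R \<alpha>", symmetric] * by simp
      qed
    qed (use R True in auto)
  next
    case False
    then have q: "q \<in> set (edge_labels R)" using assms(3,4) R(2) by auto
    obtain s' f y S where S: "distinct (edge_labels ((f, q, y) # S))"
      "set (edge_labels ((f, q, y) # S)) = set (edge_labels R)"
      "\<And>(G::real^'n^'n) I \<alpha>. linear_ah G I \<Longrightarrow>
         pairings_value G I R \<alpha> = s' * pairings_value G I ((f, q, y) # S) \<alpha>"
      by (rule pull_label[OF q]) (use R(1) in auto)
    have sub: "set (edge_labels S) \<subseteq> set (edge_labels R)" "y \<in> set (edge_labels R)"
      using S(2) by auto
    have x: "x \<notin> set (edge_labels R)" "p \<notin> set (edge_labels R)" "p \<noteq> x"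
      "q \<notin> set (edge_labels S)" "q \<noteq> y" "y \<notin> set (edge_labels S)" "distinct (edge_labels S)"
      using R(1) S(1) by auto
    have nS: "pairings_value G I S (\<alpha>(p := u, q := v)) = pairings_value G I S \<alpha>"
      for G I :: "real^'n^'n" and \<alpha> u v
      by (rule pairings_value_cong) (use x sub in auto)
    have E: "pairings_value G I E (\<alpha>(p := u, q := v)) =
        pairing G I e u (\<alpha> x) * pairing G I f v (\<alpha> y) * (s * s' * pairings_value G I S \<alpha>)"
      if "linear_ah G I" for G I :: "real^'n^'n" and \<alpha> u v
      using R(3)[OF that] S(3)[OF that] assms(4) nS x sub False by auto
    let ?sg = "\<lambda>e f. if e \<and> \<not> f then - 1 else (1::real)"
    show ?thesis
    proof (rule that[of "(e \<noteq> f, x, y) # S" "(e = f, x, y) # S" "?sg e f * (s * s')"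
          "(if f then - 1 else 1) * ?sg e (\<not> f) * (s * s')"])
      fix G I :: "real^'n^'n" and \<alpha> assume ah: "linear_ah G I"
      show "(\<Sum>a\<in>UNIV. \<Sum>b\<in>UNIV. matrix_inv G $ a $ b *
         pairings_value G I E (\<alpha>(p := frame a, q := frame b))) =
         ?sg e f * (s * s') * pairings_value G I ((e \<noteq> f, x, y) # S) \<alpha>"
        unfolding E[OF ah] mult.assoc[of _ "pairing _ _ _ _ _ * pairing _ _ _ _ _", symmetric]
          sum_distrib_right[of _ _ "s * s' * pairings_value G I S \<alpha>", symmetric]
          sum_inv_pairing2[OF ah] by simp
      have "(\<Sum>a\<in>UNIV. \<Sum>b\<in>UNIV. (\<Sum>i\<in>UNIV. \<Sum>j\<in>UNIV. matrix_inv G $ a $ i * matrix_inv G $ b $ j *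
           lower_endo G I $ i $ j) * (pairing G I e (frame a) (\<alpha> x) * pairing G I f (frame b) (\<alpha> y))) =
          (\<Sum>a\<in>UNIV. \<Sum>b\<in>UNIV. matrix_inv G $ a $ b *
            (pairing G I e (frame a) (\<alpha> x) * pairing G I f (I *v frame b) (\<alpha> y)))"
        by (rule sum_omega_inv[OF ah])
           (rule linear_compose_scale_right[OF linear_pairing(2), unfolded real_scaleR_def])
      also have "\<dots> = (if f then - 1 else 1) * (\<Sum>a\<in>UNIV. \<Sum>b\<in>UNIV. matrix_inv G $ a $ b *
            (pairing G I e (frame a) (\<alpha> x) * pairing G I (\<not> f) (frame b) (\<alpha> y)))"
        by (simp add: pairing_square(1)[OF ah] sum_negf)
      also have "\<dots> = (if f then - 1 else 1) * ?sg e (\<not> f) * pairing G I (e = f) (\<alpha> x) (\<alpha> y)"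
        unfolding sum_inv_pairing2[OF ah] by simp
      finally have *: "(\<Sum>a\<in>UNIV. \<Sum>b\<in>UNIV. (\<Sum>i\<in>UNIV. \<Sum>j\<in>UNIV. matrix_inv G $ a $ i * matrix_inv G $ b $ j *
           lower_endo G I $ i $ j) * (pairing G I e (frame a) (\<alpha> x) * pairing G I f (frame b) (\<alpha> y))) =
          (if f then - 1 else 1) * ?sg e (\<not> f) * pairing G I (e = f) (\<alpha> x) (\<alpha> y)" .
      show "(\<Sum>a\<in>UNIV. \<Sum>b\<in>UNIV. (\<Sum>i\<in>UNIV. \<Sum>j\<in>UNIV. matrix_inv G $ a $ i * matrix_inv G $ b $ j *
           lower_endo G I $ i $ j) *
         pairings_value G I E (\<alpha>(p := frame a, q := frame b))) =
         (if f then - 1 else 1) * ?sg e (\<not> f) * (s * s') * pairings_value G I ((e = f, x, y) # S) \<alpha>"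
        unfolding E[OF ah] mult.assoc[of _ "pairing _ _ _ _ _ * pairing _ _ _ _ _", symmetric]
          sum_distrib_right[of _ _ "s * s' * pairings_value G I S \<alpha>", symmetric] * by simp
    qed (use R(2) S(2) x sub False in auto)
  qed
qed

definition elementary :: "real^'n^'n \<Rightarrow> real^'n \<Rightarrow> real^'n \<Rightarrow> real^'n \<Rightarrow> 'n::finite list \<Rightarrow> real" where
  "elementary G u v w js = bil G u (frame (js!0)) * bil G v (frame (js!1)) * bil G w (frame (js!2))"

text \<open>The two contracted free slots are the labels 3 and 4, since 0, 1, 2 are the vectors
  \<open>u\<close>, \<open>v\<close>, \<open>w\<close>.\<close>

lemma contract_perfect:
  assumes "perfect (k + 5) E"
  shows "\<exists>t R. perfect (k + 3) R \<and>
      (\<forall>(G::real^'n^'n) I u v w is. linear_ah G I \<longrightarrow> (\<Sum>a\<in>UNIV. \<Sum>b\<in>UNIV. matrix_inv G $ a $ b *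
       pairings_value G I E (\<lambda>n. ([u, v, w] @ map frame (a # b # is)) ! n)) =
       t * pairings_value G I R (\<lambda>n. ([u, v, w] @ map frame is) ! n))" (is ?g)
    and "\<exists>t R. perfect (k + 3) R \<and>
      (\<forall>(G::real^'n^'n) I u v w is. linear_ah G I \<longrightarrow> (\<Sum>a\<in>UNIV. \<Sum>b\<in>UNIV.
       (\<Sum>i\<in>UNIV. \<Sum>j\<in>UNIV. matrix_inv G $ a $ i * matrix_inv G $ b $ j * lower_endo G I $ i $ j) *
       pairings_value G I E (\<lambda>n. ([u, v, w] @ map frame (a # b # is)) ! n)) =
       t * pairings_value G I R (\<lambda>n. ([u, v, w] @ map frame is) ! n))" (is ?omega)
proof -
  \<comment> \<open>Closes the gap left by the labels 3 and 4.\<close>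
  define h where "h n = (if n < 3 then n else n - 2)" for n :: nat
  have E: "distinct (edge_labels E)" "set (edge_labels E) = {..<k + 5}"
    using assms by (auto simp: perfect_def)
  have mem: "3 \<in> set (edge_labels E)" "4 \<in> set (edge_labels E)" "(3::nat) \<noteq> 4"
    using E(2) by auto
  obtain t R t' R' where R:
    "distinct (edge_labels R)" "set (edge_labels R) = set (edge_labels E) - {3, 4}"
    "distinct (edge_labels R')" "set (edge_labels R') = set (edge_labels E) - {3, 4}"
    and v: "\<And>(G::real^'n^'n) I \<alpha>. linear_ah G I \<Longrightarrow>
       (\<Sum>a\<in>UNIV. \<Sum>b\<in>UNIV. matrix_inv G $ a $ b *
         pairings_value G I E (\<alpha>(3 := frame a, 4 := frame b))) = t * pairings_value G I R \<alpha>"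
    "\<And>(G::real^'n^'n) I \<alpha>. linear_ah G I \<Longrightarrow>
       (\<Sum>a\<in>UNIV. \<Sum>b\<in>UNIV. (\<Sum>i\<in>UNIV. \<Sum>j\<in>UNIV. matrix_inv G $ a $ i * matrix_inv G $ b $ j *
           lower_endo G I $ i $ j) *
         pairings_value G I E (\<alpha>(3 := frame a, 4 := frame b))) = t' * pairings_value G I R' \<alpha>"
    by (rule contract_labels[OF E(1) mem]) blast
  have h: "bij_betw h ({..<k + 5} - {3, 4}) {..<k + 3}"
    by (rule bij_betw_byWitness[where f' = "\<lambda>n. if n < 3 then n else n + 2"]) (auto simp: h_def)
  have \<alpha>: "(\<lambda>n. ([u, v, w] @ map frame (a # b # is)) ! n) =
      ((\<lambda>n. ([u, v, w] @ map frame is) ! n) \<circ> h)(3 := frame a, 4 := frame b)" for u v w a b and "is" :: "'n list"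
  proof
    fix n :: nat
    have "n = 0 \<or> n = 1 \<or> n = 2 \<or> n = 3 \<or> n = 4 \<or> (\<exists>m. n = 5 + m)" by presburger
    then consider "n = 0" | "n = 1" | "n = 2" | "n = 3" | "n = 4" | m where "n = 5 + m" by blast
    then show "([u, v, w] @ map frame (a # b # is)) ! n =
      (((\<lambda>n. ([u, v, w] @ map frame is) ! n) \<circ> h)(3 := frame a, 4 := frame b)) n"
      by cases (simp_all add: h_def numeral_eq_Suc)
  qed
  have pf: "perfect (k + 3) (relabel h R)" "perfect (k + 3) (relabel h R')"
    using R h E by (simp_all add: perfect_def edge_labels_relabel distinct_map bij_betw_def)
  show ?g
    by (intro exI[of _ t] exI[of _ "relabel h R"] conjI pf(1) allI impI)
       (simp only: \<alpha> v(1) pairings_value_relabel)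
  show ?omega
    by (intro exI[of _ t'] exI[of _ "relabel h R'"] conjI pf(2) allI impI)
       (simp only: \<alpha> v(2) pairings_value_relabel)
qed

lemma sum_list_sum_swap:
  "(\<Sum>a\<in>A. \<Sum>b\<in>B. W a b * (\<Sum>x\<leftarrow>xs. f x a b)) = (\<Sum>x\<leftarrow>xs. \<Sum>a\<in>A. \<Sum>b\<in>B. W a b * (f x a b :: real))"
  by (induction xs) (simp_all add: algebra_simps sum.distrib)

text \<open>The coefficients do not depend on the structure (G, I): this is why the constant a of the
  theorem is universal.\<close>

definition combination_of_pairings :: "nat \<Rightarrow> nat \<Rightarrow>
    (real^'n^'n \<Rightarrow> real^'n^'n \<Rightarrow> (nat \<Rightarrow> 'n::finite list \<Rightarrow> real) \<Rightarrow> 'n list \<Rightarrow> real) \<Rightarrow>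
    (real \<times> (bool \<times> nat \<times> nat) list) list \<Rightarrow> bool" where
  "combination_of_pairings p k \<Phi> D \<longleftrightarrow> (\<forall>(c, E)\<in>set D. perfect (k + 3) E) \<and>
    (\<forall>G I u v w is. linear_ah G I \<longrightarrow> length is = k \<longrightarrow>
      \<Phi> G I (\<lambda>i. if i = p then elementary G u v w else (\<lambda>_. 0)) is =
      (\<Sum>(c, E)\<leftarrow>D. c * pairings_value G I E (\<lambda>n. ([u, v, w] @ map frame is) ! n)))"

text \<open>Stated for an arbitrary weight \<open>W\<close>, so that contraction with g and with
  omega are handled by one argument.\<close>

lemma combination_of_pairings_contract:
  fixes \<Phi> :: "real^'n^'n \<Rightarrow> real^'n^'n \<Rightarrow> (nat \<Rightarrow> 'n::finite list \<Rightarrow> real) \<Rightarrow> 'n list \<Rightarrow> real"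
  assumes step: "\<And>E. perfect (k + 5) E \<Longrightarrow> \<exists>t R. perfect (k + 3) R \<and>
    (\<forall>G I u v w is. linear_ah G I \<longrightarrow> (\<Sum>a\<in>UNIV. \<Sum>b\<in>UNIV. W G I a b *
       pairings_value G I E (\<lambda>n. ([u, v, w] @ map frame (a # b # is)) ! n)) =
       t * pairings_value G I R (\<lambda>n. ([u, v, w] @ map frame is) ! n))"
    and D: "combination_of_pairings p (k + 2) \<Phi> D"
  shows "\<exists>D'. combination_of_pairings p k (\<lambda>G I c is. \<Sum>a\<in>UNIV. \<Sum>b\<in>UNIV. W G I a b * \<Phi> G I c (a # b # is)) D'"
proof -
  let ?v = "\<lambda>u v w is n. ([u, v, w] @ map frame is) ! n"
  have k5: "k + 2 + 3 = k + 5" by simp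
  have "\<forall>(c, E)\<in>set D. perfect (k + 5) E"
    using D unfolding combination_of_pairings_def k5 by blast
  then have "\<exists>D'. (\<forall>(c, E)\<in>set D'. perfect (k + 3) E) \<and> (\<forall>G I u v w is. linear_ah G I \<longrightarrow>
      (\<Sum>(c, E)\<leftarrow>D. \<Sum>a\<in>UNIV. \<Sum>b\<in>UNIV. W G I a b *
         (c * pairings_value G I E (?v u v w (a # b # is)))) =
      (\<Sum>(c, E)\<leftarrow>D'. c * pairings_value G I E (?v u v w is)))"
  proof (induction D)
    case Nil
    show ?case by (rule exI[of _ "[]"]) simp
  next
    case (Cons d D)
    obtain c E where d: "d = (c, E)" by force
    obtain t R where R: "perfect (k + 3) R" "\<And>G I u v w is. linear_ah G I \<Longrightarrow>
       (\<Sum>a\<in>UNIV. \<Sum>b\<in>UNIV. W G I a b * pairings_value G I E (?v u v w (a # b # is))) =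
       t * pairings_value G I R (?v u v w is)"
    proof -
      have "perfect (k + 5) E" using Cons.prems d by simp
      from step[OF this] show ?thesis using that by blast
    qed
    from Cons obtain D' where D': "\<forall>(c, E)\<in>set D'. perfect (k + 3) E"
      "\<And>G I u v w is. linear_ah G I \<Longrightarrow>
      (\<Sum>(c, E)\<leftarrow>D. \<Sum>a\<in>UNIV. \<Sum>b\<in>UNIV. W G I a b * (c * pairings_value G I E (?v u v w (a # b # is)))) =
      (\<Sum>(c, E)\<leftarrow>D'. c * pairings_value G I E (?v u v w is))"
      by auto
    have "(\<Sum>a\<in>UNIV. \<Sum>b\<in>UNIV. W G I a b * (c * pairings_value G I E (?v u v w (a # b # is)))) =
       c * t * pairings_value G I R (?v u v w is)"
      if "linear_ah G I" for G I u v w "is"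
      unfolding mult.assoc[of c] R(2)[OF that, symmetric] sum_distrib_left
      by (simp add: mult.left_commute)
    then show ?case
      by (intro exI[of _ "(c * t, R) # D'"]) (use R(1) D' in \<open>simp add: d\<close>)
  qed
  then obtain D' where D': "\<forall>(c, E)\<in>set D'. perfect (k + 3) E"
      "\<And>G I u v w is. linear_ah G I \<Longrightarrow>
      (\<Sum>(c, E)\<leftarrow>D. \<Sum>a\<in>UNIV. \<Sum>b\<in>UNIV. W G I a b * (c * pairings_value G I E (?v u v w (a # b # is)))) =
      (\<Sum>(c, E)\<leftarrow>D'. c * pairings_value G I E (?v u v w is))"
    by blast
  have "combination_of_pairings p k (\<lambda>G I c is. \<Sum>a\<in>UNIV. \<Sum>b\<in>UNIV. W G I a b * \<Phi> G I c (a # b # is)) D'"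
    unfolding combination_of_pairings_def
  proof (intro conjI allI impI D'(1))
    fix G I :: "real^'n^'n" and u v w and "is" :: "'n list" assume ah: "linear_ah G I" "length is = k"
    show "(\<Sum>a\<in>UNIV. \<Sum>b\<in>UNIV. W G I a b *
        \<Phi> G I (\<lambda>i. if i = p then elementary G u v w else (\<lambda>_. 0)) (a # b # is)) =
      (\<Sum>(c, E)\<leftarrow>D'. c * pairings_value G I E (?v u v w is))"
      unfolding D'(2)[OF ah(1), symmetric]
      using D ah by (simp add: combination_of_pairings_def sum_list_sum_swap case_prod_unfold)
  qed
  then show ?thesis by blast
qed

text \<open>The two new free slots have positions \<open>k\<close> and \<open>k + 1\<close>, hence
  labels \<open>k + 3\<close> and \<open>k + 4\<close>; a factor g or omega is a new edge between
  them.\<close>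

lemma combination_of_pairings_times:
  fixes \<Phi> :: "real^'n^'n \<Rightarrow> real^'n^'n \<Rightarrow> (nat \<Rightarrow> 'n::finite list \<Rightarrow> real) \<Rightarrow> 'n list \<Rightarrow> real"
  assumes "combination_of_pairings p k \<Phi> D"
  shows "\<exists>D'. combination_of_pairings p (k + 2)
    (\<lambda>G I c is. \<Phi> G I c (take k is) * pairing G I e (frame (is!k)) (frame (is!(k+1)))) D'"
proof -
  let ?D = "map (\<lambda>(c, E). (c, E @ [(e, k + 3, k + 4)])) D"
  have ext: "([u, v, w] @ map frame (take k is)) ! n = ([u, v, w] @ map frame is) ! n"
    if "n < k + 3" for u v w n and "is" :: "'n list"
  proof -
    have "[u, v, w] @ map frame (take k is) = take (k + 3) ([u, v, w] @ map frame is)"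
      by (simp add: take_map numeral_eq_Suc)
    then show ?thesis using that by (metis nth_take)
  qed
  have val: "pairings_value G I (E @ [(e, k + 3, k + 4)]) (\<lambda>n. ([u, v, w] @ map frame is) ! n) =
      pairings_value G I E (\<lambda>n. ([u, v, w] @ map frame (take k is)) ! n) *
      pairing G I e (frame (is!k)) (frame (is!(k+1)))"
    if "perfect (k + 3) E" "length is = k + 2" for G I :: "real^'n^'n" and u v w E "is"
  proof -
    have "pairings_value G I E (\<lambda>n. ([u, v, w] @ map frame is) ! n) =
        pairings_value G I E (\<lambda>n. ([u, v, w] @ map frame (take k is)) ! n)"
      by (rule pairings_value_cong) (use that(1) ext in \<open>auto simp: perfect_def\<close>)
    moreover have "([u, v, w] @ map frame is) ! (k + 3) = frame (is!k)"
      "([u, v, w] @ map frame is) ! (k + 4) = frame (is!(k+1))"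
      using that(2) by (simp_all add: numeral_eq_Suc)
    ultimately show ?thesis by simp
  qed
  have lt: "{..<k + 2 + 3} = insert (k + 3) (insert (k + 4) {..<k + 3})" by auto
  have "perfect (k + 2 + 3) (E @ [(e, k + 3, k + 4)])" if "perfect (k + 3) E" for E
    using that unfolding perfect_def lt by simp
  moreover have "(\<Sum>(c, E)\<leftarrow>?D. c * pairings_value G I E (\<lambda>n. ([u, v, w] @ map frame is) ! n)) =
      (\<Sum>(c, E)\<leftarrow>D. c * pairings_value G I E (\<lambda>n. ([u, v, w] @ map frame (take k is)) ! n)) *
      pairing G I e (frame (is!k)) (frame (is!(k+1)))"
    if "length is = k + 2" for G I :: "real^'n^'n" and u v w "is"
  proof -
    have "\<forall>(c, E)\<in>set D. perfect (k + 3) E"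
      using assms by (simp add: combination_of_pairings_def)
    then show ?thesis
    proof (induction D)
      case (Cons d D)
      then show ?case using val[OF _ that]
        by (simp add: case_prod_unfold distrib_right mult.assoc del: pairings_value_simps)
    qed simp
  qed
  ultimately have "combination_of_pairings p (k + 2)
    (\<lambda>G I c is. \<Phi> G I c (take k is) * pairing G I e (frame (is!k)) (frame (is!(k+1)))) ?D"
    using assms by (auto simp: combination_of_pairings_def)
  then show ?thesis by blast
qed

text \<open>On a decomposable core every contraction reduces to matchings, by following the rules.
  Only core \<open>p\<close> is fed a nonzero value.\<close>

lemma contraction_op_pairings:
  assumes "contraction_op r k (\<Phi> :: real^'n^'n \<Rightarrow> _)" "r p = 3"
  shows "\<exists>D. combination_of_pairings p k \<Phi> D"
  using assms(1)
proof induction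
  case (core i)
  show ?case
  proof (cases "i = p")
    case True
    \<comment> \<open>The core itself pairs the vector labels 0, 1, 2 with its free slots 3, 4,
      5.\<close>
    have "combination_of_pairings p (r i) (\<lambda>G I c. c i)
        [(1, [(False, 0, 3), (False, 1, 4), (False, 2, 5)])]"
      using True assms(2)
      by (auto simp: combination_of_pairings_def perfect_def pairing_def elementary_def
          length_Suc_conv numeral_eq_Suc lessThan_Suc)
    then show ?thesis by blast
  next
    case False
    then have "combination_of_pairings p (r i) (\<lambda>G I c. c i) []"
      by (simp add: combination_of_pairings_def)
    then show ?thesis by blast
  qed
next
  case (times_g k \<Phi>)
  then show ?case
    using combination_of_pairings_times[where e = False] by (force simp: pairing_def bil_frame)
next
  case (times_J k \<Phi>)
  then show ?case
    using combination_of_pairings_times[where e = True]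
    by (force simp: pairing_def bil_frame lower_endo_def)
next
  case (permute k \<Phi> \<pi>)
  then obtain D where D: "combination_of_pairings p k \<Phi> D" by blast
  \<comment> \<open>A permutation of the free slots acts on labels shifted by 3 and fixes the three
    vectors.\<close>
  define f where "f n = (if n < 3 then n else 3 + \<pi> (n - 3))" for n :: nat
  have \<pi>: "inj \<pi>" "\<pi> n < k \<longleftrightarrow> n < k" for n
    using permutes_inj[OF permute.hyps(2)] permutes_in_image[OF permute.hyps(2)] by simp_all
  have inj: "inj f"
  proof (rule injI)
    fix a b assume "f a = f b"
    then show "a = b"
      by (cases "a < 3"; cases "b < 3") (auto simp: f_def dest!: injD[OF \<pi>(1)])
  qed
  have "f ` {..<k + 3} \<subseteq> {..<k + 3}"
  proof safe
    fix n assume "n < k + 3"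
    then show "f n < k + 3"
      using \<pi>(2)[of "n - 3"] by (cases "n < 3") (auto simp: f_def)
  qed
  then have bij: "bij_betw f {..<k + 3} {..<k + 3}"
    unfolding bij_betw_def by (metis endo_inj_surj finite_lessThan inj inj_on_subset subset_UNIV)
  have val: "pairings_value G I (relabel f E) (\<lambda>n. ([u, v, w] @ map frame is) ! n) =
      pairings_value G I E (\<lambda>n. ([u, v, w] @ map frame (permute_list \<pi> is)) ! n)"
    if "perfect (k + 3) E" "length is = k" for G I :: "real^'n^'n" and u v w E "is"
    unfolding pairings_value_relabel
  proof (rule pairings_value_cong)
    fix n assume "n \<in> set (edge_labels E)"
    then have "n < k + 3" using that(1) by (auto simp: perfect_def)
    then have "n = 0 \<or> n = 1 \<or> n = 2 \<or> (\<exists>m. n = 3 + m \<and> m < k)" by presburger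
    then consider "n = 0" | "n = 1" | "n = 2" | m where "n = 3 + m" "m < k" by blast
    then show "((\<lambda>n. ([u, v, w] @ map frame is) ! n) \<circ> f) n =
        ([u, v, w] @ map frame (permute_list \<pi> is)) ! n"
      by cases (use that(2) \<pi> in \<open>simp_all add: f_def permute_list_def nth_append\<close>)
  qed
  have "combination_of_pairings p k (\<lambda>G I c is. \<Phi> G I c (permute_list \<pi> is))
      (map (\<lambda>(c, E). (c, relabel f E)) D)"
    unfolding combination_of_pairings_def
  proof (intro conjI allI impI)
    show "\<forall>(c, E)\<in>set (map (\<lambda>(c, E). (c, relabel f E)) D). perfect (k + 3) E"
      using D perfect_relabel[OF _ bij] by (auto simp: combination_of_pairings_def)
    fix G I :: "real^'n^'n" and u v w and "is" :: "'n list" assume ah: "linear_ah G I" "length is = k"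
    have "\<Phi> G I (\<lambda>i. if i = p then elementary G u v w else (\<lambda>_. 0)) (permute_list \<pi> is) =
      (\<Sum>(c, E)\<leftarrow>D. c * pairings_value G I E (\<lambda>n. ([u, v, w] @ map frame (permute_list \<pi> is)) ! n))"
      using D ah by (simp add: combination_of_pairings_def)
    also have "\<dots> = (\<Sum>(c, E)\<leftarrow>D. c * pairings_value G I (relabel f E) (\<lambda>n. ([u, v, w] @ map frame is) ! n))"
    proof (intro arg_cong[of _ _ sum_list] map_cong refl)
      fix d assume "d \<in> set D"
      then have "perfect (k + 3) (snd d)" using D by (auto simp: combination_of_pairings_def)
      from val[OF this ah(2)] show "(case d of (c, E) \<Rightarrow> c * pairings_value G I E
          (\<lambda>n. ([u, v, w] @ map frame (permute_list \<pi> is)) ! n)) =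
        (case d of (c, E) \<Rightarrow> c * pairings_value G I (relabel f E) (\<lambda>n. ([u, v, w] @ map frame is) ! n))"
        by (simp only: case_prod_unfold)
    qed
    finally show "\<Phi> G I (\<lambda>i. if i = p then elementary G u v w else (\<lambda>_. 0)) (permute_list \<pi> is) =
      (\<Sum>(c, E)\<leftarrow>map (\<lambda>(c, E). (c, relabel f E)) D.
        c * pairings_value G I E (\<lambda>n. ([u, v, w] @ map frame is) ! n))"
      by (simp add: o_def case_prod_unfold)
  qed
  then show ?case by blast
next
  case (contract_g k \<Phi>)
  then obtain D where D: "combination_of_pairings p (k + 2) \<Phi> D" by blast
  show ?case by (rule combination_of_pairings_contract[OF contract_perfect(1) D])
next
  case (contract_omega k \<Phi>)
  then obtain D where D: "combination_of_pairings p (k + 2) \<Phi> D" by blast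
  show ?case by (rule combination_of_pairings_contract[OF contract_perfect(2) D])
next
  case (add k \<Phi> \<Psi>)
  then obtain D D' where D: "combination_of_pairings p k \<Phi> D" "combination_of_pairings p k \<Psi> D'"
    by blast
  have "combination_of_pairings p k (\<lambda>G I c is. \<Phi> G I c is + \<Psi> G I c is) (D @ D')"
    using D by (auto simp: combination_of_pairings_def)
  then show ?case by blast
next
  case (scale k \<Phi> s)
  then obtain D where D: "combination_of_pairings p k \<Phi> D" by blast
  have "combination_of_pairings p k (\<lambda>G I c is. s * \<Phi> G I c is) (map (\<lambda>(c, E). (s * c, E)) D)"
    using D by (auto simp: combination_of_pairings_def sum_list_const_mult[symmetric] o_def
        case_prod_unfold mult.assoc)
  then show ?case by blast
qed

text \<open>For the core g((D_X J) Y, Z) the following are \<theta> and \<theta> composed with J, up to sign.\<close>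

definition contract_trace :: "real^'n^'n \<Rightarrow> ('n::finite \<Rightarrow> real^'n^'n) \<Rightarrow> 'n \<Rightarrow> real" where
  "contract_trace G b j = (\<Sum>a\<in>UNIV. \<Sum>k\<in>UNIV. matrix_inv G $ k $ a * b a $ k $ j)"

definition contract_trace_J :: "real^'n^'n \<Rightarrow> real^'n^'n \<Rightarrow> ('n::finite \<Rightarrow> real^'n^'n) \<Rightarrow> 'n \<Rightarrow> real" where
  "contract_trace_J G I b j = contract_trace G (\<lambda>a. transpose I ** b a) j"

text \<open>A one-form has one free slot, label 3. It is paired with one of the three vectors, and
  the remaining two are paired with each other.\<close>

lemma perfect_4_cases:
  assumes "perfect 4 E"
  obtains s e x f y z where "{x, y, z} = {0, 1, 2::nat}"
    "\<And>(G::real^'n^'n) I \<alpha>. linear_ah G I \<Longrightarrow> pairings_value G I E \<alpha> =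
       s * (pairing G I e (\<alpha> 3) (\<alpha> x) * pairing G I f (\<alpha> y) (\<alpha> z))"
proof -
  have "{..<4} = {0, 1, 2, 3::nat}" by (auto simp: numeral_eq_Suc less_Suc_eq)
  then have E: "distinct (edge_labels E)" "set (edge_labels E) = {0, 1, 2, 3}"
    using assms unfolding perfect_def by simp_all
  have "3 \<in> set (edge_labels E)" using E(2) by simp
  then obtain s e x R where R: "distinct (edge_labels ((e, 3, x) # R))"
    "set (edge_labels ((e, 3, x) # R)) = {0, 1, 2, 3}"
    and v: "\<And>(G::real^'n^'n) I \<alpha>. linear_ah G I \<Longrightarrow>
       pairings_value G I E \<alpha> = s * pairings_value G I ((e, 3, x) # R) \<alpha>"
    using pull_label[OF _ E(1), where 'n = 'n] E(2) by metis
  have len: "card (set (edge_labels ((e, 3, x) # R))) = 4" unfolding R(2) by simp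
  then have "length (edge_labels ((e, 3, x) # R)) = 4"
    using distinct_card[OF R(1)] by simp
  then have "length (edge_labels R) = 2" by simp
  then obtain f y z where Rs: "R = [(f, y, z)]"
    by (cases R; cases "tl R") (auto simp: edge_labels_def split: prod.splits)
  have "{x, y, z} = {0, 1, 2, 3} - {3}"
    unfolding R(2)[symmetric] using R(1) by (auto simp: Rs)
  also have "{0, 1, 2, 3} - {3} = {0, 1, 2::nat}" by auto
  finally show ?thesis using that[of x y z s e f] v by (simp add: Rs)
qed

text \<open>The slots of DJ are the derivative slot and a skew pair. If the free slot takes the
  derivative slot, the skew pair is contracted with itself and the result is 0. Otherwise the
  derivative slot is contracted with one slot of the pair, and skewness with anticommutation leaves
  only two traces up to sign.\<close>

lemma one_form_of_pairings:
  assumes "perfect 4 E"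
  shows "\<exists>c c'. \<forall>G I (b :: 'n::finite \<Rightarrow> real^'n^'n) j. linear_ah G I \<longrightarrow>
    (\<forall>i. transpose (b i) = - b i) \<longrightarrow> (\<forall>i. transpose I ** b i = b i ** I) \<longrightarrow>
    (\<Sum>x\<in>UNIV. \<Sum>y\<in>UNIV. \<Sum>z\<in>UNIV.
      (\<Sum>a\<in>UNIV. matrix_inv G $ x $ a *\<^sub>R (matrix_inv G ** b a ** matrix_inv G)) $ y $ z *
      pairings_value G I E (\<lambda>n. ([frame x, frame y, frame z] @ map frame [j]) ! n)) =
    c * contract_trace_J G I b j + c' * contract_trace G b j"
proof -
  obtain s e x0 f y0 z0 where xyz: "{x0, y0, z0} = {0, 1, 2::nat}" and v:
    "\<And>(G::real^'n^'n) I \<alpha>. linear_ah G I \<Longrightarrow> pairings_value G I E \<alpha> =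
       s * (pairing G I e (\<alpha> 3) (\<alpha> x0) * pairing G I f (\<alpha> y0) (\<alpha> z0))"
    by (rule perfect_4_cases[OF assms]) blast
  \<comment> \<open>\<open>sg\<close> is the sign for reversing the inner edge. \<open>c\<close> and
    \<open>c'\<close> record the marks: none leaves the plain trace, one gives the trace with
    \<open>I\<close>, two give minus the plain trace since the conjugate of b by \<open>I\<close> is
    -b. \<open>t\<close> adds the sign from the skew pair when the free slot takes its first member,
    and the orientation of the inner edge.\<close>
  define sg where "sg = (if f then - 1 else (1::real))"
  define c where "c = (if e = f then 0 else (1::real))"
  define c' where "c' = (if e \<and> f then - 1 else if e \<or> f then 0 else (1::real))"
  define t where "t = (if x0 = 0 then 0 else (if x0 = 2 then s else - s) * (if y0 = 0 then 1 else sg))"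
  show ?thesis
  proof (rule exI[of _ "t * c"], rule exI[of _ "t * c'"], intro allI impI)
    fix G I and b :: "'n \<Rightarrow> real^'n^'n" and j
    assume ah: "linear_ah G I" and sk: "\<forall>i. transpose (b i) = - b i"
      and an: "\<forall>i. transpose I ** b i = b i ** I"
    define P where "P e = (if e then transpose I ** G else G)" for e
    \<comment> \<open>The core with all three indices raised, that is, its coefficients in terms of
      decomposable cores.\<close>
    define U where "U x = (\<Sum>a\<in>UNIV. matrix_inv G $ x $ a *\<^sub>R (matrix_inv G ** b a ** matrix_inv G))" for x
    have pP: "pairing G I e (frame i) (frame j) = P e $ i $ j" for e i j
      by (simp add: pairing_def P_def bil_frame bil_mult_left)
    have Psym: "P f $ i $ j = sg * P f $ j $ i" for i j
      using pairing_commute[OF ah, of f "frame i" "frame j"] by (simp add: pP sg_def)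
    have giT: "transpose (matrix_inv G) = matrix_inv G" by (rule linear_ah_inv_sym[OF ah])
    have "transpose (U x) = - U x" for x
      using sk by (simp add: U_def transpose_sum transpose_ring giT matrix_neg_left matrix_neg_right
          matrix_mul_assoc sum_negf)
    then have Usk: "U x $ y $ z = - U x $ z $ y" for x y z
      by (metis transpose_nth vector_uminus_component)
    have Pl: "P e ** matrix_inv G = (if e then transpose I else mat 1)" for e
      by (simp add: P_def matrix_mul_assoc[symmetric] linear_ah_inv_right[OF ah])
    have Pr: "matrix_inv G ** transpose (P e) = (if e then I else mat 1)" for e
      by (simp add: P_def transpose_ring linear_ah_sym[OF ah] matrix_mul_assoc linear_ah_inv_left[OF ah])
    have main: "(\<Sum>x\<in>UNIV. \<Sum>y\<in>UNIV. \<Sum>z\<in>UNIV. U x $ y $ z * (P e $ j $ z * P f $ x $ y)) =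
      c * contract_trace_J G I b j + c' * contract_trace G b j"
    proof -
      have "(\<Sum>x\<in>UNIV. \<Sum>y\<in>UNIV. \<Sum>z\<in>UNIV. U x $ y $ z * (P e $ j $ z * P f $ x $ y)) =
          (\<Sum>x\<in>UNIV. (P f ** U x ** transpose (P e)) $ x $ j)"
        unfolding matrix_mult_nth transpose_nth sum_distrib_right
        by (rule sum.cong, rule refl, subst sum.swap) (simp add: algebra_simps)
      also have "\<dots> = (\<Sum>x\<in>UNIV. \<Sum>a\<in>UNIV. matrix_inv G $ x $ a *
          ((P f ** matrix_inv G) ** b a ** (matrix_inv G ** transpose (P e))) $ x $ j)"
        by (simp add: U_def matrix_sum_left matrix_sum_right matrix_scaleR_left matrix_scaleR_right
            matrix_mul_assoc sum_component)
      also have "\<dots> = (\<Sum>a\<in>UNIV. \<Sum>x\<in>UNIV. matrix_inv G $ x $ a *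
          ((if f then transpose I else mat 1) ** b a ** (if e then I else mat 1)) $ x $ j)"
        unfolding Pl Pr by (rule sum.swap)
      also have "\<dots> = c * contract_trace_J G I b j + c' * contract_trace G b j"
      proof -
        have 1: "b a ** I = transpose I ** b a" for a using an by simp
        have "transpose I ** transpose I = - mat 1"
          by (metis linear_ah_square[OF ah] matrix_transpose_mul transpose_mat transpose_minus)
        then have 2: "transpose I ** b a ** I = - b a" for a
          by (simp add: matrix_mul_assoc[symmetric] 1) (simp add: matrix_mul_assoc matrix_neg_left)
        show ?thesis
          by (cases e; cases f)
             (simp_all add: c_def c'_def contract_trace_J_def contract_trace_def 1 2 sum_negf)
      qed
      finally show ?thesis .
    qed
    \<comment> \<open>The skew pair contracted with g vanishes by symmetry; contracted with omega it
      vanishes because \<open>b a ** I\<close> is skew again.\<close>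
    have zero: "(\<Sum>y\<in>UNIV. \<Sum>z\<in>UNIV. U x $ y $ z * P f $ y $ z) = 0" for x
    proof -
      let ?S = "\<Sum>y\<in>UNIV. \<Sum>z\<in>UNIV. U x $ y $ z * P f $ y $ z"
      have swap: "?S = - sg * ?S"
      proof -
        have "?S = (\<Sum>z\<in>UNIV. \<Sum>y\<in>UNIV. U x $ y $ z * P f $ y $ z)" by (rule sum.swap)
        also have "\<dots> = (\<Sum>z\<in>UNIV. \<Sum>y\<in>UNIV. - sg * (U x $ z $ y * P f $ z $ y))"
          by (intro sum.cong refl) (subst Usk, subst Psym, simp)
        finally show ?thesis by (simp only: sum_distrib_left[symmetric])
      qed
      show ?thesis
      proof (cases f)
        case False
        then show ?thesis using swap by (simp add: sg_def)
      next
        case True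
        have "?S = (\<Sum>y\<in>UNIV. (U x ** transpose (P f)) $ y $ y)"
          by (simp add: matrix_mult_nth transpose_nth)
        also have "U x ** transpose (P f) =
            (\<Sum>a\<in>UNIV. matrix_inv G $ x $ a *\<^sub>R (matrix_inv G ** (b a ** I)))"
          using True by (simp add: U_def matrix_sum_left matrix_scaleR_left matrix_mul_assoc[symmetric] Pr)
        finally have S: "?S = (\<Sum>y\<in>UNIV. \<Sum>a\<in>UNIV. matrix_inv G $ x $ a * (matrix_inv G ** (b a ** I)) $ y $ y)"
          by (simp add: sum_component)
        have "(\<Sum>y\<in>UNIV. (matrix_inv G ** (b a ** I)) $ y $ y) = 0" for a
        proof -
          have "transpose (b a ** I) = - (b a ** I)"
            using sk an by (simp add: transpose_ring matrix_neg_right)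
          then have k: "(b a ** I) $ q $ y = - (b a ** I) $ y $ q" for y q
            by (metis transpose_nth vector_uminus_component)
          have g: "matrix_inv G $ y $ q = matrix_inv G $ q $ y" for y q
            by (metis giT transpose_nth)
          let ?T = "\<Sum>y\<in>UNIV. \<Sum>q\<in>UNIV. matrix_inv G $ y $ q * (b a ** I) $ q $ y"
          have "?T = (\<Sum>q\<in>UNIV. \<Sum>y\<in>UNIV. matrix_inv G $ y $ q * (b a ** I) $ q $ y)" by (rule sum.swap)
          also have "\<dots> = (\<Sum>q\<in>UNIV. \<Sum>y\<in>UNIV. - (matrix_inv G $ q $ y * (b a ** I) $ y $ q))"
            by (intro sum.cong refl) (subst g, subst k, simp)
          also have "\<dots> = - ?T" by (simp only: sum_negf)
          finally show ?thesis by (simp add: matrix_mult_nth[of "matrix_inv G"])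
        qed
        then show ?thesis unfolding S by (subst sum.swap) (simp add: sum_distrib_left[symmetric])
      qed
    qed
    have vv: "pairings_value G I E (\<lambda>n. ([frame x, frame y, frame z] @ map frame [j]) ! n) =
        s * (P e $ j $ ([x, y, z] ! x0) * P f $ ([x, y, z] ! y0) $ ([x, y, z] ! z0))" for x y z
    proof -
      have "([frame x, frame y, frame z] @ map frame [j]) ! n = frame ([x, y, z] ! n)" if "n \<in> {0, 1, 2}" for n
        using that by auto
      moreover have "x0 \<in> {0, 1, 2}" "y0 \<in> {0, 1, 2}" "z0 \<in> {0, 1, 2}" using xyz by blast+
      moreover have "([frame x, frame y, frame z] @ map frame [j]) ! 3 = frame j" by simp
      ultimately show ?thesis by (simp only: v[OF ah] pP)
    qed
    have pm: "x0 = 0 \<and> y0 = 1 \<and> z0 = 2 \<or> x0 = 0 \<and> y0 = 2 \<and> z0 = 1 \<or> x0 = 1 \<and> y0 = 0 \<and> z0 = 2 \<or>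
        x0 = 1 \<and> y0 = 2 \<and> z0 = 0 \<or> x0 = 2 \<and> y0 = 0 \<and> z0 = 1 \<or> x0 = 2 \<and> y0 = 1 \<and> z0 = 0"
    proof -
      have "x0 \<in> {0, 1, 2}" "y0 \<in> {0, 1, 2}" "z0 \<in> {0, 1, 2}" using xyz by blast+
      moreover have "0 \<in> {x0, y0, z0}" "1 \<in> {x0, y0, z0}" "2 \<in> {x0, y0, z0}"
        unfolding xyz by simp_all
      ultimately show ?thesis
        by (cases "x0 = 0"; cases "x0 = 1"; cases "y0 = 0"; cases "y0 = 1"; cases "z0 = 0"; cases "z0 = 1"; simp)
    qed
    have main': "(\<Sum>x\<in>UNIV. \<Sum>y\<in>UNIV. \<Sum>z\<in>UNIV. U x $ y $ z * (P e $ j $ y * P f $ x $ z)) =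
      - (c * contract_trace_J G I b j + c' * contract_trace G b j)"
    proof -
      have "(\<Sum>x\<in>UNIV. \<Sum>y\<in>UNIV. \<Sum>z\<in>UNIV. U x $ y $ z * (P e $ j $ y * P f $ x $ z)) =
        (\<Sum>x\<in>UNIV. \<Sum>y\<in>UNIV. \<Sum>z\<in>UNIV. U x $ z $ y * (P e $ j $ z * P f $ x $ y))"
        by (rule sum.cong[OF refl], rule sum.swap)
      also have "\<dots> = (\<Sum>x\<in>UNIV. \<Sum>y\<in>UNIV. \<Sum>z\<in>UNIV. - (U x $ y $ z * (P e $ j $ z * P f $ x $ y)))"
        by (intro sum.cong refl) (subst Usk, simp)
      finally show ?thesis by (simp only: sum_negf main)
    qed
    have fl: "U x $ y $ z * (s * (p * P f $ i $ k)) = sg * s * (U x $ y $ z * (p * P f $ k $ i))"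
      for x y z p i k by (subst Psym) simp
    have fl': "U x $ y $ z * (s * q) = s * (U x $ y $ z * q)" for x y z q by simp
    have zero': "(\<Sum>x\<in>UNIV. \<Sum>y\<in>UNIV. \<Sum>z\<in>UNIV. U x $ y $ z * (P e $ j $ x * P f $ y $ z)) = 0"
    proof -
      have "(\<Sum>y\<in>UNIV. \<Sum>z\<in>UNIV. U x $ y $ z * (P e $ j $ x * P f $ y $ z)) =
          P e $ j $ x * (\<Sum>y\<in>UNIV. \<Sum>z\<in>UNIV. U x $ y $ z * P f $ y $ z)" for x
        by (simp add: sum_distrib_left mult.left_commute)
      then show ?thesis by (simp add: zero)
    qed
    have "(\<Sum>x\<in>UNIV. \<Sum>y\<in>UNIV. \<Sum>z\<in>UNIV. U x $ y $ z *
        (s * (P e $ j $ ([x, y, z] ! x0) * P f $ ([x, y, z] ! y0) $ ([x, y, z] ! z0)))) =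
      t * (c * contract_trace_J G I b j + c' * contract_trace G b j)"
      using pm
    proof (elim disjE conjE)
      assume *: "x0 = 0" "y0 = 1" "z0 = 2"
      have "(\<Sum>x\<in>UNIV. \<Sum>y\<in>UNIV. \<Sum>z\<in>UNIV. U x $ y $ z * (s * (P e $ j $ x * P f $ y $ z))) = 0"
        by (simp only: fl' sum_distrib_left[symmetric] zero' mult_zero_right)
      then show ?thesis by (simp add: * t_def)
    next
      assume *: "x0 = 0" "y0 = 2" "z0 = 1"
      have "(\<Sum>x\<in>UNIV. \<Sum>y\<in>UNIV. \<Sum>z\<in>UNIV. U x $ y $ z * (s * (P e $ j $ x * P f $ z $ y))) = 0"
        by (subst fl) (simp only: sum_distrib_left[symmetric] zero' mult_zero_right)
      then show ?thesis by (simp add: * t_def)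
    next
      assume *: "x0 = 1" "y0 = 0" "z0 = 2"
      have "(\<Sum>x\<in>UNIV. \<Sum>y\<in>UNIV. \<Sum>z\<in>UNIV. U x $ y $ z * (s * (P e $ j $ y * P f $ x $ z))) =
        - s * (c * contract_trace_J G I b j + c' * contract_trace G b j)"
        by (simp only: fl' sum_distrib_left[symmetric] main', (simp add: algebra_simps)?)
      then show ?thesis by (simp add: * t_def)
    next
      assume *: "x0 = 1" "y0 = 2" "z0 = 0"
      have "(\<Sum>x\<in>UNIV. \<Sum>y\<in>UNIV. \<Sum>z\<in>UNIV. U x $ y $ z * (s * (P e $ j $ y * P f $ z $ x))) =
        - s * sg * (c * contract_trace_J G I b j + c' * contract_trace G b j)"
        by (subst fl) (simp only: sum_distrib_left[symmetric] main', (simp add: algebra_simps)?)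
      then show ?thesis by (simp add: * t_def)
    next
      assume *: "x0 = 2" "y0 = 0" "z0 = 1"
      have "(\<Sum>x\<in>UNIV. \<Sum>y\<in>UNIV. \<Sum>z\<in>UNIV. U x $ y $ z * (s * (P e $ j $ z * P f $ x $ y))) =
        s * (c * contract_trace_J G I b j + c' * contract_trace G b j)"
        by (simp only: fl' sum_distrib_left[symmetric] main)
      then show ?thesis by (simp add: * t_def)
    next
      assume *: "x0 = 2" "y0 = 1" "z0 = 0"
      have "(\<Sum>x\<in>UNIV. \<Sum>y\<in>UNIV. \<Sum>z\<in>UNIV. U x $ y $ z * (s * (P e $ j $ z * P f $ y $ x))) =
        s * sg * (c * contract_trace_J G I b j + c' * contract_trace G b j)"
        by (subst fl) (simp only: sum_distrib_left[symmetric] main, (simp add: algebra_simps)?)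
      then show ?thesis by (simp add: * t_def)
    qed
    then show "(\<Sum>x\<in>UNIV. \<Sum>y\<in>UNIV. \<Sum>z\<in>UNIV.
        (\<Sum>a\<in>UNIV. matrix_inv G $ x $ a *\<^sub>R (matrix_inv G ** b a ** matrix_inv G)) $ y $ z *
        pairings_value G I E (\<lambda>n. ([frame x, frame y, frame z] @ map frame [j]) ! n)) =
      t * c * contract_trace_J G I b j + t * c' * contract_trace G b j"
      unfolding U_def[symmetric] vv by (simp add: algebra_simps)
  qed
qed

text \<open>\<open>c\<close> and \<open>c'\<close> are chosen before \<open>G\<close> and
  \<open>I\<close>: they come from the matchings, whose coefficients are the same for all
  pairs.\<close>

lemma contraction_op_one_form:
  assumes "contraction_op r 1 (\<Phi> :: real^'n^'n \<Rightarrow> _)" "r p = 3"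
  shows "\<exists>c c'. \<forall>G I (b :: 'n \<Rightarrow> real^'n^'n) j. linear_ah G I \<longrightarrow>
    (\<forall>i. transpose (b i) = - b i) \<longrightarrow> (\<forall>i. transpose I ** b i = b i ** I) \<longrightarrow>
    \<Phi> G I (\<lambda>i js. if i = p then b (js!0) $ (js!1) $ (js!2) else 0) [j] =
    c * contract_trace_J G I b j + c' * contract_trace G b j"
proof -
  obtain D where D: "combination_of_pairings p 1 \<Phi> D"
    using contraction_op_pairings[where \<Phi> = \<Phi>, OF assms] by blast
  let ?U = "\<lambda>G b x. \<Sum>a\<in>UNIV. matrix_inv G $ x $ a *\<^sub>R (matrix_inv G ** (b :: 'n \<Rightarrow> real^'n^'n) a ** matrix_inv G)"
  have "\<forall>(c, E)\<in>set D. perfect 4 E" using D by (simp add: combination_of_pairings_def)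
  then have "\<exists>c c'. \<forall>G I (b :: 'n \<Rightarrow> real^'n^'n) j. linear_ah G I \<longrightarrow>
    (\<forall>i. transpose (b i) = - b i) \<longrightarrow> (\<forall>i. transpose I ** b i = b i ** I) \<longrightarrow>
    (\<Sum>x\<in>UNIV. \<Sum>y\<in>UNIV. \<Sum>z\<in>UNIV. ?U G b x $ y $ z * (\<Sum>(c, E)\<leftarrow>D. c *
      pairings_value G I E (\<lambda>n. ([frame x, frame y, frame z] @ map frame [j]) ! n))) =
    c * contract_trace_J G I b j + c' * contract_trace G b j"
  proof (induction D)
    case Nil
    show ?case by (intro exI[of _ 0]) simp
  next
    case (Cons d D)
    obtain w E where d: "d = (w, E)" by force
    have pf: "perfect 4 E" using Cons.prems d by simp
    obtain c1 c1' where 1: "\<And>G I (b :: 'n \<Rightarrow> real^'n^'n) j. linear_ah G I \<Longrightarrow>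
      \<forall>i. transpose (b i) = - b i \<Longrightarrow> \<forall>i. transpose I ** b i = b i ** I \<Longrightarrow>
      (\<Sum>x\<in>UNIV. \<Sum>y\<in>UNIV. \<Sum>z\<in>UNIV. ?U G b x $ y $ z *
        pairings_value G I E (\<lambda>n. ([frame x, frame y, frame z] @ map frame [j]) ! n)) =
      c1 * contract_trace_J G I b j + c1' * contract_trace G b j"
      using one_form_of_pairings[OF pf, where 'n = 'n] by blast
    from Cons obtain c2 c2' where 2: "\<And>G I (b :: 'n \<Rightarrow> real^'n^'n) j. linear_ah G I \<Longrightarrow>
      \<forall>i. transpose (b i) = - b i \<Longrightarrow> \<forall>i. transpose I ** b i = b i ** I \<Longrightarrow>
      (\<Sum>x\<in>UNIV. \<Sum>y\<in>UNIV. \<Sum>z\<in>UNIV. ?U G b x $ y $ z * (\<Sum>(c, E)\<leftarrow>D. c *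
        pairings_value G I E (\<lambda>n. ([frame x, frame y, frame z] @ map frame [j]) ! n))) =
      c2 * contract_trace_J G I b j + c2' * contract_trace G b j"
      by auto
    have split: "u * (\<Sum>(c, E)\<leftarrow>d # D. c * q E) = w * (u * q E) + u * (\<Sum>(c, E)\<leftarrow>D. c * q E)"
      for u :: real and q by (simp add: d algebra_simps)
    show ?case
    proof (rule exI[of _ "w * c1 + c2"], rule exI[of _ "w * c1' + c2'"], intro allI impI)
      fix G I and b :: "'n \<Rightarrow> real^'n^'n" and j
      assume h: "linear_ah G I" "\<forall>i. transpose (b i) = - b i" "\<forall>i. transpose I ** b i = b i ** I"
      show "(\<Sum>x\<in>UNIV. \<Sum>y\<in>UNIV. \<Sum>z\<in>UNIV. ?U G b x $ y $ z * (\<Sum>(c, E)\<leftarrow>d # D. c *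
        pairings_value G I E (\<lambda>n. ([frame x, frame y, frame z] @ map frame [j]) ! n))) =
        (w * c1 + c2) * contract_trace_J G I b j + (w * c1' + c2') * contract_trace G b j"
        unfolding split sum.distrib sum_distrib_left[of w, symmetric] 1[OF h] 2[OF h]
        by (simp add: algebra_simps)
    qed
  qed
  then obtain c c' where cc: "\<And>G I (b :: 'n \<Rightarrow> real^'n^'n) j. linear_ah G I \<Longrightarrow>
    \<forall>i. transpose (b i) = - b i \<Longrightarrow> \<forall>i. transpose I ** b i = b i ** I \<Longrightarrow>
    (\<Sum>x\<in>UNIV. \<Sum>y\<in>UNIV. \<Sum>z\<in>UNIV. ?U G b x $ y $ z * (\<Sum>(c, E)\<leftarrow>D. c *
      pairings_value G I E (\<lambda>n. ([frame x, frame y, frame z] @ map frame [j]) ! n))) =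
    c * contract_trace_J G I b j + c' * contract_trace G b j" by blast
  show ?thesis
  proof (rule exI[of _ c], rule exI[of _ c'], intro allI impI)
    fix G I and b :: "'n \<Rightarrow> real^'n^'n" and j
    assume ah: "linear_ah G I" and sk: "\<forall>i. transpose (b i) = - b i"
      and an: "\<forall>i. transpose I ** b i = b i ** I"
    let ?el = "\<lambda>x y z i. if i = p then elementary G (frame x) (frame y) (frame z) else (\<lambda>_. 0)"
    \<comment> \<open>Every core is a sum of decomposable ones: raise its indices and lower them
      again.\<close>
    have b: "b i $ j $ k = (\<Sum>x\<in>UNIV. \<Sum>y\<in>UNIV. \<Sum>z\<in>UNIV. ?U G b x $ y $ z *
        (G $ x $ i * G $ y $ j * G $ z $ k))" for i j k
    proof -
      have "(\<Sum>x\<in>UNIV. \<Sum>y\<in>UNIV. \<Sum>z\<in>UNIV. ?U G b x $ y $ z * (G $ x $ i * G $ y $ j * G $ z $ k)) =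
          (\<Sum>x\<in>UNIV. G $ x $ i * (transpose G ** ?U G b x ** G) $ j $ k)"
        unfolding matrix_mult_nth transpose_nth sum_distrib_right sum_distrib_left
        by (rule sum.cong, rule refl, subst sum.swap) (simp add: algebra_simps)
      also have "\<dots> = (\<Sum>x\<in>UNIV. \<Sum>a\<in>UNIV. G $ x $ i * (matrix_inv G $ x $ a * b a $ j $ k))"
        by (simp add: linear_ah_sym[OF ah] matrix_sum_left matrix_sum_right matrix_scaleR_left
            matrix_scaleR_right matrix_mul_assoc linear_ah_inv_right[OF ah])
           (simp add: matrix_mul_assoc[symmetric] linear_ah_inv_left[OF ah] sum_component sum_distrib_left)
      also have "\<dots> = (\<Sum>a\<in>UNIV. (transpose G ** matrix_inv G) $ i $ a * b a $ j $ k)"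
        unfolding matrix_mult_nth transpose_nth sum_distrib_right
        by (subst sum.swap) (simp add: algebra_simps)
      also have "\<dots> = b i $ j $ k"
        by (simp add: linear_ah_sym[OF ah] linear_ah_inv_right[OF ah] mat_def if_distrib
            if_distribR cong: if_cong)
      finally show ?thesis by simp
    qed
    have "(\<lambda>i js. if i = p then b (js!0) $ (js!1) $ (js!2) else 0) =
      (\<lambda>i js. \<Sum>x\<in>UNIV. \<Sum>y\<in>UNIV. \<Sum>z\<in>UNIV. ?U G b x $ y $ z * ?el x y z i js)"
      by (intro ext) (simp add: elementary_def bil_frame b)
    then have "\<Phi> G I (\<lambda>i js. if i = p then b (js!0) $ (js!1) $ (js!2) else 0) [j] =
      (\<Sum>x\<in>UNIV. \<Sum>y\<in>UNIV. \<Sum>z\<in>UNIV. ?U G b x $ y $ z * \<Phi> G I (?el x y z) [j])"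
      by (simp only: contraction_op_sum[OF assms(1)] contraction_op_mult[OF assms(1)])
    also have "\<dots> = (\<Sum>x\<in>UNIV. \<Sum>y\<in>UNIV. \<Sum>z\<in>UNIV. ?U G b x $ y $ z * (\<Sum>(c, E)\<leftarrow>D. c *
      pairings_value G I E (\<lambda>n. ([frame x, frame y, frame z] @ map frame [j]) ! n)))"
      using D[unfolded combination_of_pairings_def, THEN conjunct2, rule_format, OF ah, of "[j]"]
      by (simp only: length_Cons list.size One_nat_def)
    also have "\<dots> = c * contract_trace_J G I b j + c' * contract_trace G b j"
      by (rule cc[OF ah sk an])
    finally show "\<Phi> G I (\<lambda>i js. if i = p then b (js!0) $ (js!1) $ (js!2) else 0) [j] =
      c * contract_trace_J G I b j + c' * contract_trace G b j" .
  qed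
qed

section \<open>Partial derivatives\<close>

lemma pd_eqI: "(f has_derivative f') (at x) \<Longrightarrow> pd i f x = f' (frame i)"
  unfolding pd_def by (metis frechet_derivative_at)

lemma frechet_derivative_eq_pd:
  assumes "f differentiable at x"
  shows "frechet_derivative f (at x) v = (\<Sum>i\<in>UNIV. v $ i *\<^sub>R pd i f x)"
proof -
  have lin: "linear (frechet_derivative f (at x))"
    using assms by (rule linear_frechet_derivative)
  have "v = (\<Sum>i\<in>UNIV. v $ i *\<^sub>R frame i)"
    by (simp add: vec_eq_iff axis_def if_distrib cong: if_cong)
  then have "frechet_derivative f (at x) v = frechet_derivative f (at x) (\<Sum>i\<in>UNIV. v $ i *\<^sub>R frame i)"
    by simp
  then show ?thesis by (simp add: linear_sum[OF lin] linear_cmul[OF lin] pd_def)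
qed

lemma has_derivative_pd:
  assumes "f differentiable at x"
  shows "(f has_derivative (\<lambda>v. \<Sum>i\<in>UNIV. v $ i *\<^sub>R pd i f x)) (at x)"
proof -
  have "frechet_derivative f (at x) = (\<lambda>v. \<Sum>i\<in>UNIV. v $ i *\<^sub>R pd i f x)"
    using frechet_derivative_eq_pd[OF assms] by blast
  then show ?thesis using assms by (simp add: frechet_derivative_works)
qed

lemma has_derivative_cong_open:
  assumes "open U" "x \<in> U" "\<And>y. y \<in> U \<Longrightarrow> f y = h y"
  shows "(f has_derivative f') (at x) \<longleftrightarrow> (h has_derivative f') (at x)"
  using has_derivative_transform_within_open[of f f' x UNIV U h]
    has_derivative_transform_within_open[of h f' x UNIV U f] assms by auto

lemma pd_cong_open:
  assumes "open U" "x \<in> U" "\<And>y. y \<in> U \<Longrightarrow> f y = h y"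
  shows "pd i f x = pd i h x"
  unfolding pd_def frechet_derivative_def by (simp only: has_derivative_cong_open[OF assms])

lemma differentiable_cong_open:
  assumes "open U" "x \<in> U" "\<And>y. y \<in> U \<Longrightarrow> f y = h y"
  shows "f differentiable at x \<longleftrightarrow> h differentiable at x"
  unfolding differentiable_def by (simp only: has_derivative_cong_open[OF assms])

lemma differentiable_bounded_linear:
  assumes "f differentiable at x" "bounded_linear L"
  shows "(\<lambda>y. L (f y)) differentiable at x"
  using bounded_linear.has_derivative[OF assms(2)] assms(1) by (auto simp: differentiable_def)

lemma pd_bounded_linear:
  assumes "f differentiable at x" "bounded_linear L"
  shows "pd i (\<lambda>y. L (f y)) x = L (pd i f x)"
  using pd_eqI[OF bounded_linear.has_derivative[OF assms(2)]] assms(1)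
  by (simp add: pd_def frechet_derivative_works)

lemma differentiable_bounded_bilinear:
  assumes "f differentiable at x" "h differentiable at x" "bounded_bilinear B"
  shows "(\<lambda>y. B (f y) (h y)) differentiable at x"
  using bounded_bilinear.FDERIV[OF assms(3)] assms(1,2) unfolding differentiable_def by blast

lemma pd_bounded_bilinear:
  assumes "f differentiable at x" "h differentiable at x" "bounded_bilinear B"
  shows "pd i (\<lambda>y. B (f y) (h y)) x = B (pd i f x) (h x) + B (f x) (pd i h x)"
proof -
  have f: "(f has_derivative frechet_derivative f (at x)) (at x)"
    "(h has_derivative frechet_derivative h (at x)) (at x)"
    using assms by (simp_all add: frechet_derivative_works)
  show ?thesis
    using pd_eqI[OF bounded_bilinear.FDERIV[OF assms(3) f]] by (simp add: pd_def)
qed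

lemma pd_add:
  assumes "f differentiable at x" "h differentiable at x"
  shows "pd i (\<lambda>y. f y + h y) x = pd i f x + pd i h x"
  using pd_eqI[OF has_derivative_add[OF assms[unfolded frechet_derivative_works]]] by (simp add: pd_def)

lemma pd_diff:
  assumes "f differentiable at x" "h differentiable at x"
  shows "pd i (\<lambda>y. f y - h y) x = pd i f x - pd i h x"
  using pd_eqI[OF has_derivative_diff[OF assms[unfolded frechet_derivative_works]]] by (simp add: pd_def)

lemma pd_const: "pd i (\<lambda>y. c) x = 0"
  by (simp add: pd_def)

lemma pd_sum:
  assumes "\<And>a. a \<in> A \<Longrightarrow> f a differentiable at x"
  shows "pd i (\<lambda>y. \<Sum>a\<in>A. f a y) x = (\<Sum>a\<in>A. pd i (f a) x)"
  using pd_eqI[OF has_derivative_sum[of A f "\<lambda>a. frechet_derivative (f a) (at x)" "at x"]] assms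
  by (simp add: frechet_derivative_works pd_def)

lemmas pd_matrix_mult = pd_bounded_bilinear[OF _ _ bounded_bilinear_matrix_mult]
lemmas differentiable_matrix_mult = differentiable_bounded_bilinear[OF _ _ bounded_bilinear_matrix_mult]
lemmas pd_transpose = pd_bounded_linear[OF _ bounded_linear_transpose]
lemmas differentiable_transpose = differentiable_bounded_linear[OF _ bounded_linear_transpose]

lemma bounded_linear_nth2: "bounded_linear (\<lambda>A::'b::real_normed_vector^'m^'n. A $ i $ j)"
  using bounded_linear_compose[OF bounded_linear_vec_nth bounded_linear_vec_nth] .

lemmas pd_nth = pd_bounded_linear[OF _ bounded_linear_vec_nth]
lemmas pd_nth2 = pd_bounded_linear[OF _ bounded_linear_nth2]
lemmas differentiable_nth2 = differentiable_bounded_linear[OF _ bounded_linear_nth2]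

lemma differentiable_vec:
  fixes f :: "'a::real_normed_vector \<Rightarrow> 'b::real_normed_vector^'m"
  assumes "\<And>i. (\<lambda>y. f y $ i) differentiable at x"
  shows "f differentiable at x"
proof -
  have ax: "bounded_linear (axis i :: 'b \<Rightarrow> 'b^'m)" for i
    by (rule bounded_linear_intro[of _ 1])
       (auto simp: vec_eq_iff axis_def norm_vec_def L2_set_def
         if_distrib[where f = norm] if_distrib[where f = "\<lambda>x. x\<^sup>2"] cong: if_cong)
  have "f y = (\<Sum>i\<in>UNIV. axis i (f y $ i))" for y
    by (simp add: vec_eq_iff axis_def if_distrib cong: if_cong)
  then have "f = (\<lambda>y. \<Sum>i\<in>UNIV. axis i (f y $ i))" by blast
  moreover have "(\<lambda>y. \<Sum>i\<in>UNIV. axis i (f y $ i)) differentiable at x"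
    using assms differentiable_bounded_linear[OF _ ax] by (intro differentiable_sum) auto
  ultimately show ?thesis by simp
qed

lemma differentiable_mat:
  fixes f :: "'a::real_normed_vector \<Rightarrow> real^'m^'n"
  assumes "\<And>i j. (\<lambda>y. f y $ i $ j) differentiable at x"
  shows "f differentiable at x"
  using assms by (intro differentiable_vec)

lemma smooth_on_differentiable:
  assumes "smooth_on U f" "open U" "x \<in> U"
  shows "f differentiable at x" "pd i f differentiable at x" "pd j (pd i f) differentiable at x"
  using assms(1)[unfolded smooth_on_def, rule_format, of "[]"]
    assms(1)[unfolded smooth_on_def, rule_format, of "[i]"]
    assms(1)[unfolded smooth_on_def, rule_format, of "[j, i]"] assms(2,3)
  by (auto simp: differentiable_on_eq_differentiable_at)

text \<open>Symmetry of second derivatives under the weak hypothesis that the first partials are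
  differentiable at the single point: both mixed partials are limits of one symmetric second
  difference.\<close>

lemma pd_commute_real:
  fixes f :: "real^'n \<Rightarrow> real"
  assumes U: "open U" "x \<in> U" "\<And>y. y \<in> U \<Longrightarrow> f differentiable at y"
    and "pd i f differentiable at x" "pd j f differentiable at x"
  shows "pd i (pd j f) x = pd j (pd i f) x"
proof -
  define \<Delta> where "\<Delta> h = f (x + h *\<^sub>R frame i + h *\<^sub>R frame j) - f (x + h *\<^sub>R frame i)
    - f (x + h *\<^sub>R frame j) + f x" for h
  \<comment> \<open>\<open>\<Delta>\<close> is symmetric in the two directions, so this limit is
    computed once for a generic order and used twice.\<close>
  have lim: "((\<lambda>h. \<Delta> h / h\<^sup>2) \<longlongrightarrow> pd q (pd p f) x) (at_right 0)"
    if pq: "\<And>h. \<Delta> h = f (x + h *\<^sub>R frame p + h *\<^sub>R frame q) - f (x + h *\<^sub>R frame p)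
    - f (x + h *\<^sub>R frame q) + f x" and d: "pd p f differentiable at x" for p q
  proof (rule tendstoI)
    fix e :: real assume "e > 0"
    then have e: "e / 4 > 0" by simp
    let ?L = "frechet_derivative (pd p f) (at x)"
    have L: "(pd p f has_derivative ?L) (at x)" using d by (simp add: frechet_derivative_works)
    then have lin: "linear ?L" by (rule has_derivative_linear)
    from L e obtain d1 where d1: "d1 > 0"
      "\<And>y. norm (y - x) < d1 \<Longrightarrow> norm (pd p f y - pd p f x - ?L (y - x)) \<le> e / 4 * norm (y - x)"
      unfolding has_derivative_at_alt by blast
    obtain d2 where d2: "d2 > 0" "ball x d2 \<subseteq> U" using U(1,2) openE by blast
    \<comment> \<open>Halved because the corners of the square of side h lie at distance up to
      2h.\<close>
    define d where "d = min d1 d2 / 2"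
    have "d > 0" using d1 d2 by (simp add: d_def)
    moreover have "dist (\<Delta> h / h\<^sup>2) (pd q (pd p f) x) < e" if h: "0 < h" "h < d" for h
    proof -
      have near: "norm (s *\<^sub>R frame p + t *\<^sub>R frame q :: real^'n) \<le> s + t" if "0 \<le> s" "0 \<le> t" for s t
        using norm_triangle_ineq[of "s *\<^sub>R frame p" "t *\<^sub>R frame q :: real^'n"] that
        by (simp add: norm_axis_1)
      have inU: "x + s *\<^sub>R frame p + t *\<^sub>R frame q \<in> U" if "0 \<le> s" "s \<le> h" "0 \<le> t" "t \<le> h" for s t
      proof -
        have "dist (x + s *\<^sub>R frame p + t *\<^sub>R frame q) x = norm (s *\<^sub>R frame p + t *\<^sub>R frame q :: real^'n)"
          by (simp add: dist_norm add.assoc)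
        also have "\<dots> < d2" using near[OF that(1,3)] that h by (simp add: d_def)
        finally show ?thesis using d2(2) by (auto simp: dist_commute)
      qed
      \<comment> \<open>The increment in direction q as a function of the displacement in direction
        p; its mean value turns the second difference into a difference of first partials. The two
        error terms then add up to (3/4) e h, from distances 2h and h with weight e/4.\<close>
      define \<phi> where "\<phi> s = f (x + s *\<^sub>R frame p + h *\<^sub>R frame q) - f (x + s *\<^sub>R frame p + 0 *\<^sub>R frame q)" for s
      have der: "(\<phi> has_real_derivative (pd p f (x + s *\<^sub>R frame p + h *\<^sub>R frame q)
          - pd p f (x + s *\<^sub>R frame p + 0 *\<^sub>R frame q))) (at s)" if s: "0 \<le> s" "s \<le> h" for s
      proof -
        have dd: "((\<lambda>s. f (x + s *\<^sub>R frame p + t *\<^sub>R frame q)) has_real_derivative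
            pd p f (x + s *\<^sub>R frame p + t *\<^sub>R frame q)) (at s)" if "0 \<le> t" "t \<le> h" for t
        proof -
          let ?y = "x + s *\<^sub>R frame p + t *\<^sub>R frame q"
          have "(f has_derivative frechet_derivative f (at ?y)) (at ?y)"
            using U(3)[OF inU[OF s that]] by (simp add: frechet_derivative_works)
          then have "((\<lambda>s. f (x + s *\<^sub>R frame p + t *\<^sub>R frame q)) has_derivative
              (\<lambda>r. frechet_derivative f (at ?y) (r *\<^sub>R frame p))) (at s)"
            by (rule has_derivative_compose[rotated]) (auto intro!: derivative_eq_intros)
          moreover have "frechet_derivative f (at ?y) (r *\<^sub>R frame p) = pd p f ?y * r" for r
            using linear_cmul[OF linear_frechet_derivative[OF U(3)[OF inU[OF s that]]]]
            by (simp add: pd_def)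
          ultimately show ?thesis by (simp add: has_field_derivative_def mult_commute_abs)
        qed
        from DERIV_diff[OF dd[of h] dd[of 0]] show ?thesis unfolding \<phi>_def using h(1) by simp
      qed
      obtain s where s: "0 < s" "s < h" and mv: "\<phi> h - \<phi> 0 = (h - 0) *
          (pd p f (x + s *\<^sub>R frame p + h *\<^sub>R frame q) - pd p f (x + s *\<^sub>R frame p + 0 *\<^sub>R frame q))"
        using MVT2[OF h(1) der] by auto
      have "\<phi> h - \<phi> 0 = \<Delta> h" by (simp add: \<phi>_def pq)
      then have \<Delta>: "\<Delta> h = h * (pd p f (x + s *\<^sub>R frame p + h *\<^sub>R frame q) - pd p f (x + s *\<^sub>R frame p))"
        using mv by simp
      have n1: "norm (s *\<^sub>R frame p + h *\<^sub>R frame q :: real^'n) \<le> 2 * h" using near[of s h] s h by simp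
      have n2: "norm (s *\<^sub>R frame p :: real^'n) \<le> h" using near[of s 0] s h by simp
      have est: "norm (pd p f (x + w) - pd p f x - ?L w) \<le> e / 4 * c" if "norm w \<le> c" "c \<le> 2 * h" for w c
      proof -
        have "norm ((x + w) - x) < d1" using that h by (simp add: d_def)
        from d1(2)[OF this] have "norm (pd p f (x + w) - pd p f x - ?L w) \<le> e / 4 * norm w" by simp
        also have "\<dots> \<le> e / 4 * c" using that e by (intro mult_left_mono) auto
        finally show ?thesis .
      qed
      have arith: "\<bar>(A - B) - q\<bar> \<le> k1 + k2"
        if "norm (A - a - L1) \<le> k1" "norm (B - a - L2) \<le> k2" "L1 - L2 = q" for A B a L1 L2 q k1 k2 :: real
        using that unfolding real_norm_def by linarith
      have "?L (s *\<^sub>R frame p + h *\<^sub>R frame q) - ?L (s *\<^sub>R frame p) = h * pd q (pd p f) x"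
        by (simp add: linear_add[OF lin] linear_cmul[OF lin] pd_def)
      from arith[OF est[OF n1 order.refl] est[OF n2] this]
      have "\<bar>(pd p f (x + s *\<^sub>R frame p + h *\<^sub>R frame q) - pd p f (x + s *\<^sub>R frame p))
          - h * pd q (pd p f) x\<bar> \<le> e * 3 / 4 * h"
        using h by (simp add: add.assoc)
      moreover have "\<Delta> h / h\<^sup>2 - pd q (pd p f) x = ((pd p f (x + s *\<^sub>R frame p + h *\<^sub>R frame q)
          - pd p f (x + s *\<^sub>R frame p)) - h * pd q (pd p f) x) / h"
        using h unfolding \<Delta> by (simp add: field_simps power2_eq_square)
      ultimately have "\<bar>\<Delta> h / h\<^sup>2 - pd q (pd p f) x\<bar> \<le> e * 3 / 4"
        using h by (simp add: divide_le_eq)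
      then show ?thesis using \<open>e > 0\<close> by (simp add: dist_real_def)
    qed
    ultimately show "\<forall>\<^sub>F h in at_right 0. dist (\<Delta> h / h\<^sup>2) (pd q (pd p f) x) < e"
      unfolding eventually_at_right_field by blast
  qed
  have "((\<lambda>h. \<Delta> h / h\<^sup>2) \<longlongrightarrow> pd j (pd i f) x) (at_right 0)"
    by (rule lim[OF _ assms(4)]) (simp add: \<Delta>_def)
  moreover have "((\<lambda>h. \<Delta> h / h\<^sup>2) \<longlongrightarrow> pd i (pd j f) x) (at_right 0)"
    by (rule lim[OF _ assms(5)]) (simp add: \<Delta>_def algebra_simps)
  ultimately show ?thesis
    using tendsto_unique trivial_limit_at_right_real by blast
qed

lemma pd_commute:
  fixes f :: "real^'n \<Rightarrow> 'b::euclidean_space"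
  assumes "smooth_on U f" "open U" "x \<in> U"
  shows "pd i (pd j f) x = pd j (pd i f) x"
proof (rule euclidean_eqI)
  fix b :: 'b
  note d = smooth_on_differentiable[OF assms(1,2)]
  have 1: "pd k (\<lambda>y. f y \<bullet> b) y = pd k f y \<bullet> b" if "y \<in> U" for k y
    by (rule pd_bounded_linear[OF d(1)[OF that] bounded_linear_inner_left])
  have 2: "pd l (pd k (\<lambda>y. f y \<bullet> b)) x = pd l (pd k f) x \<bullet> b"
    "pd k (\<lambda>y. f y \<bullet> b) differentiable at x" for k l
    using pd_cong_open[OF assms(2,3) 1]
      pd_bounded_linear[OF d(2)[OF assms(3)] bounded_linear_inner_left]
      differentiable_cong_open[OF assms(2,3) 1]
      differentiable_bounded_linear[OF d(2)[OF assms(3)] bounded_linear_inner_left]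
    by simp_all
  have "pd i (pd j (\<lambda>y. f y \<bullet> b)) x = pd j (pd i (\<lambda>y. f y \<bullet> b)) x"
    by (rule pd_commute_real[OF assms(2,3) differentiable_bounded_linear[OF d(1) bounded_linear_inner_left] 2(2) 2(2)])
  then show "pd i (pd j f) x \<bullet> b = pd j (pd i f) x \<bullet> b" by (simp add: 2)
qed

text \<open>Cramer's rule: the entries of the inverse are quotients of determinants, which are
  polynomial in the entries.\<close>

lemma differentiable_matrix_inv:
  fixes A :: "'a::real_normed_vector \<Rightarrow> real^'n^'n"
  assumes "open U" "x \<in> U" "\<And>y. y \<in> U \<Longrightarrow> invertible (A y)" "A differentiable at x"
  shows "(\<lambda>y. matrix_inv (A y)) differentiable at x"
proof (rule differentiable_mat)
  fix k l
  let ?B = "\<lambda>y. (\<chi> i j. if j = k then axis l 1 $ i else A y $ i $ j) :: real^'n^'n"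
  have det: "(\<lambda>y. det (B y)) differentiable at x"
    if "\<And>i j. (\<lambda>y. B y $ i $ j) differentiable at x" for B :: "'a \<Rightarrow> real^'n^'n"
  proof -
    have "(\<lambda>y. \<Prod>i\<in>UNIV. B y $ i $ p i) differentiable at x" for p
    proof -
      have "\<forall>i. \<exists>D. ((\<lambda>y. B y $ i $ p i) has_derivative D) (at x)"
        using that by (simp add: differentiable_def)
      then obtain D where "\<And>i. ((\<lambda>y. B y $ i $ p i) has_derivative D i) (at x)" by metis
      then show ?thesis unfolding differentiable_def
        using has_derivative_prod[of UNIV "\<lambda>i y. B y $ i $ p i" D x UNIV] by blast
    qed
    then show ?thesis unfolding det_def by (intro differentiable_sum) (auto intro: differentiable_mult)
  qed
  have eq: "matrix_inv (A y) $ k $ l = det (?B y) / det (A y)" if "y \<in> U" for y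
  proof -
    have d: "det (A y) \<noteq> 0" using assms(3)[OF that] by (simp add: invertible_det_nz)
    obtain C where "A y ** C = mat 1" using assms(3)[OF \<open>y \<in> U\<close>] by (auto simp: invertible_def)
    then have "A y ** matrix_inv (A y) = mat 1" using matrix_inv_unique by metis
    then have "A y *v (matrix_inv (A y) *v axis l 1) = axis l 1"
      by (simp add: matrix_vector_mul_assoc)
    then have "matrix_inv (A y) *v axis l 1 = (\<chi> k. det (\<chi> i j. if j = k then axis l 1 $ i else A y $ i $ j) / det (A y))"
      using cramer[OF d] by blast
    then show ?thesis by (simp add: matrix_vector_frame vec_eq_iff)
  qed
  have "(\<lambda>y. ?B y $ i $ j) differentiable at x" for i j
    using differentiable_nth2[OF assms(4)] by (cases "j = k") simp_all
  then have "(\<lambda>y. det (?B y)) differentiable at x" by (rule det)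
  moreover have "(\<lambda>y. det (A y)) differentiable at x" by (rule det) (rule differentiable_nth2[OF assms(4)])
  moreover have "det (A x) \<noteq> 0" using assms(2,3) by (simp add: invertible_det_nz)
  ultimately have "(\<lambda>y. det (?B y) / det (A y)) differentiable at x"
    by (intro differentiable_divide)
  then show "(\<lambda>y. matrix_inv (A y) $ k $ l) differentiable at x"
    by (rule differentiable_cong_open[OF assms(1,2), THEN iffD2, rotated]) (rule eq)
qed

section \<open>Local geometry of almost Hermitian structures\<close>

lemma sum4_eq_0:
  fixes a b c d :: "'a::ab_group_add"
  assumes "a + b + (c + d) = 0"
  shows "a + d = - (b + c)"
  using assms unfolding eq_neg_iff_add_eq_0 by (simp add: ac_simps)

locale ah_field =
  fixes U :: "(real^'n::finite) set" and g J :: "'n mfield"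
  assumes ah: "ah_on U g J"
begin

abbreviation "\<Gamma> i \<equiv> (\<lambda>x. levi_civita g x i)"
abbreviation "gi \<equiv> (\<lambda>x. matrix_inv (g x))"

lemma open_U: "open U" and smooth_g: "smooth_on U g" and smooth_J: "smooth_on U J"
  using ah by (simp_all add: ah_on_def)

lemma lah: "x \<in> U \<Longrightarrow> linear_ah (g x) (J x)"
  using ah by (simp add: ah_on_def)

lemma diff:
  assumes "x \<in> U"
  shows diff_g: "g differentiable at x" and diff_J: "J differentiable at x"
    and diff_pd_g: "pd i g differentiable at x" and diff_pd_J: "pd i J differentiable at x"
    and diff_gi: "gi differentiable at x"
  using smooth_on_differentiable[OF smooth_g open_U assms] smooth_on_differentiable[OF smooth_J open_U assms]
    differentiable_matrix_inv[OF open_U assms linear_ah_invertible[OF lah]] by auto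

lemma pd_g_sym:
  assumes "x \<in> U"
  shows "transpose (pd i g x) = pd i g x"
proof -
  have "pd i (\<lambda>y. transpose (g y)) x = pd i g x"
    using linear_ah_sym[OF lah] by (intro pd_cong_open[OF open_U assms]) auto
  then show ?thesis by (simp add: pd_transpose diff[OF assms])
qed

lemma pd_g_nth_sym: "x \<in> U \<Longrightarrow> pd i g x $ a $ b = pd i g x $ b $ a"
  by (metis pd_g_sym transpose_nth)

lemma torsion_free:
  assumes "x \<in> U"
  shows "\<Gamma> i x $ k $ j = \<Gamma> j x $ k $ i"
  by (simp add: levi_civita_def pd_g_nth_sym[OF assms] algebra_simps)

lemma diff_Gamma:
  assumes "x \<in> U"
  shows "\<Gamma> i differentiable at x"
proof (rule differentiable_mat)
  fix k j
  note d = differentiable_nth2[OF diff_gi[OF assms]] differentiable_nth2[OF diff_pd_g[OF assms]]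
  have "(\<lambda>y. (1/2) * (\<Sum>l\<in>UNIV. gi y $ k $ l * (pd i g y $ j $ l + pd j g y $ i $ l - pd l g y $ i $ j)))
      differentiable at x"
    by (intro differentiable_mult[OF differentiable_const] differentiable_sum)
       (auto intro!: differentiable_mult differentiable_diff differentiable_add d)
  then show "(\<lambda>y. \<Gamma> i y $ k $ j) differentiable at x" by (simp add: levi_civita_def)
qed

lemma g_Gamma:
  assumes "x \<in> U"
  shows "(g x ** \<Gamma> i x) $ m $ j = (1/2) * (pd i g x $ j $ m + pd j g x $ i $ m - pd m g x $ i $ j)"
proof -
  let ?S = "\<lambda>l. pd i g x $ j $ l + pd j g x $ i $ l - pd l g x $ i $ j"
  have "(g x ** \<Gamma> i x) $ m $ j = (\<Sum>l\<in>UNIV. (g x ** gi x) $ m $ l * ((1/2) * ?S l))"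
    unfolding matrix_mult_nth levi_civita_def vec_lambda_beta sum_distrib_left sum_distrib_right
    by (rule trans[OF _ sum.swap]) (simp add: algebra_simps)
  also have "\<dots> = (1/2) * ?S m"
    by (simp add: linear_ah_inv_right[OF lah[OF assms]] mat_def if_distrib if_distribR cong: if_cong)
  finally show ?thesis .
qed

lemma metric_compatible:
  assumes "x \<in> U"
  shows "pd i g x = transpose (\<Gamma> i x) ** g x + g x ** \<Gamma> i x"
proof -
  have "transpose (\<Gamma> i x) ** g x = transpose (g x ** \<Gamma> i x)"
    by (simp add: matrix_transpose_mul linear_ah_sym[OF lah[OF assms]])
  then have "(transpose (\<Gamma> i x) ** g x + g x ** \<Gamma> i x) $ j $ m = pd i g x $ j $ m" for j m
    by (simp add: transpose_nth g_Gamma[OF assms]) (simp add: pd_g_nth_sym[OF assms] field_simps)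
  then show ?thesis by (simp add: vec_eq_iff)
qed

lemma pd_J_anticommute:
  assumes "x \<in> U"
  shows "pd i J x ** J x + J x ** pd i J x = 0"
proof -
  have "pd i (\<lambda>y. J y ** J y) x = pd i (\<lambda>y. - mat 1) x"
    using linear_ah_square[OF lah] by (intro pd_cong_open[OF open_U assms]) auto
  then show ?thesis by (simp add: pd_matrix_mult diff[OF assms] pd_const)
qed

text \<open>The derivative of J^2 = -1; the connection terms cancel because J^2 is scalar.\<close>

lemma DJ_anticommute:
  assumes "x \<in> U"
  shows "DJ g J i x ** J x = - (J x ** DJ g J i x)"
proof -
  have "DJ g J i x ** J x + J x ** DJ g J i x =
      (pd i J x ** J x + J x ** pd i J x) + (\<Gamma> i x ** (J x ** J x) - (J x ** J x) ** \<Gamma> i x)"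
    by (simp add: DJ_def cov_endo_def matrix_ring)
  also have "\<dots> = 0"
    by (simp add: pd_J_anticommute[OF assms] linear_ah_square[OF lah[OF assms]] matrix_ring)
  finally show ?thesis by (simp add: eq_neg_iff_add_eq_0)
qed

text \<open>A metric connection preserves skewness. Applied to J it gives \<open>DJ_skew\<close>,
  and applied to DJ it gives \<open>D2J_skew\<close>.\<close>

lemma cov_skew:
  assumes x: "x \<in> U" and A: "A differentiable at x"
    and skew: "\<And>y. y \<in> U \<Longrightarrow> transpose (A y) ** g y = - (g y ** A y)"
  shows "transpose (cov_endo (levi_civita g) A i x) ** g x = - (g x ** cov_endo (levi_civita g) A i x)"
proof -
  let ?T = transpose and ?G = "g x" and ?A = "A x" and ?C = "\<Gamma> i x"
  have "pd i (\<lambda>y. ?T (A y) ** g y + g y ** A y) x = pd i (\<lambda>y. 0) x"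
    using skew by (intro pd_cong_open[OF open_U x]) auto
  then have "?T (pd i A x) ** ?G + ?T ?A ** pd i g x + (pd i g x ** ?A + ?G ** pd i A x) = 0"
    by (simp add: pd_add pd_matrix_mult pd_transpose pd_const A diff[OF x]
        differentiable_matrix_mult differentiable_transpose)
  then have e: "?T (pd i A x) ** ?G + ?G ** pd i A x = - (?T ?A ** pd i g x + pd i g x ** ?A)"
    by (rule sum4_eq_0)
  note s = skew[OF x]
  have c: "?T ?A ** ?T ?C ** ?G = ?T ?A ** pd i g x + ?G ** ?A ** ?C"
    by (simp add: metric_compatible[OF x] matrix_ring s)
  have "?T (cov_endo (levi_civita g) A i x) ** ?G + ?G ** cov_endo (levi_civita g) A i x =
    (?T (pd i A x) ** ?G + ?G ** pd i A x) + (?T ?A ** ?T ?C ** ?G - ?T ?C ** (?T ?A ** ?G)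
      + ?G ** ?C ** ?A - ?G ** ?A ** ?C)"
    by (simp add: cov_endo_def transpose_ring matrix_ring)
  also have "\<dots> = - (pd i g x ** ?A) + ?T ?C ** (?G ** ?A) + ?G ** ?C ** ?A"
    unfolding e c s by (simp add: matrix_ring)
  also have "\<dots> = 0" by (simp add: metric_compatible[OF x] matrix_ring)
  finally show ?thesis by (simp add: eq_neg_iff_add_eq_0)
qed

lemma DJ_skew: "x \<in> U \<Longrightarrow> transpose (DJ g J i x) ** g x = - (g x ** DJ g J i x)"
  unfolding DJ_def by (rule cov_skew) (auto simp: diff linear_ah_skew[OF lah])

lemma diff_DJ: "x \<in> U \<Longrightarrow> DJ g J i differentiable at x"
  unfolding DJ_def cov_endo_def
  by (intro differentiable_add differentiable_diff differentiable_matrix_mult diff_pd_J diff_Gamma diff_J)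

lemma pd_DJ:
  assumes "x \<in> U"
  shows "pd i (DJ g J j) x = pd i (pd j J) x + (pd i (\<Gamma> j) x ** J x + \<Gamma> j x ** pd i J x)
    - (pd i J x ** \<Gamma> j x + J x ** pd i (\<Gamma> j) x)"
  unfolding DJ_def cov_endo_def
  by (simp add: pd_add pd_diff pd_matrix_mult diff[OF assms] diff_Gamma[OF assms] differentiable_matrix_mult)

text \<open>Differentiating J^2 = -1 twice. The quadratic right-hand side is what separates the
  second derivative of J at a general point from the one at a point where DJ vanishes.\<close>

lemma D2J_anticommute:
  assumes x: "x \<in> U"
  shows "D2J g J i j x ** J x + J x ** D2J g J i j x =
    - (DJ g J i x ** DJ g J j x + DJ g J j x ** DJ g J i x)"
proof -
  let ?C = "\<Gamma> i x" and ?E = "DJ g J j x"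
  have "pd i (\<lambda>y. DJ g J j y ** J y + J y ** DJ g J j y) x = pd i (\<lambda>y. 0) x"
    using DJ_anticommute by (intro pd_cong_open[OF open_U x]) auto
  then have "pd i (DJ g J j) x ** J x + ?E ** pd i J x + (pd i J x ** ?E + J x ** pd i (DJ g J j) x) = 0"
    by (simp add: pd_add pd_matrix_mult pd_const diff[OF x] diff_DJ[OF x] differentiable_matrix_mult)
  then have e: "pd i (DJ g J j) x ** J x + J x ** pd i (DJ g J j) x = - (?E ** pd i J x + pd i J x ** ?E)"
    by (rule sum4_eq_0)
  have "cov_endo (levi_civita g) (DJ g J j) i x ** J x + J x ** cov_endo (levi_civita g) (DJ g J j) i x =
    (pd i (DJ g J j) x ** J x + J x ** pd i (DJ g J j) x) +
    (?C ** (?E ** J x) - ?E ** ?C ** J x + J x ** ?C ** ?E - (J x ** ?E) ** ?C)"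
    by (simp add: cov_endo_def matrix_ring)
  also have "\<dots> = - (DJ g J i x ** ?E + ?E ** DJ g J i x) +
      (?C ** (?E ** J x + J x ** ?E) - (?E ** J x + J x ** ?E) ** ?C)"
    unfolding e by (simp add: DJ_def cov_endo_def matrix_ring)
  also have "\<dots> = - (DJ g J i x ** ?E + ?E ** DJ g J i x)"
    by (simp add: DJ_anticommute[OF x])
  finally have c: "cov_endo (levi_civita g) (DJ g J j) i x ** J x + J x ** cov_endo (levi_civita g) (DJ g J j) i x =
    - (DJ g J i x ** ?E + ?E ** DJ g J i x)" .
  have "D2J g J i j x ** J x + J x ** D2J g J i j x =
    (cov_endo (levi_civita g) (DJ g J j) i x ** J x + J x ** cov_endo (levi_civita g) (DJ g J j) i x)
    - (\<Sum>l\<in>UNIV. levi_civita g x i $ l $ j *\<^sub>R (DJ g J l x ** J x + J x ** DJ g J l x))"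
    by (simp add: D2J_def matrix_ring matrix_sum_left matrix_sum_right scaleR_add_right sum.distrib)
  then show ?thesis by (simp add: c DJ_anticommute[OF x])
qed

lemma D2J_skew:
  assumes x: "x \<in> U"
  shows "transpose (D2J g J i j x) ** g x = - (g x ** D2J g J i j x)"
  using cov_skew[OF x diff_DJ[OF x] DJ_skew] DJ_skew[OF x]
  by (simp add: D2J_def transpose_ring transpose_sum matrix_ring matrix_sum_left matrix_sum_right sum_negf)

text \<open>The Ricci identity for J: ordinary second derivatives commute, the torsion terms cancel,
  and the curvature acts on endomorphisms by commutator.\<close>

lemma D2J_commute:
  assumes x: "x \<in> U"
  shows "D2J g J i j x - D2J g J j i x = riemann g i j x ** J x - J x ** riemann g i j x"
proof -
  have "pd i (pd j J) x = pd j (pd i J) x" by (rule pd_commute[OF smooth_J open_U x])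
  moreover have "(\<Sum>l\<in>UNIV. levi_civita g x i $ l $ j *\<^sub>R DJ g J l x) =
      (\<Sum>l\<in>UNIV. levi_civita g x j $ l $ i *\<^sub>R DJ g J l x)"
    by (simp add: torsion_free[OF x, of i _ j])
  ultimately show ?thesis
    by (simp add: D2J_def cov_endo_def pd_DJ[OF x] riemann_def)
       (simp add: DJ_def cov_endo_def matrix_ring)
qed

lemma riemann_antisym: "riemann g i j x = - riemann g j i x"
  by (simp add: riemann_def)

text \<open>Second derivatives of g commute; writing them by differentiating metric compatibility
  leaves exactly the curvature term.\<close>

lemma riemann_skew:
  assumes x: "x \<in> U"
  shows "transpose (riemann g i j x) ** g x = - (g x ** riemann g i j x)"
proof -
  let ?T = transpose and ?G = "g x"
  have pp: "pd i (pd j g) x = ?T (pd i (\<Gamma> j) x) ** ?G + ?T (\<Gamma> j x) ** (?T (\<Gamma> i x) ** ?G + ?G ** \<Gamma> i x)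
    + ((?T (\<Gamma> i x) ** ?G + ?G ** \<Gamma> i x) ** \<Gamma> j x + ?G ** pd i (\<Gamma> j) x)" for i j
  proof -
    have "pd i (pd j g) x = pd i (\<lambda>y. ?T (\<Gamma> j y) ** g y + g y ** \<Gamma> j y) x"
      using metric_compatible by (intro pd_cong_open[OF open_U x]) auto
    also have "\<dots> = ?T (pd i (\<Gamma> j) x) ** ?G + ?T (\<Gamma> j x) ** pd i g x + (pd i g x ** \<Gamma> j x + ?G ** pd i (\<Gamma> j) x)"
      by (simp add: pd_add pd_matrix_mult pd_transpose diff[OF x] diff_Gamma[OF x]
        differentiable_matrix_mult differentiable_transpose)
    finally show ?thesis by (simp only: metric_compatible[OF x])
  qed
  have "pd i (pd j g) x - pd j (pd i g) x = ?T (riemann g i j x) ** ?G + ?G ** riemann g i j x"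
    unfolding pp by (simp add: riemann_def transpose_ring matrix_ring)
  moreover have "pd i (pd j g) x = pd j (pd i g) x" by (rule pd_commute[OF smooth_g open_U x])
  ultimately show ?thesis by (simp add: eq_neg_iff_add_eq_0)
qed

lemma pd_torsion_free: "x \<in> U \<Longrightarrow> pd a (\<Gamma> i) x $ k $ j = pd a (\<Gamma> j) x $ k $ i"
  using pd_cong_open[OF open_U, of x "\<lambda>y. \<Gamma> i y $ k $ j" "\<lambda>y. \<Gamma> j y $ k $ i" a]
  by (simp add: pd_nth2[OF diff_Gamma] torsion_free[of _ i])

lemma bianchi:
  assumes x: "x \<in> U"
  shows "riemann g i j x $ l $ k + riemann g j k x $ l $ i + riemann g k i x $ l $ j = 0"
proof -
  have "(\<Gamma> a x ** \<Gamma> b x) $ l $ c = (\<Gamma> a x ** \<Gamma> c x) $ l $ b" for a b c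
    unfolding matrix_mult_nth using torsion_free[OF x, of b _ c] by simp
  from this[of i j k] this[of j k i] this[of k i j] show ?thesis
    using pd_torsion_free[OF x, of i j l k] pd_torsion_free[OF x, of j k l i] pd_torsion_free[OF x, of k i l j]
    by (simp add: riemann_def)
qed

lemma trace_skew:
  assumes x: "x \<in> U" and "transpose A ** g x = - (g x ** A)"
  shows "(\<Sum>i\<in>UNIV. A $ i $ i) = 0"
proof -
  have "transpose A = - (g x ** A ** gi x)"
    by (metis assms(2) linear_ah_inv_right[OF lah[OF x]] matrix_mul_assoc matrix_mul_rid matrix_neg_left)
  then have "(\<Sum>i\<in>UNIV. A $ i $ i) = - (\<Sum>i\<in>UNIV. (g x ** A ** gi x) $ i $ i)"
    by (metis (no_types, lifting) sum.cong sum_negf transpose_nth vector_uminus_component)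
  also have "(\<Sum>i\<in>UNIV. (g x ** A ** gi x) $ i $ i) = (\<Sum>i\<in>UNIV. (gi x ** (g x ** A)) $ i $ i)"
    unfolding matrix_mult_nth[of "g x ** A"] matrix_mult_nth[of "gi x"]
    by (subst sum.swap) (simp add: mult.commute)
  also have "\<dots> = (\<Sum>i\<in>UNIV. A $ i $ i)"
    by (simp add: matrix_mul_assoc linear_ah_inv_left[OF lah[OF x]])
  finally show ?thesis by simp
qed

text \<open>Trace of the Bianchi identity; the term R(j, k) drops out because a skew endomorphism
  has trace 0.\<close>

lemma ricci_sym:
  assumes x: "x \<in> U"
  shows "transpose (ricci g x) = ricci g x"
proof -
  have "ricci g x $ j $ k - ricci g x $ k $ j =
    (\<Sum>i\<in>UNIV. riemann g i j x $ i $ k + riemann g j k x $ i $ i + riemann g k i x $ i $ j)" for j k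
    using riemann_antisym[of k _ x]
    by (simp add: ricci_def sum.distrib sum_subtractf trace_skew[OF x riemann_skew[OF x]])
  then have "ricci g x $ j $ k = ricci g x $ k $ j" for j k
    by (simp add: bianchi[OF x])
  then show ?thesis by (simp add: vec_eq_iff transpose_nth)
qed

end

section \<open>Lie derivatives along the dual of theta\<close>

text \<open>The matrix of the endomorphism sending X to the covariant derivative of the dual of theta in
  direction X.\<close>

definition nabla_theta :: "'n mfield \<Rightarrow> 'n mfield \<Rightarrow> real^'n::finite \<Rightarrow> real^'n^'n" where
  "nabla_theta g J x = (\<chi> p i. \<Sum>a\<in>UNIV.
     ((D2J g J i a x ** J x + DJ g J a x ** DJ g J i x) ** matrix_inv (g x)) $ p $ a)"

context ah_field
begin

lemma gi_sym: "x \<in> U \<Longrightarrow> gi x $ a $ b = gi x $ b $ a"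
  by (metis linear_ah_inv_sym[OF lah] transpose_nth)

lemma theta_sharp_eq:
  assumes x: "x \<in> U"
  shows "theta_sharp g J x = (\<chi> p. \<Sum>a\<in>UNIV. (DJ g J a x ** J x ** gi x) $ p $ a)"
proof -
  let ?A = "\<lambda>i. DJ g J i x ** J x"
  have t: "theta g J x $ k = (\<Sum>i\<in>UNIV. (transpose (g x) ** (?A i ** gi x)) $ k $ i)" for k
  proof -
    have "theta g J x $ k = (\<Sum>i\<in>UNIV. \<Sum>j\<in>UNIV. gi x $ j $ i * (transpose (?A i) ** g x) $ j $ k)"
      unfolding theta_def
      by (simp add: matrix_vector_mul_assoc bil_mult_left bil_frame, intro sum.cong refl,
          subst gi_sym[OF x], rule refl)
    also have "\<dots> = (\<Sum>i\<in>UNIV. (transpose (g x) ** ?A i ** gi x) $ k $ i)"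
    proof (intro sum.cong refl)
      fix i
      have "transpose (g x) ** ?A i = transpose (transpose (?A i) ** g x)"
        by (simp add: matrix_transpose_mul)
      then have "(transpose (g x) ** ?A i ** gi x) $ k $ i =
          (\<Sum>j\<in>UNIV. (transpose (?A i) ** g x) $ j $ k * gi x $ j $ i)"
        by (simp only: matrix_mult_nth[of _ "gi x"] transpose_nth)
      then show "(\<Sum>j\<in>UNIV. gi x $ j $ i * (transpose (?A i) ** g x) $ j $ k) =
          (transpose (g x) ** ?A i ** gi x) $ k $ i"
        by (simp only: mult.commute)
    qed
    finally show ?thesis by (simp add: matrix_mul_assoc)
  qed
  have "theta_sharp g J x $ p = (\<Sum>i\<in>UNIV. (gi x ** (transpose (g x) ** (?A i ** gi x))) $ p $ i)" for p
    unfolding theta_sharp_def sharp_def matrix_vector_mult_def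
    by (simp add: t sum_distrib_left matrix_mult_nth[of "gi x"]) (rule sum.swap)
  then show ?thesis
    by (simp add: vec_eq_iff linear_ah_sym[OF lah[OF x]] matrix_mul_assoc linear_ah_inv_left[OF lah[OF x]])
qed

lemma pd_gi:
  assumes x: "x \<in> U"
  shows "pd i gi x = - (gi x ** transpose (\<Gamma> i x)) - \<Gamma> i x ** gi x"
proof -
  have "pd i (\<lambda>y. gi y ** g y) x = pd i (\<lambda>y. mat 1) x"
    using linear_ah_inv_left[OF lah] by (intro pd_cong_open[OF open_U x]) auto
  then have e: "pd i gi x ** g x = - (gi x ** pd i g x)"
    by (simp add: pd_matrix_mult diff[OF x] pd_const eq_neg_iff_add_eq_0)
  have "pd i gi x = pd i gi x ** g x ** gi x"
    by (simp add: matrix_mul_assoc[symmetric] linear_ah_inv_right[OF lah[OF x]])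
  also have "\<dots> = - (gi x ** transpose (\<Gamma> i x) ** (g x ** gi x)) - gi x ** g x ** \<Gamma> i x ** gi x"
    unfolding e by (simp add: metric_compatible[OF x] matrix_ring)
  finally show ?thesis
    by (simp add: linear_ah_inv_right[OF lah[OF x]] linear_ah_inv_left[OF lah[OF x]])
qed

text \<open>The product rule applied to D_a J o J o g^(-1), with partial derivatives rewritten
  through covariant ones.\<close>

lemma
  assumes x: "x \<in> U"
  shows diff_theta_sharp: "theta_sharp g J differentiable at x"
    and pd_theta_sharp: "pd i (theta_sharp g J) x $ p = nabla_theta g J x $ p $ i -
      (\<Gamma> i x *v theta_sharp g J x) $ p"
proof -
  note d = diff[OF x] diff_DJ[OF x]
  let ?M = "\<lambda>a y. DJ g J a y ** J y ** gi y"
  let ?f = "\<lambda>y. \<chi> p. \<Sum>a\<in>UNIV. ?M a y $ p $ a"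
  have dM: "?M a differentiable at x" for a by (intro differentiable_matrix_mult d)
  have df: "?f differentiable at x"
    using differentiable_nth2[OF dM] by (intro differentiable_vec) (simp add: differentiable_sum)
  then show dth: "theta_sharp g J differentiable at x"
    by (rule differentiable_cong_open[OF open_U x, THEN iffD2, rotated]) (rule theta_sharp_eq)
  have "pd i (theta_sharp g J) x = pd i ?f x"
    by (rule pd_cong_open[OF open_U x theta_sharp_eq])
  then have "pd i (theta_sharp g J) x $ p = pd i (\<lambda>y. ?f y $ p) x"
    by (simp only: pd_nth[OF df])
  also have "\<dots> = (\<Sum>a\<in>UNIV. pd i (?M a) x $ p $ a)"
    by (simp add: pd_sum[OF differentiable_nth2[OF dM]] pd_nth2[OF dM])
  also have "\<dots> = (\<Sum>a\<in>UNIV. ((D2J g J i a x ** J x + DJ g J a x ** DJ g J i x) ** gi x) $ p $ a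
    - (\<Gamma> i x ** ?M a x) $ p $ a + ((\<Sum>l\<in>UNIV. \<Gamma> i x $ l $ a * ?M l x $ p $ a) - (?M a x ** transpose (\<Gamma> i x)) $ p $ a))"
  proof (intro sum.cong refl)
    fix a
    have 1: "pd i (DJ g J a) x = D2J g J i a x - \<Gamma> i x ** DJ g J a x + DJ g J a x ** \<Gamma> i x
        + (\<Sum>l\<in>UNIV. \<Gamma> i x $ l $ a *\<^sub>R DJ g J l x)"
      by (simp add: D2J_def cov_endo_def)
    have 2: "pd i J x = DJ g J i x - \<Gamma> i x ** J x + J x ** \<Gamma> i x"
      by (simp add: DJ_def cov_endo_def)
    have "pd i (?M a) x = (pd i (DJ g J a) x ** J x + DJ g J a x ** pd i J x) ** gi x
        + DJ g J a x ** J x ** pd i gi x"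
      by (simp add: pd_matrix_mult d differentiable_matrix_mult)
    also have "\<dots> = (D2J g J i a x ** J x + DJ g J a x ** DJ g J i x) ** gi x
      - \<Gamma> i x ** ?M a x + (\<Sum>l\<in>UNIV. \<Gamma> i x $ l $ a *\<^sub>R ?M l x) - ?M a x ** transpose (\<Gamma> i x)"
      unfolding 1 2 pd_gi[OF x] by (simp add: matrix_ring matrix_sum_left)
    finally show "pd i (?M a) x $ p $ a =
      ((D2J g J i a x ** J x + DJ g J a x ** DJ g J i x) ** gi x) $ p $ a
      - (\<Gamma> i x ** ?M a x) $ p $ a + ((\<Sum>l\<in>UNIV. \<Gamma> i x $ l $ a * ?M l x $ p $ a) - (?M a x ** transpose (\<Gamma> i x)) $ p $ a)"
      by (simp add: sum_component)
  qed
  also have "\<dots> = nabla_theta g J x $ p $ i - (\<Sum>a\<in>UNIV. (\<Gamma> i x ** ?M a x) $ p $ a)"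
  proof -
    \<comment> \<open>The connection term from the derivative index \<open>a\<close> and the one
      from the inverse metric cancel once \<open>a\<close> is summed.\<close>
    have "(\<Sum>a\<in>UNIV. (?M a x ** transpose (\<Gamma> i x)) $ p $ a) = (\<Sum>a\<in>UNIV. \<Sum>l\<in>UNIV. \<Gamma> i x $ l $ a * ?M l x $ p $ a)"
      unfolding matrix_mult_nth[of _ "transpose _"] transpose_nth by (subst sum.swap) (simp only: mult.commute)
    then show ?thesis by (simp only: sum.distrib sum_subtractf nabla_theta_def vec_lambda_beta)
  qed
  also have "(\<Sum>a\<in>UNIV. (\<Gamma> i x ** ?M a x) $ p $ a) = (\<Gamma> i x *v theta_sharp g J x) $ p"
    unfolding theta_sharp_eq[OF x] matrix_vector_mult_def matrix_mult_nth[of "\<Gamma> i x"]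
    by (subst sum.swap) (simp add: sum_distrib_left)
  finally show "pd i (theta_sharp g J) x $ p = nabla_theta g J x $ p $ i - (\<Gamma> i x *v theta_sharp g J x) $ p" .
qed

text \<open>Torsion freeness turns the connection term into a combination of the matrices of the
  connection, the form in which it cancels in Lie derivatives.\<close>

lemma jacobian_theta_sharp:
  assumes x: "x \<in> U"
  shows "jacobian (theta_sharp g J) (at x) =
    nabla_theta g J x - (\<Sum>q\<in>UNIV. theta_sharp g J x $ q *\<^sub>R \<Gamma> q x)"
proof -
  have "jacobian (theta_sharp g J) (at x) $ p $ i = nabla_theta g J x $ p $ i -
      (\<Sum>q\<in>UNIV. theta_sharp g J x $ q * \<Gamma> q x $ p $ i)" for p i
  proof -
    have "jacobian (theta_sharp g J) (at x) $ p $ i = pd i (theta_sharp g J) x $ p"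
      by (simp add: jacobian_def matrix_def pd_def)
    also have "\<dots> = nabla_theta g J x $ p $ i - (\<Sum>q\<in>UNIV. \<Gamma> i x $ p $ q * theta_sharp g J x $ q)"
      by (simp add: pd_theta_sharp[OF x] matrix_vector_mult_def)
    finally show ?thesis by (simp add: torsion_free[OF x, of i] mult.commute)
  qed
  then show ?thesis by (simp add: vec_eq_iff sum_component)
qed

text \<open>The usual formula for the Lie derivative of the metric through the covariant derivative
  of the field; the transport term is absorbed by metric compatibility. For J the transport term
  survives as the derivative of J along the field.\<close>

lemma lie_form_theta_sharp:
  assumes x: "x \<in> U"
  shows "lie_form (theta_sharp g J) g x =
    transpose (nabla_theta g J x) ** g x + g x ** nabla_theta g J x"
  unfolding lie_form_def frechet_derivative_eq_pd[OF diff_g[OF x]] jacobian_theta_sharp[OF x]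
  by (simp add: metric_compatible[OF x] transpose_diff transpose_sum transpose_scalar matrix_ring
      matrix_sum_left matrix_sum_right scaleR_add_right sum.distrib)

lemma lie_endo_theta_sharp:
  assumes x: "x \<in> U"
  shows "lie_endo (theta_sharp g J) J x = (\<Sum>q\<in>UNIV. theta_sharp g J x $ q *\<^sub>R DJ g J q x)
    - nabla_theta g J x ** J x + J x ** nabla_theta g J x"
  unfolding lie_endo_def frechet_derivative_eq_pd[OF diff_J[OF x]] jacobian_theta_sharp[OF x]
  by (simp add: DJ_def cov_endo_def matrix_ring matrix_sum_left matrix_sum_right
      scaleR_add_right scaleR_diff_right sum.distrib sum_subtractf)

end

section \<open>Tangent vectors to the space of almost Hermitian structures\<close>

text \<open>The linearization of \<open>transpose I ** G ** I = G\<close> along a velocity (S, A).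
  In \<open>tangent_pair\<close> it joins the linearizations of the symmetry of \<open>G\<close> and
  of I^2 = -1; positivity is an open condition.\<close>

definition tangent_defect :: "real^'n^'n \<Rightarrow> real^'n^'n \<Rightarrow> real^'n^'n \<Rightarrow> real^'n^'n \<Rightarrow> real^'n^'n" where
  "tangent_defect G I S A = S - (transpose I ** S ** I + transpose A ** G ** I + transpose I ** G ** A)"

definition tangent_pair :: "real^'n^'n \<Rightarrow> real^'n^'n \<Rightarrow> real^'n^'n \<Rightarrow> real^'n^'n \<Rightarrow> bool" where
  "tangent_pair G I S A \<longleftrightarrow> transpose S = S \<and> A ** I = - (I ** A) \<and> tangent_defect G I S A = 0"

lemma tangent_pair_add:
  assumes "tangent_pair G I S A" "tangent_pair G I S' A'"
  shows "tangent_pair G I (S + S') (A + A')"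
proof -
  have "tangent_defect G I (S + S') (A + A') = tangent_defect G I S A + tangent_defect G I S' A'"
    by (simp add: tangent_defect_def transpose_ring matrix_ring)
  then show ?thesis using assms by (simp add: tangent_pair_def transpose_ring matrix_ring)
qed

lemma tangent_pair_scaleR:
  assumes "tangent_pair G I S A"
  shows "tangent_pair G I (c *\<^sub>R S) (c *\<^sub>R A)"
proof -
  have "tangent_defect G I (c *\<^sub>R S) (c *\<^sub>R A) = c *\<^sub>R tangent_defect G I S A"
    by (simp add: tangent_defect_def transpose_ring matrix_ring scaleR_add_right scaleR_diff_right)
  then show ?thesis using assms by (simp add: tangent_pair_def transpose_ring matrix_ring)
qed

lemma tangent_pair_diff:
  assumes "tangent_pair G I S A" "tangent_pair G I S' A'"
  shows "tangent_pair G I (S - S') (A - A')"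
  using tangent_pair_add[OF assms(1) tangent_pair_scaleR[OF assms(2), of "-1"]] by simp

text \<open>These are the conditions of the theorem on (Q1, Q2). As A anticommutes with I, the
  lowered form of A has no (1,1) part; the linearized compatibility equates the difference of S and
  its conjugate by I with the symmetrized lowered form of A precomposed with I.\<close>

lemma tangent_pair_conditions:
  assumes ah: "linear_ah G I" and tan: "tangent_pair G I S A"
  shows "\<forall>u v. bil S u v = bil S v u" "part_11 I (lower_endo G A) = 0"
    "part_02_20 I S = form_J I (part_sym (lower_endo G A))"
proof -
  show "\<forall>u v. bil S u v = bil S v u"
    using tan by (metis bil_commute tangent_pair_def)
  let ?k = "transpose A ** G"
  have AI: "transpose I ** transpose A = - (transpose A ** transpose I)"
    using tan by (metis matrix_transpose_mul tangent_pair_def transpose_minus)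
  have k: "transpose I ** ?k = ?k ** I"
    by (simp add: matrix_mul_assoc AI matrix_neg_left)
       (simp add: matrix_mul_assoc[symmetric] linear_ah_skew[OF ah] matrix_neg_right)
  have II: "I ** I = - mat 1" by (rule linear_ah_square[OF ah])
  show "part_11 I (lower_endo G A) = 0"
    by (simp add: part_11_eq lower_endo_eq k)
       (simp add: matrix_mul_assoc[symmetric] II matrix_neg_right)
  have "S - transpose I ** S ** I = ?k ** I + transpose I ** transpose ?k"
    using tan by (simp add: tangent_pair_def tangent_defect_def transpose_ring linear_ah_sym[OF ah]
        matrix_mul_assoc diff_eq_eq add_ac)
  also have "\<dots> = transpose I ** (?k + transpose ?k)"
    by (simp only: matrix_add_ldistrib k)
  finally show "part_02_20 I S = form_J I (part_sym (lower_endo G A))"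
    by (simp add: part_02_20_eq form_J_eq part_sym_eq lower_endo_eq matrix_scaleR_right)
qed

text \<open>Differentiate the defining equations along the curve; uniqueness of derivatives turns
  equal functions into equal velocities.\<close>

lemma tangent_pair_curve:
  assumes curve: "\<And>s. linear_ah (\<gamma> s) (\<eta> s)" "(\<gamma> has_vector_derivative S) (at (0::real))"
    "(\<eta> has_vector_derivative A) (at 0)"
  shows "tangent_pair (\<gamma> 0) (\<eta> 0) S A"
proof -
  note mult = bounded_bilinear.has_vector_derivative[OF bounded_bilinear_matrix_mult]
  have T: "((\<lambda>s. transpose (f s)) has_vector_derivative transpose f') (at 0)"
    if "(f has_vector_derivative f') (at 0)" for f :: "real \<Rightarrow> real^'n^'n" and f'
    using bounded_linear.has_vector_derivative[OF bounded_linear_transpose that] .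
  have uniq: "a = b" if "(f has_vector_derivative a) (at (0::real))" "(h has_vector_derivative b) (at 0)" "f = h"
    for f h :: "real \<Rightarrow> real^'n^'n" and a b
    using that vector_derivative_unique_at by blast
  have 1: "transpose S = S"
    by (rule uniq[OF T[OF curve(2)] curve(2)]) (simp add: linear_ah_sym[OF curve(1)])
  have "\<eta> 0 ** A + A ** \<eta> 0 = 0"
    by (rule uniq[OF mult[OF curve(3,3)] has_vector_derivative_const[of "- mat 1"]])
       (simp add: linear_ah_square[OF curve(1)])
  then have 2: "A ** \<eta> 0 = - (\<eta> 0 ** A)" by (simp add: eq_neg_iff_add_eq_0 add.commute)
  have "(transpose (\<eta> 0) ** \<gamma> 0) ** A + (transpose (\<eta> 0) ** S + transpose A ** \<gamma> 0) ** \<eta> 0 = S"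
    by (rule uniq[OF mult[OF mult[OF T[OF curve(3)] curve(2)] curve(3)] curve(2)])
       (simp add: linear_ah_compat[OF curve(1)])
  then have "S = transpose (\<eta> 0) ** S ** \<eta> 0 + transpose A ** \<gamma> 0 ** \<eta> 0 + transpose (\<eta> 0) ** \<gamma> 0 ** A"
    by (simp add: matrix_add_rdistrib add_ac)
  then show ?thesis using 1 2 unfolding tangent_pair_def tangent_defect_def by (metis right_minus_eq)
qed

context ah_field
begin

lemma N_endo_eq:
  assumes x: "x \<in> U"
  shows "N_endo g J x = - (\<Sum>a\<in>UNIV. \<Sum>b\<in>UNIV. gi x $ a $ b *\<^sub>R (DJ g J b x ** DJ g J a x ** J x))"
proof -
  let ?T = transpose
  have sk: "?T (DJ g J b x) ** g x = - (g x ** DJ g J b x)" for b by (rule DJ_skew[OF x])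
  have "(\<chi> i j. \<Sum>a\<in>UNIV. \<Sum>b\<in>UNIV. gi x $ a $ b *
      bil (g x) (DJ g J a x *v (J x *v frame i)) (DJ g J b x *v frame j)) =
    (\<Sum>a\<in>UNIV. \<Sum>b\<in>UNIV. gi x $ a $ b *\<^sub>R (?T (DJ g J a x ** J x) ** g x ** DJ g J b x))"
    by (simp add: vec_eq_iff matrix_vector_mul_assoc bil_mult bil_frame sum_component)
  then have "N_endo g J x = (\<Sum>a\<in>UNIV. \<Sum>b\<in>UNIV. gi x $ a $ b *\<^sub>R
      (gi x ** (?T (DJ g J b x) ** g x) ** DJ g J a x ** J x))"
    by (simp add: N_endo_def raise_form_def transpose_sum transpose_ring matrix_sum_right
        linear_ah_sym[OF lah[OF x]] matrix_mul_assoc matrix_scaleR_right)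
  then show ?thesis
    by (simp add: sk matrix_neg_left matrix_neg_right matrix_mul_assoc
        linear_ah_inv_left[OF lah[OF x]] sum_negf)
qed

lemma gi_J:
  assumes x: "x \<in> U"
  shows "gi x ** transpose (J x) = - (J x ** gi x)"
proof -
  have "gi x ** transpose (J x) = gi x ** (transpose (J x) ** g x) ** gi x"
    by (simp add: matrix_mul_assoc[symmetric] linear_ah_inv_right[OF lah[OF x]])
  also have "\<dots> = - (gi x ** g x ** J x ** gi x)"
    by (simp add: linear_ah_skew[OF lah[OF x]] matrix_ring)
  finally show ?thesis by (simp add: linear_ah_inv_left[OF lah[OF x]])
qed

lemma R_endo_eq:
  assumes x: "x \<in> U"
  shows "R_endo g J x = gi x ** ricci g x ** J x - J x ** gi x ** ricci g x"
proof -
  have "(\<chi> i j. bil (ricci g x) (J x *v frame i) (frame j) + bil (ricci g x) (frame i) (J x *v frame j)) =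
      transpose (J x) ** ricci g x + ricci g x ** J x"
    by (simp add: vec_eq_iff bil_mult_left bil_mult_right bil_frame)
  then have "R_endo g J x = gi x ** ricci g x ** J x + (gi x ** transpose (J x)) ** ricci g x"
    by (simp add: R_endo_def raise_form_def transpose_ring ricci_sym[OF x] matrix_ring)
  then show ?thesis by (simp add: gi_J[OF x] matrix_ring)
qed

text \<open>Lie derivatives are velocities of pullbacks, hence tangent. The verification is
  algebraic: the terms in the covariant derivative of the field cancel, and the derivative of J
  along it is skew and anticommutes with J.\<close>

lemma tangent_pair_lie:
  assumes x: "x \<in> U"
  shows "tangent_pair (g x) (J x) (lie_form (theta_sharp g J) g x) (lie_endo (theta_sharp g J) J x)"
proof -
  let ?G = "g x" and ?I = "J x" and ?N = "nabla_theta g J x" and ?T = transpose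
  let ?D = "\<Sum>q\<in>UNIV. theta_sharp g J x $ q *\<^sub>R DJ g J q x"
  have D: "?D ** ?I = - (?I ** ?D)"
    by (simp add: matrix_sum_left matrix_sum_right matrix_ring DJ_anticommute[OF x] sum_negf)
  have Ds: "?T ?D ** ?G = - (?G ** ?D)"
    by (simp add: matrix_sum_left matrix_sum_right transpose_sum transpose_ring matrix_ring DJ_skew[OF x] sum_negf)
  note l = lah[OF x]
  have II: "?I ** ?I = - mat 1" by (rule linear_ah_square[OF l])
  have II': "M ** ?I ** ?I = - M" for M :: "real^'n^'n"
    by (simp add: matrix_mul_assoc[symmetric] II matrix_neg_right)
  have c: "?T ?I ** ?G ** ?I = ?G" by (rule linear_ah_compat[OF l])
  have "transpose (?T ?N ** ?G + ?G ** ?N) = ?T ?N ** ?G + ?G ** ?N"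
    by (simp add: transpose_ring linear_ah_sym[OF l])
  moreover have "(?D - ?N ** ?I + ?I ** ?N) ** ?I = - (?I ** (?D - ?N ** ?I + ?I ** ?N))"
    by (simp add: matrix_ring D II' II)
  moreover have "?T ?I ** (?T ?N ** ?G + ?G ** ?N) ** ?I + ?T (?D - ?N ** ?I + ?I ** ?N) ** ?G ** ?I
      + ?T ?I ** ?G ** (?D - ?N ** ?I + ?I ** ?N) = ?T ?N ** ?G + ?G ** ?N"
  proof -
    have "?T ?I ** (?T ?N ** ?G + ?G ** ?N) ** ?I + ?T (?D - ?N ** ?I + ?I ** ?N) ** ?G ** ?I
      + ?T ?I ** ?G ** (?D - ?N ** ?I + ?I ** ?N) =
      ?T ?N ** (?T ?I ** ?G ** ?I) + (?T ?I ** ?G ** ?I) ** ?N + ((?T ?D ** ?G) ** ?I + (?T ?I ** ?G) ** ?D)"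
      by (simp add: transpose_ring matrix_ring)
    also have "(?T ?D ** ?G) ** ?I + (?T ?I ** ?G) ** ?D = - (?G ** (?D ** ?I + ?I ** ?D))"
      unfolding Ds linear_ah_skew[OF l] by (simp add: matrix_ring)
    finally show ?thesis by (simp add: c D)
  qed
  ultimately show ?thesis
    unfolding lie_form_theta_sharp[OF x] lie_endo_theta_sharp[OF x] tangent_pair_def tangent_defect_def by simp
qed

text \<open>The Laplacian plus N is skew and anticommutes with J, so it drops out of the
  compatibility equation; R is symmetric for g and balances -2 Ric there. Thus each extra term
  repairs one algebraic defect of the pair (-2 Ric, Laplacian of J).\<close>

lemma tangent_pair_ricci:
  assumes x: "x \<in> U"
  shows "tangent_pair (g x) (J x) (- 2 *\<^sub>R ricci g x)
    (rough_laplacian g J x + N_endo g J x + R_endo g J x)"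
proof -
  let ?G = "g x" and ?I = "J x" and ?T = transpose and ?R = "ricci g x"
  let ?S = "rough_laplacian g J x + N_endo g J x"
  note l = lah[OF x]
  have II: "?I ** ?I = - mat 1" by (rule linear_ah_square[OF l])
  have II': "M ** ?I ** ?I = - M" for M :: "real^'n^'n"
    by (simp add: matrix_mul_assoc[symmetric] II matrix_neg_right)
  let ?Q = "\<Sum>a\<in>UNIV. \<Sum>b\<in>UNIV. gi x $ a $ b *\<^sub>R (DJ g J a x ** DJ g J b x)"
  have Q: "?Q = (\<Sum>a\<in>UNIV. \<Sum>b\<in>UNIV. gi x $ a $ b *\<^sub>R (DJ g J b x ** DJ g J a x))"
    by (rule trans[OF sum.swap], intro sum.cong refl, subst gi_sym[OF x], rule refl)
  have QI: "?Q ** ?I = ?I ** ?Q"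
    unfolding matrix_sum_left matrix_sum_right matrix_scaleR_left matrix_scaleR_right
    by (intro sum.cong refl arg_cong[where f = "scaleR _"])
       (simp add: matrix_mul_assoc[symmetric] DJ_anticommute[OF x] matrix_neg_right,
        simp add: matrix_mul_assoc DJ_anticommute[OF x] matrix_neg_left)
  have N: "N_endo g J x = - (?Q ** ?I)"
    unfolding N_endo_eq[OF x] Q by (simp add: matrix_sum_left matrix_scaleR_left)
  \<comment> \<open>The trace of the second derivative of J^2 = -1. As N is -Q J with Q commuting
    with J, its anticommutator with J is 2 Q and cancels this term.\<close>
  have L: "rough_laplacian g J x ** ?I + ?I ** rough_laplacian g J x = - (2 *\<^sub>R ?Q)"
  proof -
    have "rough_laplacian g J x ** ?I + ?I ** rough_laplacian g J x =
      (\<Sum>i\<in>UNIV. \<Sum>j\<in>UNIV. gi x $ i $ j *\<^sub>R (D2J g J i j x ** ?I + ?I ** D2J g J i j x))"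
      by (simp add: rough_laplacian_def matrix_sum_left matrix_sum_right matrix_ring
          scaleR_add_right sum.distrib)
    also have "\<dots> = - (?Q + (\<Sum>a\<in>UNIV. \<Sum>b\<in>UNIV. gi x $ a $ b *\<^sub>R (DJ g J b x ** DJ g J a x)))"
      unfolding D2J_anticommute[OF x]
      by (simp add: scaleR_add_right sum.distrib sum_subtractf scaleR_minus_right scaleR_diff_right sum_negf)
    finally show ?thesis unfolding Q[symmetric] by (simp add: scaleR_2)
  qed
  have "?S ** ?I + ?I ** ?S = (rough_laplacian g J x ** ?I + ?I ** rough_laplacian g J x)
      - (?Q ** ?I ** ?I + ?I ** ?Q ** ?I)"
    by (simp add: N matrix_ring)
  also have "?I ** ?Q ** ?I = - ?Q" by (simp only: QI[symmetric] II')
  finally have "?S ** ?I + ?I ** ?S = 0" by (simp add: L II' scaleR_2)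
  then have S: "?S ** ?I = - (?I ** ?S)" by (simp add: eq_neg_iff_add_eq_0)
  have "?T ?Q = (\<Sum>a\<in>UNIV. \<Sum>b\<in>UNIV. gi x $ a $ b *\<^sub>R (?T (DJ g J b x) ** ?T (DJ g J a x)))"
    by (simp add: transpose_sum transpose_ring)
  then have "?T ?Q ** ?G = (\<Sum>a\<in>UNIV. \<Sum>b\<in>UNIV. gi x $ a $ b *\<^sub>R (?G ** DJ g J b x ** DJ g J a x))"
    by (simp add: matrix_sum_left matrix_scaleR_left matrix_mul_assoc[symmetric] DJ_skew[OF x] matrix_neg_right)
       (simp add: matrix_mul_assoc DJ_skew[OF x] matrix_neg_left)
  then have "?T ?Q ** ?G = ?G ** ?Q"
    unfolding Q by (simp add: matrix_sum_right matrix_scaleR_right matrix_mul_assoc)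
  then have "?T (N_endo g J x) ** ?G = - (?T ?I ** ?G ** ?Q)"
    by (simp add: N transpose_ring matrix_neg_left matrix_mul_assoc[symmetric])
  then have Ns: "?T (N_endo g J x) ** ?G = - (?G ** N_endo g J x)"
    by (simp add: linear_ah_skew[OF l] N matrix_ring QI)
  have "?T (rough_laplacian g J x) ** ?G = - (?G ** rough_laplacian g J x)"
    by (simp add: rough_laplacian_def transpose_sum transpose_ring matrix_sum_left matrix_sum_right
        matrix_scaleR_left matrix_scaleR_right D2J_skew[OF x] sum_negf)
  then have Ss: "?T ?S ** ?G = - (?G ** ?S)"
    by (simp add: transpose_ring matrix_ring Ns)
  let ?E = "R_endo g J x"
  have E: "?E = gi x ** ?R ** ?I - ?I ** gi x ** ?R" by (rule R_endo_eq[OF x])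
  have EI: "?E ** ?I = - (?I ** ?E)"
    unfolding E by (simp add: matrix_ring II II')
  have GE: "?G ** ?E = ?R ** ?I + ?T ?I ** ?R"
    unfolding E by (simp add: matrix_ring linear_ah_inv_right[OF l] linear_ah_skew[OF l, symmetric])
      (metis (no_types, opaque_lifting) linear_ah_inv_right[OF l] linear_ah_skew[OF l] matrix_mul_assoc
        matrix_mul_lid matrix_mul_rid matrix_neg_left minus_minus)
  \<comment> \<open>R is symmetric rather than skew for g: it alone matches the part of Ric that is
    not J-invariant.\<close>
  have EG: "?T ?E ** ?G = ?G ** ?E"
  proof -
    have "?T ?E ** ?G = ?T (?G ** ?E)" by (simp add: matrix_transpose_mul linear_ah_sym[OF l])
    then show ?thesis unfolding GE by (simp add: transpose_ring ricci_sym[OF x] add.commute)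
  qed
  have "?T (- 2 *\<^sub>R ?R) = - 2 *\<^sub>R ?R" by (simp only: transpose_scalar ricci_sym[OF x])
  moreover have "(?S + ?E) ** ?I = - (?I ** (?S + ?E))"
    unfolding matrix_add_rdistrib[of ?S ?E] matrix_add_ldistrib[of ?I ?S ?E] S EI by simp
  moreover have "?T ?I ** (- 2 *\<^sub>R ?R) ** ?I + ?T (?S + ?E) ** ?G ** ?I + ?T ?I ** ?G ** (?S + ?E) = - 2 *\<^sub>R ?R"
  proof -
    have "?T (?S + ?E) ** ?G ** ?I + ?T ?I ** ?G ** (?S + ?E) =
      ((?T ?S ** ?G) ** ?I + (?T ?I ** ?G) ** ?S) + ((?T ?E ** ?G) ** ?I + ?T ?I ** (?G ** ?E))"
      by (simp only: transpose_add matrix_ring) (simp add: add_ac)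
    also have "(?T ?S ** ?G) ** ?I + (?T ?I ** ?G) ** ?S = - (?G ** (?S ** ?I + ?I ** ?S))"
      unfolding Ss linear_ah_skew[OF l]
      by (simp only: matrix_neg_left matrix_add_ldistrib[of ?G "?S ** ?I"] matrix_mul_assoc minus_add_distrib)
    also have "\<dots> = 0" by (simp only: S) simp
    also have "(?T ?E ** ?G) ** ?I + ?T ?I ** (?G ** ?E) = 2 *\<^sub>R (?T ?I ** ?R ** ?I) - 2 *\<^sub>R ?R"
    proof -
      have "?T ?I ** ?T ?I = - mat 1"
        by (metis II matrix_transpose_mul transpose_mat transpose_minus)
      then show ?thesis unfolding EG GE
        by (simp add: matrix_ring II' scaleR_2)
    qed
    finally have F: "?T (?S + ?E) ** ?G ** ?I + ?T ?I ** ?G ** (?S + ?E) =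
      0 + (2 *\<^sub>R (?T ?I ** ?R ** ?I) - 2 *\<^sub>R ?R)" .
    show ?thesis unfolding add.assoc[of "?T ?I ** (- 2 *\<^sub>R ?R) ** ?I"] F
      by (simp add: matrix_scaleR_left matrix_scaleR_right matrix_neg_left matrix_neg_right)
  qed
  ultimately show ?thesis unfolding tangent_pair_def tangent_defect_def by simp
qed

end

section \<open>Natural expressions\<close>

text \<open>Equality is required only on almost Hermitian structures and at lists of the right
  length, so that identities such as the inverse property of the metric can be used between
  applications of the rules.\<close>

definition is_contraction :: "(nat \<times> 'n::finite top) set \<Rightarrow> nat \<Rightarrow> 'n top \<Rightarrow> bool" where
  "is_contraction C k T \<longleftrightarrow> (\<exists>T'. contraction C k T' \<and>
     (\<forall>U g J. ah_on U g J \<longrightarrow> (\<forall>x\<in>U. \<forall>is. length is = k \<longrightarrow> T g J x is = T' g J x is)))"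

lemma is_contractionI: "contraction C k T \<Longrightarrow> is_contraction C k T"
  unfolding is_contraction_def by blast

lemma is_contraction_cong:
  assumes "is_contraction C k T"
    "\<And>U g J x is. ah_on U g J \<Longrightarrow> x \<in> U \<Longrightarrow> length is = k \<Longrightarrow> S g J x is = T g J x is"
  shows "is_contraction C k S"
  using assms unfolding is_contraction_def by metis

lemma is_contraction_add:
  assumes "is_contraction C k T" "is_contraction C k S"
  shows "is_contraction C k (\<lambda>g J x is. T g J x is + S g J x is)"
  using assms unfolding is_contraction_def by (metis (no_types, lifting) contraction.add)

lemma is_contraction_scale:
  assumes "is_contraction C k T"
  shows "is_contraction C k (\<lambda>g J x is. r * T g J x is)"
  using assms unfolding is_contraction_def by (metis (no_types, lifting) contraction.scale)

lemma is_contraction_diff: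
  assumes "is_contraction C k T" "is_contraction C k S"
  shows "is_contraction C k (\<lambda>g J x is. T g J x is - S g J x is)"
  using is_contraction_add[OF assms(1) is_contraction_scale[OF assms(2), of "-1"]] by simp

lemma is_contraction_times_J:
  assumes "is_contraction C k T"
  shows "is_contraction C (k + 2) (\<lambda>g J x is. T g J x (take k is) * omega g J x $ (is!k) $ (is!(k+1)))"
proof -
  obtain T' where T': "contraction C k T'" "\<And>U g J x is. ah_on U g J \<Longrightarrow> x \<in> U \<Longrightarrow> length is = k \<Longrightarrow>
      T g J x is = T' g J x is"
    using assms unfolding is_contraction_def by blast
  show ?thesis unfolding is_contraction_def
    using contraction.times_J[OF T'(1)] T'(2) by (intro exI conjI) auto
qed

lemma is_contraction_permute_list:
  assumes "is_contraction C k T" "\<pi> permutes {..<k}"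
  shows "is_contraction C k (\<lambda>g J x is. T g J x (permute_list \<pi> is))"
proof -
  obtain T' where T': "contraction C k T'" "\<And>U g J x is. ah_on U g J \<Longrightarrow> x \<in> U \<Longrightarrow> length is = k \<Longrightarrow>
      T g J x is = T' g J x is"
    using assms unfolding is_contraction_def by blast
  show ?thesis unfolding is_contraction_def
    using contraction.permute[OF T'(1) assms(2)] T'(2) by (intro exI conjI) auto
qed

lemma is_contraction_contract_g:
  assumes "is_contraction C (k + 2) T"
  shows "is_contraction C k (\<lambda>g J x is. \<Sum>a\<in>UNIV. \<Sum>b\<in>UNIV. matrix_inv (g x) $ a $ b * T g J x (a # b # is))"
proof -
  obtain T' where T': "contraction C (k + 2) T'" "\<And>U g J x is. ah_on U g J \<Longrightarrow> x \<in> U \<Longrightarrow> length is = k + 2 \<Longrightarrow>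
      T g J x is = T' g J x is"
    using assms unfolding is_contraction_def by blast
  show ?thesis unfolding is_contraction_def
    using contraction.contract_g[OF T'(1)] T'(2) by (intro exI conjI) auto
qed

text \<open>Slot number i of \<open>T\<close> reads the index at position
  \<open>\<sigma> ! i\<close>; the permutation is given by the list of these positions.\<close>

lemma is_contraction_perm:
  assumes "is_contraction C k T" "distinct \<sigma>" "set \<sigma> = set [0..<k]"
  shows "is_contraction C k (\<lambda>g J x is. T g J x (map ((!) is) \<sigma>))"
proof -
  define \<pi> where "\<pi> i = (if i < k then \<sigma> ! i else i)" for i
  have len: "length \<sigma> = k" using distinct_card[OF assms(2)] assms(3) by simp
  have "bij_betw ((!) \<sigma>) {..<k} {..<k}"
    using bij_betw_nth[OF assms(2), of "{..<k}" "{..<k}"] assms(3) len by (auto simp: lessThan_atLeast0)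
  then have "bij_betw \<pi> {..<k} {..<k}"
    by (rule bij_betw_cong[THEN iffD1, rotated]) (simp add: \<pi>_def)
  then have "\<pi> permutes {..<k}" by (rule bij_imp_permutes) (simp add: \<pi>_def)
  from is_contraction_permute_list[OF assms(1) this] show ?thesis
  proof (rule is_contraction_cong)
    fix U and g J :: "'a mfield" and x and "is" :: "'a list" assume "length is = k"
    then have "map ((!) is) \<sigma> = permute_list \<pi> is"
      by (intro nth_equalityI) (simp_all add: len \<pi>_def permute_list_def)
    then show "T g J x (map ((!) is) \<sigma>) = T g J x (permute_list \<pi> is)" by simp
  qed
qed

text \<open>Precomposing a slot with J is multiplication by omega followed by a contraction with
  g.\<close>

lemma is_contraction_J:
  assumes "is_contraction C (Suc k) T"
  shows "is_contraction C (Suc k) (\<lambda>g J x is. \<Sum>q\<in>UNIV. J x $ q $ hd is * T g J x (q # tl is))"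
proof -
  \<comment> \<open>In the list a, b, i, js the tensor reads a and js, while omega reads (i,
    b).\<close>
  let ?\<sigma> = "0 # [3..<k + 3] @ [2, 1]"
  have "is_contraction C (Suc k + 2) (\<lambda>g J x is. T g J x (take (Suc k) is) * omega g J x $ (is!Suc k) $ (is!(Suc k + 1)))"
    by (rule is_contraction_times_J[OF assms])
  then have "is_contraction C (Suc k + 2) (\<lambda>g J x is. (\<lambda>g J x is. T g J x (take (Suc k) is) *
      omega g J x $ (is!Suc k) $ (is!(Suc k + 1))) g J x (map ((!) is) ?\<sigma>))"
    by (rule is_contraction_perm) auto
  then have "is_contraction C (Suc k) (\<lambda>g J x is. \<Sum>a\<in>UNIV. \<Sum>b\<in>UNIV. matrix_inv (g x) $ a $ b *
    (\<lambda>g J x is. (\<lambda>g J x is. T g J x (take (Suc k) is) *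
      omega g J x $ (is!Suc k) $ (is!(Suc k + 1))) g J x (map ((!) is) ?\<sigma>)) g J x (a # b # is))"
    by (rule is_contraction_contract_g)
  then show ?thesis
  proof (rule is_contraction_cong)
    fix U and g J :: "'a mfield" and x and "is" :: "'a list" assume h: "ah_on U g J" "x \<in> U" and l: "length is = Suc k"
    interpret ah_field U g J by unfold_locales (rule h(1))
    obtain i js where i: "is = i # js" "length js = k" using l by (cases "is") auto
    have m: "map ((!) (a # b # is)) [3..<k + 3] = js" for a b
      using i(2) by (intro nth_equalityI) (simp_all add: i(1) eval_nat_numeral del: upt_Suc)
    have "(\<Sum>a\<in>UNIV. \<Sum>b\<in>UNIV. matrix_inv (g x) $ a $ b * (T g J x (a # js) * omega g J x $ i $ b)) =
        (\<Sum>a\<in>UNIV. J x $ a $ i * T g J x (a # js))"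
    proof (intro sum.cong refl)
      fix a
      have "(\<Sum>b\<in>UNIV. matrix_inv (g x) $ a $ b * omega g J x $ i $ b) = (matrix_inv (g x) ** transpose (omega g J x)) $ a $ i"
        by (simp add: matrix_mult_nth transpose_nth)
      also have "\<dots> = J x $ a $ i"
        by (simp add: omega_def lower_endo_eq transpose_ring linear_ah_sym[OF lah[OF h(2)]]
            matrix_mul_assoc linear_ah_inv_left[OF lah[OF h(2)]])
      finally have e: "(\<Sum>b\<in>UNIV. matrix_inv (g x) $ a $ b * omega g J x $ i $ b) = J x $ a $ i" .
      have "(\<Sum>b\<in>UNIV. matrix_inv (g x) $ a $ b * (T g J x (a # js) * omega g J x $ i $ b)) =
          (\<Sum>b\<in>UNIV. matrix_inv (g x) $ a $ b * omega g J x $ i $ b) * T g J x (a # js)"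
        by (simp add: sum_distrib_left sum_distrib_right algebra_simps)
      then show "(\<Sum>b\<in>UNIV. matrix_inv (g x) $ a $ b * (T g J x (a # js) * omega g J x $ i $ b)) =
          J x $ a $ i * T g J x (a # js)" by (simp only: e)
    qed
    then show "(\<Sum>q\<in>UNIV. J x $ q $ hd is * T g J x (q # tl is)) =
      (\<Sum>a\<in>UNIV. \<Sum>b\<in>UNIV. matrix_inv (g x) $ a $ b *
       (\<lambda>g J x is. (\<lambda>g J x is. T g J x (take (Suc k) is) *
      omega g J x $ (is!Suc k) $ (is!(Suc k + 1))) g J x (map ((!) is) ?\<sigma>)) g J x (a # b # is))"
      using i(2) m by (simp add: i(1) nth_append)
  qed
qed

lemma form_contraction_iff:
  "form_contraction C B \<longleftrightarrow> is_contraction C 2 (\<lambda>g J x is. B g J x $ (is!0) $ (is!1))"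
proof -
  have e: "(\<forall>is. length is = 2 \<longrightarrow> B g J x $ (is!0) $ (is!1) = T g J x is) \<longleftrightarrow>
      (\<forall>i j. B g J x $ i $ j = T g J x [i, j])" for g J x T
  proof safe
    fix i j assume "\<forall>is. length is = 2 \<longrightarrow> B g J x $ (is!0) $ (is!1) = T g J x is"
    from this[rule_format, of "[i, j]"] show "B g J x $ i $ j = T g J x [i, j]" by simp
  qed (auto simp: length_Suc_conv numeral_eq_Suc)
  show ?thesis unfolding form_contraction_def is_contraction_def e ..
qed

section \<open>Index formulas for Ric, N and the Lie derivatives along the dual of \<theta>\<close>

context ah_field
begin

lemma D2J_t_eq: "D2J_t g J x [a, b, i, j] = lower_endo (g x) (D2J g J a b x) $ i $ j"
  by (simp add: D2J_t_def lower_endo_def numeral_eq_Suc)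

lemma Rm_t_eq: "Rm_t g J x [a, b, i, j] = lower_endo (g x) (riemann g a b x) $ i $ j"
  by (simp add: Rm_t_def lower_endo_def numeral_eq_Suc)

lemma DJDJ_t_eq: "DJDJ_t g J x [a, i, j, b, k, l] =
    lower_endo (g x) (DJ g J a x) $ i $ j * lower_endo (g x) (DJ g J b x) $ k $ l"
  by (simp add: DJDJ_t_def DJ_t_def lower_endo_def numeral_eq_Suc)

lemma lower_raise:
  assumes x: "x \<in> U"
  shows "lower_endo (g x) (raise_form (g x) B) = B"
  by (simp add: lower_endo_eq raise_form_def transpose_ring linear_ah_inv_sym[OF lah[OF x]]
      matrix_mul_assoc[symmetric] linear_ah_inv_left[OF lah[OF x]])

lemma ricci_contraction:
  assumes x: "x \<in> U"
  shows "ricci g x $ j $ k = (\<Sum>a\<in>UNIV. \<Sum>b\<in>UNIV. gi x $ a $ b * Rm_t g J x [a, j, k, b])"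
proof -
  have "(\<Sum>b\<in>UNIV. gi x $ a $ b * Rm_t g J x [a, j, k, b]) = riemann g a j x $ a $ k" for a
  proof -
    have "(\<Sum>b\<in>UNIV. gi x $ a $ b * Rm_t g J x [a, j, k, b]) = (gi x ** transpose (lower_endo (g x) (riemann g a j x))) $ a $ k"
      by (simp add: Rm_t_eq matrix_mult_nth transpose_nth)
    then show ?thesis
      by (simp add: lower_endo_eq transpose_ring linear_ah_sym[OF lah[OF x]]
            matrix_mul_assoc linear_ah_inv_left[OF lah[OF x]])
  qed
  then show ?thesis by (simp add: ricci_def)
qed

lemma DJ_from_lower:
  assumes x: "x \<in> U"
  shows "transpose (DJ g J a x) = lower_endo (g x) (DJ g J a x) ** gi x"
    "g x ** DJ g J a x = transpose (lower_endo (g x) (DJ g J a x))"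
    "DJ g J a x = gi x ** transpose (lower_endo (g x) (DJ g J a x))"
  by (simp_all add: lower_endo_eq transpose_ring linear_ah_sym[OF lah[OF x]] matrix_mul_assoc
      linear_ah_inv_left[OF lah[OF x]])
     (simp add: matrix_mul_assoc[symmetric] linear_ah_inv_right[OF lah[OF x]])

lemma N_contraction:
  assumes x: "x \<in> U"
  shows "lower_endo (g x) (N_endo g J x) $ i $ j = (\<Sum>a\<in>UNIV. \<Sum>b\<in>UNIV. gi x $ a $ b *
    (\<Sum>c\<in>UNIV. \<Sum>d\<in>UNIV. gi x $ c $ d * (\<Sum>q\<in>UNIV. J x $ q $ i * DJDJ_t g J x [a, q, c, b, j, d])))"
proof -
  let ?L = "\<lambda>a. lower_endo (g x) (DJ g J a x)"
  have "bil (g x) (DJ g J a x *v (J x *v frame i)) (DJ g J b x *v frame j) =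
      (transpose (J x) ** (?L a ** gi x) ** transpose (?L b)) $ i $ j" for a b
    by (simp add: matrix_vector_mul_assoc bil_mult bil_frame transpose_ring matrix_mul_assoc[symmetric]
        DJ_from_lower(1)[OF x] DJ_from_lower(2)[OF x])
  also have "(transpose (J x) ** (?L a ** gi x) ** transpose (?L b)) $ i $ j =
    (\<Sum>c\<in>UNIV. \<Sum>d\<in>UNIV. gi x $ c $ d * (\<Sum>q\<in>UNIV. J x $ q $ i * DJDJ_t g J x [a, q, c, b, j, d]))" for a b
  proof -
    have "(transpose (J x) ** (?L a ** gi x) ** transpose (?L b)) $ i $ j =
      (\<Sum>d\<in>UNIV. \<Sum>c\<in>UNIV. (transpose (J x) ** ?L a) $ i $ c * gi x $ c $ d * ?L b $ j $ d)"
      by (simp add: matrix_mul_assoc matrix_mult_nth[of _ "transpose (?L b)"] matrix_mult_nth[of _ "gi x"]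
          transpose_nth sum_distrib_right)
    also have "\<dots> = (\<Sum>c\<in>UNIV. \<Sum>d\<in>UNIV. (transpose (J x) ** ?L a) $ i $ c * gi x $ c $ d * ?L b $ j $ d)"
      by (rule sum.swap)
    finally show ?thesis
      by (simp add: matrix_mult_nth transpose_nth DJDJ_t_eq sum_distrib_left sum_distrib_right algebra_simps)
  qed
  finally show ?thesis by (simp add: N_endo_def lower_raise[OF x])
qed

lemma nabla_theta_contraction:
  assumes x: "x \<in> U"
  shows "lower_endo (g x) (nabla_theta g J x) $ i $ k =
    (\<Sum>a\<in>UNIV. \<Sum>b\<in>UNIV. gi x $ a $ b * (\<Sum>q\<in>UNIV. J x $ q $ b * D2J_t g J x [i, a, q, k])) +
    (\<Sum>a\<in>UNIV. \<Sum>b\<in>UNIV. gi x $ a $ b *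
      (\<Sum>c\<in>UNIV. \<Sum>d\<in>UNIV. gi x $ c $ d * DJDJ_t g J x [i, b, c, a, d, k]))"
proof -
  let ?L = "\<lambda>a. lower_endo (g x) (DJ g J a x)"
  let ?M = "\<lambda>a. D2J g J i a x ** J x + DJ g J a x ** DJ g J i x"
  have "lower_endo (g x) (nabla_theta g J x) $ i $ k =
      (\<Sum>a\<in>UNIV. \<Sum>p\<in>UNIV. \<Sum>b\<in>UNIV. ?M a $ p $ b * gi x $ b $ a * g x $ p $ k)"
    unfolding lower_endo_nth nabla_theta_def vec_lambda_beta matrix_mult_nth[of _ "gi x"] sum_distrib_right
    by (rule sum.swap)
  also have "\<dots> = (\<Sum>a\<in>UNIV. \<Sum>b\<in>UNIV. gi x $ a $ b * lower_endo (g x) (?M a) $ b $ k)"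
  proof (rule sum.cong[OF refl])
    fix a
    have "(\<Sum>p\<in>UNIV. \<Sum>b\<in>UNIV. ?M a $ p $ b * gi x $ b $ a * g x $ p $ k) =
      (\<Sum>b\<in>UNIV. \<Sum>p\<in>UNIV. ?M a $ p $ b * gi x $ b $ a * g x $ p $ k)" by (rule sum.swap)
    also have "\<dots> = (\<Sum>b\<in>UNIV. \<Sum>p\<in>UNIV. gi x $ a $ b * (?M a $ p $ b * g x $ p $ k))"
      by (intro sum.cong refl, subst gi_sym[OF x]) (simp only: ac_simps)
    finally show "(\<Sum>p\<in>UNIV. \<Sum>b\<in>UNIV. ?M a $ p $ b * gi x $ b $ a * g x $ p $ k) =
       (\<Sum>b\<in>UNIV. gi x $ a $ b * lower_endo (g x) (?M a) $ b $ k)"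
      by (simp only: lower_endo_nth sum_distrib_left)
  qed
  also have "\<dots> = (\<Sum>a\<in>UNIV. \<Sum>b\<in>UNIV. gi x $ a $ b * (\<Sum>q\<in>UNIV. J x $ q $ b * D2J_t g J x [i, a, q, k])) +
    (\<Sum>a\<in>UNIV. \<Sum>b\<in>UNIV. gi x $ a $ b *
      (\<Sum>c\<in>UNIV. \<Sum>d\<in>UNIV. gi x $ c $ d * DJDJ_t g J x [i, b, c, a, d, k]))"
  proof -
    have "lower_endo (g x) (?M a) = transpose (J x) ** lower_endo (g x) (D2J g J i a x)
        + transpose (DJ g J i x) ** ?L a" for a
      by (simp add: lower_endo_eq transpose_ring matrix_add_rdistrib matrix_mul_assoc)
    then have "lower_endo (g x) (?M a) = transpose (J x) ** lower_endo (g x) (D2J g J i a x)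
        + ?L i ** gi x ** ?L a" for a
      by (simp only: DJ_from_lower(1)[OF x])
    then have "lower_endo (g x) (?M a) $ b $ k = (\<Sum>q\<in>UNIV. J x $ q $ b * D2J_t g J x [i, a, q, k]) +
       (?L i ** gi x ** ?L a) $ b $ k" for a b
      by (simp add: matrix_mult_nth[of "transpose (J x)"] transpose_nth D2J_t_eq)
    moreover have "(?L i ** gi x ** ?L a) $ b $ k = (\<Sum>c\<in>UNIV. \<Sum>d\<in>UNIV. gi x $ c $ d * DJDJ_t g J x [i, b, c, a, d, k])" for a b
      unfolding matrix_mult_nth[of _ "?L a"] matrix_mult_nth[of _ "gi x"] sum_distrib_right
      by (subst sum.swap) (simp add: DJDJ_t_eq algebra_simps)
    ultimately show ?thesis by (simp add: distrib_left sum.distrib)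
  qed
  finally show ?thesis .
qed

lemma lie_form_contraction:
  assumes x: "x \<in> U"
  shows "lie_form (theta_sharp g J) g x $ i $ k =
    lower_endo (g x) (nabla_theta g J x) $ i $ k + lower_endo (g x) (nabla_theta g J x) $ k $ i"
proof -
  have "g x ** nabla_theta g J x = transpose (lower_endo (g x) (nabla_theta g J x))"
    by (simp add: lower_endo_eq transpose_ring linear_ah_sym[OF lah[OF x]])
  then show ?thesis by (simp add: lie_form_theta_sharp[OF x] transpose_nth lower_endo_eq)
qed

lemma lie_endo_contraction:
  assumes x: "x \<in> U"
  shows "lower_endo (g x) (lie_endo (theta_sharp g J) J x) $ i $ k =
    (\<Sum>q\<in>UNIV. \<Sum>p\<in>UNIV. gi x $ q $ p * (\<Sum>a\<in>UNIV. \<Sum>b\<in>UNIV. gi x $ a $ b *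
      (\<Sum>c\<in>UNIV. J x $ c $ b * DJDJ_t g J x [a, c, p, q, i, k])))
    - (\<Sum>q\<in>UNIV. J x $ q $ i * lower_endo (g x) (nabla_theta g J x) $ q $ k)
    - (\<Sum>q\<in>UNIV. J x $ q $ k * lower_endo (g x) (nabla_theta g J x) $ i $ q)"
proof -
  let ?L = "\<lambda>a. lower_endo (g x) (DJ g J a x)" and ?N = "nabla_theta g J x"
  have th: "theta_sharp g J x $ q = (\<Sum>p\<in>UNIV. gi x $ q $ p * (\<Sum>a\<in>UNIV. \<Sum>b\<in>UNIV. gi x $ a $ b *
      (\<Sum>c\<in>UNIV. J x $ c $ b * ?L a $ c $ p)))" for q
  proof -
    have "theta g J x $ p = (\<Sum>a\<in>UNIV. \<Sum>b\<in>UNIV. gi x $ a $ b * (\<Sum>c\<in>UNIV. J x $ c $ b * ?L a $ c $ p))" for p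
      by (simp add: theta_def matrix_vector_mul_assoc bil_mult_left bil_frame transpose_ring
          matrix_mul_assoc[symmetric] lower_endo_eq matrix_mult_nth[of "transpose (J x)"] transpose_nth)
    then show ?thesis by (simp add: theta_sharp_def sharp_def matrix_vector_mult_def)
  qed
  have "lower_endo (g x) (lie_endo (theta_sharp g J) J x) =
    (\<Sum>q\<in>UNIV. theta_sharp g J x $ q *\<^sub>R ?L q) - transpose (J x) ** lower_endo (g x) ?N
    - lower_endo (g x) ?N ** J x"
    by (simp add: lie_endo_theta_sharp[OF x] lower_endo_eq transpose_ring transpose_sum matrix_sum_left
        matrix_ring)
       (simp add: matrix_mul_assoc[symmetric] linear_ah_skew[OF lah[OF x]] matrix_neg_right)
  then have "lower_endo (g x) (lie_endo (theta_sharp g J) J x) $ i $ k =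
    (\<Sum>q\<in>UNIV. theta_sharp g J x $ q * ?L q $ i $ k) - (\<Sum>q\<in>UNIV. J x $ q $ i * lower_endo (g x) ?N $ q $ k)
    - (\<Sum>q\<in>UNIV. J x $ q $ k * lower_endo (g x) ?N $ i $ q)"
    by (simp add: sum_component matrix_mult_nth transpose_nth mult.commute)
  then show ?thesis unfolding th DJDJ_t_eq
    by (simp add: sum_distrib_left sum_distrib_right mult.assoc)
qed

end


section \<open>The explicit terms of the right-hand sides are natural\<close>

lemma is_contraction_core: "(k, T) \<in> C \<Longrightarrow> is_contraction C k T"
  by (rule is_contractionI, rule contraction.core)

lemma length_2_cases:
  assumes "length is = 2"
  obtains i j where "is = [i, j]"
  using assms by (auto simp: length_Suc_conv numeral_eq_Suc)

lemma is_contraction_2I: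
  assumes "is_contraction C 2 T"
    "\<And>U g J x i j. ah_on U g J \<Longrightarrow> x \<in> U \<Longrightarrow> S g J x $ i $ j = T g J x [i, j]"
  shows "is_contraction C 2 (\<lambda>g J x is. S g J x $ (is!0) $ (is!1))"
  by (rule is_contraction_cong[OF assms(1)]) (auto elim!: length_2_cases simp: assms(2))

lemma is_contraction_swap:
  assumes "is_contraction C 2 T"
  shows "is_contraction C 2 (\<lambda>g J x is. T g J x [is!1, is!0])"
  using is_contraction_perm[OF assms, of "[1, 0]"] by (simp add: upt_rec insert_commute)

lemma is_contraction_J2:
  assumes "is_contraction C 2 T"
  shows "is_contraction C 2 (\<lambda>g J x is. \<Sum>q\<in>UNIV. J x $ q $ (is!0) * T g J x [q, is!1])"
    "is_contraction C 2 (\<lambda>g J x is. \<Sum>q\<in>UNIV. J x $ q $ (is!1) * T g J x [is!0, q])"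
proof -
  have 1: "is_contraction C 2 (\<lambda>g J x is. \<Sum>q\<in>UNIV. J x $ q $ (is!0) * T g J x [q, is!1])"
    if "is_contraction C 2 T" for T
    by (rule is_contraction_cong[OF is_contraction_J[of C 1 T, simplified Suc_1]])
       (use that in \<open>auto elim!: length_2_cases\<close>)
  show "is_contraction C 2 (\<lambda>g J x is. \<Sum>q\<in>UNIV. J x $ q $ (is!0) * T g J x [q, is!1])"
    by (rule 1[OF assms])
  show "is_contraction C 2 (\<lambda>g J x is. \<Sum>q\<in>UNIV. J x $ q $ (is!1) * T g J x [is!0, q])"
    using is_contraction_swap[OF 1[OF is_contraction_swap[OF assms]]] by simp
qed

lemma is_contraction_contract:
  assumes "is_contraction C m T" "m = Suc (Suc k)"
  shows "is_contraction C k (\<lambda>g J x is. \<Sum>a\<in>UNIV. \<Sum>b\<in>UNIV. matrix_inv (g x) $ a $ b * T g J x (a # b # is))"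
  using is_contraction_contract_g[of C k T] assms by simp

lemma is_contraction_J_hd:
  assumes "is_contraction C m T" "m = Suc k"
  shows "is_contraction C m (\<lambda>g J x is. \<Sum>q\<in>UNIV. J x $ q $ hd is * T g J x (q # tl is))"
  using is_contraction_J[of C k T] assms by simp

lemma upt_4_6: "set [0..<4] = {0, 1, 2, 3::nat}" "set [0..<6] = {0, 1, 2, 3, 4, 5::nat}"
  by (auto simp: eval_nat_numeral)

lemma ricci_is_contraction:
  "is_contraction natural_cores 2 (\<lambda>g J x is. ricci g x $ (is!0) $ (is!1))"
proof (rule is_contraction_2I)
  have "is_contraction natural_cores 4 Rm_t"
    by (rule is_contraction_core) (simp add: natural_cores_def)
  \<comment> \<open>The list a, b, j, k is read as a, j, k, b: contractions always remove the first
    two indices, whereas Ric contracts the first and last slots.\<close>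
  then have "is_contraction natural_cores 4 (\<lambda>g J x is. Rm_t g J x (map ((!) is) [0, 2, 3, 1]))"
    by (rule is_contraction_perm) (auto simp: upt_4_6)
  from is_contraction_contract[OF this, of 2]
  show "is_contraction natural_cores 2 (\<lambda>g J x is. \<Sum>a\<in>UNIV. \<Sum>b\<in>UNIV. matrix_inv (g x) $ a $ b *
      Rm_t g J x (map ((!) (a # b # is)) [0, 2, 3, 1]))" by simp
  fix U and g J :: "'a mfield" and x i j assume "ah_on U g J" "x \<in> U"
  then interpret ah_field U g J by unfold_locales
  show "ricci g x $ i $ j = (\<Sum>a\<in>UNIV. \<Sum>b\<in>UNIV. matrix_inv (g x) $ a $ b *
      Rm_t g J x (map ((!) (a # b # [i, j])) [0, 2, 3, 1]))"
    by (simp add: ricci_contraction[OF \<open>x \<in> U\<close>])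
qed

lemma nabla_theta_is_contraction:
  "is_contraction natural_cores 2 (\<lambda>g J x is. lower_endo (g x) (nabla_theta g J x) $ (is!0) $ (is!1))"
proof (rule is_contraction_2I)
  have "is_contraction natural_cores 4 D2J_t"
    by (rule is_contraction_core) (simp add: natural_cores_def)
  \<comment> \<open>J can only be inserted at the head, so the endomorphism slot is moved there
    first; the later exchange restores the order required by the contraction.\<close>
  then have "is_contraction natural_cores 4 (\<lambda>g J x is. D2J_t g J x (map ((!) is) [2, 1, 0, 3]))"
    by (rule is_contraction_perm) (auto simp: upt_4_6)
  then have "is_contraction natural_cores 4 (\<lambda>g J x is. \<Sum>q\<in>UNIV. J x $ q $ hd is *
      D2J_t g J x (map ((!) (q # tl is)) [2, 1, 0, 3]))" (is "is_contraction _ _ ?T")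
    by (rule is_contraction_J_hd) simp
  then have "is_contraction natural_cores 4 (\<lambda>g J x is. ?T g J x (map ((!) is) [1, 0, 2, 3]))"
    by (rule is_contraction_perm) (auto simp: upt_4_6)
  from is_contraction_contract[OF this, of 2]
  have 1: "is_contraction natural_cores 2 (\<lambda>g J x is. \<Sum>a\<in>UNIV. \<Sum>b\<in>UNIV. matrix_inv (g x) $ a $ b *
      ?T g J x (map ((!) (a # b # is)) [1, 0, 2, 3]))" (is "is_contraction _ _ ?S1") by simp
  have "is_contraction natural_cores 6 DJDJ_t"
    by (rule is_contraction_core) (simp add: natural_cores_def)
  \<comment> \<open>Reads the list c, d, a, b, i, k as i, b, c, a, d, k, the slots of the product of
    the two derivatives of J.\<close>
  then have "is_contraction natural_cores 6 (\<lambda>g J x is. DJDJ_t g J x (map ((!) is) [4, 3, 0, 2, 1, 5]))"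
    by (rule is_contraction_perm) (auto simp: upt_4_6)
  then have "is_contraction natural_cores 4 (\<lambda>g J x is. \<Sum>c\<in>UNIV. \<Sum>d\<in>UNIV. matrix_inv (g x) $ c $ d *
      DJDJ_t g J x (map ((!) (c # d # is)) [4, 3, 0, 2, 1, 5]))"
    by (rule is_contraction_contract) simp
  from is_contraction_contract[OF this, of 2]
  have 2: "is_contraction natural_cores 2 (\<lambda>g J x is. \<Sum>a\<in>UNIV. \<Sum>b\<in>UNIV. matrix_inv (g x) $ a $ b *
    (\<Sum>c\<in>UNIV. \<Sum>d\<in>UNIV. matrix_inv (g x) $ c $ d *
      DJDJ_t g J x (map ((!) (c # d # a # b # is)) [4, 3, 0, 2, 1, 5])))" (is "is_contraction _ _ ?S2") by simp
  show "is_contraction natural_cores 2 (\<lambda>g J x is. ?S1 g J x is + ?S2 g J x is)"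
    by (rule is_contraction_add[OF 1 2])
  fix U and g J :: "'a mfield" and x i j assume "ah_on U g J" "x \<in> U"
  then interpret ah_field U g J by unfold_locales
  show "lower_endo (g x) (nabla_theta g J x) $ i $ j = ?S1 g J x [i, j] + ?S2 g J x [i, j]"
    by (simp add: nabla_theta_contraction[OF \<open>x \<in> U\<close>])
qed

lemma lie_form_is_contraction:
  "is_contraction natural_cores 2 (\<lambda>g J x is. lie_form (theta_sharp g J) g x $ (is!0) $ (is!1))"
proof (rule is_contraction_2I)
  show "is_contraction natural_cores 2 (\<lambda>g J x is. lower_endo (g x) (nabla_theta g J x) $ (is!0) $ (is!1) +
      lower_endo (g x) (nabla_theta g J x) $ (is!1) $ (is!0))"
    using is_contraction_add[OF nabla_theta_is_contraction is_contraction_swap[OF nabla_theta_is_contraction]]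
    by simp
  fix U and g J :: "'a mfield" and x i j assume "ah_on U g J" "x \<in> U"
  then interpret ah_field U g J by unfold_locales
  show "lie_form (theta_sharp g J) g x $ i $ j = lower_endo (g x) (nabla_theta g J x) $ ([i, j]!0) $ ([i, j]!1) +
      lower_endo (g x) (nabla_theta g J x) $ ([i, j]!1) $ ([i, j]!0)"
    by (simp add: lie_form_contraction[OF \<open>x \<in> U\<close>])
qed

lemma lie_endo_is_contraction:
  "is_contraction natural_cores 2 (\<lambda>g J x is. lower_endo (g x) (lie_endo (theta_sharp g J) J x) $ (is!0) $ (is!1))"
proof (rule is_contraction_2I)
  have "is_contraction natural_cores 6 DJDJ_t"
    by (rule is_contraction_core) (simp add: natural_cores_def)
  then have "is_contraction natural_cores 6 (\<lambda>g J x is. DJDJ_t g J x (map ((!) is) [1, 0, 2, 3, 4, 5]))"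
    by (rule is_contraction_perm) (auto simp: upt_4_6)
  then have "is_contraction natural_cores 6 (\<lambda>g J x is. \<Sum>q\<in>UNIV. J x $ q $ hd is *
      DJDJ_t g J x (map ((!) (q # tl is)) [1, 0, 2, 3, 4, 5]))" (is "is_contraction _ _ ?T")
    by (rule is_contraction_J_hd) simp
  then have "is_contraction natural_cores 6 (\<lambda>g J x is. ?T g J x (map ((!) is) [1, 0, 3, 2, 4, 5]))"
    by (rule is_contraction_perm) (auto simp: upt_4_6)
  then have "is_contraction natural_cores 4 (\<lambda>g J x is. \<Sum>a\<in>UNIV. \<Sum>b\<in>UNIV. matrix_inv (g x) $ a $ b *
      ?T g J x (map ((!) (a # b # is)) [1, 0, 3, 2, 4, 5]))" (is "is_contraction _ _ ?R")
    by (rule is_contraction_contract) simp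
  from is_contraction_contract[OF this, of 2]
  have 1: "is_contraction natural_cores 2 (\<lambda>g J x is. \<Sum>q\<in>UNIV. \<Sum>p\<in>UNIV. matrix_inv (g x) $ q $ p *
      ?R g J x (q # p # is))" (is "is_contraction _ _ ?S1") by simp
  note 2 = is_contraction_J2[OF nabla_theta_is_contraction]
  show "is_contraction natural_cores 2 (\<lambda>g J x is. ?S1 g J x is
    - (\<Sum>q\<in>UNIV. J x $ q $ (is!0) * lower_endo (g x) (nabla_theta g J x) $ ([q, is!1]!0) $ ([q, is!1]!1))
    - (\<Sum>q\<in>UNIV. J x $ q $ (is!1) * lower_endo (g x) (nabla_theta g J x) $ ([is!0, q]!0) $ ([is!0, q]!1)))"
    (is "is_contraction _ _ ?S")
    by (rule is_contraction_diff[OF is_contraction_diff[OF 1 2(1)] 2(2)])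
  fix U and g J :: "'a mfield" and x i j assume "ah_on U g J" "x \<in> U"
  then interpret ah_field U g J by unfold_locales
  show "lower_endo (g x) (lie_endo (theta_sharp g J) J x) $ i $ j = ?S g J x [i, j]"
    by (simp add: lie_endo_contraction[OF \<open>x \<in> U\<close>])
qed

lemma acs_is_contraction:
  "is_contraction natural_cores 2 (\<lambda>g J x is.
    lower_endo (g x) (rough_laplacian g J x + N_endo g J x + R_endo g J x) $ (is!0) $ (is!1))"
proof (rule is_contraction_2I)
  have "is_contraction natural_cores 4 D2J_t"
    by (rule is_contraction_core) (simp add: natural_cores_def)
  from is_contraction_contract[OF this, of 2]
  have 1: "is_contraction natural_cores 2 (\<lambda>g J x is. \<Sum>a\<in>UNIV. \<Sum>b\<in>UNIV. matrix_inv (g x) $ a $ b *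
      D2J_t g J x (a # b # is))" (is "is_contraction _ _ ?S1") by simp
  have "is_contraction natural_cores 6 DJDJ_t"
    by (rule is_contraction_core) (simp add: natural_cores_def)
  then have "is_contraction natural_cores 6 (\<lambda>g J x is. DJDJ_t g J x (map ((!) is) [1, 0, 2, 3, 4, 5]))"
    by (rule is_contraction_perm) (auto simp: upt_4_6)
  then have "is_contraction natural_cores 6 (\<lambda>g J x is. \<Sum>q\<in>UNIV. J x $ q $ hd is *
      DJDJ_t g J x (map ((!) (q # tl is)) [1, 0, 2, 3, 4, 5]))" (is "is_contraction _ _ ?T")
    by (rule is_contraction_J_hd) simp
  \<comment> \<open>Reads c, d, a, b, i, j as i, a, c, b, j, d, with i at the head because J has
    been inserted there.\<close>
  then have "is_contraction natural_cores 6 (\<lambda>g J x is. ?T g J x (map ((!) is) [4, 2, 0, 3, 5, 1]))"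
    by (rule is_contraction_perm) (auto simp: upt_4_6)
  then have "is_contraction natural_cores 4 (\<lambda>g J x is. \<Sum>c\<in>UNIV. \<Sum>d\<in>UNIV. matrix_inv (g x) $ c $ d *
      ?T g J x (map ((!) (c # d # is)) [4, 2, 0, 3, 5, 1]))" (is "is_contraction _ _ ?R")
    by (rule is_contraction_contract) simp
  from is_contraction_contract[OF this, of 2]
  have 2: "is_contraction natural_cores 2 (\<lambda>g J x is. \<Sum>a\<in>UNIV. \<Sum>b\<in>UNIV. matrix_inv (g x) $ a $ b *
      ?R g J x (a # b # is))" (is "is_contraction _ _ ?S2") by simp
  note 3 = is_contraction_J2[OF ricci_is_contraction]
  show "is_contraction natural_cores 2 (\<lambda>g J x is. ?S1 g J x is + ?S2 g J x is
    + ((\<Sum>q\<in>UNIV. J x $ q $ (is!0) * ricci g x $ ([q, is!1]!0) $ ([q, is!1]!1))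
    + (\<Sum>q\<in>UNIV. J x $ q $ (is!1) * ricci g x $ ([is!0, q]!0) $ ([is!0, q]!1))))"
    (is "is_contraction _ _ ?S")
    by (rule is_contraction_add[OF is_contraction_add[OF 1 2] is_contraction_add[OF 3]])
  fix U and g J :: "'a mfield" and x i j assume "ah_on U g J" and x: "x \<in> U"
  then interpret ah_field U g J by unfold_locales
  have L: "lower_endo (g x) (rough_laplacian g J x) $ i $ j = ?S1 g J x [i, j]"
    by (simp add: rough_laplacian_def lower_endo_eq transpose_sum transpose_scalar matrix_sum_left
        matrix_scaleR_left sum_component D2J_t_eq)
  have R: "lower_endo (g x) (R_endo g J x) $ i $ j =
    (\<Sum>q\<in>UNIV. J x $ q $ i * ricci g x $ q $ j) + (\<Sum>q\<in>UNIV. J x $ q $ j * ricci g x $ i $ q)"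
    unfolding R_endo_def lower_raise[OF x]
    by (simp add: bil_mult_left bil_mult_right bil_frame matrix_mult_nth transpose_nth mult.commute)
  have add: "lower_endo (g x) (A + B) = lower_endo (g x) A + lower_endo (g x) B" for A B
    by (simp add: lower_endo_eq transpose_add matrix_add_rdistrib)
  show "lower_endo (g x) (rough_laplacian g J x + N_endo g J x + R_endo g J x) $ i $ j = ?S g J x [i, j]"
    by (simp add: add L R N_contraction[OF x])
qed

section \<open>Second jets at a point where the first derivatives vanish\<close>

text \<open>The first derivative in direction \<open>a\<close> of the Levi-Civita connection matrix
  \<open>i\<close> at a point where the first derivatives of g vanish; \<open>S\<close> stands for
  the second derivatives of g. Its antisymmetrization is then the full curvature.\<close>

definition jet_Gamma :: "real^'n^'n \<Rightarrow> ('n \<Rightarrow> 'n \<Rightarrow> real^'n^'n) \<Rightarrow> 'n::finite \<Rightarrow> 'n \<Rightarrow> real^'n^'n" where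
  "jet_Gamma G S a i = (\<chi> k j. (1/2) * (\<Sum>l\<in>UNIV. matrix_inv G $ k $ l *
     (S a i $ j $ l + S a j $ i $ l - S a l $ i $ j)))"

definition jet_riemann :: "real^'n^'n \<Rightarrow> ('n \<Rightarrow> 'n \<Rightarrow> real^'n^'n) \<Rightarrow> 'n::finite \<Rightarrow> 'n \<Rightarrow> real^'n^'n" where
  "jet_riemann G S i j = jet_Gamma G S i j - jet_Gamma G S j i"

definition jet_D2J :: "real^'n^'n \<Rightarrow> real^'n^'n \<Rightarrow> ('n \<Rightarrow> 'n \<Rightarrow> real^'n^'n) \<Rightarrow>
    ('n \<Rightarrow> 'n \<Rightarrow> real^'n^'n) \<Rightarrow> 'n::finite \<Rightarrow> 'n \<Rightarrow> real^'n^'n" where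
  "jet_D2J G I S V i j = V i j + (jet_Gamma G S i j ** I - I ** jet_Gamma G S i j)"

text \<open>\<open>jet_g\<close> and \<open>jet_J\<close> are the infinitesimal action of a matrix
  on (G, I): the derivative of (Q^T G Q, Q^(-1) I Q) at Q = 1.\<close>

definition jet_g :: "real^'n^'n \<Rightarrow> ('n \<Rightarrow> 'n \<Rightarrow> real^'n^'n) \<Rightarrow> 'n::finite \<Rightarrow> 'n \<Rightarrow> real^'n^'n" where
  "jet_g G M a b = transpose (M a b) ** G + G ** M a b"

definition jet_J :: "real^'n^'n \<Rightarrow> ('n \<Rightarrow> 'n \<Rightarrow> real^'n^'n) \<Rightarrow> 'n::finite \<Rightarrow> 'n \<Rightarrow> real^'n^'n" where
  "jet_J I M a b = I ** M a b - M a b ** I"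

lemma lower_jet_Gamma:
  assumes "linear_ah G I"
  shows "lower_endo G (jet_Gamma G S i j) $ k $ l = (1/2) * (S i j $ k $ l + S i k $ j $ l - S i l $ j $ k)"
proof -
  let ?s = "\<lambda>l. S i j $ k $ l + S i k $ j $ l - S i l $ j $ k"
  have "lower_endo G (jet_Gamma G S i j) $ k $ l =
      (\<Sum>p\<in>UNIV. \<Sum>q\<in>UNIV. (1/2) * (matrix_inv G $ p $ q * ?s q) * G $ p $ l)"
    by (simp add: lower_endo_nth jet_Gamma_def sum_distrib_left sum_distrib_right)
  also have "\<dots> = (\<Sum>q\<in>UNIV. (1/2) * ?s q * (transpose (matrix_inv G) ** G) $ q $ l)"
    unfolding matrix_mult_nth transpose_nth sum_distrib_left
    by (rule trans[OF sum.swap]) (simp add: algebra_simps)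
  also have "\<dots> = (1/2) * ?s l"
    by (simp add: linear_ah_inv_sym[OF assms] linear_ah_inv_left[OF assms] mat_def if_distrib cong: if_cong)
  finally show ?thesis .
qed

lemma lower_endo_inject:
  assumes "linear_ah G I" "lower_endo G A = lower_endo G B"
  shows "A = B"
proof -
  have "transpose A ** G ** matrix_inv G = transpose B ** G ** matrix_inv G"
    using assms(2) by (simp add: lower_endo_eq)
  then show ?thesis by (simp add: matrix_mul_assoc[symmetric] linear_ah_inv_right[OF assms(1)])
qed

context ah_field
begin

context
  fixes x
  assumes x: "x \<in> U" and g0: "\<And>i. pd i g x = 0" and J0: "\<And>i. pd i J x = 0"
begin

abbreviation "S0 \<equiv> \<lambda>a b. pd a (pd b g) x"
abbreviation "V0 \<equiv> \<lambda>a b. pd a (pd b J) x"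

lemma normal_Gamma: "\<Gamma> i x = 0"
  by (simp add: levi_civita_def g0 vec_eq_iff)

lemma normal_pd_Gamma: "pd a (\<Gamma> i) x = jet_Gamma (g x) S0 a i"
proof -
  note d = differentiable_nth2[OF diff_gi[OF x]] differentiable_nth2[OF diff_pd_g[OF x]]
  let ?s = "\<lambda>j l y. pd i g y $ j $ l + pd j g y $ i $ l - pd l g y $ i $ j"
  have ds: "?s j l differentiable at x" for j l
    by (intro differentiable_add differentiable_diff d)
  have ps: "pd a (?s j l) x = S0 a i $ j $ l + S0 a j $ i $ l - S0 a l $ i $ j" for j l
    by (simp add: pd_add pd_diff d differentiable_add pd_nth2[OF diff_pd_g[OF x]])
  have dp: "(\<lambda>y. gi y $ k $ l * ?s j l y) differentiable at x" for k j l
    by (intro differentiable_mult d ds)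
  \<comment> \<open>The derivative of the inverse metric multiplies a combination of first
    derivatives of g, which is 0 at x.\<close>
  have pp: "pd a (\<lambda>y. gi y $ k $ l * ?s j l y) x = gi x $ k $ l * pd a (?s j l) x" for k j l
    by (subst pd_bounded_bilinear[OF d(1) ds bounded_bilinear_mult]) (simp add: g0)
  have "pd a (\<Gamma> i) x $ k $ j = pd a (\<lambda>y. (1/2) * (\<Sum>l\<in>UNIV. gi y $ k $ l * ?s j l y)) x" for k j
    by (subst pd_nth2[OF diff_Gamma[OF x], symmetric]) (simp add: levi_civita_def)
  also have "pd a (\<lambda>y. (1/2) * (\<Sum>l\<in>UNIV. gi y $ k $ l * ?s j l y)) x =
      (1/2) * (\<Sum>l\<in>UNIV. gi x $ k $ l * pd a (?s j l) x)" for k j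
    by (subst pd_bounded_linear[OF _ bounded_linear_mult_right])
       (simp_all add: differentiable_sum dp pd_sum pp)
  finally show ?thesis by (simp add: vec_eq_iff jet_Gamma_def ps)
qed

lemma normal_DJ: "DJ g J i x = 0"
  by (simp add: DJ_def cov_endo_def normal_Gamma J0)

lemma normal_pd_DJ: "pd i (DJ g J j) x = jet_D2J (g x) (J x) S0 V0 i j"
  by (simp add: pd_DJ[OF x] J0 normal_Gamma normal_pd_Gamma jet_D2J_def)

lemma normal_D2J: "D2J g J i j x = jet_D2J (g x) (J x) S0 V0 i j"
  by (simp add: D2J_def cov_endo_def normal_Gamma normal_DJ normal_pd_DJ)

lemma normal_riemann: "riemann g i j x = jet_riemann (g x) S0 i j"
  by (simp add: riemann_def normal_Gamma normal_pd_Gamma jet_riemann_def)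

lemma normal_lie_form: "lie_form X g x = transpose (jacobian X (at x)) ** g x + g x ** jacobian X (at x)"
  by (simp add: lie_form_def frechet_derivative_eq_pd[OF diff_g[OF x]] g0)

lemma normal_lie_endo: "lie_endo X J x = J x ** jacobian X (at x) - jacobian X (at x) ** J x"
  by (simp add: lie_endo_def frechet_derivative_eq_pd[OF diff_J[OF x]] J0)

end

end

section \<open>Model structures\<close>

text \<open>Every second jet with vanishing first derivatives is a combination of those of the structures
  pulled back by the frame change Q = 1 + t m with t = (\<xi> \<bullet> x)^2 / 2, where m is nilpotent of order 2
  or the identity.  The choice of such m keeps the structure polynomial in \<xi> \<bullet> x.\<close>

definition ridge_poly :: "real^'n \<Rightarrow> nat \<Rightarrow> (nat \<Rightarrow> 'b::real_normed_vector) \<Rightarrow> real^'n \<Rightarrow> 'b" where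
  "ridge_poly \<xi> n c x = (\<Sum>k\<le>n. (\<xi> \<bullet> x) ^ k *\<^sub>R c k)"

lemma ridge_poly_has_derivative:
  "(ridge_poly \<xi> n c has_derivative (\<lambda>v. \<Sum>k\<le>n. (real k * (\<xi> \<bullet> x) ^ (k - 1) * (\<xi> \<bullet> v)) *\<^sub>R c k)) (at x)"
  unfolding ridge_poly_def
  by (auto intro!: derivative_eq_intros sum.cong simp: fun_eq_iff algebra_simps)

lemma pd_ridge_poly:
  "pd i (ridge_poly \<xi> n c) = ridge_poly \<xi> n (\<lambda>k. if k < n then (real (Suc k) * \<xi> $ i) *\<^sub>R c (Suc k) else 0)"
proof
  fix x
  have "pd i (ridge_poly \<xi> n c) x = (\<Sum>k\<le>n. (real k * (\<xi> \<bullet> x) ^ (k - 1) * \<xi> $ i) *\<^sub>R c k)"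
    using pd_eqI[OF ridge_poly_has_derivative, of i \<xi> n c x] by (simp add: inner_axis)
  also have "\<dots> = (\<Sum>k<n. (real (Suc k) * (\<xi> \<bullet> x) ^ k * \<xi> $ i) *\<^sub>R c (Suc k))"
    by (subst sum.atMost_shift) simp
  also have "\<dots> = ridge_poly \<xi> n (\<lambda>k. if k < n then (real (Suc k) * \<xi> $ i) *\<^sub>R c (Suc k) else 0) x"
    unfolding ridge_poly_def lessThan_Suc_atMost[symmetric] by (simp add: algebra_simps)
  finally show "pd i (ridge_poly \<xi> n c) x =
      ridge_poly \<xi> n (\<lambda>k. if k < n then (real (Suc k) * \<xi> $ i) *\<^sub>R c (Suc k) else 0) x" .
qed

lemma smooth_on_ridge_poly:
  "smooth_on U (ridge_poly \<xi> n (c :: nat \<Rightarrow> 'b::real_normed_vector))"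
proof -
  have "\<exists>c'. foldr pd is (ridge_poly \<xi> n c) = ridge_poly \<xi> n c'" for "is"
  proof (induction "is")
    case (Cons a js)
    then obtain c' where "foldr pd js (ridge_poly \<xi> n c) = ridge_poly \<xi> n c'" by blast
    then show ?case using pd_ridge_poly[of a \<xi> n c'] by auto
  qed auto
  moreover have "ridge_poly \<xi> n c' differentiable_on U" for c' :: "nat \<Rightarrow> 'b"
    unfolding differentiable_on_def differentiable_def
    using ridge_poly_has_derivative has_derivative_at_withinI by blast
  ultimately show ?thesis unfolding smooth_on_def by metis
qed

lemma ridge_poly_0: "ridge_poly \<xi> n c 0 = c 0"
  by (simp add: ridge_poly_def power_0_left if_distrib if_distribR cong: if_cong)

text \<open>Q^T G Q for Q = 1 + t m and t = s^2 / 2 with s = \<open>\<xi> \<bullet> x\<close>,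
  expanded in powers of s; hence the coefficients 1/2 and 1/4.\<close>

definition model_g :: "real^'n^'n \<Rightarrow> real^'n \<Rightarrow> real^'n^'n \<Rightarrow> real^'n \<Rightarrow> real^'n^'n" where
  "model_g G \<xi> m = ridge_poly \<xi> 4 (\<lambda>k. if k = 0 then G else if k = 2 then (1/2) *\<^sub>R (transpose m ** G + G ** m)
     else if k = 4 then (1/4) *\<^sub>R (transpose m ** G ** m) else 0)"

text \<open>Q^(-1) I Q in the cases where it is quadratic in t; \<open>N\<close> is the coefficient
  of t^2.\<close>

definition model_J :: "real^'n^'n \<Rightarrow> real^'n \<Rightarrow> real^'n^'n \<Rightarrow> real^'n^'n \<Rightarrow> real^'n \<Rightarrow> real^'n^'n" where
  "model_J I \<xi> m N = ridge_poly \<xi> 4 (\<lambda>k. if k = 0 then I else if k = 2 then (1/2) *\<^sub>R (I ** m - m ** I)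
     else if k = 4 then (1/4) *\<^sub>R N else 0)"

text \<open>The condition is multiplied through by Q to avoid its inverse. Only t \<ge> 0 is asked
  for, since t is half a square; for m = 1 the matrix Q degenerates at t = -1.\<close>

definition admissible :: "real^'n^'n \<Rightarrow> real^'n^'n \<Rightarrow> real^'n^'n \<Rightarrow> bool" where
  "admissible I m N \<longleftrightarrow> (\<forall>t\<ge>0. invertible (mat 1 + t *\<^sub>R m) \<and>
     (mat 1 + t *\<^sub>R m) ** (I + t *\<^sub>R (I ** m - m ** I) + t\<^sup>2 *\<^sub>R N) = I ** (mat 1 + t *\<^sub>R m))"

text \<open>Here Q^(-1) = 1 - t m, so Q^(-1) I Q stops at the quadratic term - m I m.\<close>

lemma admissible_nilpotent:
  assumes "m ** m = 0" shows "admissible I m (- (m ** I ** m))"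
  unfolding admissible_def
proof (intro allI impI conjI)
  fix t :: real
  have "(mat 1 + t *\<^sub>R m) ** (mat 1 - t *\<^sub>R m) = mat 1"
    by (simp add: matrix_ring assms)
  then show "invertible (mat 1 + t *\<^sub>R m)" by (metis invertible_right_inverse)
  have mm: "m ** m ** A = 0" for A by (simp add: assms)
  show "(mat 1 + t *\<^sub>R m) ** (I + t *\<^sub>R (I ** m - m ** I) + t\<^sup>2 *\<^sub>R - (m ** I ** m)) = I ** (mat 1 + t *\<^sub>R m)"
    by (simp add: matrix_ring mm scaleR_diff_right scaleR_add_right power2_eq_square)
qed

text \<open>A conformal change of the metric that leaves J constant. It is needed because nilpotent
  matrices span only the trace-free ones.\<close>

lemma admissible_identity: "admissible I (mat 1) 0"
  unfolding admissible_def
proof (intro allI impI conjI)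
  fix t :: real assume "t \<ge> 0"
  moreover have "mat 1 + t *\<^sub>R mat 1 = (1 + t) *\<^sub>R (mat 1 :: real^'a^'a)"
    by (simp add: scaleR_add_left)
  ultimately have "(mat 1 + t *\<^sub>R mat 1) ** ((1 / (1 + t)) *\<^sub>R mat 1) = (mat 1 :: real^'a^'a)"
    by (simp add: matrix_scaleR_left)
  then show "invertible (mat 1 + t *\<^sub>R mat 1 :: real^'a^'a)" by (metis invertible_right_inverse)
  show "(mat 1 + t *\<^sub>R mat 1) ** (I + t *\<^sub>R (I ** mat 1 - mat 1 ** I) + t\<^sup>2 *\<^sub>R 0) = I ** (mat 1 + t *\<^sub>R mat 1)"
    by (simp add: matrix_ring)
qed

lemma admissible_zero: "admissible I 0 0"
  using admissible_nilpotent[of 0 I] by simp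

lemma admissible_uminus:
  assumes "admissible I m N" shows "admissible (- I) m (- N)"
proof -
  have "- I + t *\<^sub>R (- I ** m - m ** - I) + t\<^sup>2 *\<^sub>R - N = - (I + t *\<^sub>R (I ** m - m ** I) + t\<^sup>2 *\<^sub>R N)" for t
    by (simp add: matrix_ring scaleR_add_right scaleR_diff_right)
  then show ?thesis
    using assms unfolding admissible_def by (simp only: matrix_neg_left matrix_neg_right) auto
qed

lemma model_J_uminus: "model_J (- I) \<xi> m (- N) = (\<lambda>x. - model_J I \<xi> m N x)"
proof -
  have "(if k = 0 then - I else if k = 2 then (1/2) *\<^sub>R (- I ** m - m ** - I)
     else if k = 4 then (1/4) *\<^sub>R - N else 0) = - (if k = 0 then I else if k = 2 then (1/2) *\<^sub>R (I ** m - m ** I)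
     else if k = 4 then (1/4) *\<^sub>R N else 0)" for k :: nat
    by (simp add: matrix_ring scaleR_diff_right)
  then show ?thesis
    unfolding model_J_def ridge_poly_def by (simp only: scaleR_minus_right sum_negf)
qed

text \<open>At each point the pair is (G, I) transported by the invertible Q; conjugation preserves
  all four algebraic conditions.\<close>

lemma model_ah:
  assumes ah: "linear_ah G I" and ad: "admissible I m N"
  shows "ah_on UNIV (model_g G \<xi> m) (model_J I \<xi> m N)"
  unfolding ah_on_def
proof (intro conjI ballI)
  show "smooth_on UNIV (model_g G \<xi> m)" "smooth_on UNIV (model_J I \<xi> m N)"
    unfolding model_g_def model_J_def by (rule smooth_on_ridge_poly)+
  fix x :: "real^'a"
  define t where "t = (\<xi> \<bullet> x)\<^sup>2 / 2"
  define Q where "Q = mat 1 + t *\<^sub>R m"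
  have t: "t \<ge> 0" by (simp add: t_def)
  have s4: "(\<Sum>k\<le>4. f k) = f 0 + f 1 + f 2 + f 3 + f (4::nat)" for f :: "nat \<Rightarrow> real^'a^'a"
    by (simp add: eval_nat_numeral)
  have g: "model_g G \<xi> m x = transpose Q ** G ** Q"
    by (simp add: model_g_def ridge_poly_def s4 Q_def transpose_ring matrix_ring t_def scaleR_add_right
        power2_eq_square power4_eq_xxxx)
  have J: "model_J I \<xi> m N x = I + t *\<^sub>R (I ** m - m ** I) + t\<^sup>2 *\<^sub>R N"
    by (simp add: model_J_def ridge_poly_def s4 t_def power2_eq_square power4_eq_xxxx)
  have inv: "invertible Q" and QJ: "Q ** model_J I \<xi> m N x = I ** Q"
    using ad t unfolding admissible_def J Q_def by auto
  obtain P where P: "P ** Q = mat 1" using inv by (auto simp: invertible_def)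
  have cancel: "A = B" if "Q ** A = Q ** B" for A B :: "real^'a^'a"
    by (metis P matrix_mul_assoc matrix_mul_lid that)
  show "linear_ah (model_g G \<xi> m x) (model_J I \<xi> m N x)"
  proof (rule linear_ahI)
    show "transpose (model_g G \<xi> m x) = model_g G \<xi> m x"
      unfolding g by (simp add: transpose_ring linear_ah_sym[OF ah] matrix_mul_assoc)
    fix u :: "real^'a" assume "u \<noteq> 0"
    then have "Q *v u \<noteq> 0"
      by (metis P matrix_vector_mul_assoc matrix_vector_mul_lid matrix_vector_mult_0_right)
    then show "bil (model_g G \<xi> m x) u u > 0"
      unfolding g bil_mult[symmetric] by (rule linear_ah_pos[OF ah])
  next
    show "model_J I \<xi> m N x ** model_J I \<xi> m N x = - mat 1"
    proof (rule cancel)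
      have "Q ** (model_J I \<xi> m N x ** model_J I \<xi> m N x) = (I ** Q) ** model_J I \<xi> m N x"
        by (simp only: matrix_mul_assoc QJ)
      also have "\<dots> = I ** (Q ** model_J I \<xi> m N x)" by (rule matrix_mul_assoc[symmetric])
      also have "\<dots> = I ** I ** Q" by (simp only: QJ) (simp only: matrix_mul_assoc)
      finally show "Q ** (model_J I \<xi> m N x ** model_J I \<xi> m N x) = Q ** (- mat 1)"
        by (simp add: linear_ah_square[OF ah] matrix_neg_left matrix_neg_right)
    qed
    have "transpose (model_J I \<xi> m N x) ** (transpose Q ** G ** Q) ** model_J I \<xi> m N x =
        transpose (Q ** model_J I \<xi> m N x) ** G ** (Q ** model_J I \<xi> m N x)"
      by (simp add: transpose_ring matrix_mul_assoc)
    also have "\<dots> = transpose Q ** (transpose I ** G ** I) ** Q"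
      by (simp add: QJ transpose_ring matrix_mul_assoc)
    finally show "transpose (model_J I \<xi> m N x) ** model_g G \<xi> m x ** model_J I \<xi> m N x = model_g G \<xi> m x"
      unfolding g by (simp add: linear_ah_compat[OF ah])
  qed
qed simp

text \<open>t vanishes to first order at 0 and has second derivatives xi_a xi_b, so only the term
  linear in t is seen by the second jet: \<open>N\<close> does not enter.\<close>

lemma model_jets:
  "model_g G \<xi> m 0 = G" "model_J I \<xi> m N 0 = I"
  "pd i (model_g G \<xi> m) 0 = 0" "pd i (model_J I \<xi> m N) 0 = 0"
  "pd a (pd b (model_g G \<xi> m)) 0 = jet_g G (\<lambda>a b. (\<xi> $ a * \<xi> $ b) *\<^sub>R m) a b"
  "pd a (pd b (model_J I \<xi> m N)) 0 = jet_J I (\<lambda>a b. (\<xi> $ a * \<xi> $ b) *\<^sub>R m) a b"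
  unfolding model_g_def model_J_def pd_ridge_poly ridge_poly_0 jet_g_def jet_J_def
  by (simp_all add: numeral_2_eq_2[symmetric] transpose_ring matrix_ring scaleR_add_right scaleR_diff_right algebra_simps)

text \<open>Matrices of square 0 and the identity span all matrices.\<close>

lemma linear_vanishes_matrix:
  assumes f: "linear (f :: real^'n^'n \<Rightarrow> real)"
    and nil: "\<And>m. m ** m = 0 \<Longrightarrow> f m = 0" and one: "f (mat 1) = 0"
  shows "f m = 0"
proof -
  define E where "E i j = (\<chi> a b. if a = i \<and> b = j then 1 else 0 :: real^'n^'n)" for i j :: 'n
  have E: "E i j ** E k l = (if j = k then E i l else 0)" for i j k l
  proof -
    have "E i j $ a $ q * E k l $ q $ b = (if q = j then if j = k \<and> a = i \<and> b = l then 1 else 0 else 0)" for a b q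
      by (simp add: E_def)
    then have "(E i j ** E k l) $ a $ b = (if j = k \<and> a = i \<and> b = l then 1 else 0)" for a b
      by (simp add: matrix_mult_nth)
    then show ?thesis by (simp add: vec_eq_iff E_def)
  qed
  have off: "f (E i j) = 0" if "i \<noteq> j" for i j by (rule nil) (use that in \<open>auto simp: E\<close>)
  have diag: "f (E i i) = f (E j j)" for i j
  proof (cases "i = j")
    case False
    \<comment> \<open>The block with rows (1, -1) and (1, -1) has square 0. It makes the diagonal
      units indistinguishable for \<open>f\<close>, after which the identity forces their common
      value to be 0.\<close>
    have "f (E i i - E i j + E j i - E j j) = 0"
      by (rule nil) (use False in \<open>auto simp: matrix_ring E\<close>)
    then show ?thesis using False by (simp add: linear_add[OF f] linear_diff[OF f] off)
  qed simp
  have 1: "mat 1 = (\<Sum>i\<in>UNIV. E i i)"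
  proof -
    have "E i i $ a $ b = (if i = a then if a = b then 1 else 0 else 0)" for i a b
      by (simp add: E_def)
    then show ?thesis by (simp add: vec_eq_iff mat_def sum_component)
  qed
  have "(\<Sum>j\<in>(UNIV::'n set). f (E j j)) = 0" using one by (simp add: 1 linear_sum[OF f])
  moreover have "(\<Sum>j\<in>(UNIV::'n set). f (E j j)) = (\<Sum>j\<in>(UNIV::'n set). f (E i i))" for i
    by (intro sum.cong refl) (rule diag)
  ultimately have "real CARD('n) * f (E i i) = 0" for i by simp
  then have dz: "f (E i i) = 0" for i by simp
  have "m = (\<Sum>i\<in>UNIV. \<Sum>j\<in>UNIV. m $ i $ j *\<^sub>R E i j)"
  proof -
    have "(\<Sum>i\<in>UNIV. \<Sum>j\<in>UNIV. (m $ i $ j *\<^sub>R E i j) $ a $ b) = m $ a $ b" for a b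
    proof -
      have "(m $ i $ j *\<^sub>R E i j) $ a $ b = (if j = b then if i = a then m $ i $ j else 0 else 0)" for i j
        by (auto simp: E_def)
      then show ?thesis by simp
    qed
    then show ?thesis by (simp add: vec_eq_iff sum_component)
  qed
  from arg_cong[OF this, of f]
  have "f m = (\<Sum>i\<in>UNIV. \<Sum>j\<in>UNIV. m $ i $ j * f (E i j))"
    by (simp only: linear_sum[OF f] linear_cmul[OF f] real_scaleR_def)
  also have "\<dots> = 0"
  proof (intro sum.neutral ballI)
    fix i j show "m $ i $ j * f (E i j) = 0" by (cases "i = j") (simp_all add: off dz)
  qed
  finally show ?thesis .
qed

section \<open>Realizing algebraic curvature data\<close>

text \<open>First a metric with curvature \<open>R\<close> is written down as in normal coordinates.
  What remains of \<open>D\<close> after subtracting the part caused by the connection is symmetric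
  in i, j, skew, and anticommutes with I; such endomorphisms are commutators of I with skew ones,
  which do not disturb the metric.\<close>

lemma jet_surjective:
  fixes R D :: "'n::finite \<Rightarrow> 'n \<Rightarrow> real^'n^'n"
  assumes ah: "linear_ah G I"
    and R: "\<And>i j. R i j = - R j i" "\<And>i j. transpose (R i j) ** G = - (G ** R i j)"
      "\<And>i j k l. R i j $ l $ k + R j k $ l $ i + R k i $ l $ j = 0"
    and D: "\<And>i j. transpose (D i j) ** G = - (G ** D i j)" "\<And>i j. D i j ** I = - (I ** D i j)"
      "\<And>i j. D i j - D j i = R i j ** I - I ** R i j"
  obtains M where "\<And>a b. M a b = M b a" "jet_riemann G (jet_g G M) = R"
    "jet_D2J G I (jet_g G M) (jet_J I M) = D"
proof -
  let ?T = transpose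
  define \<rho> where "\<rho> i j k l = lower_endo G (R i j) $ k $ l" for i j k l
  have r1: "\<rho> i j k l = - \<rho> j i k l" for i j k l
  proof -
    have "lower_endo G (R i j) = - lower_endo G (R j i)"
      using R(1)[of i j] by (simp add: lower_endo_eq transpose_minus matrix_neg_left)
    then show ?thesis by (simp add: \<rho>_def)
  qed
  have r2: "\<rho> i j k l = - \<rho> i j l k" for i j k l
  proof -
    have "?T (lower_endo G (R i j)) = - lower_endo G (R i j)"
      by (simp add: lower_endo_eq transpose_ring linear_ah_sym[OF ah] R(2))
    then show ?thesis unfolding \<rho>_def by (metis transpose_nth vector_uminus_component)
  qed
  have r3: "\<rho> i j k l + \<rho> j k i l + \<rho> k i j l = 0" for i j k l
  proof -
    have "\<rho> i j k l + \<rho> j k i l + \<rho> k i j l =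
      (\<Sum>p\<in>UNIV. (R i j $ p $ k + R j k $ p $ i + R k i $ p $ j) * G $ p $ l)"
      by (simp add: \<rho>_def lower_endo_nth sum.distrib distrib_right)
    then show ?thesis by (simp add: R(3))
  qed
  \<comment> \<open>Pair symmetry, from four instances of the Bianchi identity and the two
    antisymmetries.\<close>
  have pair: "\<rho> i j k l = \<rho> k l i j" for i j k l
    using r3[of i j k l] r3[of j k l i] r3[of k l i j] r3[of l i j k]
      r1[of i j k l] r1[of j k i l] r1[of k i j l] r1[of j k l i] r1[of k l j i] r1[of l j k i]
      r1[of k l i j] r1[of l i k j] r1[of i k l j] r1[of l i j k] r1[of i j l k] r1[of j l i k]
      r2[of i j k l] r2[of j k i l] r2[of k i j l] r2[of j l i k] r2[of l i j k] r2[of k l i j]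
      r2[of l j k i] r2[of i k l j] r2[of l i k j] r2[of j k l i] r2[of k l j i]
    by linarith
  \<comment> \<open>The second derivatives of the metric in normal coordinates with curvature
    \<open>\<rho>\<close>.\<close>
  define S where "S a b = (\<chi> k l. (1/3) * (\<rho> a k b l + \<rho> b k a l))" for a b
  have S_sym: "S a b = S b a" for a b by (simp add: S_def add.commute)
  have S_T: "?T (S a b) = S a b" for a b
    by (simp add: vec_eq_iff transpose_nth S_def) (metis add.commute pair)
  let ?C = "\<lambda>i j. jet_Gamma G S i j"
  have RS: "jet_riemann G S i j = R i j" for i j
  proof (rule lower_endo_inject[OF ah])
    have "lower_endo G (jet_riemann G S i j) $ k $ l = \<rho> i j k l" for k l
    proof -
      have e: "lower_endo G (jet_riemann G S i j) = lower_endo G (?C i j) - lower_endo G (?C j i)"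
        by (simp add: jet_riemann_def lower_endo_eq transpose_ring matrix_ring)
      have "lower_endo G (jet_riemann G S i j) $ k $ l = (1/2) * (S i k $ j $ l - S i l $ j $ k
          - S j k $ i $ l + S j l $ i $ k)"
        unfolding e vector_minus_component by (simp add: lower_jet_Gamma[OF ah] S_sym[of j i] field_simps)
      also have "\<dots> = \<rho> i j k l"
      proof -
        have sv: "S a b $ k $ l = (1/3) * (\<rho> a k b l + \<rho> b k a l)" for a b k l by (simp add: S_def)
        have "\<rho> i j k l + \<rho> k j i l - (\<rho> i j l k + \<rho> l j i k) - (\<rho> j i k l + \<rho> k i j l)
            + (\<rho> j i l k + \<rho> l i j k) = 6 * \<rho> i j k l"
          using r3[of k j i l] r1[of i k j l] r1[of j i k l] r3[of l j i k] r1[of i l j k]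
            r1[of j i l k] r2[of i j k l] by linarith
        then show ?thesis unfolding sv by (simp add: field_simps)
      qed
      finally show ?thesis .
    qed
    then show "lower_endo G (jet_riemann G S i j) = lower_endo G (R i j)"
      by (simp add: vec_eq_iff \<rho>_def)
  qed
  \<comment> \<open>The skew part of the derivative of the connection; the removed symmetric part is
    what \<open>jet_J\<close> contributes through the metric half of \<open>M\<close>.\<close>
  define Z where "Z i j = ?C i j - (1/2) *\<^sub>R (matrix_inv G ** S i j)" for i j
  have Z: "?T (Z i j) ** G = - (G ** Z i j)" for i j
  proof -
    have e: "lower_endo G (Z i j) = lower_endo G (?C i j) - (1/2) *\<^sub>R S i j"
      by (simp add: Z_def lower_endo_eq transpose_ring matrix_ring linear_ah_inv_sym[OF ah] S_T)
         (simp add: matrix_mul_assoc[symmetric] linear_ah_inv_left[OF ah])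
    have e2: "lower_endo G (Z i j) $ k $ l = (1/2) * (S i k $ j $ l - S i l $ j $ k)" for k l
      unfolding e vector_minus_component by (simp add: lower_jet_Gamma[OF ah] field_simps)
    have "?T (lower_endo G (Z i j)) = - lower_endo G (Z i j)"
      unfolding vec_eq_iff transpose_nth vector_uminus_component e2 by (simp add: field_simps)
    then show ?thesis by (simp add: lower_endo_eq transpose_ring linear_ah_sym[OF ah])
  qed
  \<comment> \<open>Symmetric in i, j because the antisymmetric part of \<open>D\<close> is exactly
    the commutator with the curvature.\<close>
  define W where "W i j = D i j - (Z i j ** I - I ** Z i j)" for i j
  have II: "A ** I ** I = - A" "I ** I = - mat 1" for A :: "real^'n^'n"
    by (simp_all add: matrix_mul_assoc[symmetric] linear_ah_square[OF ah] matrix_neg_right)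
  have WI: "W i j ** I = - (I ** W i j)" for i j
    by (simp add: W_def matrix_ring II D(2))
  have W_sym: "W i j = W j i" for i j
  proof -
    have z: "Z i j - Z j i = R i j"
      using RS[of i j] by (simp add: Z_def jet_riemann_def S_sym[of j i])
    have "W i j - W j i = (D i j - D j i) - ((Z i j - Z j i) ** I - I ** (Z i j - Z j i))"
      by (simp add: W_def matrix_ring)
    also have "\<dots> = 0" unfolding D(3) z by simp
    finally show ?thesis by simp
  qed
  have W_skew: "?T (W i j) ** G = - (G ** W i j)" for i j
  proof -
    have 1: "?T I ** ?T (Z i j) ** G = G ** I ** Z i j"
      by (simp add: matrix_mul_assoc[symmetric] Z matrix_neg_right)
         (simp add: matrix_mul_assoc linear_ah_skew[OF ah] matrix_neg_left)
    have 2: "?T (Z i j) ** ?T I ** G = G ** Z i j ** I"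
      by (simp add: matrix_mul_assoc[symmetric] linear_ah_skew[OF ah] matrix_neg_right)
         (simp add: matrix_mul_assoc Z matrix_neg_left)
    show ?thesis by (simp add: W_def transpose_ring matrix_ring 1 2 D(1))
  qed
  \<comment> \<open>Solves [I, B] = W: for W anticommuting with I, [I, I W] = -2 W.\<close>
  define B where "B i j = - (1/2) *\<^sub>R (I ** W i j)" for i j
  have B_skew: "?T (B i j) ** G = - (G ** B i j)" for i j
  proof -
    have "?T (W i j) ** ?T I ** G = G ** W i j ** I"
      by (simp add: matrix_mul_assoc[symmetric] linear_ah_skew[OF ah] matrix_neg_right)
         (simp add: matrix_mul_assoc W_skew matrix_neg_left)
    also have "\<dots> = - (G ** I ** W i j)"
      by (simp add: matrix_mul_assoc[symmetric] WI matrix_neg_right)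
    finally show ?thesis by (simp add: B_def transpose_ring matrix_ring)
  qed
  have BI: "I ** B i j - B i j ** I = W i j" for i j
  proof -
    have "I ** W i j ** I = W i j"
      by (simp add: matrix_mul_assoc[symmetric] WI matrix_neg_right) (simp add: matrix_mul_assoc II matrix_neg_left)
    then show ?thesis by (simp add: B_def matrix_ring II)
  qed
  define M where "M i j = (1/2) *\<^sub>R (matrix_inv G ** S i j) + B i j" for i j
  have jg: "jet_g G M = S"
  proof (intro ext)
    fix a b
    have "jet_g G M a b = (1/2) *\<^sub>R (S a b ** (matrix_inv G ** G)) + (1/2) *\<^sub>R (G ** matrix_inv G ** S a b)
        + (?T (B a b) ** G + G ** B a b)"
      by (simp add: jet_g_def M_def transpose_ring matrix_ring linear_ah_inv_sym[OF ah] S_T)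
    then show "jet_g G M a b = S a b"
      by (simp add: linear_ah_inv_left[OF ah] linear_ah_inv_right[OF ah] B_skew scaleR_2[symmetric])
  qed
  show thesis
  proof (rule that[of M])
    show "M a b = M b a" for a b
      by (simp add: M_def B_def S_sym[of a b] W_sym[of a b])
    show "jet_riemann G (jet_g G M) = R" unfolding jg by (intro ext RS)
    show "jet_D2J G I (jet_g G M) (jet_J I M) = D" unfolding jg
    proof (intro ext)
      fix i j
      have "jet_D2J G I S (jet_J I M) i j = (I ** B i j - B i j ** I) + (Z i j ** I - I ** Z i j)"
        by (simp add: jet_D2J_def jet_J_def M_def Z_def matrix_ring)
      then show "jet_D2J G I S (jet_J I M) i j = D i j" by (simp add: BI W_def)
    qed
  qed
qed

section \<open>Linear dependence on the second jet\<close>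

abbreviation ridge_family :: "real^'n \<Rightarrow> real^'n^'n \<Rightarrow> 'n::finite \<Rightarrow> 'n \<Rightarrow> real^'n^'n" where
  "ridge_family \<xi> m \<equiv> (\<lambda>a b. (\<xi> $ a * \<xi> $ b) *\<^sub>R m)"

text \<open>All indices from 3 on stand for the scalar core 1, so that a family indexed by all
  numbers has exactly the four natural cores as its range.\<close>

definition natural_rank :: "nat \<Rightarrow> nat" where
  "natural_rank i = (if i = 0 \<or> i = 1 then 4 else if i = 2 then 6 else 0)"

definition natural_core :: "nat \<Rightarrow> 'n::finite top" where
  "natural_core i = (if i = 0 then Rm_t else if i = 1 then D2J_t else if i = 2 then DJDJ_t
     else (\<lambda>g J x is. 1))"

lemma natural_cores_range: "natural_cores = range (\<lambda>i. (natural_rank i, natural_core i))"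
proof
  show "natural_cores \<subseteq> range (\<lambda>i. (natural_rank i, natural_core i))"
  proof
    fix p assume "p \<in> natural_cores"
    then consider "p = (4, Rm_t)" | "p = (4, D2J_t)" | "p = (6, DJDJ_t)" | "p = (0, \<lambda>g J x is. 1)"
      by (auto simp: natural_cores_def)
    then show "p \<in> range (\<lambda>i. (natural_rank i, natural_core i))"
    proof cases
      case 1 then show ?thesis by (intro range_eqI[of _ _ 0]) (simp add: natural_rank_def natural_core_def)
    next
      case 2 then show ?thesis by (intro range_eqI[of _ _ 1]) (simp add: natural_rank_def natural_core_def)
    next
      case 3 then show ?thesis by (intro range_eqI[of _ _ 2]) (simp add: natural_rank_def natural_core_def)
    next
      case 4 then show ?thesis by (intro range_eqI[of _ _ 3]) (simp add: natural_rank_def natural_core_def)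
    qed
  qed
  have "(natural_rank i, natural_core i) \<in> natural_cores" for i
    by (cases "i = 0"; cases "i = 1"; cases "i = 2")
       (simp_all add: natural_cores_def natural_rank_def natural_core_def)
  then show "range (\<lambda>i. (natural_rank i, natural_core i)) \<subseteq> natural_cores" by blast
qed

definition curvature_core :: "real^'n^'n \<Rightarrow> ('n \<Rightarrow> 'n \<Rightarrow> real^'n^'n) \<Rightarrow> ('n \<Rightarrow> 'n \<Rightarrow> real^'n^'n) \<Rightarrow>
    nat \<Rightarrow> 'n::finite list \<Rightarrow> real" where
  "curvature_core G R D i js = (if i = 0 then lower_endo G (R (js!0) (js!1)) $ (js!2) $ (js!3)
     else if i = 1 then lower_endo G (D (js!0) (js!1)) $ (js!2) $ (js!3) else 0)"

abbreviation scalar_core :: "nat \<Rightarrow> 'n list \<Rightarrow> real" where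
  "scalar_core \<equiv> (\<lambda>i js. if natural_rank i = 0 then 1 else 0)"

abbreviation curv :: "real^'n^'n \<Rightarrow> ('n \<Rightarrow> 'n \<Rightarrow> real^'n^'n) \<Rightarrow> 'n::finite \<Rightarrow> 'n \<Rightarrow> real^'n^'n" where
  "curv G M \<equiv> jet_riemann G (jet_g G M)"

abbreviation hess :: "real^'n^'n \<Rightarrow> real^'n^'n \<Rightarrow> ('n \<Rightarrow> 'n \<Rightarrow> real^'n^'n) \<Rightarrow> 'n::finite \<Rightarrow> 'n \<Rightarrow> real^'n^'n" where
  "hess G I M \<equiv> jet_D2J G I (jet_g G M) (jet_J I M)"

abbreviation jet_core where
  "jet_core G I M \<equiv> curvature_core G (curv G M) (hess G I M)"

lemma lower_endo_linear:
  "lower_endo G (x *\<^sub>R A + y *\<^sub>R B) = x *\<^sub>R lower_endo G A + y *\<^sub>R lower_endo G B"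
  by (simp add: lower_endo_eq transpose_ring matrix_ring)

lemma jet_linear:
  fixes M M' :: "'n::finite \<Rightarrow> 'n \<Rightarrow> real^'n^'n"
  shows jet_g_linear: "jet_g G (\<lambda>a b. x *\<^sub>R M a b + y *\<^sub>R M' a b) a b = x *\<^sub>R jet_g G M a b + y *\<^sub>R jet_g G M' a b"
    and jet_J_linear: "jet_J I (\<lambda>a b. x *\<^sub>R M a b + y *\<^sub>R M' a b) a b = x *\<^sub>R jet_J I M a b + y *\<^sub>R jet_J I M' a b"
    and curv_linear: "curv G (\<lambda>a b. x *\<^sub>R M a b + y *\<^sub>R M' a b) a b = x *\<^sub>R curv G M a b + y *\<^sub>R curv G M' a b"
    and hess_linear: "hess G I (\<lambda>a b. x *\<^sub>R M a b + y *\<^sub>R M' a b) a b = x *\<^sub>R hess G I M a b + y *\<^sub>R hess G I M' a b"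
proof -
  let ?L = "\<lambda>a b. x *\<^sub>R M a b + y *\<^sub>R M' a b"
  show g: "jet_g G ?L a b = x *\<^sub>R jet_g G M a b + y *\<^sub>R jet_g G M' a b" for a b
    by (simp add: jet_g_def transpose_ring matrix_ring scaleR_add_right)
  show J: "jet_J I ?L a b = x *\<^sub>R jet_J I M a b + y *\<^sub>R jet_J I M' a b" for a b
    by (simp add: jet_J_def matrix_ring scaleR_diff_right)
  have C: "jet_Gamma G (jet_g G ?L) a b = x *\<^sub>R jet_Gamma G (jet_g G M) a b + y *\<^sub>R jet_Gamma G (jet_g G M') a b" for a b
    by (simp add: vec_eq_iff jet_Gamma_def g sum_distrib_left sum.distrib[symmetric] sum_distrib_right algebra_simps)
  show "curv G ?L a b = x *\<^sub>R curv G M a b + y *\<^sub>R curv G M' a b"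
    by (simp add: jet_riemann_def C scaleR_diff_right)
  show "hess G I ?L a b = x *\<^sub>R hess G I M a b + y *\<^sub>R hess G I M' a b"
    by (simp add: jet_D2J_def C J matrix_ring scaleR_diff_right scaleR_add_right)
qed

lemma jet_core_linear:
  "jet_core G I (\<lambda>a b. x *\<^sub>R M a b + y *\<^sub>R M' a b) = (\<lambda>i js. x * jet_core G I M i js + y * jet_core G I M' i js)"
  by (intro ext) (simp add: curvature_core_def curv_linear hess_linear lower_endo_linear)

lemma ridge_family_linear:
  "ridge_family \<xi> (x *\<^sub>R m + y *\<^sub>R m') = (\<lambda>a b. x *\<^sub>R ridge_family \<xi> m a b + y *\<^sub>R ridge_family \<xi> m' a b)"
  by (simp add: fun_eq_iff scaleR_add_right mult.commute)

lemma linear_2I: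
  fixes f :: "'a::real_vector \<Rightarrow> real"
  assumes "\<And>x y u v. f (x *\<^sub>R u + y *\<^sub>R v) = x * f u + y * f v"
  shows "linear f"
  using assms[of 1 _ 1] assms[of _ _ 0 0] by (intro linearI) simp_all

lemma linear_jet_core:
  assumes "contraction_op natural_rank k \<Phi>"
  shows "linear (\<lambda>m. \<Phi> G I (jet_core G I (ridge_family \<xi> m)) is)"
  by (rule linear_2I) (simp only: ridge_family_linear jet_core_linear contraction_op_linear[OF assms])

text \<open>Polarization: the ridge families have coefficients xi_a xi_b m, and sums of their
  polarizations give every family symmetric in a, b. The operator is evaluated on families that need
  not come from one of the models.\<close>

lemma vanishes_on_jets:
  fixes \<Phi> :: "real^'n^'n \<Rightarrow> real^'n^'n \<Rightarrow> (nat \<Rightarrow> 'n::finite list \<Rightarrow> real) \<Rightarrow> 'n list \<Rightarrow> real"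
  assumes \<Phi>: "contraction_op natural_rank k \<Phi>"
    and z: "\<And>\<xi> m N. admissible I m N \<Longrightarrow> \<Phi> G I (jet_core G I (ridge_family \<xi> m)) is = 0"
    and sym: "\<And>a b. M a b = M b a"
  shows "\<Phi> G I (jet_core G I M) is = 0"
proof -
  define e where "e \<xi> \<eta> m = \<Phi> G I (jet_core G I (\<lambda>a b. (\<xi> $ a * \<eta> $ b) *\<^sub>R m)) is" for \<xi> \<eta> m
  have lin: "\<Phi> G I (jet_core G I (\<lambda>a b. x *\<^sub>R M a b + y *\<^sub>R M' a b)) is =
      x * \<Phi> G I (jet_core G I M) is + y * \<Phi> G I (jet_core G I M') is" for x y M M'
    by (simp only: jet_core_linear contraction_op_linear[OF \<Phi>])
  have add: "\<Phi> G I (jet_core G I (\<lambda>a b. M a b + M' a b)) is =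
      \<Phi> G I (jet_core G I M) is + \<Phi> G I (jet_core G I M') is" for M M'
    using lin[of 1 M 1 M'] by simp
  have zero: "\<Phi> G I (jet_core G I (\<lambda>a b. 0)) is = 0"
    using lin[of 0 "\<lambda>a b. 0" 0 "\<lambda>a b. 0"] by simp
  \<comment> \<open>Admissible matrices span, so the hypothesis extends to every \<open>m\<close> by
    linearity.\<close>
  have rz: "e \<xi> \<xi> m = 0" for \<xi> m
    unfolding e_def
    by (rule linear_vanishes_matrix[OF linear_jet_core[OF \<Phi>]])
       (auto intro: z admissible_nilpotent admissible_identity)
  have fam: "(\<lambda>a b. ((\<xi> + \<eta>) $ a * (\<xi> + \<eta>) $ b) *\<^sub>R m) =
      (\<lambda>a b. ((\<xi> $ a * \<xi> $ b) *\<^sub>R m + (\<xi> $ a * \<eta> $ b) *\<^sub>R m) +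
        ((\<eta> $ a * \<xi> $ b) *\<^sub>R m + (\<eta> $ a * \<eta> $ b) *\<^sub>R m))" for \<xi> \<eta> :: "real^'n" and m :: "real^'n^'n"
    by (simp add: fun_eq_iff algebra_simps)
  have "e (\<xi> + \<eta>) (\<xi> + \<eta>) m = (e \<xi> \<xi> m + e \<xi> \<eta> m) + (e \<eta> \<xi> m + e \<eta> \<eta> m)" for \<xi> \<eta> m
    unfolding e_def fam add ..
  \<comment> \<open>Vanishing on the diagonal makes \<open>e\<close> antisymmetric in the two
    covectors, and this is paired with the symmetry of \<open>M\<close>.\<close>
  then have anti: "e \<xi> \<eta> m = - e \<eta> \<xi> m" for \<xi> \<eta> m
    by (simp add: rz eq_neg_iff_add_eq_0)
  have sum: "\<Phi> G I (jet_core G I (\<lambda>a b. \<Sum>s\<in>A. F s a b)) is = (\<Sum>s\<in>A. \<Phi> G I (jet_core G I (F s)) is)" for A :: "'n set" and F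
    by (induction A rule: infinite_finite_induct) (simp_all add: zero add)
  have M: "M = (\<lambda>a b. \<Sum>p\<in>UNIV. \<Sum>q\<in>UNIV. (frame p $ a * frame q $ b) *\<^sub>R M p q)"
  proof (intro ext)
    fix a b
    have "(frame p $ a * frame q $ b) *\<^sub>R M p q = (if q = b then if p = a then M p q else 0 else 0)" for p q
      by (simp add: axis_def)
    then show "M a b = (\<Sum>p\<in>UNIV. \<Sum>q\<in>UNIV. (frame p $ a * frame q $ b) *\<^sub>R M p q)" by simp
  qed
  let ?s = "\<Sum>p\<in>UNIV. \<Sum>q\<in>UNIV. e (frame p) (frame q) (M p q)"
  have "\<Phi> G I (jet_core G I M) is = ?s"
    using arg_cong[OF M, of "\<lambda>M. \<Phi> G I (jet_core G I M) is"] by (simp only: sum e_def)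
  moreover have "?s = - ?s"
  proof -
    have "?s = (\<Sum>q\<in>UNIV. \<Sum>p\<in>UNIV. e (frame p) (frame q) (M p q))" by (rule sum.swap)
    also have "\<dots> = (\<Sum>q\<in>UNIV. \<Sum>p\<in>UNIV. - e (frame q) (frame p) (M q p))"
      by (intro sum.cong refl) (subst anti, subst sym, rule refl)
    finally show ?thesis by (simp only: sum_negf)
  qed
  ultimately show ?thesis by simp
qed

section \<open>Values on the models\<close>

lemma normal_core_eq:
  assumes "ah_on U g J" "x \<in> U" "\<And>i. pd i g x = 0" "\<And>i. pd i J x = 0" "length js = natural_rank i"
  shows "natural_core i g J x js =
    curvature_core (g x) (\<lambda>i j. riemann g i j x) (\<lambda>i j. D2J g J i j x) i js + scalar_core i js"
proof -
  interpret ah_field U g J by unfold_locales (rule assms(1))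
  note n = normal_DJ[OF assms(2-4)]
  have D: "DJ_t g J x is = 0" for "is" by (simp add: DJ_t_def n bil_def)
  consider "i = 0" | "i = 1" | "i = 2" | "i > 2" by linarith
  then show ?thesis
    by cases (simp_all add: natural_core_def natural_rank_def curvature_core_def Rm_t_def D2J_t_def
        DJDJ_t_def D lower_endo_def)
qed

lemma model_core:
  assumes h: "linear_ah G I" and ad: "admissible I m N" and "length js = natural_rank i"
  shows "natural_core i (model_g G \<xi> m) (model_J I \<xi> m N) 0 js =
    jet_core G I (ridge_family \<xi> m) i js + scalar_core i js"
proof -
  interpret ah_field UNIV "model_g G \<xi> m" "model_J I \<xi> m N"
    by unfold_locales (rule model_ah[OF h ad])
  have R: "riemann (model_g G \<xi> m) i j 0 = curv G (ridge_family \<xi> m) i j" for i j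
    using normal_riemann[of 0 i j] by (simp add: model_jets)
  have D: "D2J (model_g G \<xi> m) (model_J I \<xi> m N) i j 0 = hess G I (ridge_family \<xi> m) i j" for i j
    using normal_D2J[of 0 i j] by (simp add: model_jets)
  have "natural_core i (model_g G \<xi> m) (model_J I \<xi> m N) 0 js =
    curvature_core (model_g G \<xi> m 0) (\<lambda>i j. riemann (model_g G \<xi> m) i j 0)
      (\<lambda>i j. D2J (model_g G \<xi> m) (model_J I \<xi> m N) i j 0) i js + scalar_core i js"
    by (rule normal_core_eq[OF model_ah[OF h ad] UNIV_I]) (simp_all add: model_jets assms(3))
  then show ?thesis by (simp only: model_jets R D)
qed

lemma model_value:
  assumes \<Phi>: "contraction_op natural_rank k \<Phi>" and ah: "linear_ah G I" and ad: "admissible I m N"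
    and len: "length is = k"
  shows "\<Phi> G I (\<lambda>i. natural_core i (model_g G \<xi> m) (model_J I \<xi> m N) 0) is =
    \<Phi> G I (jet_core G I (ridge_family \<xi> m)) is + \<Phi> G I scalar_core is"
  unfolding contraction_op_add[OF \<Phi>, symmetric]
  by (rule contraction_op_cong[OF \<Phi> _ len]) (rule model_core[OF ah ad])

lemma model_const: "model_g G \<xi> 0 = (\<lambda>x. G)" "model_J I \<xi> 0 0 = (\<lambda>x. I)"
  by (auto simp: model_g_def model_J_def ridge_poly_def fun_eq_iff eval_nat_numeral)

lemma jet_core_zero: "jet_core G I (\<lambda>a b. 0) = (\<lambda>i js. 0)"
  using jet_core_linear[where G = G and I = I and x = 0 and y = 0 and M = "\<lambda>a b. 0" and M' = "\<lambda>a b. 0"] by simp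

lemma linear_ah_scaleR:
  assumes "linear_ah (G::real^'n^'n) I" "c > 0" shows "linear_ah (c *\<^sub>R G) I"
proof (rule linear_ahI)
  fix u :: "real^'n" assume "u \<noteq> 0"
  then show "bil (c *\<^sub>R G) u u > 0"
    using linear_ah_pos[OF assms(1), of u] assms(2) by (simp add: bil_def scaleR_matrix_vector_assoc[symmetric])
qed (simp_all add: transpose_scalar linear_ah_sym[OF assms(1)] linear_ah_square[OF assms(1)]
  linear_ah_compat[OF assms(1)] matrix_scaleR_left matrix_scaleR_right)

text \<open>On a constant structure only the scalar core contributes. Under scaling of the metric by
  4 a rank 2 contraction of it is multiplied by 4, whereas \<open>B\<close> is invariant.\<close>

lemma scalar_part_zero:
  fixes B :: "'n::finite mop"
  assumes \<Phi>: "contraction_op natural_rank 2 \<Phi>"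
    and B: "\<And>U g J x i j. ah_on U g J \<Longrightarrow> x \<in> U \<Longrightarrow>
      B g J x $ i $ j = \<Phi> (g x) (J x) (\<lambda>i. natural_core i g J x) [i, j]"
    and sc: "\<And>r U g J x. r > 0 \<Longrightarrow> ah_on U g J \<Longrightarrow> x \<in> U \<Longrightarrow> B (\<lambda>y. r\<^sup>2 *\<^sub>R g y) J x = B g J x"
    and ah: "linear_ah G I"
  shows "\<Phi> G I scalar_core [i, j] = 0"
proof -
  have v: "B (\<lambda>x. G) (\<lambda>x. I) 0 $ i $ j = \<Phi> G I scalar_core [i, j]" if "linear_ah G I" for G
    using B[OF model_ah[OF that admissible_zero, of 0] UNIV_I, of 0 i j]
      model_value[OF \<Phi> that admissible_zero, of "[i, j]" 0]
    by (simp add: model_const jet_core_zero contraction_op_0[OF \<Phi>])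
  have "\<Phi> (2\<^sup>2 *\<^sub>R G) I scalar_core [i, j] = \<Phi> G I scalar_core [i, j]"
    using v[OF ah] v[OF linear_ah_scaleR[OF ah, of "2\<^sup>2"]]
      sc[OF _ model_ah[OF ah admissible_zero, of 0] UNIV_I, of 2 0] by (simp add: model_const)
  moreover have "\<Phi> (2\<^sup>2 *\<^sub>R G) I scalar_core [i, j] = 2 ^ 2 * \<Phi> G I scalar_core [i, j]"
    by (rule contraction_op_scaling[OF \<Phi> linear_ah_invertible[OF ah], where c = "\<lambda>i. 1"]) simp
  ultimately show ?thesis by simp
qed

section \<open>The Ricci tensor and the Laplacian of a second jet\<close>

definition jet_ricci :: "real^'n^'n \<Rightarrow> ('n \<Rightarrow> 'n \<Rightarrow> real^'n^'n) \<Rightarrow> real^'n^'n" where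
  "jet_ricci G S = (\<chi> j k. \<Sum>i\<in>UNIV. jet_riemann G S i j $ i $ k)"

text \<open>The second jet of the one-form by which the Ricci operator differs from the Laplacian of the
  metric (DeTurck).\<close>

definition jet_gauge :: "real^'n^'n \<Rightarrow> ('n \<Rightarrow> real^'n^'n) \<Rightarrow> 'n::finite \<Rightarrow> real" where
  "jet_gauge G P j = (\<Sum>p\<in>UNIV. \<Sum>q\<in>UNIV. matrix_inv G $ p $ q * (P p $ j $ q - (1/2) * P j $ p $ q))"

definition jet_laplace :: "real^'n^'n \<Rightarrow> ('n \<Rightarrow> 'n \<Rightarrow> real^'n^'n) \<Rightarrow> real^'n^'n" where
  "jet_laplace G S = (\<Sum>a\<in>UNIV. \<Sum>b\<in>UNIV. matrix_inv G $ a $ b *\<^sub>R S a b)"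

lemma sum_inv_swap:
  assumes "linear_ah G I"
  shows "(\<Sum>p\<in>UNIV. \<Sum>q\<in>UNIV. matrix_inv G $ p $ q * f p q) = (\<Sum>p\<in>UNIV. \<Sum>q\<in>UNIV. matrix_inv G $ p $ q * f q p)"
proof -
  have "matrix_inv G $ p $ q = matrix_inv G $ q $ p" for p q
    by (metis linear_ah_inv_sym[OF assms] transpose_nth)
  then have "(\<Sum>p\<in>UNIV. \<Sum>q\<in>UNIV. matrix_inv G $ p $ q * f p q) = (\<Sum>p\<in>UNIV. \<Sum>q\<in>UNIV. matrix_inv G $ q $ p * f p q)"
    by (intro sum.cong refl) simp
  also have "\<dots> = (\<Sum>q\<in>UNIV. \<Sum>p\<in>UNIV. matrix_inv G $ q $ p * f p q)" by (rule sum.swap)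
  finally show ?thesis .
qed

context
  fixes G I :: "real^'n^'n::finite" and S :: "'n \<Rightarrow> 'n \<Rightarrow> real^'n^'n"
  assumes ah: "linear_ah G I" and S1: "\<And>a b. S a b = S b a" and S2: "\<And>a b. transpose (S a b) = S a b"
begin

lemma S_sym: "S a b $ k $ l = S a b $ l $ k"
  by (metis S2 transpose_nth)

abbreviation "tr f \<equiv> \<Sum>p\<in>UNIV. \<Sum>q\<in>UNIV. matrix_inv G $ p $ q * (f p q :: real)"

lemma tr_add: "tr (\<lambda>p q. f p q + h p q) = tr f + tr h"
  by (simp add: distrib_left sum.distrib)

lemma tr_diff: "tr (\<lambda>p q. f p q - h p q) = tr f - tr h"
  by (simp add: right_diff_distrib sum_subtractf)

lemma tr_scale: "tr (\<lambda>p q. c * f p q) = c * tr f"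
  by (simp add: sum_distrib_left mult.left_commute)

lemma tr_S: "tr (\<lambda>p q. S p j $ k $ q) = tr (\<lambda>p q. S j p $ k $ q)"
  "tr (\<lambda>p q. S p j $ q $ k) = tr (\<lambda>p q. S j p $ k $ q)"
  "tr (\<lambda>p q. S k j $ p $ q) = tr (\<lambda>p q. S j k $ p $ q)"
  by (intro sum.cong refl, metis S1 S_sym)+

lemma jet_gauge_eq: "jet_gauge G (S j) k = tr (\<lambda>p q. S j p $ k $ q) - (1/2) * tr (\<lambda>p q. S j k $ p $ q)"
  unfolding jet_gauge_def tr_diff tr_scale ..

lemma jet_laplace_nth: "jet_laplace G S $ j $ k = tr (\<lambda>p q. S p q $ j $ k)"
  by (simp add: jet_laplace_def sum_component)

text \<open>DeTurck's identity at a point with vanishing first derivatives: the Ricci tensor is the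
  Laplacian of the metric up to a Lie derivative.\<close>

lemma jet_ricci_eq: "- 2 * jet_ricci G S $ j $ k = jet_laplace G S $ j $ k - jet_gauge G (S j) k - jet_gauge G (S k) j"
proof -
  have "jet_ricci G S $ j $ k = (\<Sum>i\<in>UNIV. (1/2) * (\<Sum>l\<in>UNIV. matrix_inv G $ i $ l * (S i j $ k $ l + S i k $ j $ l - S i l $ j $ k))
    - (1/2) * (\<Sum>l\<in>UNIV. matrix_inv G $ i $ l * (S j i $ k $ l + S j k $ i $ l - S j l $ i $ k)))"
    by (simp add: jet_ricci_def jet_riemann_def jet_Gamma_def)
  also have "\<dots> = (1/2) * tr (\<lambda>i l. S i j $ k $ l + S i k $ j $ l - S i l $ j $ k)
     - (1/2) * tr (\<lambda>i l. S j i $ k $ l + S j k $ i $ l - S j l $ i $ k)"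
    by (simp only: sum_subtractf sum_distrib_left)
  also have "\<dots> = (1/2) * (tr (\<lambda>i l. S k i $ j $ l) - tr (\<lambda>i l. S i l $ j $ k) - tr (\<lambda>i l. S j k $ i $ l)
     + tr (\<lambda>i l. S j i $ k $ l))"
  proof -
    have "tr (\<lambda>i l. S j l $ i $ k) = tr (\<lambda>i l. S j i $ k $ l)"
      by (subst sum_inv_swap[OF ah]) (simp only: S_sym[of j _ _ k])
    then show ?thesis unfolding tr_add tr_diff tr_S(1)[of j k] tr_S(1)[of k j] by (simp add: field_simps)
  qed
  finally show ?thesis unfolding jet_gauge_eq jet_laplace_nth tr_S(3)[of k j] by (simp add: field_simps)
qed

lemma jet_ricci_sym: "transpose (jet_ricci G S) = jet_ricci G S"
proof -
  have "jet_laplace G S $ j $ k = jet_laplace G S $ k $ j" for j k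
    unfolding jet_laplace_nth by (simp only: S_sym[of _ _ j k])
  then have "jet_ricci G S $ j $ k = jet_ricci G S $ k $ j" for j k
    using jet_ricci_eq[of j k] jet_ricci_eq[of k j] by simp
  then show ?thesis by (simp add: vec_eq_iff transpose_nth)
qed

text \<open>Compares the coordinate Laplacian of J with the covariant one. The two differ by the
  commutator of the traced connection derivative with I, so the DeTurck field turns one into the
  other plus the commutator of the raised Ricci tensor with I, which is R.\<close>

lemma jet_gauge_endo:
  assumes W: "\<And>i j. lower_endo G W $ i $ j = jet_gauge G (S i) j"
  shows "(\<Sum>a\<in>UNIV. \<Sum>b\<in>UNIV. matrix_inv G $ a $ b *\<^sub>R jet_Gamma G S a b) + matrix_inv G ** jet_ricci G S = W"
proof (rule lower_endo_inject[OF ah])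
  let ?C = "\<Sum>a\<in>UNIV. \<Sum>b\<in>UNIV. matrix_inv G $ a $ b *\<^sub>R jet_Gamma G S a b"
  have "lower_endo G (?C + matrix_inv G ** jet_ricci G S) $ j $ k = jet_gauge G (S j) k" for j k
  proof -
    have "lower_endo G (?C + matrix_inv G ** jet_ricci G S) = lower_endo G ?C + jet_ricci G S"
      by (simp add: lower_endo_eq transpose_ring matrix_ring jet_ricci_sym linear_ah_inv_sym[OF ah])
         (simp add: matrix_mul_assoc[symmetric] linear_ah_inv_left[OF ah])
    moreover have "lower_endo G ?C $ j $ k = tr (\<lambda>a b. lower_endo G (jet_Gamma G S a b) $ j $ k)"
      by (simp add: lower_endo_eq transpose_sum transpose_scalar matrix_sum_left matrix_scaleR_left sum_component)
    moreover have "tr (\<lambda>a b. lower_endo G (jet_Gamma G S a b) $ j $ k) =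
        (1/2) * (jet_laplace G S $ j $ k + tr (\<lambda>a b. S j a $ k $ b) - tr (\<lambda>a b. S k a $ j $ b))"
      unfolding lower_jet_Gamma[OF ah] tr_scale tr_add tr_diff jet_laplace_nth
      by (simp only: tr_S(2))
    ultimately show ?thesis
      using jet_ricci_eq[of j k] unfolding jet_gauge_eq tr_S(3)[of k j] by (simp add: field_simps)
  qed
  then show "lower_endo G (?C + matrix_inv G ** jet_ricci G S) = lower_endo G W"
    by (simp add: vec_eq_iff W)
qed

end

section \<open>The gauge term on the models\<close>

text \<open>Core 1 is DJ and every other index is Dg, matching the two cores of the gauge one-form.
  \<open>P\<close> and \<open>Q\<close> hold their derivatives in one fixed direction.\<close>

definition symbol_core :: "real^'n^'n \<Rightarrow> ('n \<Rightarrow> real^'n^'n) \<Rightarrow> ('n \<Rightarrow> real^'n^'n) \<Rightarrow> nat \<Rightarrow> 'n::finite list \<Rightarrow> real" where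
  "symbol_core G P Q p js = (if p = 1 then lower_endo G (Q (js!0)) $ (js!1) $ (js!2) else P (js!0) $ (js!1) $ (js!2))"

lemma bounded_bilinear_matrix_vector: "bounded_bilinear (\<lambda>(A::real^'n^'m) x. A *v x)"
  unfolding bilinear_conv_bounded_bilinear[symmetric] bilinear_def
  by (auto intro!: linearI simp: algebra_simps scaleR_matrix_vector_assoc[symmetric])

lemma cov_form_nth:
  "cov_form \<Gamma> B i y $ j $ k = pd i B y $ j $ k - (transpose (\<Gamma> y i) ** B y) $ j $ k - (B y ** \<Gamma> y i) $ j $ k"
  by (simp add: cov_form_def bil_mult_left bil_mult_right bil_frame)

lemma jacobian_nth: "jacobian X (at x) $ p $ i = pd i X x $ p"
  by (simp add: jacobian_def matrix_def pd_def)

text \<open>At the origin of a model the metric, J and the inverse metric are stationary, so the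
  operator passes through the derivative. The background connection contributes only the term
  \<open>W\<close>, the same for all models with the same (G, I).\<close>

lemma model_gauge_jacobian:
  fixes G I :: "real^'n^'n::finite"
  assumes \<Phi>: "contraction_op (\<lambda>_. 3) 1 \<Phi>"
    and \<Gamma>: "\<And>i. smooth_on UNIV (\<lambda>x. \<Gamma> x i)"
    and X: "\<And>g J x. X g J x = sharp (g x)
      (\<chi> i. \<Phi> (g x) (J x) (\<lambda>p. if p = 1 then DJ_t g J x else Dg_t \<Gamma> g J x) [i])"
    and lah0: "linear_ah G I"
  shows "\<exists>W. \<forall>\<xi> m N. admissible I m N \<longrightarrow> (\<forall>i j.
    lower_endo G (jacobian (X (model_g G \<xi> m) (model_J I \<xi> m N)) (at 0)) $ i $ j =
    \<Phi> G I (symbol_core G (jet_g G (ridge_family \<xi> m) i) (hess G I (ridge_family \<xi> m) i)) [j] - W i j)"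
proof -
  \<comment> \<open>Minus the derivative in direction \<open>a\<close> of the background covariant
    derivative of g, coming from the connection matrices; the metric appears only through its value
    \<open>G\<close>.\<close>
  define w where "w a p js = (if p = (1::nat) then 0 else
    (transpose (pd a (\<lambda>y. \<Gamma> y (js!0)) 0) ** G + G ** pd a (\<lambda>y. \<Gamma> y (js!0)) 0) $ (js!1) $ (js!2))" for a and js :: "'n list" and p
  show ?thesis
  proof (rule exI[of _ "\<lambda>i j. \<Phi> G I (w i) [j]"], intro allI impI)
    fix \<xi> m N i j assume ad: "admissible I m N"
    define mg where "mg = model_g G \<xi> m"
    define mJ where "mJ = model_J I \<xi> m N"
    let ?S = "jet_g G (ridge_family \<xi> m)" and ?D = "hess G I (ridge_family \<xi> m)"
    interpret ah_field UNIV mg mJ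
      unfolding mg_def mJ_def by unfold_locales (rule model_ah[OF lah0 ad])
    have j0: "mg 0 = G" "mJ 0 = I" "\<And>i. pd i mg 0 = 0" "\<And>i. pd i mJ 0 = 0"
      "\<And>a b. pd a (pd b mg) 0 = ?S a b" "\<And>a b. pd a (pd b mJ) 0 = jet_J I (ridge_family \<xi> m) a b"
      by (simp_all add: mg_def mJ_def model_jets)
    note U = UNIV_I[of "0 :: real^'n"]
    have dG: "(\<lambda>y. \<Gamma> y i) differentiable at 0" for i
      using smooth_on_differentiable(1)[OF \<Gamma> open_UNIV UNIV_I] .
    have pdDJ: "pd a (DJ mg mJ i) 0 = ?D a i" for a i
      using normal_pd_DJ[OF U j0(3,4)] by (simp add: j0)
    define c where "c y p = (if p = (1::nat) then DJ_t mg mJ y else Dg_t \<Gamma> mg mJ y)" for y p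
    have c1: "c y 1 js = (transpose (DJ mg mJ (js!0) y) ** mg y) $ (js!1) $ (js!2)" for y js
      by (simp add: c_def DJ_t_def bil_mult_left bil_frame numeral_2_eq_2)
    have c0: "c y p js = (pd (js!0) mg y - transpose (\<Gamma> y (js!0)) ** mg y - mg y ** \<Gamma> y (js!0)) $ (js!1) $ (js!2)"
      if "p \<noteq> 1" for y p js
      using that by (simp add: c_def Dg_t_def cov_form_nth numeral_2_eq_2)
    have A: "(\<lambda>y. c y p js) differentiable at 0 \<and>
        pd a (\<lambda>y. c y p js) 0 = symbol_core G (?S a) (?D a) p js - w a p js" for a p js
    proof (cases "p = 1")
      case True
      have d: "(\<lambda>y. transpose (DJ mg mJ (js!0) y) ** mg y) differentiable at 0"
        by (intro differentiable_matrix_mult differentiable_transpose diff_DJ[OF U] diff_g[OF U])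
      have "pd a (\<lambda>y. transpose (DJ mg mJ (js!0) y) ** mg y) 0 = transpose (?D a (js!0)) ** G"
        by (simp add: pd_matrix_mult pd_transpose differentiable_transpose diff_DJ[OF U] diff_g[OF U] pdDJ j0)
      then show ?thesis
        unfolding True c1 pd_nth2[OF d] using differentiable_nth2[OF d]
        by (simp add: symbol_core_def w_def lower_endo_eq)
    next
      case False
      let ?i = "js!0"
      have d: "(\<lambda>y. pd ?i mg y - transpose (\<Gamma> y ?i) ** mg y - mg y ** \<Gamma> y ?i) differentiable at 0"
        by (intro differentiable_diff differentiable_matrix_mult differentiable_transpose
            diff_pd_g[OF U] diff_g[OF U] dG)
      have "pd a (\<lambda>y. pd ?i mg y - transpose (\<Gamma> y ?i) ** mg y - mg y ** \<Gamma> y ?i) 0 =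
          ?S a ?i - (transpose (pd a (\<lambda>y. \<Gamma> y ?i) 0) ** G + G ** pd a (\<lambda>y. \<Gamma> y ?i) 0)"
        by (simp add: pd_diff pd_matrix_mult pd_transpose differentiable_transpose differentiable_diff
            differentiable_matrix_mult diff_pd_g[OF U] diff_g[OF U] dG j0)
      then show ?thesis
        unfolding c0[OF False] pd_nth2[OF d] using differentiable_nth2[OF d] False
        by (simp add: symbol_core_def w_def)
    qed
    define A' where "A' a p js = symbol_core G (?S a) (?D a) p js - w a p js" for a p js
    have zero: "(f has_derivative (\<lambda>v. 0)) (at 0)"
      if "f differentiable at 0" "\<And>i. pd i f 0 = 0" for f :: "real^'n \<Rightarrow> real^'n^'n"
      using has_derivative_pd[OF that(1)] by (simp add: that(2))
    have gi0: "pd i gi 0 = 0" for i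
      by (simp add: pd_gi[OF U] normal_Gamma[OF U j0(3,4)])
    have der: "((\<lambda>y. \<Phi> (mg y) (mJ y) (c y) [j]) has_derivative
        (\<lambda>v. \<Phi> (mg 0) (mJ 0) (\<lambda>p js. \<Sum>a\<in>UNIV. v $ a * A' a p js) [j])) (at 0)" for j
    proof (rule contraction_op_has_derivative[OF \<Phi>])
      show "((\<lambda>y. c y p js) has_derivative (\<lambda>v. \<Sum>a\<in>UNIV. v $ a * A' a p js)) (at 0)" for p js
        using has_derivative_pd[OF A[THEN conjunct1], of p js] A[THEN conjunct2] by (simp add: A'_def)
    qed (auto intro!: zero diff_g[OF U] diff_J[OF U] diff_gi[OF U] simp: j0 gi0)
    then have d\<tau>: "(\<lambda>y. \<Phi> (mg y) (mJ y) (c y) [j]) differentiable at 0" for j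
      unfolding differentiable_def by blast
    have fr: "(\<lambda>p js. \<Sum>a\<in>UNIV. frame i $ a * A' a p js) = A' i" for i
      by (simp add: fun_eq_iff axis_def if_distrib if_distribR cong: if_cong)
    have p\<tau>: "pd i (\<lambda>y. \<Phi> (mg y) (mJ y) (c y) [j]) 0 = \<Phi> G I (A' i) [j]" for i j
      using pd_eqI[OF der, of i j] unfolding fr j0 .
    let ?\<tau> = "\<lambda>y. \<chi> j. \<Phi> (mg y) (mJ y) (c y) [j]"
    have dv: "?\<tau> differentiable at 0" by (rule differentiable_vec) (simp add: d\<tau>)
    have cx: "c y = (\<lambda>p. if p = 1 then DJ_t mg mJ y else Dg_t \<Gamma> mg mJ y)" for y
      by (simp add: fun_eq_iff c_def)
    have Xeq: "X mg mJ = (\<lambda>y. gi y *v ?\<tau> y)"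
      by (intro ext) (simp only: X sharp_def cx)
    have "pd i ?\<tau> 0 = (\<chi> j. \<Phi> G I (A' i) [j])" for i
      using pd_nth[OF dv] p\<tau> by (simp add: vec_eq_iff)
    then have pX: "pd i (X mg mJ) 0 = matrix_inv G *v (\<chi> j. \<Phi> G I (A' i) [j])" for i
      unfolding Xeq
      by (subst pd_bounded_bilinear[OF diff_gi[OF U] dv bounded_bilinear_matrix_vector]) (simp add: gi0 j0)
    have "lower_endo G (jacobian (X mg mJ) (at 0)) $ i $ j = (transpose G *v pd i (X mg mJ) 0) $ j"
      by (simp add: lower_endo_nth jacobian_nth matrix_vector_mult_def transpose_nth mult.commute)
    also have "\<dots> = \<Phi> G I (A' i) [j]"
      unfolding pX by (simp add: matrix_vector_mul_assoc linear_ah_sym[OF lah0] linear_ah_inv_right[OF lah0])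
    also have "\<dots> = \<Phi> G I (symbol_core G (?S i) (?D i)) [j] - \<Phi> G I (w i) [j]"
      unfolding A'_def by (rule contraction_op_diff[OF \<Phi>])
    finally show "lower_endo G (jacobian (X (model_g G \<xi> m) (model_J I \<xi> m N)) (at 0)) $ i $ j =
      \<Phi> G I (symbol_core G (?S i) (?D i)) [j] - \<Phi> G I (w i) [j]" by (simp only: mg_def mJ_def)
  qed
qed

lemma jet_zero: "jet_g G (\<lambda>a b. 0) a b = 0" "jet_J I (\<lambda>a b. 0) a b = 0" "hess G I (\<lambda>a b. 0) a b = 0"
  "curv G (\<lambda>a b. 0) a b = 0"
proof -
  show g: "jet_g G (\<lambda>a b. 0) a b = 0" "jet_J I (\<lambda>a b. 0) a b = 0" for a b
    by (simp_all add: jet_g_def jet_J_def)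
  have "jet_Gamma G (jet_g G (\<lambda>a b. 0)) a b = 0" for a b
    by (simp add: vec_eq_iff jet_Gamma_def g)
  then show "hess G I (\<lambda>a b. 0) a b = 0" "curv G (\<lambda>a b. 0) a b = 0"
    by (simp_all add: jet_D2J_def jet_riemann_def g)
qed

text \<open>All models with the same (G, I) have the same 1-jet at 0, hence the same unknown lower
  order terms. Comparison with the constant structure, where h and K vanish, removes these together
  with the background term.\<close>

lemma symbol_on_models:
  fixes h K :: "'n::finite mop"
  assumes "identity_symbol_mod_gauge h K"
    and flat: "\<And>G I. linear_ah G I \<Longrightarrow> h (\<lambda>x. G) (\<lambda>x. I) 0 = 0 \<and> K (\<lambda>x. G) (\<lambda>x. I) 0 = 0"
  shows "\<exists>\<Phi>. contraction_op (\<lambda>_. 3) 1 \<Phi> \<and> (\<forall>G I \<xi> m N. linear_ah G I \<longrightarrow> admissible I m N \<longrightarrow> (\<exists>Y.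
    (\<forall>i j. lower_endo G Y $ i $ j =
      \<Phi> G I (symbol_core G (jet_g G (ridge_family \<xi> m) i) (hess G I (ridge_family \<xi> m) i)) [j]) \<and>
    h (model_g G \<xi> m) (model_J I \<xi> m N) 0 =
      jet_laplace G (jet_g G (ridge_family \<xi> m)) - (transpose Y ** G + G ** Y) \<and>
    K (model_g G \<xi> m) (model_J I \<xi> m N) 0 =
      jet_laplace G (jet_J I (ridge_family \<xi> m)) + (Y ** I - I ** Y)))"
proof -
  note assms(1)[unfolded identity_symbol_mod_gauge_def]
  then show ?thesis
  proof (elim exE conjE, goal_cases)
    case (1 \<Gamma> T X F H)
    then have \<Gamma>: "\<And>i. smooth_on UNIV (\<lambda>x. \<Gamma> x i)"
      and T: "contraction {(3, Dg_t \<Gamma>), (3, DJ_t)} 1 T"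
      and X: "\<And>g J x. X g J x = sharp (g x) (\<chi> i. T g J x [i])" by blast+
    note eq = 1(5)[rule_format]
  have cores: "{(3::nat, Dg_t \<Gamma>), (3, DJ_t)} = range (\<lambda>p. ((\<lambda>_. 3) p, if p = (1::nat) then DJ_t else Dg_t \<Gamma>))"
    by (auto simp: image_iff)
  obtain \<Phi> where \<Phi>: "contraction_op (\<lambda>_. 3) 1 \<Phi>"
    and T\<Phi>: "T = (\<lambda>g J x. \<Phi> (g x) (J x) (\<lambda>p. (if p = 1 then DJ_t else Dg_t \<Gamma>) g J x))"
    using contraction_imp_op[OF T[unfolded cores]] by blast
  have X': "X g J x = sharp (g x)
      (\<chi> i. \<Phi> (g x) (J x) (\<lambda>p. if p = 1 then DJ_t g J x else Dg_t \<Gamma> g J x) [i])" for g J x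
    by (simp add: X T\<Phi> if_distrib if_distribR cong: if_cong)
  show ?case
  proof (rule exI[of _ \<Phi>], intro conjI \<Phi> allI impI)
    fix G I :: "real^'n^'n" and \<xi> m N assume ah: "linear_ah G I" and ad: "admissible I m N"
    obtain W where W: "\<And>\<xi> m N i j. admissible I m N \<Longrightarrow>
      lower_endo G (jacobian (X (model_g G \<xi> m) (model_J I \<xi> m N)) (at 0)) $ i $ j =
      \<Phi> G I (symbol_core G (jet_g G (ridge_family \<xi> m) i) (hess G I (ridge_family \<xi> m) i)) [j] - W i j"
      using model_gauge_jacobian[OF \<Phi> \<Gamma> X' ah] by blast
    define Jac where "Jac m N = jacobian (X (model_g G \<xi> m) (model_J I \<xi> m N)) (at 0)" for m N
    have e: "h (model_g G \<xi> m) (model_J I \<xi> m N) 0 + (transpose (Jac m N) ** G + G ** Jac m N) =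
        jet_laplace G (jet_g G (ridge_family \<xi> m)) + F (0, G, I, (\<lambda>i. 0), (\<lambda>i. 0)) \<and>
      K (model_g G \<xi> m) (model_J I \<xi> m N) 0 + (I ** Jac m N - Jac m N ** I) =
        jet_laplace G (jet_J I (ridge_family \<xi> m)) + H (0, G, I, (\<lambda>i. 0), (\<lambda>i. 0))"
      if ad': "admissible I m N" for m N
    proof -
      interpret ah_field UNIV "model_g G \<xi> m" "model_J I \<xi> m N"
        by unfold_locales (rule model_ah[OF \<open>linear_ah G I\<close> ad'])
      have "lie_form (X (model_g G \<xi> m) (model_J I \<xi> m N)) (model_g G \<xi> m) 0 =
          transpose (Jac m N) ** G + G ** Jac m N"
        using normal_lie_form[OF UNIV_I, of 0] by (simp add: model_jets Jac_def)
      moreover have "lie_endo (X (model_g G \<xi> m) (model_J I \<xi> m N)) (model_J I \<xi> m N) 0 =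
          I ** Jac m N - Jac m N ** I"
        using normal_lie_endo[OF UNIV_I, of 0] by (simp add: model_jets Jac_def)
      ultimately show ?thesis
        using eq[OF model_ah[OF \<open>linear_ah G I\<close> ad', of \<xi>] UNIV_I, of 0]
        by (simp add: model_jets jet_laplace_def)
    qed
    \<comment> \<open>The case m = 0 expresses the unknown terms through the gauge field of the
      constant structure.\<close>
    have e0: "transpose (Jac 0 0) ** G + G ** Jac 0 0 = F (0, G, I, (\<lambda>i. 0), (\<lambda>i. 0))"
      "I ** Jac 0 0 - Jac 0 0 ** I = H (0, G, I, (\<lambda>i. 0), (\<lambda>i. 0))"
      using e[OF admissible_zero] flat[OF ah] by (simp_all add: model_const jet_laplace_def jet_zero)
    let ?Y = "Jac m N - Jac 0 0"
    show "\<exists>Y. (\<forall>i j. lower_endo G Y $ i $ j =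
      \<Phi> G I (symbol_core G (jet_g G (ridge_family \<xi> m) i) (hess G I (ridge_family \<xi> m) i)) [j]) \<and>
      h (model_g G \<xi> m) (model_J I \<xi> m N) 0 =
        jet_laplace G (jet_g G (ridge_family \<xi> m)) - (transpose Y ** G + G ** Y) \<and>
      K (model_g G \<xi> m) (model_J I \<xi> m N) 0 =
        jet_laplace G (jet_J I (ridge_family \<xi> m)) + (Y ** I - I ** Y)"
    proof (rule exI[of _ ?Y], intro conjI allI)
      fix i j
      have z: "symbol_core G (jet_g G (ridge_family \<xi> 0) i) (hess G I (ridge_family \<xi> 0) i) = (\<lambda>p js. 0)"
        by (simp add: fun_eq_iff symbol_core_def jet_zero lower_endo_eq)
      have "lower_endo G ?Y = lower_endo G (Jac m N) - lower_endo G (Jac 0 0)"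
        by (simp add: lower_endo_eq transpose_ring matrix_ring)
      then show "lower_endo G ?Y $ i $ j =
        \<Phi> G I (symbol_core G (jet_g G (ridge_family \<xi> m) i) (hess G I (ridge_family \<xi> m) i)) [j]"
        using W[OF ad, of \<xi> i j] W[OF admissible_zero, of \<xi> i j]
        unfolding z Jac_def[symmetric] contraction_op_0[OF \<Phi>] by simp
      show "h (model_g G \<xi> m) (model_J I \<xi> m N) 0 =
        jet_laplace G (jet_g G (ridge_family \<xi> m)) - (transpose ?Y ** G + G ** ?Y)"
        using e[OF ad] unfolding e0[symmetric] by (simp add: transpose_ring matrix_ring algebra_simps)
      show "K (model_g G \<xi> m) (model_J I \<xi> m N) 0 =
        jet_laplace G (jet_J I (ridge_family \<xi> m)) + (?Y ** I - I ** ?Y)"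
        using e[OF ad] unfolding e0[symmetric] by (simp add: matrix_ring algebra_simps)
    qed
  qed
qed
qed

section \<open>Gauge invariance\<close>

text \<open>Skew in the first two and symmetric in the last two arguments: alternating the two
  exchanges three times leads back to minus the start. This is the algebra behind uniqueness of the
  Levi-Civita connection.\<close>

lemma trilinear_vanishes:
  fixes f :: "'a::real_vector \<Rightarrow> 'a \<Rightarrow> 'a \<Rightarrow> real"
  assumes sym: "\<And>a b c. f a b c = f a c b" and add: "\<And>a a' b c. f (a + a') b c = f a b c + f a' b c"
    "\<And>a b b' c. f a (b + b') c = f a b c + f a b' c"
    and z: "\<And>a c. f a a c = 0"
  shows "f a b c = 0"
proof -
  have anti: "f a b c = - f b a c" for a b c
    using z[of "a + b" c] unfolding add by (simp add: z eq_neg_iff_add_eq_0)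
  have "f a b c = - f b c a" using anti[of a b c] sym[of b a c] by simp
  also have "\<dots> = f c a b" using anti[of b c a] sym[of c b a] by simp
  also have "\<dots> = - f a b c" using anti[of c a b] sym[of a c b] by simp
  finally show ?thesis by simp
qed

definition outer :: "real^'n \<Rightarrow> real^'n \<Rightarrow> real^'n^'n" where
  "outer u v = (\<chi> i j. u $ i * v $ j)"

text \<open>For m = v xi^T the matrix Q is the Jacobian of the map x to x + (xi . x)^3 v / 6, so
  these are second jets of pulled-back constant structures: curvature and second derivative of J
  vanish.\<close>

lemma pure_gauge_jets:
  assumes ah: "linear_ah G I"
  shows "jet_g G (ridge_family \<xi> (outer v \<xi>)) a b = (\<xi> $ a * \<xi> $ b) *\<^sub>R (outer \<xi> (G *v v) + outer (G *v v) \<xi>)"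
    and "curv G (ridge_family \<xi> (outer v \<xi>)) a b = 0"
    and "hess G I (ridge_family \<xi> (outer v \<xi>)) a b = 0"
proof -
  let ?m = "outer v \<xi>"
  have Gm: "G ** ?m = outer (G *v v) \<xi>"
    by (simp add: vec_eq_iff matrix_mult_nth outer_def matrix_vector_mult_def sum_distrib_right mult.assoc)
  have "transpose ?m ** G = transpose (G ** ?m)"
    by (simp add: matrix_transpose_mul linear_ah_sym[OF ah])
  also have "\<dots> = outer \<xi> (G *v v)"
    unfolding Gm by (simp add: vec_eq_iff transpose_nth outer_def mult.commute)
  finally have mG: "transpose ?m ** G = outer \<xi> (G *v v)" .
  show g: "jet_g G (ridge_family \<xi> ?m) a b = (\<xi> $ a * \<xi> $ b) *\<^sub>R (outer \<xi> (G *v v) + outer (G *v v) \<xi>)" for a b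
    by (simp add: jet_g_def transpose_ring matrix_ring Gm mG scaleR_add_right)
  have C: "jet_Gamma G (jet_g G (ridge_family \<xi> ?m)) a b = (\<xi> $ a * \<xi> $ b) *\<^sub>R ?m" for a b
  proof (rule lower_endo_inject[OF ah])
    have "lower_endo G ((\<xi> $ a * \<xi> $ b) *\<^sub>R ?m) = (\<xi> $ a * \<xi> $ b) *\<^sub>R outer \<xi> (G *v v)"
      by (simp add: lower_endo_eq transpose_scalar matrix_scaleR_left mG)
    moreover have "lower_endo G (jet_Gamma G (jet_g G (ridge_family \<xi> ?m)) a b) $ k $ l =
        ((\<xi> $ a * \<xi> $ b) *\<^sub>R outer \<xi> (G *v v)) $ k $ l" for k l
      unfolding lower_jet_Gamma[OF ah] g by (simp add: outer_def algebra_simps)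
    ultimately show "lower_endo G (jet_Gamma G (jet_g G (ridge_family \<xi> ?m)) a b) = lower_endo G ((\<xi> $ a * \<xi> $ b) *\<^sub>R ?m)"
      by (simp only: vec_eq_iff) simp
  qed
  show "curv G (ridge_family \<xi> ?m) a b = 0"
    by (simp add: jet_riemann_def C mult.commute)
  show "hess G I (ridge_family \<xi> ?m) a b = 0"
    by (simp add: jet_D2J_def C jet_J_def matrix_ring)
qed

lemma symbol_core_linear:
  "symbol_core G (\<lambda>b. x *\<^sub>R P b + y *\<^sub>R P' b) (\<lambda>b. x *\<^sub>R Q b + y *\<^sub>R Q' b) =
    (\<lambda>p js. x * symbol_core G P Q p js + y * symbol_core G P' Q' p js)"
  by (simp add: fun_eq_iff symbol_core_def lower_endo_linear)

lemma jet_gauge_linear: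
  "jet_gauge G (\<lambda>b. x *\<^sub>R P b + y *\<^sub>R P' b) j = x * jet_gauge G P j + y * jet_gauge G P' j"
  by (simp add: jet_gauge_def sum_distrib_left sum.distrib[symmetric] algebra_simps)

lemma jet_laplace_linear:
  "jet_laplace G (\<lambda>a b. x *\<^sub>R S a b + y *\<^sub>R S' a b) = x *\<^sub>R jet_laplace G S + y *\<^sub>R jet_laplace G S'"
  by (simp add: jet_laplace_def scaleR_sum_right sum.distrib[symmetric] scaleR_add_right mult.commute)

lemma jet_g_symmetries:
  assumes "linear_ah G I" "\<And>a b. M a b = M b a"
  shows "jet_g G M a b = jet_g G M b a" "transpose (jet_g G M a b) = jet_g G M a b"
  using assms(2)[of a b] by (simp_all add: jet_g_def transpose_ring linear_ah_sym[OF assms(1)] add.commute)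

text \<open>On pure gauge jets \<Psi> vanishes, and there the Laplacian of the metric is the
  symmetrized DeTurck term. The two gauge forms therefore agree on symmetric products of
  \<open>\<xi>\<close> with an arbitrary covector, and a trilinear argument extends this to all
  symmetric \<open>s\<close>.\<close>

lemma gauge_symbol:
  fixes G I :: "real^'n^'n::finite"
  assumes \<Phi>: "contraction_op (\<lambda>_. 3) 1 \<Phi>" and \<Psi>: "contraction_op natural_rank 2 \<Psi>" and ah: "linear_ah G I"
    and eq: "\<And>\<xi> m N i j. admissible I m N \<Longrightarrow> \<Psi> G I (jet_core G I (ridge_family \<xi> m)) [i, j] =
      jet_laplace G (jet_g G (ridge_family \<xi> m)) $ i $ j
      - \<Phi> G I (symbol_core G (jet_g G (ridge_family \<xi> m) i) (hess G I (ridge_family \<xi> m) i)) [j]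
      - \<Phi> G I (symbol_core G (jet_g G (ridge_family \<xi> m) j) (hess G I (ridge_family \<xi> m) j)) [i]"
    and s: "transpose s = s"
  shows "\<Phi> G I (symbol_core G (\<lambda>b. \<xi> $ b *\<^sub>R s) (\<lambda>b. 0)) [j] = jet_gauge G (\<lambda>b. \<xi> $ b *\<^sub>R s) j"
proof -
  define t where "t \<xi> m i j = \<Phi> G I (symbol_core G (jet_g G (ridge_family \<xi> m) i) (hess G I (ridge_family \<xi> m) i)) [j]" for \<xi> m i j
  have t_lin: "t \<xi> (x *\<^sub>R m + y *\<^sub>R m') i j = x * t \<xi> m i j + y * t \<xi> m' i j" for \<xi> x y m m' i j
  proof -
    let ?M = "\<lambda>a b. x *\<^sub>R ridge_family \<xi> m a b + y *\<^sub>R ridge_family \<xi> m' a b"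
    have "jet_g G ?M i = (\<lambda>b. x *\<^sub>R jet_g G (ridge_family \<xi> m) i b + y *\<^sub>R jet_g G (ridge_family \<xi> m') i b)"
      by (intro ext) (rule jet_g_linear)
    moreover have "hess G I ?M i = (\<lambda>b. x *\<^sub>R hess G I (ridge_family \<xi> m) i b + y *\<^sub>R hess G I (ridge_family \<xi> m') i b)"
      by (intro ext) (rule hess_linear)
    ultimately show ?thesis
      unfolding t_def ridge_family_linear by (simp only: symbol_core_linear contraction_op_linear[OF \<Phi>])
  qed
  \<comment> \<open>Linear extension beyond admissible matrices: v xi^T has square 0 only when xi .
    v = 0.\<close>
  have all: "\<Psi> G I (jet_core G I (ridge_family \<xi> m)) [i, j] - (jet_laplace G (jet_g G (ridge_family \<xi> m)) $ i $ j
      - t \<xi> m i j - t \<xi> m j i) = 0" for \<xi> m i j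
  proof (rule linear_vanishes_matrix[where m = m])
    show "linear (\<lambda>m. \<Psi> G I (jet_core G I (ridge_family \<xi> m)) [i, j] -
        (jet_laplace G (jet_g G (ridge_family \<xi> m)) $ i $ j - t \<xi> m i j - t \<xi> m j i))"
    proof (rule linear_2I)
      fix x y u v
      have "jet_laplace G (jet_g G (ridge_family \<xi> (x *\<^sub>R u + y *\<^sub>R v))) =
          x *\<^sub>R jet_laplace G (jet_g G (ridge_family \<xi> u)) + y *\<^sub>R jet_laplace G (jet_g G (ridge_family \<xi> v))"
        unfolding ridge_family_linear jet_laplace_linear[symmetric]
        by (intro arg_cong[where f = "jet_laplace G"] ext jet_g_linear)
      moreover have "\<Psi> G I (jet_core G I (ridge_family \<xi> (x *\<^sub>R u + y *\<^sub>R v))) [i, j] =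
          x * \<Psi> G I (jet_core G I (ridge_family \<xi> u)) [i, j] + y * \<Psi> G I (jet_core G I (ridge_family \<xi> v)) [i, j]"
        by (simp only: ridge_family_linear jet_core_linear contraction_op_linear[OF \<Psi>])
      ultimately show "\<Psi> G I (jet_core G I (ridge_family \<xi> (x *\<^sub>R u + y *\<^sub>R v))) [i, j] -
        (jet_laplace G (jet_g G (ridge_family \<xi> (x *\<^sub>R u + y *\<^sub>R v))) $ i $ j
          - t \<xi> (x *\<^sub>R u + y *\<^sub>R v) i j - t \<xi> (x *\<^sub>R u + y *\<^sub>R v) j i) =
        x * (\<Psi> G I (jet_core G I (ridge_family \<xi> u)) [i, j] - (jet_laplace G (jet_g G (ridge_family \<xi> u)) $ i $ j
          - t \<xi> u i j - t \<xi> u j i)) +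
        y * (\<Psi> G I (jet_core G I (ridge_family \<xi> v)) [i, j] - (jet_laplace G (jet_g G (ridge_family \<xi> v)) $ i $ j
          - t \<xi> v i j - t \<xi> v j i))"
        unfolding t_lin by (simp add: algebra_simps)
    qed
  qed (auto simp: t_def eq[OF admissible_nilpotent] eq[OF admissible_identity])
  \<comment> \<open>The deviation of the gauge symbol from the DeTurck one.\<close>
  define D where "D \<xi> s j = \<Phi> G I (symbol_core G (\<lambda>b. \<xi> $ b *\<^sub>R s) (\<lambda>b. 0)) [j] - jet_gauge G (\<lambda>b. \<xi> $ b *\<^sub>R s) j"
    for \<xi> :: "real^'n" and s j
  have D_lin: "D \<xi> (x *\<^sub>R s + y *\<^sub>R s') j = x * D \<xi> s j + y * D \<xi> s' j" for \<xi> x y s s' j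
  proof -
    have fam: "(\<lambda>b. \<xi> $ b *\<^sub>R (x *\<^sub>R s + y *\<^sub>R s')) = (\<lambda>b. x *\<^sub>R (\<xi> $ b *\<^sub>R s) + y *\<^sub>R (\<xi> $ b *\<^sub>R s'))"
      by (simp add: scaleR_add_right mult.commute)
    have sc: "symbol_core G (\<lambda>b. x *\<^sub>R (\<xi> $ b *\<^sub>R s) + y *\<^sub>R (\<xi> $ b *\<^sub>R s')) (\<lambda>b. 0) =
        (\<lambda>p js. x * symbol_core G (\<lambda>b. \<xi> $ b *\<^sub>R s) (\<lambda>b. 0) p js + y * symbol_core G (\<lambda>b. \<xi> $ b *\<^sub>R s') (\<lambda>b. 0) p js)"
      by (simp add: fun_eq_iff symbol_core_def lower_endo_eq)
    show ?thesis
      unfolding D_def fam sc jet_gauge_linear contraction_op_linear[OF \<Phi>] by (simp add: algebra_simps)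
  qed
  have D_lin': "D (\<xi> + \<eta>) s j = D \<xi> s j + D \<eta> s j" for \<xi> \<eta> s j
  proof -
    have fam: "(\<lambda>b. (\<xi> + \<eta>) $ b *\<^sub>R s) = (\<lambda>b. 1 *\<^sub>R (\<xi> $ b *\<^sub>R s) + 1 *\<^sub>R (\<eta> $ b *\<^sub>R s))"
      by (simp add: scaleR_add_left)
    have sc: "symbol_core G (\<lambda>b. 1 *\<^sub>R (\<xi> $ b *\<^sub>R s) + 1 *\<^sub>R (\<eta> $ b *\<^sub>R s)) (\<lambda>b. 0) =
        (\<lambda>p js. 1 * symbol_core G (\<lambda>b. \<xi> $ b *\<^sub>R s) (\<lambda>b. 0) p js + 1 * symbol_core G (\<lambda>b. \<eta> $ b *\<^sub>R s) (\<lambda>b. 0) p js)"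
      by (simp add: fun_eq_iff symbol_core_def lower_endo_eq)
    show ?thesis
      unfolding D_def fam sc jet_gauge_linear contraction_op_linear[OF \<Phi>] by simp
  qed
  \<comment> \<open>Flatness gives xi_i D_j + xi_j D_i = 0 for all i, j. Choosing i with xi_i
    nonzero kills first D_i and then every D_j.\<close>
  have key: "D \<xi> (outer \<xi> (G *v v) + outer (G *v v) \<xi>) j = 0" for \<xi> v j
  proof -
    let ?s = "outer \<xi> (G *v v) + outer (G *v v) \<xi>" and ?m = "outer v \<xi>"
    note pg = pure_gauge_jets[OF ah, of \<xi> v]
    let ?S = "jet_g G (ridge_family \<xi> ?m)"
    have Si: "?S i = (\<lambda>b. \<xi> $ i *\<^sub>R (\<xi> $ b *\<^sub>R ?s) + 0 *\<^sub>R 0)" for i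
      by (simp add: fun_eq_iff pg(1))
    have t: "t \<xi> ?m i j = \<xi> $ i * \<Phi> G I (symbol_core G (\<lambda>b. \<xi> $ b *\<^sub>R ?s) (\<lambda>b. 0)) [j]" for i j
    proof -
      have "symbol_core G (?S i) (hess G I (ridge_family \<xi> ?m) i) =
          (\<lambda>p js. \<xi> $ i * symbol_core G (\<lambda>b. \<xi> $ b *\<^sub>R ?s) (\<lambda>b. 0) p js)"
        by (simp add: fun_eq_iff symbol_core_def pg lower_endo_eq mult.assoc)
      then show ?thesis by (simp add: t_def contraction_op_mult[OF \<Phi>])
    qed
    have w: "jet_gauge G (?S i) j = \<xi> $ i * jet_gauge G (\<lambda>b. \<xi> $ b *\<^sub>R ?s) j" for i j
      unfolding Si jet_gauge_linear by simp
    have sy: "ridge_family \<xi> ?m a b = ridge_family \<xi> ?m b a" for a b by (simp add: mult.commute)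
    have s1: "?S a b = ?S b a" for a b
      by (rule jet_g_symmetries(1)[where M = "ridge_family \<xi> ?m", OF ah sy])
    have s2: "transpose (?S a b) = ?S a b" for a b
      by (rule jet_g_symmetries(2)[where M = "ridge_family \<xi> ?m", OF ah sy])
    have ric: "jet_ricci G ?S = 0"
      by (simp add: jet_ricci_def pg(2) vec_eq_iff)
    have "jet_core G I (ridge_family \<xi> ?m) = (\<lambda>i js. 0)"
      by (simp add: fun_eq_iff curvature_core_def pg lower_endo_eq)
    then have "jet_laplace G ?S $ i $ j = t \<xi> ?m i j + t \<xi> ?m j i" for i j
      using all[of \<xi> ?m i j] by (simp add: contraction_op_0[OF \<Psi>])
    moreover have "jet_laplace G ?S $ i $ j = jet_gauge G (?S i) j + jet_gauge G (?S j) i" for i j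
      using jet_ricci_eq[where S = ?S, OF ah s1 s2, where j = i and k = j] by (simp add: ric)
    ultimately have sum0: "\<xi> $ i * D \<xi> ?s j + \<xi> $ j * D \<xi> ?s i = 0" for i j
      unfolding t w D_def by (simp add: algebra_simps)
    show ?thesis
    proof (cases "\<xi> = 0")
      case True
      have "symbol_core G (\<lambda>b. 0) (\<lambda>b. 0) = (\<lambda>p js. 0)"
        by (simp add: fun_eq_iff symbol_core_def lower_endo_eq)
      with True show ?thesis by (simp add: D_def contraction_op_0[OF \<Phi>] jet_gauge_def)
    next
      case False
      then obtain i where i: "\<xi> $ i \<noteq> 0" by (auto simp: vec_eq_iff)
      then have "D \<xi> ?s i = 0" using sum0[of i i] by simp
      then show ?thesis using sum0[of i j] i by simp
    qed
  qed
  have outer_add: "outer (a + a') b = outer a b + outer a' b" "outer b (a + a') = outer b a + outer b a'" for a a' b :: "real^'n"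
    by (simp_all add: vec_eq_iff outer_def algebra_simps)
  have D_add: "D \<xi> (s + s') j = D \<xi> s j + D \<xi> s' j" for \<xi> s s' j
    using D_lin[of \<xi> 1 s 1 s' j] by simp
  \<comment> \<open>Skewness in the first two arguments comes from \<open>key\<close> with the
    raised covector as the free vector.\<close>
  have tri: "D a (outer b c + outer c b) j = 0" for a b c
  proof (rule trilinear_vanishes[where f = "\<lambda>a b c. D a (outer b c + outer c b) j"])
    show "D a (outer a c + outer c a) j = 0" for a c
      using key[of a "matrix_inv G *v c"]
      by (simp add: matrix_vector_mul_assoc linear_ah_inv_right[OF ah])
  qed (simp_all add: D_lin' D_add outer_add add_ac)
  have sexp: "s = (\<Sum>p\<in>UNIV. \<Sum>q\<in>UNIV. (s $ p $ q / 2) *\<^sub>R (outer (frame p) (frame q) + outer (frame q) (frame p)))"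
  proof -
    have sk: "s $ l $ k = s $ k $ l" for k l by (metis s transpose_nth)
    have e1: "(\<Sum>p\<in>UNIV. \<Sum>q\<in>UNIV. (s $ p $ q / 2) * (frame p $ k * frame q $ l)) = s $ k $ l / 2" for k l
    proof -
      have "(s $ p $ q / 2) * (frame p $ k * frame q $ l) = (if q = l then if p = k then s $ p $ q / 2 else 0 else 0)" for p q
        by (simp add: axis_def)
      then show ?thesis by simp
    qed
    have e2: "(\<Sum>p\<in>UNIV. \<Sum>q\<in>UNIV. (s $ p $ q / 2) * (frame q $ k * frame p $ l)) = s $ k $ l / 2" for k l
    proof -
      have "(s $ p $ q / 2) * (frame q $ k * frame p $ l) = (if q = k then if p = l then s $ p $ q / 2 else 0 else 0)" for p q
        by (simp add: axis_def)
      then show ?thesis by (simp add: sk[of l k])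
    qed
    have "(\<Sum>p\<in>UNIV. \<Sum>q\<in>UNIV. (s $ p $ q / 2) *\<^sub>R (outer (frame p) (frame q) + outer (frame q) (frame p))) $ k $ l
        = s $ k $ l / 2 + s $ k $ l / 2" for k l
      by (simp only: sum_component vector_scaleR_component vector_add_component outer_def vec_lambda_beta
          distrib_left sum.distrib real_scaleR_def e1 e2)
    then show ?thesis by (simp add: vec_eq_iff)
  qed
  have dsum: "D \<xi> (\<Sum>p\<in>A. F p) j = (\<Sum>p\<in>A. D \<xi> (F p) j)" for A :: "'n set" and F
  proof -
    have "D \<xi> 0 j = 0" using D_lin[of \<xi> 0 0 0 0 j] by simp
    then show ?thesis by (induction A rule: infinite_finite_induct) (simp_all add: D_add)
  qed
  have dscale: "D \<xi> (x *\<^sub>R s) j = x * D \<xi> s j" for x s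
    using D_lin[of \<xi> x s 0 0 j] by simp
  have "D \<xi> s j = 0"
    using arg_cong[OF sexp, of "\<lambda>s. D \<xi> s j"] by (simp only: dsum dscale tri) simp
  then show ?thesis by (simp add: D_def)
qed

section \<open>The system on the models\<close>

lemma lower_endo_raise:
  assumes "linear_ah G I"
  shows "lower_endo G (raise_form G B) = B"
  by (simp add: lower_endo_eq raise_form_def transpose_ring linear_ah_inv_sym[OF assms]
      matrix_mul_assoc[symmetric] linear_ah_inv_left[OF assms])

lemma sym_lower:
  assumes "linear_ah G I"
  shows "(transpose Y ** G + G ** Y) $ i $ j = lower_endo G Y $ i $ j + lower_endo G Y $ j $ i"
proof -
  have "G ** Y = transpose (lower_endo G Y)"
    by (simp add: lower_endo_eq transpose_ring linear_ah_sym[OF assms])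
  then show ?thesis by (simp add: transpose_nth lower_endo_eq)
qed

text \<open>Where DJ vanishes, the quadratic term in the anticommutator of the second derivative
  with J disappears. The second derivative is then of the algebraic type to which the classification
  of one-forms applies.\<close>

lemma model_hess:
  assumes lah0: "linear_ah G I" and ad: "admissible I m N"
  shows "transpose (lower_endo G (hess G I (ridge_family \<xi> m) i a)) = - lower_endo G (hess G I (ridge_family \<xi> m) i a)"
    and "transpose I ** lower_endo G (hess G I (ridge_family \<xi> m) i a) = lower_endo G (hess G I (ridge_family \<xi> m) i a) ** I"
proof -
  interpret ah_field UNIV "model_g G \<xi> m" "model_J I \<xi> m N"
    by unfold_locales (rule model_ah[OF lah0 ad])
  let ?D = "hess G I (ridge_family \<xi> m) i a"
  have D: "D2J (model_g G \<xi> m) (model_J I \<xi> m N) i a 0 = ?D"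
    using normal_D2J[of 0 i a] by (simp add: model_jets)
  have sk: "transpose ?D ** G = - (G ** ?D)"
    using D2J_skew[of 0 i a] by (simp add: D model_jets)
  have "?D ** I + I ** ?D = 0"
    using D2J_anticommute[of 0 i a] normal_DJ[of 0] by (simp add: D model_jets)
  then have an: "?D ** I = - (I ** ?D)" by (simp add: eq_neg_iff_add_eq_0)
  show "transpose (lower_endo G ?D) = - lower_endo G ?D"
    by (simp add: lower_endo_eq transpose_ring linear_ah_sym[OF lah0] sk)
  have "transpose I ** transpose ?D = - (transpose ?D ** transpose I)"
    using arg_cong[OF an, of transpose] by (simp only: matrix_transpose_mul transpose_minus)
  then have "transpose I ** lower_endo G ?D = - (transpose ?D ** (transpose I ** G))"
    by (simp add: lower_endo_eq matrix_mul_assoc matrix_neg_left)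
  then show "transpose I ** lower_endo G ?D = lower_endo G ?D ** I"
    by (simp only: linear_ah_skew[OF lah0] matrix_neg_right minus_minus lower_endo_eq matrix_mul_assoc)
qed

text \<open>The gauge endomorphism splits into the DeTurck part, which produces Ric and R, and two
  parts \<open>E1\<close>, \<open>E2\<close> for the two one-forms contracted from DJ.\<close>

lemma models_values:
  fixes h K :: "'n::finite mop"
  assumes symb: "identity_symbol_mod_gauge h K"
    and \<Phi>h: "contraction_op natural_rank 2 \<Phi>h" and \<Phi>K: "contraction_op natural_rank 2 \<Phi>K"
    and h: "\<And>U g J x i j. ah_on U g J \<Longrightarrow> x \<in> U \<Longrightarrow>
      h g J x $ i $ j = \<Phi>h (g x) (J x) (\<lambda>i. natural_core i g J x) [i, j]"
    and K: "\<And>U g J x i j. ah_on U g J \<Longrightarrow> x \<in> U \<Longrightarrow>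
      lower_endo (g x) (K g J x) $ i $ j = \<Phi>K (g x) (J x) (\<lambda>i. natural_core i g J x) [i, j]"
    and sc: "scaling_system h K"
  obtains c c' where "\<And>G I \<xi> m N E1 E2. linear_ah G I \<Longrightarrow> admissible I m N \<Longrightarrow>
    (\<And>i j. lower_endo G E1 $ i $ j =
      contract_trace_J G I (\<lambda>a. lower_endo G (hess G I (ridge_family \<xi> m) i a)) j) \<Longrightarrow>
    (\<And>i j. lower_endo G E2 $ i $ j =
      contract_trace G (\<lambda>a. lower_endo G (hess G I (ridge_family \<xi> m) i a)) j) \<Longrightarrow>
    h (model_g G \<xi> m) (model_J I \<xi> m N) 0 = - 2 *\<^sub>R jet_ricci G (jet_g G (ridge_family \<xi> m))
      - c *\<^sub>R (transpose E1 ** G + G ** E1) - c' *\<^sub>R (transpose E2 ** G + G ** E2) \<and>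
    K (model_g G \<xi> m) (model_J I \<xi> m N) 0 = jet_laplace G (hess G I (ridge_family \<xi> m))
      + (matrix_inv G ** jet_ricci G (jet_g G (ridge_family \<xi> m)) ** I
         - I ** (matrix_inv G ** jet_ricci G (jet_g G (ridge_family \<xi> m))))
      + c *\<^sub>R (E1 ** I - I ** E1) + c' *\<^sub>R (E2 ** I - I ** E2)"
proof -
  have zh: "\<Phi>h G I scalar_core [i, j] = 0" if "linear_ah G I" for G I :: "real^'n^'n" and i j
    by (rule scalar_part_zero[OF \<Phi>h h _ that]) (use sc in \<open>auto simp: scaling_system_def\<close>)
  have zK: "\<Phi>K G I scalar_core [i, j] = 0" if "linear_ah G I" for G I :: "real^'n^'n" and i j
  proof (rule scalar_part_zero[OF \<Phi>K, where B = "\<lambda>g J x. lower_endo (g x) (K g J x)", OF K _ that])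
    fix r :: real and U and g J :: "'n mfield" and x assume r: "r > 0" "ah_on U g J" "x \<in> U"
    then have "K (\<lambda>y. r\<^sup>2 *\<^sub>R g y) J x = (1 / r\<^sup>2) *\<^sub>R K g J x"
      using sc unfolding scaling_system_def by blast
    then show "lower_endo (r\<^sup>2 *\<^sub>R g x) (K (\<lambda>y. r\<^sup>2 *\<^sub>R g y) J x) = lower_endo (g x) (K g J x)"
      using r(1) by (simp add: lower_endo_eq transpose_scalar matrix_scaleR_left matrix_scaleR_right)
  qed
  have vh: "h (model_g G \<xi> m) (model_J I \<xi> m N) 0 $ i $ j = \<Phi>h G I (jet_core G I (ridge_family \<xi> m)) [i, j]"
    if "linear_ah G I" "admissible I m N" for G I m N :: "real^'n^'n" and \<xi> i j
    using h[OF model_ah[OF that] UNIV_I, of \<xi> 0 i j] model_value[OF \<Phi>h that, of "[i, j]" \<xi>]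
    by (simp add: model_jets zh[OF that(1)])
  have vK: "lower_endo G (K (model_g G \<xi> m) (model_J I \<xi> m N) 0) $ i $ j = \<Phi>K G I (jet_core G I (ridge_family \<xi> m)) [i, j]"
    if "linear_ah G I" "admissible I m N" for G I m N :: "real^'n^'n" and \<xi> i j
    using K[OF model_ah[OF that] UNIV_I, of \<xi> 0 i j] model_value[OF \<Phi>K that, of "[i, j]" \<xi>]
    by (simp add: model_jets zK[OF that(1)])
  have flat: "h (\<lambda>x. G) (\<lambda>x. I) 0 = 0 \<and> K (\<lambda>x. G) (\<lambda>x. I) 0 = 0" if "linear_ah G I" for G I :: "real^'n^'n"
  proof
    show "h (\<lambda>x. G) (\<lambda>x. I) 0 = 0"
      using vh[OF that admissible_zero, of 0]
      by (simp add: vec_eq_iff model_const jet_core_zero contraction_op_0[OF \<Phi>h])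
    have "lower_endo G (K (\<lambda>x. G) (\<lambda>x. I) 0) = lower_endo G 0"
      using vK[OF that admissible_zero, of 0]
      by (simp add: vec_eq_iff model_const jet_core_zero contraction_op_0[OF \<Phi>K]) (simp add: lower_endo_nth)
    then show "K (\<lambda>x. G) (\<lambda>x. I) 0 = 0" by (rule lower_endo_inject[OF that])
  qed
  obtain \<Phi> where \<Phi>: "contraction_op (\<lambda>_. 3) 1 \<Phi>"
    and Y: "\<And>(G::real^'n^'n) I \<xi> m N. linear_ah G I \<Longrightarrow> admissible I m N \<Longrightarrow> \<exists>Y.
    (\<forall>i j. lower_endo G Y $ i $ j =
      \<Phi> G I (symbol_core G (jet_g G (ridge_family \<xi> m) i) (hess G I (ridge_family \<xi> m) i)) [j]) \<and>
    h (model_g G \<xi> m) (model_J I \<xi> m N) 0 =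
      jet_laplace G (jet_g G (ridge_family \<xi> m)) - (transpose Y ** G + G ** Y) \<and>
    K (model_g G \<xi> m) (model_J I \<xi> m N) 0 =
      jet_laplace G (jet_J I (ridge_family \<xi> m)) + (Y ** I - I ** Y)"
  proof -
    have "\<And>(G::real^'n^'n) I. linear_ah G I \<Longrightarrow> h (\<lambda>x. G) (\<lambda>x. I) 0 = 0 \<and> K (\<lambda>x. G) (\<lambda>x. I) 0 = 0"
      by (rule flat)
    note symbol_on_models[OF symb, OF this]
    then show ?thesis using that by blast
  qed
  \<comment> \<open>Fixed before any pair (G, I): the constants belong to the operator of the gauge
    form.\<close>
  obtain c c' where cc: "\<And>G I (b :: 'n \<Rightarrow> real^'n^'n) j. linear_ah G I \<Longrightarrow>
    \<forall>i. transpose (b i) = - b i \<Longrightarrow> \<forall>i. transpose I ** b i = b i ** I \<Longrightarrow>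
    \<Phi> G I (\<lambda>i js. if i = 1 then b (js!0) $ (js!1) $ (js!2) else 0) [j] =
    c * contract_trace_J G I b j + c' * contract_trace G b j"
    using contraction_op_one_form[OF \<Phi>, of 1] by blast
  show ?thesis
  proof (rule that[of c c'])
    fix G I :: "real^'n^'n" and \<xi> m N E1 E2
    assume ah: "linear_ah G I" and ad: "admissible I m N"
    let ?M = "ridge_family \<xi> m"
    let ?S = "jet_g G ?M" and ?D = "hess G I ?M"
    assume E1: "\<And>i j. lower_endo G E1 $ i $ j = contract_trace_J G I (\<lambda>a. lower_endo G (?D i a)) j"
      and E2: "\<And>i j. lower_endo G E2 $ i $ j = contract_trace G (\<lambda>a. lower_endo G (?D i a)) j"
    have eq: "\<Phi>h G I (jet_core G I (ridge_family \<xi> m)) [i, j] =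
      jet_laplace G (jet_g G (ridge_family \<xi> m)) $ i $ j
      - \<Phi> G I (symbol_core G (jet_g G (ridge_family \<xi> m) i) (hess G I (ridge_family \<xi> m) i)) [j]
      - \<Phi> G I (symbol_core G (jet_g G (ridge_family \<xi> m) j) (hess G I (ridge_family \<xi> m) j)) [i]"
      if ad: "admissible I m N" for \<xi> m N i j
    proof -
      obtain Y where Y: "\<And>i j. lower_endo G Y $ i $ j =
          \<Phi> G I (symbol_core G (jet_g G (ridge_family \<xi> m) i) (hess G I (ridge_family \<xi> m) i)) [j]"
        "h (model_g G \<xi> m) (model_J I \<xi> m N) 0 =
          jet_laplace G (jet_g G (ridge_family \<xi> m)) - (transpose Y ** G + G ** Y)"
        using Y[OF ah ad, of \<xi>] by blast
      show ?thesis
        unfolding vh[OF ah ad, symmetric] Y(2) vector_minus_component sym_lower[OF ah] Y(1) by simp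
    qed
    obtain Y where Y1: "\<And>i j. lower_endo G Y $ i $ j = \<Phi> G I (symbol_core G (?S i) (?D i)) [j]"
      and Yh: "h (model_g G \<xi> m) (model_J I \<xi> m N) 0 = jet_laplace G ?S - (transpose Y ** G + G ** Y)"
      and YK: "K (model_g G \<xi> m) (model_J I \<xi> m N) 0 = jet_laplace G (jet_J I ?M) + (Y ** I - I ** Y)"
      using Y[OF ah ad, of \<xi>] by blast
    have sy: "?M a b = ?M b a" for a b by (simp add: mult.commute)
    have s1: "?S a b = ?S b a" for a b by (rule jet_g_symmetries(1)[where M = ?M, OF ah sy])
    have s2: "transpose (?S a b) = ?S a b" for a b by (rule jet_g_symmetries(2)[where M = ?M, OF ah sy])
    \<comment> \<open>For a fixed direction i the metric jet of a ridge has the form xi_b s with s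
      symmetric, as \<open>gauge_symbol\<close> requires.\<close>
    have g: "\<Phi> G I (symbol_core G (?S i) (\<lambda>b. 0)) [j] = jet_gauge G (?S i) j" for i j
    proof -
      have "?S i = (\<lambda>b. \<xi> $ b *\<^sub>R (\<xi> $ i *\<^sub>R (transpose m ** G + G ** m)))"
        by (simp add: fun_eq_iff jet_g_def transpose_scalar matrix_scaleR_left matrix_scaleR_right
            scaleR_add_right mult.commute)
      moreover have "transpose (\<xi> $ i *\<^sub>R (transpose m ** G + G ** m)) = \<xi> $ i *\<^sub>R (transpose m ** G + G ** m)"
        by (simp add: transpose_ring linear_ah_sym[OF ah] add.commute)
      ultimately show ?thesis 
        using gauge_symbol[OF \<Phi> \<Phi>h ah, of "\<xi> $ i *\<^sub>R (transpose m ** G + G ** m)" \<xi> j] eq by simp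
    qed
    have d: "\<Phi> G I (symbol_core G (\<lambda>b. 0) (?D i)) [j] =
        c * lower_endo G E1 $ i $ j + c' * lower_endo G E2 $ i $ j" for i j
    proof -
      have "symbol_core G (\<lambda>b. 0) (?D i) = (\<lambda>p js. if p = 1 then (\<lambda>a. lower_endo G (?D i a)) (js!0) $ (js!1) $ (js!2) else 0)"
        by (simp add: fun_eq_iff symbol_core_def)
      then show ?thesis
        using cc[OF ah, of "\<lambda>a. lower_endo G (?D i a)" j] model_hess[OF ah ad] E1 E2 by simp
    qed
    have Ylow: "lower_endo G Y $ i $ j = jet_gauge G (?S i) j + (c * lower_endo G E1 $ i $ j + c' * lower_endo G E2 $ i $ j)" for i j
    proof -
      have "symbol_core G (?S i) (?D i) = (\<lambda>p js. symbol_core G (?S i) (\<lambda>b. 0) p js + symbol_core G (\<lambda>b. 0) (?D i) p js)"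
        by (simp add: fun_eq_iff symbol_core_def lower_endo_eq)
      then show ?thesis unfolding Y1 by (simp add: contraction_op_add[OF \<Phi>] g d)
    qed
    \<comment> \<open>The DeTurck part of \<open>Y\<close>.\<close>
    define W where "W = Y - (c *\<^sub>R E1 + c' *\<^sub>R E2)"
    have W: "lower_endo G W $ i $ j = jet_gauge G (?S i) j" for i j
    proof -
      have "lower_endo G W = lower_endo G Y - (c *\<^sub>R lower_endo G E1 + c' *\<^sub>R lower_endo G E2)"
        by (simp add: W_def lower_endo_eq transpose_ring matrix_ring)
      then show ?thesis by (simp add: Ylow)
    qed
    have YW: "Y = W + (c *\<^sub>R E1 + c' *\<^sub>R E2)" by (simp add: W_def)
    have r: "jet_laplace G ?S - (transpose W ** G + G ** W) = - 2 *\<^sub>R jet_ricci G ?S"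
      using jet_ricci_eq[where S = ?S, OF ah s1 s2]
      unfolding vec_eq_iff vector_minus_component sym_lower[OF ah] W by simp
    have "h (model_g G \<xi> m) (model_J I \<xi> m N) 0 = (jet_laplace G ?S - (transpose W ** G + G ** W))
      - c *\<^sub>R (transpose E1 ** G + G ** E1) - c' *\<^sub>R (transpose E2 ** G + G ** E2)"
      unfolding Yh YW by (simp add: transpose_ring matrix_ring scaleR_add_right)
    moreover have "K (model_g G \<xi> m) (model_J I \<xi> m N) 0 = jet_laplace G ?D
      + (matrix_inv G ** jet_ricci G ?S ** I - I ** (matrix_inv G ** jet_ricci G ?S))
      + c *\<^sub>R (E1 ** I - I ** E1) + c' *\<^sub>R (E2 ** I - I ** E2)"
    proof -
      \<comment> \<open>The traced derivative of the connection, by which the covariant Laplacian of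
        J exceeds the coordinate one.\<close>
      let ?C = "\<Sum>a\<in>UNIV. \<Sum>b\<in>UNIV. matrix_inv G $ a $ b *\<^sub>R jet_Gamma G ?S a b"
      have "W = ?C + matrix_inv G ** jet_ricci G ?S"
        by (rule jet_gauge_endo[where S = ?S, OF ah s1 s2, symmetric]) (rule W)
      moreover have "jet_laplace G ?D = jet_laplace G (jet_J I ?M) + (?C ** I - I ** ?C)"
        by (simp add: jet_laplace_def jet_D2J_def scaleR_add_right scaleR_diff_right sum.distrib sum_subtractf
            matrix_sum_left matrix_sum_right matrix_scaleR_left matrix_scaleR_right)
      ultimately show ?thesis
        unfolding YK YW by (simp add: matrix_ring scaleR_diff_right)
    qed
    ultimately show "h (model_g G \<xi> m) (model_J I \<xi> m N) 0 = - 2 *\<^sub>R jet_ricci G ?S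
      - c *\<^sub>R (transpose E1 ** G + G ** E1) - c' *\<^sub>R (transpose E2 ** G + G ** E2) \<and>
      K (model_g G \<xi> m) (model_J I \<xi> m N) 0 = jet_laplace G ?D
      + (matrix_inv G ** jet_ricci G ?S ** I - I ** (matrix_inv G ** jet_ricci G ?S))
      + c *\<^sub>R (E1 ** I - I ** E1) + c' *\<^sub>R (E2 ** I - I ** E2)" by (simp only: r)
  qed
qed

text \<open>As DJ vanishes at the origin, N and the transport term of the Lie derivative disappear,
  and the derivative of \<theta> is precisely the trace with J of the second derivative of
  J.\<close>

lemma model_terms:
  fixes G I m N :: "real^'n::finite^'n" and \<xi> :: "real^'n"
  assumes lah0: "linear_ah G I" and ad: "admissible I m N"
  shows "ricci (model_g G \<xi> m) 0 = jet_ricci G (jet_g G (ridge_family \<xi> m))"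
    and "rough_laplacian (model_g G \<xi> m) (model_J I \<xi> m N) 0 + N_endo (model_g G \<xi> m) (model_J I \<xi> m N) 0 + R_endo (model_g G \<xi> m) (model_J I \<xi> m N) 0 = jet_laplace G (hess G I (ridge_family \<xi> m))
      + (matrix_inv G ** jet_ricci G (jet_g G (ridge_family \<xi> m)) ** I
         - I ** (matrix_inv G ** jet_ricci G (jet_g G (ridge_family \<xi> m))))"
    and "lower_endo G (nabla_theta (model_g G \<xi> m) (model_J I \<xi> m N) 0) $ i $ j =
      contract_trace_J G I (\<lambda>a. lower_endo G (hess G I (ridge_family \<xi> m) i a)) j"
    and "lie_form (theta_sharp (model_g G \<xi> m) (model_J I \<xi> m N)) (model_g G \<xi> m) 0 = transpose (nabla_theta (model_g G \<xi> m) (model_J I \<xi> m N) 0) ** G + G ** nabla_theta (model_g G \<xi> m) (model_J I \<xi> m N) 0"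
    and "lie_endo (theta_sharp (model_g G \<xi> m) (model_J I \<xi> m N)) (model_J I \<xi> m N) 0 = - (nabla_theta (model_g G \<xi> m) (model_J I \<xi> m N) 0 ** I - I ** nabla_theta (model_g G \<xi> m) (model_J I \<xi> m N) 0)"
proof -
  define mg where "mg = model_g G \<xi> m"
  define mJ where "mJ = model_J I \<xi> m N"
  note md = mg_def[symmetric] mJ_def[symmetric]
  interpret ah_field UNIV mg mJ
    unfolding mg_def mJ_def by unfold_locales (rule model_ah[OF lah0 ad])
  have j0: "mg 0 = G" "mJ 0 = I" "\<And>i. pd i mg 0 = 0" "\<And>i. pd i mJ 0 = 0"
    "\<And>a b. pd a (pd b mg) 0 = jet_g G (ridge_family \<xi> m) a b"
    "\<And>a b. pd a (pd b mJ) 0 = jet_J I (ridge_family \<xi> m) a b"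
    by (simp_all add: mg_def mJ_def model_jets)
  note U = UNIV_I[of "0 :: real^'n"]
  have DJ: "DJ mg mJ i 0 = 0" for i by (rule normal_DJ[OF U j0(3,4)])
  have D: "D2J mg mJ i a 0 = hess G I (ridge_family \<xi> m) i a" for i a
    using normal_D2J[OF U j0(3,4)] by (simp add: j0)
  have R: "riemann mg i a 0 = curv G (ridge_family \<xi> m) i a" for i a
    using normal_riemann[OF U j0(3,4)] by (simp add: j0)
  have ric: "ricci mg 0 = jet_ricci G (jet_g G (ridge_family \<xi> m))"
    by (simp add: ricci_def jet_ricci_def R)
  then show "ricci (model_g G \<xi> m) 0 = jet_ricci G (jet_g G (ridge_family \<xi> m))" unfolding md .
  show "rough_laplacian (model_g G \<xi> m) (model_J I \<xi> m N) 0 + N_endo (model_g G \<xi> m) (model_J I \<xi> m N) 0 + R_endo (model_g G \<xi> m) (model_J I \<xi> m N) 0 = jet_laplace G (hess G I (ridge_family \<xi> m))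
      + (matrix_inv G ** jet_ricci G (jet_g G (ridge_family \<xi> m)) ** I
         - I ** (matrix_inv G ** jet_ricci G (jet_g G (ridge_family \<xi> m))))"
    unfolding md by (simp add: rough_laplacian_def N_endo_eq[OF U] DJ R_endo_eq[OF U] ric j0 D jet_laplace_def matrix_mul_assoc)
  have z: "DJDJ_t mg mJ 0 js = 0" for js by (simp add: DJDJ_t_def DJ_t_def DJ bil_def)
  have Dt: "D2J_t mg mJ 0 [i, a, q, j] = lower_endo G (hess G I (ridge_family \<xi> m) i a) $ q $ j" for a q
    by (simp add: D2J_t_eq D j0)
  have "matrix_inv G $ a $ b = matrix_inv G $ b $ a" for a b
    using gi_sym[OF U] by (simp add: j0)
  then show "lower_endo G (nabla_theta (model_g G \<xi> m) (model_J I \<xi> m N) 0) $ i $ j =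
      contract_trace_J G I (\<lambda>a. lower_endo G (hess G I (ridge_family \<xi> m) i a)) j"
    unfolding md using nabla_theta_contraction[OF U, of i j]
    by (simp add: z Dt j0 contract_trace_J_def contract_trace_def matrix_mult_nth transpose_nth)
  show "lie_form (theta_sharp (model_g G \<xi> m) (model_J I \<xi> m N)) (model_g G \<xi> m) 0 = transpose (nabla_theta (model_g G \<xi> m) (model_J I \<xi> m N) 0) ** G + G ** nabla_theta (model_g G \<xi> m) (model_J I \<xi> m N) 0"
    unfolding md by (simp add: lie_form_theta_sharp[OF U] j0)
  show "lie_endo (theta_sharp (model_g G \<xi> m) (model_J I \<xi> m N)) (model_J I \<xi> m N) 0 = - (nabla_theta (model_g G \<xi> m) (model_J I \<xi> m N) 0 ** I - I ** nabla_theta (model_g G \<xi> m) (model_J I \<xi> m N) 0)"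
    unfolding md by (simp add: lie_endo_theta_sharp[OF U] DJ j0)
qed

lemma natural_op:
  fixes B :: "'n::finite mop"
  assumes "form_contraction natural_cores B"
  obtains \<Phi> where "contraction_op natural_rank 2 \<Phi>" "\<And>U g J x i j. ah_on U g J \<Longrightarrow> x \<in> U \<Longrightarrow>
    B g J x $ i $ j = \<Phi> (g x) (J x) (\<lambda>i. natural_core i g J x) [i, j]"
proof -
  obtain T where T: "contraction natural_cores 2 T"
    "\<forall>U g J. ah_on U g J \<longrightarrow> (\<forall>x\<in>U. \<forall>i j. B g J x $ i $ j = T g J x [i, j])"
    using assms unfolding form_contraction_def by (elim exE conjE)
  obtain \<Phi> where \<Phi>: "contraction_op natural_rank 2 \<Phi>"
    "T = (\<lambda>g J x. \<Phi> (g x) (J x) (\<lambda>i. natural_core i g J x))"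
    using contraction_imp_op[OF T(1)[unfolded natural_cores_range]] by (elim exE conjE)
  show thesis by (rule that[OF \<Phi>(1)]) (simp add: T(2)[unfolded \<Phi>(2), rule_format])
qed

text \<open>Parity removes the second one-form: it changes sign with J, while \<theta> contains an
  even number of copies of J.\<close>

lemma models_rhs:
  fixes h K :: "'n::finite mop"
  assumes nat: "natural_system h K" and par: "parity_system h K"
    and sc: "scaling_system h K" and symb: "identity_symbol_mod_gauge h K"
  shows "\<exists>a. \<forall>G I \<xi> m N. linear_ah G I \<longrightarrow> admissible I m N \<longrightarrow>
    h (model_g G \<xi> m) (model_J I \<xi> m N) 0 = metric_rhs a (\<lambda>g J x. 0) (model_g G \<xi> m) (model_J I \<xi> m N) 0 \<and>
    K (model_g G \<xi> m) (model_J I \<xi> m N) 0 = acs_rhs a (\<lambda>g J x. 0) (model_g G \<xi> m) (model_J I \<xi> m N) 0"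
proof -
  have nat': "form_contraction natural_cores h" "form_contraction natural_cores (\<lambda>g J x. lower_endo (g x) (K g J x))"
    using nat by (simp_all add: natural_system_def endo_contraction_def)
  obtain \<Phi>h where \<Phi>h: "contraction_op natural_rank 2 \<Phi>h" "\<And>U g J x i j. ah_on U g J \<Longrightarrow> x \<in> U \<Longrightarrow>
      h g J x $ i $ j = \<Phi>h (g x) (J x) (\<lambda>i. natural_core i g J x) [i, j]"
    by (rule natural_op[OF nat'(1)], rule that, assumption, blast)
  obtain \<Phi>K where \<Phi>K: "contraction_op natural_rank 2 \<Phi>K" "\<And>U g J x i j. ah_on U g J \<Longrightarrow> x \<in> U \<Longrightarrow>
      lower_endo (g x) (K g J x) $ i $ j = \<Phi>K (g x) (J x) (\<lambda>i. natural_core i g J x) [i, j]"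
    by (rule natural_op[OF nat'(2)], rule that, assumption, blast)
  show ?thesis
  proof (rule models_values[OF symb \<Phi>h(1) \<Phi>K(1)], goal_cases)
    case 1 then show ?case by (rule \<Phi>h(2))
  next
    case 2 then show ?case by (rule \<Phi>K(2))
  next
    case 3 show ?case by (rule sc)
  next
    case (4 c c')
    note v = 4
  show ?thesis
  \<comment> \<open>The gauge Lie derivative is added to (h, K) in the symbol condition and so
    appears here with a minus sign.\<close>
  proof (rule exI[of _ "- c"], intro allI impI)
    fix G I :: "real^'n^'n" and \<xi> m N assume ah: "linear_ah G I" and ad: "admissible I m N"
    let ?g = "model_g G \<xi> m" and ?J = "model_J I \<xi> m N" and ?M = "ridge_family \<xi> m"
    let ?b = "\<lambda>I i a. lower_endo G (hess G I ?M i a)"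
    define E1 where "E1 = nabla_theta ?g ?J 0"
    define E2 where "E2 = raise_form G (\<chi> i j. contract_trace G (?b I i) j)"
    have E1: "lower_endo G E1 $ i $ j = contract_trace_J G I (?b I i) j" for i j
      unfolding E1_def by (rule model_terms(3)[OF ah ad])
    have E2: "lower_endo G E2 $ i $ j = contract_trace G (?b I i) j" for i j
      unfolding E2_def lower_endo_raise[OF ah] by simp
    have neg: "lower_endo G (- A) = - lower_endo G A" for A
      by (simp add: lower_endo_eq transpose_minus matrix_neg_left)
    have hn: "hess G (- I) ?M i a = - hess G I ?M i a" for i a
      by (simp add: jet_D2J_def jet_J_def matrix_neg_left matrix_neg_right)
    have bn: "?b (- I) i a = - ?b I i a" for i a by (simp only: hn neg)
    \<comment> \<open>Replacing I by -I also negates the second derivative of J: \<open>E1\<close>,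
      which involves both, is unchanged, and \<open>E2\<close> changes sign.\<close>
    have E1': "lower_endo G E1 $ i $ j = contract_trace_J G (- I) (?b (- I) i) j" for i j
      unfolding bn E1 contract_trace_J_def by (simp add: transpose_minus matrix_neg_left matrix_neg_right)
    have E2': "lower_endo G (- E2) $ i $ j = contract_trace G (?b (- I) i) j" for i j
      unfolding bn neg by (simp add: E2 contract_trace_def sum_negf)
    have v1: "h ?g ?J 0 = - 2 *\<^sub>R jet_ricci G (jet_g G ?M)
        - c *\<^sub>R (transpose E1 ** G + G ** E1) - c' *\<^sub>R (transpose E2 ** G + G ** E2)"
      "K ?g ?J 0 = jet_laplace G (hess G I ?M)
        + (matrix_inv G ** jet_ricci G (jet_g G ?M) ** I - I ** (matrix_inv G ** jet_ricci G (jet_g G ?M)))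
        + c *\<^sub>R (E1 ** I - I ** E1) + c' *\<^sub>R (E2 ** I - I ** E2)"
      using v[OF ah ad E1 E2] by blast+
    have v2: "h ?g (model_J (- I) \<xi> m (- N)) 0 = - 2 *\<^sub>R jet_ricci G (jet_g G ?M)
        - c *\<^sub>R (transpose E1 ** G + G ** E1) - c' *\<^sub>R (transpose (- E2) ** G + G ** (- E2))"
      "K ?g (model_J (- I) \<xi> m (- N)) 0 = jet_laplace G (hess G (- I) ?M)
        + (matrix_inv G ** jet_ricci G (jet_g G ?M) ** (- I) - (- I) ** (matrix_inv G ** jet_ricci G (jet_g G ?M)))
        + c *\<^sub>R (E1 ** (- I) - (- I) ** E1) + c' *\<^sub>R ((- E2) ** (- I) - (- I) ** (- E2))"
      using v[OF linear_ah_uminus[OF ah] admissible_uminus[OF ad] E1' E2'] by blast+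
    have par': "h ?g (model_J (- I) \<xi> m (- N)) 0 = h ?g ?J 0" "K ?g (model_J (- I) \<xi> m (- N)) 0 = - K ?g ?J 0"
      using par model_ah[OF ah ad, of \<xi>] unfolding parity_system_def model_J_uminus by blast+
    have dbl: "A = 0" if "A = - A" for A :: "real^'n^'n"
    proof -
      have "2 *\<^sub>R A = A + A" by (simp add: scaleR_2)
      also have "\<dots> = 0" using that by (metis add.right_inverse)
      finally show ?thesis by simp
    qed
    have z1: "c' *\<^sub>R (transpose E2 ** G + G ** E2) = 0"
    proof (rule dbl)
      have "c' *\<^sub>R (transpose E2 ** G + G ** E2) = c' *\<^sub>R (transpose (- E2) ** G + G ** (- E2))"
        using par'(1) unfolding v1(1) v2(1) by auto
      also have "transpose (- E2) ** G + G ** (- E2) = - (transpose E2 ** G + G ** E2)"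
        by (simp add: transpose_minus matrix_neg_left matrix_neg_right)
      finally show "c' *\<^sub>R (transpose E2 ** G + G ** E2) = - (c' *\<^sub>R (transpose E2 ** G + G ** E2))"
        by (rule trans[OF _ scaleR_minus_right])
    qed
    have z2: "c' *\<^sub>R (E2 ** I - I ** E2) = 0"
    proof (rule dbl)
      let ?X = "jet_laplace G (hess G I ?M)" and ?Y = "matrix_inv G ** jet_ricci G (jet_g G ?M)"
      have "jet_laplace G (hess G (- I) ?M) = - ?X" by (simp add: jet_laplace_def hn sum_negf)
      then have "- ?X - (?Y ** I - I ** ?Y) - c *\<^sub>R (E1 ** I - I ** E1) + c' *\<^sub>R (E2 ** I - I ** E2) =
          - (?X + (?Y ** I - I ** ?Y) + c *\<^sub>R (E1 ** I - I ** E1) + c' *\<^sub>R (E2 ** I - I ** E2))"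
        using par'(2) unfolding v1(2) v2(2)
        by (simp add: matrix_neg_left matrix_neg_right scaleR_diff_right)
      then show "c' *\<^sub>R (E2 ** I - I ** E2) = - (c' *\<^sub>R (E2 ** I - I ** E2))" by simp
    qed
    show "h ?g ?J 0 = metric_rhs (- c) (\<lambda>g J x. 0) ?g ?J 0 \<and> K ?g ?J 0 = acs_rhs (- c) (\<lambda>g J x. 0) ?g ?J 0"
      unfolding metric_rhs_def acs_rhs_def model_terms(1,2,4,5)[OF ah ad] v1 z1 z2 E1_def[symmetric] by (simp add: scaleR_diff_right)
  qed
  qed
qed

section \<open>The remainder\<close>

text \<open>A particular solution X of X I + I X = -(A_i A_j + A_j A_i): the bracket commutes with
  I, and I^2 = -1. The factor 1/2 compensates for the two equal terms.\<close>

definition DJ_square :: "real^'n^'n \<Rightarrow> ('n \<Rightarrow> real^'n^'n) \<Rightarrow> 'n::finite \<Rightarrow> 'n \<Rightarrow> real^'n^'n" where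
  "DJ_square I A i j = (1/2) *\<^sub>R (I ** (A i ** A j + A j ** A i))"

text \<open>What is left of each natural core after its curvature part and its scalar part have been
  removed.\<close>

definition quadratic_core :: "nat \<Rightarrow> 'n::finite top" where
  "quadratic_core i g J x js = (if i = 0 then 0
     else if i = 1 then lower_endo (g x) (DJ_square (J x) (\<lambda>a. DJ g J a x) (js!0) (js!1)) $ (js!2) $ (js!3)
     else if i = 2 then DJDJ_t g J x js else 0)"

lemma quadratic_core_is_contraction:
  "is_contraction DJ_DJ_cores (natural_rank i) (quadratic_core i :: 'n::finite top)"
proof -
  let ?C = "DJ_DJ_cores :: (nat \<times> 'n top) set"
  have 6: "is_contraction ?C 6 DJDJ_t"
    by (rule is_contraction_core) (simp add: DJ_DJ_cores_def)
  have 4: "is_contraction ?C 4 (\<lambda>g J x js. \<Sum>a\<in>UNIV. \<Sum>b\<in>UNIV. matrix_inv (g x) $ a $ b *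
      DJDJ_t g J x (a # b # js))" by (rule is_contraction_contract[OF 6]) simp
  have 2: "is_contraction ?C 2 (\<lambda>g J x js. \<Sum>a\<in>UNIV. \<Sum>b\<in>UNIV. matrix_inv (g x) $ a $ b *
      (\<Sum>c\<in>UNIV. \<Sum>d\<in>UNIV. matrix_inv (g x) $ c $ d * DJDJ_t g J x (c # d # a # b # js)))"
    by (rule is_contraction_contract[OF 4]) simp
  \<comment> \<open>The zero tensor of each needed rank is a contraction of the core, multiplied by
    0.\<close>
  have "is_contraction ?C 4 (\<lambda>g J x js. 0)" using is_contraction_scale[OF 4, of 0] by simp
  moreover have "is_contraction ?C 0 (\<lambda>g J x js. 0)"
    using is_contraction_scale[OF is_contraction_contract[OF 2, of 0], of 0] by simp
  moreover have "is_contraction ?C 4 (\<lambda>g J x js.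
      lower_endo (g x) (DJ_square (J x) (\<lambda>a. DJ g J a x) (js!0) (js!1)) $ (js!2) $ (js!3))"
  proof -
    \<comment> \<open>Arranged so that the last slot of the second factor can be precomposed with J
      and the remaining pair contracted; the result is the (k, l) entry of a_j g^(-1) a_i J with a
      the lowered DJ.\<close>
    have "is_contraction ?C 6 (\<lambda>g J x is. DJDJ_t g J x (map ((!) is) [4, 5, 0, 3, 1, 2]))"
      by (rule is_contraction_perm[OF 6]) (auto simp: upt_4_6)
    then have "is_contraction ?C 4 (\<lambda>g J x is. \<Sum>c\<in>UNIV. \<Sum>d\<in>UNIV. matrix_inv (g x) $ c $ d *
        DJDJ_t g J x (map ((!) (c # d # is)) [4, 5, 0, 3, 1, 2]))" (is "is_contraction _ _ ?E")
      by (rule is_contraction_contract) simp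
    then have "is_contraction ?C 4 (\<lambda>g J x is. \<Sum>q\<in>UNIV. J x $ q $ hd is * ?E g J x (q # tl is))"
      (is "is_contraction _ _ ?T") by (rule is_contraction_J_hd) simp
    then have "is_contraction ?C 4 (\<lambda>g J x is. ?T g J x (map ((!) is) [3, 0, 1, 2]))"
      (is "is_contraction _ _ ?Q") by (rule is_contraction_perm) (auto simp: upt_4_6)
    moreover from this have "is_contraction ?C 4 (\<lambda>g J x is. ?Q g J x (map ((!) is) [1, 0, 2, 3]))"
      by (rule is_contraction_perm) (auto simp: upt_4_6)
    ultimately have "is_contraction ?C 4 (\<lambda>g J x is. - (1/2) *
        (?Q g J x is + ?Q g J x (map ((!) is) [1, 0, 2, 3])))"
      by (intro is_contraction_scale is_contraction_add)
    then show ?thesis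
    proof (rule is_contraction_cong)
      fix U and g J :: "'n mfield" and x and "is" :: "'n list"
      assume ah: "ah_on U g J" and x: "x \<in> U" and len: "length is = 4"
      interpret ah_field U g J by unfold_locales (rule ah)
      obtain i j k l where ijkl: "is = [i, j, k, l]"
        using len by (auto simp: length_Suc_conv eval_nat_numeral)
      let ?a = "\<lambda>i. lower_endo (g x) (DJ g J i x)"
      have t: "transpose (DJ g J i x) ** transpose (DJ g J j x) ** transpose (J x) ** g x =
          - (?a i ** gi x ** ?a j ** J x)" for i j
      proof -
        have "transpose (DJ g J i x) ** transpose (DJ g J j x) ** transpose (J x) ** g x =
          - (transpose (DJ g J i x) ** (transpose (DJ g J j x) ** g x) ** J x)"
          by (simp add: matrix_mul_assoc[symmetric] linear_ah_skew[OF lah[OF x]] matrix_neg_right)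
        also have "transpose (DJ g J j x) ** g x = ?a j" by (simp add: lower_endo_eq)
        finally show ?thesis by (simp only: DJ_from_lower(1)[OF x, of i])
      qed
      have "lower_endo (g x) (DJ_square (J x) (\<lambda>a. DJ g J a x) i j) = - (1/2) *\<^sub>R
          (?a j ** gi x ** ?a i ** J x + ?a i ** gi x ** ?a j ** J x)"
        unfolding DJ_square_def lower_endo_eq transpose_scalar matrix_transpose_mul transpose_add
        by (simp add: matrix_add_rdistrib matrix_scaleR_left t[unfolded lower_endo_eq] scaleR_add_right)
      moreover have "(?a j ** gi x ** ?a i ** J x) $ k $ l = ?Q g J x [i, j, k, l]" for i j
        by (simp add: matrix_mult_nth DJDJ_t_eq sum_distrib_left sum_distrib_right mult_ac)
           (rule sum.cong[OF refl], rule sum.swap)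
      ultimately show "lower_endo (g x) (DJ_square (J x) (\<lambda>a. DJ g J a x) (is!0) (is!1)) $ (is!2) $ (is!3) =
          - (1/2) * (?Q g J x is + ?Q g J x (map ((!) is) [1, 0, 2, 3]))"
        unfolding ijkl by simp
    qed
  qed
  moreover consider "i = 0" | "i = 1" | "i = 2" | "i > 2" by linarith
  ultimately show ?thesis
    by cases (simp_all add: 6 natural_rank_def quadratic_core_def[abs_def])
qed

lemma natural_core_split:
  assumes "length js = natural_rank i"
  shows "natural_core i g J x js =
    curvature_core (g x) (\<lambda>i j. riemann g i j x) (\<lambda>i j. D2J g J i j x - DJ_square (J x) (\<lambda>a. DJ g J a x) i j) i js
    + quadratic_core i g J x js + scalar_core i js"
proof -
  consider "i = 0" | "i = 1" | "i = 2" | "i > 2" by linarith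
  then show ?thesis
    by cases (simp_all add: natural_core_def natural_rank_def curvature_core_def quadratic_core_def Rm_t_def
        D2J_t_def lower_endo_eq bil_mult_left bil_frame transpose_diff matrix_sub_rdistrib)
qed

text \<open>Subtracting the quadratic term makes the second covariant derivative of \<^term>\<open>J\<close> anticommute
  with \<^term>\<open>J\<close>, so that it is, together with the curvature, the second jet of a model.\<close>

lemma (in ah_field) curvature_realized:
  assumes x: "x \<in> U"
  obtains M where "\<And>a b. M a b = M b a"
    "curvature_core (g x) (\<lambda>i j. riemann g i j x) (\<lambda>i j. D2J g J i j x - DJ_square (J x) (\<lambda>a. DJ g J a x) i j) =
      jet_core (g x) (J x) M"
proof -
  let ?A = "\<lambda>a. DJ g J a x" and ?I = "J x" and ?G = "g x"
  let ?S = "\<lambda>i j. ?A i ** ?A j + ?A j ** ?A i"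
  let ?D = "\<lambda>i j. D2J g J i j x - DJ_square ?I ?A i j"
  have comm2: "(?A i ** ?A j) ** ?I = ?I ** (?A i ** ?A j)" for i j
  proof -
    have "(?A i ** ?A j) ** ?I = ?A i ** (?A j ** ?I)" by (rule matrix_mul_assoc[symmetric])
    also have "\<dots> = - ((?A i ** ?I) ** ?A j)" by (simp add: DJ_anticommute[OF x] matrix_neg_right matrix_mul_assoc)
    also have "\<dots> = ?I ** (?A i ** ?A j)" by (simp add: DJ_anticommute[OF x] matrix_neg_left matrix_mul_assoc)
    finally show ?thesis .
  qed
  have comm: "?S i j ** ?I = ?I ** ?S i j" for i j by (simp add: matrix_ring(1,2) comm2)
  have II: "?I ** (?I ** B) = - B" for B
    by (simp add: matrix_mul_assoc linear_ah_square[OF lah[OF x]] matrix_neg_left)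
  have an: "?D i j ** ?I = - (?I ** ?D i j)" for i j
  proof -
    have "?D i j ** ?I + ?I ** ?D i j = (D2J g J i j x ** ?I + ?I ** D2J g J i j x)
       - (1/2) *\<^sub>R (?I ** (?S i j ** ?I) + ?I ** (?I ** ?S i j))"
      by (simp add: DJ_square_def matrix_sub_ldistrib matrix_sub_rdistrib matrix_scaleR_left matrix_scaleR_right
          matrix_mul_assoc scaleR_add_right)
    also have "\<dots> = - ?S i j + ?S i j"
      by (simp add: D2J_anticommute[OF x] comm II scaleR_add_right[symmetric] scaleR_2[symmetric])
    finally show ?thesis by (simp add: eq_neg_iff_add_eq_0)
  qed
  have sq_skew: "transpose (DJ_square ?I ?A i j) ** ?G = - (?G ** DJ_square ?I ?A i j)" for i j
  proof -
    have s: "transpose (?A i ** ?A j) ** ?G = ?G ** (?A j ** ?A i)" for i j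
    proof -
      have "transpose (?A i ** ?A j) ** ?G = transpose (?A j) ** (transpose (?A i) ** ?G)"
        by (simp only: matrix_transpose_mul matrix_mul_assoc)
      also have "\<dots> = - ((transpose (?A j) ** ?G) ** ?A i)"
        by (simp only: DJ_skew[OF x] matrix_neg_right matrix_mul_assoc)
      also have "\<dots> = ?G ** (?A j ** ?A i)"
        by (simp only: DJ_skew[OF x] matrix_neg_left matrix_mul_assoc minus_minus)
      finally show ?thesis .
    qed
    have S: "transpose (?S i j) ** ?G = ?G ** ?S i j"
      by (simp add: transpose_add matrix_add_rdistrib matrix_add_ldistrib s add.commute del: matrix_transpose_mul)
    have "transpose (?I ** ?S i j) ** ?G = transpose (?S i j) ** (transpose ?I ** ?G)"
      by (simp only: matrix_transpose_mul matrix_mul_assoc)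
    also have "\<dots> = - (?G ** (?S i j ** ?I))"
      by (simp only: linear_ah_skew[OF lah[OF x]] matrix_neg_right matrix_mul_assoc S)
    also have "\<dots> = - (?G ** (?I ** ?S i j))" by (simp only: comm)
    finally show ?thesis
      by (simp only: DJ_square_def transpose_scalar matrix_scaleR_left matrix_scaleR_right scaleR_minus_right)
  qed
  obtain M where M: "\<And>a b. M a b = M b a" "jet_riemann ?G (jet_g ?G M) = (\<lambda>i j. riemann g i j x)"
    "jet_D2J ?G ?I (jet_g ?G M) (jet_J ?I M) = ?D"
  proof (rule jet_surjective[OF lah[OF x], of "\<lambda>i j. riemann g i j x" ?D])
    show "transpose (?D i j) ** ?G = - (?G ** ?D i j)" for i j
      by (simp only: transpose_diff matrix_sub_ldistrib matrix_sub_rdistrib sq_skew D2J_skew[OF x]) simp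
    show "?D i j - ?D j i = riemann g i j x ** ?I - ?I ** riemann g i j x" for i j
      using D2J_commute[OF x, of i j] by (simp add: DJ_square_def add.commute)
  qed (rule riemann_antisym riemann_skew[OF x] bianchi[OF x] an | use that in blast)+
  show thesis by (rule that[of M], rule M(1)) (simp only: M(2,3))
qed

text \<open>Split the cores. The curvature part of the operator vanishes by extension from the
  models, the scalar part by evaluation at m = 0, and what remains is the operator applied to
  quadratic expressions in DJ.\<close>

lemma remainder:
  fixes B :: "'n::finite mop"
  assumes nat: "form_contraction natural_cores B"
    and z: "\<And>G I \<xi> m N. linear_ah G I \<Longrightarrow> admissible I m N \<Longrightarrow> B (model_g G \<xi> m) (model_J I \<xi> m N) 0 = 0"
  shows "form_contraction DJ_DJ_cores B"
proof -
  obtain \<Phi> where \<Phi>: "contraction_op natural_rank 2 \<Phi>" and B\<Phi>: "\<And>U g J x i j. ah_on U g J \<Longrightarrow> x \<in> U \<Longrightarrow>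
      B g J x $ i $ j = \<Phi> (g x) (J x) (\<lambda>i. natural_core i g J x) [i, j]"
    by (rule natural_op[OF nat], rule that, assumption, blast)
  have v: "\<Phi> G I (jet_core G I (ridge_family \<xi> m)) [i, j] + \<Phi> G I scalar_core [i, j] = 0"
    if "linear_ah G I" "admissible I m N" for G I m N :: "real^'n^'n" and \<xi> i j
    using B\<Phi>[OF model_ah[OF that] UNIV_I, of \<xi> 0 i j] model_value[OF \<Phi> that, of "[i, j]" \<xi>]
    by (simp add: z[OF that] model_jets)
  have s0: "\<Phi> G I scalar_core [i, j] = 0" if "linear_ah G I" for G I :: "real^'n^'n" and i j
    using v[OF that admissible_zero, of 0 i j] by (simp add: jet_core_zero contraction_op_0[OF \<Phi>])
  \<comment> \<open>Each quadratic core is only equal to a contraction on almost Hermitian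
    structures; genuine contractions are chosen so that they can be substituted into the
    operator.\<close>
  have "\<exists>f :: nat \<Rightarrow> 'n top. \<forall>i. contraction DJ_DJ_cores (natural_rank i) (f i) \<and> (\<forall>U g J. ah_on U g J \<longrightarrow> (\<forall>x\<in>U. \<forall>is.
      length is = natural_rank i \<longrightarrow> quadratic_core i g J x is = f i g J x is))" (is "\<exists>f. ?P f")
    using quadratic_core_is_contraction unfolding is_contraction_def by (rule choice[OF allI])
  then obtain f where "?P f" by (elim exE)
  then have f: "contraction DJ_DJ_cores (natural_rank i) (f i)"
    "ah_on U g J \<Longrightarrow> x \<in> U \<Longrightarrow> length is = natural_rank i \<Longrightarrow> quadratic_core i g J x is = f i g J x is"
    for i U g J x "is" by simp_all
  have "B g J x $ i $ j = \<Phi> (g x) (J x) (\<lambda>i. f i g J x) [i, j]"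
    if ah: "ah_on U g J" and x: "x \<in> U" for U g J x i j
  proof -
    interpret ah_field U g J by unfold_locales (rule ah)
    obtain M where M: "\<And>a b. M a b = M b a"
      "curvature_core (g x) (\<lambda>i j. riemann g i j x)
         (\<lambda>i j. D2J g J i j x - DJ_square (J x) (\<lambda>a. DJ g J a x) i j) = jet_core (g x) (J x) M"
      by (rule curvature_realized[OF x]) (use that in blast)
    \<comment> \<open>The operator cannot distinguish the curvature data at x from those of an
      abstract jet \<open>M\<close>, where it vanishes by polarization.\<close>
    have "\<Phi> (g x) (J x) (jet_core (g x) (J x) M) [i, j] = 0"
      by (rule vanishes_on_jets[OF \<Phi> _ M(1)]) (use v[OF lah[OF x]] s0[OF lah[OF x]] in simp)
    moreover have "\<Phi> (g x) (J x) (\<lambda>i. natural_core i g J x) [i, j] = \<Phi> (g x) (J x)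
        (\<lambda>i js. jet_core (g x) (J x) M i js + f i g J x js + scalar_core i js) [i, j]"
      by (rule contraction_op_cong[OF \<Phi>]) (simp_all add: natural_core_split M(2) f(2)[OF ah x])
    ultimately show ?thesis
      unfolding B\<Phi>[OF ah x] contraction_op_add[OF \<Phi>] s0[OF lah[OF x]] by simp
  qed
  then show ?thesis
    unfolding form_contraction_def using op_imp_contraction[OF \<Phi> f(1)] by blast
qed

theorem theorem1p1:
  fixes h K :: "'n::finite mop"
  assumes "natural_system h K"
    and "second_order_system h K"
    and "parity_system h K"
    and "scaling_system h K"
    and "identity_symbol_mod_gauge h K"
    and "tangent_to_ah h K"
  shows "\<exists>(a::real) Q1 Q2.
    form_contraction DJ_DJ_cores Q1 \<and> endo_contraction DJ_DJ_cores Q2 \<and>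
    (\<forall>(A :: ('a::{t2_space,second_countable_topology}, 'n) chart set) g J.
       ah_structure A g J \<longrightarrow> (\<forall>c\<in>A. \<forall>x \<in> snd c ` fst c.
         h (g c) (J c) x = metric_rhs a Q1 (g c) (J c) x \<and>
         K (g c) (J c) x = acs_rhs a Q2 (g c) (J c) x \<and>
         (let G = g c x; I = J c x; q1 = Q1 (g c) (J c) x; q2 = lower_endo G (Q2 (g c) (J c) x) in
            (\<forall>u v. bil q1 u v = bil q1 v u) \<and>
            part_11 I q2 = 0 \<and>
            part_02_20 I q1 = form_J I (part_sym q2)))) \<and>
    (\<forall>(A :: ('a, 'n) chart set) T g J.
       flow_of h K A T g J \<longleftrightarrow> flow_of (metric_rhs a Q1) (acs_rhs a Q2) A T g J)"
proof -
  obtain a where a: "\<And>(G::real^'n^'n) I \<xi> m N. linear_ah G I \<Longrightarrow> admissible I m N \<Longrightarrow>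
    h (model_g G \<xi> m) (model_J I \<xi> m N) 0 = metric_rhs a (\<lambda>g J x. 0) (model_g G \<xi> m) (model_J I \<xi> m N) 0 \<and>
    K (model_g G \<xi> m) (model_J I \<xi> m N) 0 = acs_rhs a (\<lambda>g J x. 0) (model_g G \<xi> m) (model_J I \<xi> m N) 0"
    using models_rhs[OF assms(1,3,4,5)] by blast
  \<comment> \<open>With the remainders defined as differences, the two equations hold identically,
    as equalities of operators, and the flows trivially coincide. What has to be shown is that the
    differences involve only DJ tensor DJ and satisfy the algebraic conditions.\<close>
  define Q1 where "Q1 g J x = h g J x - metric_rhs a (\<lambda>g J x. 0) g J x" for g J x
  define Q2 where "Q2 g J x = K g J x - acs_rhs a (\<lambda>g J x. 0) g J x" for g J x
  have rhs: "metric_rhs a Q1 = h" "acs_rhs a Q2 = K"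
    by (simp_all add: fun_eq_iff metric_rhs_def acs_rhs_def Q1_def Q2_def)
  have h: "form_contraction natural_cores h" and K: "endo_contraction natural_cores K"
    using assms(1) by (simp_all add: natural_system_def)
  have "form_contraction DJ_DJ_cores Q1"
  proof (rule remainder)
    have "is_contraction natural_cores 2 (\<lambda>g J x is. h g J x $ (is!0) $ (is!1) -
        ((- 2) * ricci g x $ (is!0) $ (is!1) + a * lie_form (theta_sharp g J) g x $ (is!0) $ (is!1)))"
      by (intro is_contraction_diff is_contraction_add is_contraction_scale ricci_is_contraction
          lie_form_is_contraction h[unfolded form_contraction_iff])
    then show "form_contraction natural_cores Q1"
      by (simp add: form_contraction_iff Q1_def metric_rhs_def)
  qed (simp add: Q1_def a)
  moreover have "endo_contraction DJ_DJ_cores Q2"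
    unfolding endo_contraction_def
  proof (rule remainder)
    have "is_contraction natural_cores 2 (\<lambda>g J x is. lower_endo (g x) (K g J x) $ (is!0) $ (is!1) -
        (lower_endo (g x) (rough_laplacian g J x + N_endo g J x + R_endo g J x) $ (is!0) $ (is!1) +
         a * lower_endo (g x) (lie_endo (theta_sharp g J) J x) $ (is!0) $ (is!1)))"
      by (intro is_contraction_diff is_contraction_add is_contraction_scale acs_is_contraction
          lie_endo_is_contraction K[unfolded endo_contraction_def form_contraction_iff])
    then show "form_contraction natural_cores (\<lambda>g J x. lower_endo (g x) (Q2 g J x))"
      by (simp add: form_contraction_iff Q2_def acs_rhs_def lower_endo_eq transpose_ring matrix_ring)
  qed (simp add: Q2_def a lower_endo_eq)
  ultimately have contr: "form_contraction DJ_DJ_cores Q1 \<and> endo_contraction DJ_DJ_cores Q2" ..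
  have cond: "(\<forall>u v. bil (Q1 g J x) u v = bil (Q1 g J x) v u) \<and>
      part_11 (J x) (lower_endo (g x) (Q2 g J x)) = 0 \<and>
      part_02_20 (J x) (Q1 g J x) = form_J (J x) (part_sym (lower_endo (g x) (Q2 g J x)))"
    if ah: "ah_on U g J" and x: "x \<in> U" for U g J x
  proof -
    interpret ah_field U g J by unfold_locales (rule ah)
    obtain \<gamma> \<eta> where c: "\<And>s. linear_ah (\<gamma> s) (\<eta> s)" "\<gamma> 0 = g x" "\<eta> 0 = J x"
      "(\<gamma> has_vector_derivative h g J x) (at 0)" "(\<eta> has_vector_derivative K g J x) (at 0)"
      using assms(6) ah x unfolding tangent_to_ah_def by blast
    have "tangent_pair (g x) (J x) (h g J x) (K g J x)"
      using tangent_pair_curve[OF c(1,4,5)] by (simp only: c(2,3))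
    \<comment> \<open>The linearized equations are linear, so the difference of two tangent
      velocities at the same structure is tangent.\<close>
    from tangent_pair_diff[OF this tangent_pair_add[OF tangent_pair_ricci[OF x]
      tangent_pair_scaleR[OF tangent_pair_lie[OF x], of a]]]
    have "tangent_pair (g x) (J x) (Q1 g J x) (Q2 g J x)"
      by (simp add: Q1_def Q2_def metric_rhs_def acs_rhs_def)
    from tangent_pair_conditions[OF lah[OF x] this] show ?thesis by blast
  qed
  show ?thesis
  proof (rule exI[of _ a], rule exI[of _ Q1], rule exI[of _ Q2], unfold rhs Let_def, intro conjI allI impI ballI,
      goal_cases)
    case (3 A g J c x)
    show ?case ..
  next
    case (4 A g J c x)
    show ?case ..
  next
    case (5 A g J c x u v)
    then have "ah_on (snd c ` fst c) (g c) (J c)" unfolding ah_structure_def by blast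
    from cond[OF this 5(3)] show ?case by blast
  next
    case (6 A g J c x)
    then have "ah_on (snd c ` fst c) (g c) (J c)" unfolding ah_structure_def by blast
    from cond[OF this 6(3)] show ?case by blast
  next
    case (7 A g J c x)
    then have "ah_on (snd c ` fst c) (g c) (J c)" unfolding ah_structure_def by blast
    from cond[OF this 7(3)] show ?case by blast
  qed (use contr in simp_all)
qed

end
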